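(* Let $\beta>0$ be fixed. For each $d$ let $Q,K\in\mathbb R^{d\times d}$ be independent random matrices with independent $\mathcal N(0,1)$ entries, let $S=QK^\top/\sqrt d$, and let $A\in\mathbb R^{d\times d}$ be given by $A_{ij}=e^{\beta S_{ij}}/\sum_{r=1}^{d}e^{\beta S_{ir}}$, with singular values $s_1(A)\ge\dots\ge s_d(A)$ (this is Gaussian softmax attention with $\ell=p=d$ and $X=I_d$). Then for every fixed $k\ge2$, as $d\to\infty$, $$d\,s_k(A)^2\longrightarrow\mathcal K_\beta(w_* )^2\qquad\text{in probability,}$$ where $\mathcal K_\beta$ and $w_*$ are defined in the context. In particular, $$d\,s_2(A)^2\longrightarrow\max\operatorname{supp}\nu_\infty\qquad\text{in probability,}$$ where $\nu_\infty$ is the limiting bulk law of the model, defined in the context.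
   Context: Put $a=e^{\beta^2}-1-\beta^2>0$ and $b=\beta^2$, and define $$\mathcal K_\beta(w)=\frac1w+aw+\frac{bw}{1-bw^2},\qquad 0<w<b^{-1/2}.$$ This function is strictly convex and $w_*\in(0,b^{-1/2})$ is its unique critical point, $\mathcal K_\beta'(w_* )=0$. Let $u=d^{-1/2}\mathbf 1\in\mathbb R^d$ with $\mathbf 1$ the all-ones vector. By a theorem of Hayase, Collins and Karakida, the empirical law $\frac1d\sum_{j=1}^d\delta_{s_j^2}$ of the squared singular values $s_j^2$ of $\sqrt d\,(A-uu^\top)$ converges almost surely in moments (hence weakly), as $d\to\infty$, to a deterministic compactly supported probability measure $\nu_\infty$ on $[0,\infty)$ depending only on $\beta$; this defines $\nu_\infty$. *)

theory Defs
  imports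
    "HOL-Probability.Probability"
    "Jordan_Normal_Form.Char_Poly"
begin

no_notation Finite_Cartesian_Product.vec_nth (infixl \<open>$\<close> 90)
hide_const (open) Finite_Cartesian_Product.vec Finite_Cartesian_Product.mat
  Finite_Cartesian_Product.row Finite_Cartesian_Product.column
  Finite_Cartesian_Product.transpose Determinants.det Cartesian_Space.rank
hide_type (open) Finite_Cartesian_Product.vec

text \<open>
  Matrices whose size is a natural number are those of Jordan_Normal_Form, with row and
  column indices starting at 0.
\<close>

definition singular_values :: "real mat \<Rightarrow> real list" where
  "singular_values A =
     rev (sorted_list_of_multiset
       (image_mset sqrt (proots (char_poly (transpose_mat A * A)))))"

text \<open>
  Singular values are numbered from 1 in decreasing order; the value 0 for an index out of
  range is a convention, irrelevant for a fixed index as the size tends to infinity.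
\<close>

definition singular_value :: "nat \<Rightarrow> real mat \<Rightarrow> real" where
  "singular_value k A =
     (if 1 \<le> k \<and> k \<le> length (singular_values A) then singular_values A ! (k - 1) else 0)"

text \<open>
  The uniform law on the positions of a list: \<open>(1 / n) * (\<Sum>j. \<delta>(x\<^sub>j))\<close>, so repeated
  values are counted with multiplicity. Only meaningful for nonempty lists.
\<close>

definition empirical_law :: "real list \<Rightarrow> real pmf" where
  "empirical_law xs = map_pmf (\<lambda>j. xs ! j) (pmf_of_set {..<length xs})"

definition indep_gaussian_pair ::
  "'w measure \<Rightarrow> nat \<Rightarrow> ('w \<Rightarrow> real mat) \<Rightarrow> ('w \<Rightarrow> real mat) \<Rightarrow> bool" where
  "indep_gaussian_pair M d Q K \<longleftrightarrow>
     (\<forall>\<omega>\<in>space M. Q \<omega> \<in> carrier_mat d d \<and> K \<omega> \<in> carrier_mat d d) \<and>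
     prob_space.indep_vars M (\<lambda>_. borel)
       (case_sum (\<lambda>(i, j) \<omega>. Q \<omega> $$ (i, j)) (\<lambda>(i, j) \<omega>. K \<omega> $$ (i, j)))
       (({..<d} \<times> {..<d}) <+> ({..<d} \<times> {..<d})) \<and>
     (\<forall>i<d. \<forall>j<d.
        distributed M lborel (\<lambda>\<omega>. Q \<omega> $$ (i, j)) std_normal_density \<and>
        distributed M lborel (\<lambda>\<omega>. K \<omega> $$ (i, j)) std_normal_density)"

definition score :: "nat \<Rightarrow> real mat \<Rightarrow> real mat \<Rightarrow> real mat" where
  "score d Q K = (1 / sqrt (real d)) \<cdot>\<^sub>m (Q * transpose_mat K)"

definition attention :: "real \<Rightarrow> nat \<Rightarrow> real mat \<Rightarrow> real mat \<Rightarrow> real mat" where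
  "attention \<beta> d Q K =
     mat d d (\<lambda>(i, j). exp (\<beta> * score d Q K $$ (i, j)) /
                       (\<Sum>r<d. exp (\<beta> * score d Q K $$ (i, r))))"

definition unit_ones :: "nat \<Rightarrow> real vec" where
  "unit_ones d = (1 / sqrt (real d)) \<cdot>\<^sub>v vec d (\<lambda>_. 1)"

definition centered_attention :: "real \<Rightarrow> nat \<Rightarrow> real mat \<Rightarrow> real mat \<Rightarrow> real mat" where
  "centered_attention \<beta> d Q K =
     sqrt (real d) \<cdot>\<^sub>m
       (attention \<beta> d Q K - mat d d (\<lambda>(i, j). unit_ones d $ i * unit_ones d $ j))"

definition K_fun :: "real \<Rightarrow> real \<Rightarrow> real" where
  "K_fun \<beta> w =
     (let a = exp (\<beta>\<^sup>2) - 1 - \<beta>\<^sup>2; b = \<beta>\<^sup>2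
      in 1 / w + a * w + b * w / (1 - b * w\<^sup>2))"

definition w_star :: "real \<Rightarrow> real" where
  "w_star \<beta> =
     (THE w. 0 < w \<and> w < (\<beta>\<^sup>2) powr (- 1 / 2) \<and> (K_fun \<beta> has_real_derivative 0) (at w))"

definition topological_support :: "real measure \<Rightarrow> real set" where
  "topological_support \<nu> = {x. \<forall>U. open U \<longrightarrow> x \<in> U \<longrightarrow> 0 < emeasure \<nu> U}"

text \<open>
  The deterministic compactly supported law to which the squared singular values of the
  centered attention matrices converge almost surely in moments. Compactness of the support
  makes such a law unique and all of its moments finite.
\<close>

definition limiting_bulk_law ::
  "'w measure \<Rightarrow> real \<Rightarrow> (nat \<Rightarrow> 'w \<Rightarrow> real mat) \<Rightarrow> (nat \<Rightarrow> 'w \<Rightarrow> real mat) \<Rightarrow>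
   real measure \<Rightarrow> bool" where
  "limiting_bulk_law M \<beta> Q K \<nu> \<longleftrightarrow>
     prob_space \<nu> \<and> sets \<nu> = sets borel \<and>
     compact (topological_support \<nu>) \<and> topological_support \<nu> \<subseteq> {0..} \<and>
     (AE \<omega> in M. \<forall>m::nat.
        (\<lambda>d. measure_pmf.expectation
               (empirical_law
                  (map (\<lambda>s. s\<^sup>2) (singular_values (centered_attention \<beta> d (Q d \<omega>) (K d \<omega>)))))
               (\<lambda>x. x ^ m))
        \<longlonglongrightarrow> (\<integral>x. x ^ m \<partial>\<nu>))"

definition tendsto_in_probability ::
  "'w measure \<Rightarrow> (nat \<Rightarrow> 'w \<Rightarrow> real) \<Rightarrow> real \<Rightarrow> bool" where
  "tendsto_in_probability M X c \<longleftrightarrow>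
     (\<forall>d. X d \<in> borel_measurable M) \<and>
     (\<forall>\<epsilon>>0. (\<lambda>d. measure M {\<omega> \<in> space M. \<epsilon> < \<bar>X d \<omega> - c\<bar>}) \<longlonglongrightarrow> 0)"

end

theory Submission
  imports Defs "HOL-Real_Asymp.Real_Asymp" "HOL-Complex_Analysis.Complex_Analysis"
begin

text \<open>Given the keys, the rows of the exponentiated scores are independent, and their normalisations
 are asymptotically constant. Up to one rank-one perturbation the Gram matrix of the attention matrix is thus a
 sum of independent rank-one matrices whose covariance is a constant plus a multiple of the projected
 Wishart matrix of the keys: higher powers of the kernel contribute only to the diagonal.
 A barrier potential, in the manner of Batson, Spielman and Srivastava, bounds the top of such a sum, first for
 the Wishart matrix and then for the rows. For the lower bound, exchanging the rank-one matrices for their mean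
 one at a time yields the limit of the resolvent. If only o(d) eigenvalues exceeded some r below the edge, then by
 Montel's theorem this limit would continue analytically past the critical point of its functional inverse
 \<open>kc a b\<close>. Moments then transfer both bounds to the support of the bulk law.\<close>

hide_const (open) Finite_Cartesian_Product.vec Finite_Cartesian_Product.mat
  Finite_Cartesian_Product.row Finite_Cartesian_Product.column
  Finite_Cartesian_Product.transpose Determinants.det Cartesian_Space.rank
hide_type (open) Finite_Cartesian_Product.vec

text \<open>Both bounds meet at the square of \<open>K_fun \<beta> (w_star \<beta>)\<close>, for
  different reasons. Write \<open>S = a I + b G\<close>, with \<open>G\<close> the projected Gram
  matrix of the keys, for the approximate covariance of a row. With \<open>g = b w^2\<close>, a
  barrier for \<open>G\<close> that starts at \<open>1/g\<close> with potential \<open>g\<close>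
  ends near \<open>X = 1/(g (1 - g))\<close>. The barrier for the rows starts at a multiple of
  \<open>X I - G\<close>, so that its total shift, a multiple of \<open>S\<close>, makes it scalar.
  As the slack vanishes that scalar tends to \<open>(kc a b w)^2\<close>; since \<open>w\<close> is
  free, the minimum counts. In the lower bound the resolvent limit, continued to \<open>- x\<close>,
  yields an admissible \<open>w\<close> with \<open>kc a b w = 1 / sqrt x\<close>, impossible once
  \<open>1 / sqrt x\<close> is below the minimum. The rows are neither Gaussian nor bounded. Both
  arguments see them only through a fourth-moment bound for quadratic forms, supplied by a Poincare
  inequality for exponential polynomials. The lower bound puts a positive fraction of the
  eigenvalues above any level below the edge, so one count serves every fixed index and the bulk
  law, and changes of bounded rank do no harm.\<close>

abbreviation "count_gt (n::nat) (c::real) \<mu> \<equiv> card {i. i < n \<and> c < \<mu> i}"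
abbreviation eventually_seq (binder "EV " 10) where "eventually_seq P \<equiv> eventually P sequentially"
abbreviation (input) "zf (n::nat) f \<equiv> \<forall>i j. n <= i \<or> n <= j --> f i j = (0::real)"

lemmas integrable_sum_set = Bochner_Integration.integrable_sum
lemmas integral_sum_set = Bochner_Integration.integral_sum

section \<open>Finitely supported matrices\<close>

text \<open>One type holds the matrices of all sizes, so that the algebra laws carry no side
  conditions. The size survives only in the predicate \<open>indim\<close> and in the local unit
  \<open>idm d\<close>; there is no global unit.\<close>

typedef fmat = "{f :: nat => nat => real. \<exists>n. zf n f}"
 morphisms ent Abs_fmat
 by (rule exI[of _ "%i j. 0"]) simp

setup_lifting type_definition_fmat

lemma fmat_eqI: "(\<And>i j. ent A i j = ent B i j) ==> A = B"
 by (metis ent_inject ext)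

definition indim :: "nat => fmat => bool" where
 "indim d A \<longleftrightarrow> (\<forall>i j. d <= i \<or> d <= j --> ent A i j = 0)"

lemma indim_exists: "\<exists>n. indim n A"
 using ent[of A] by (auto simp: indim_def)

lemma indim_mono: "indim m A ==> m <= n ==> indim n A"
 by (auto simp: indim_def)

lemma common_indim: "\<exists>n. indim n A \<and> indim n B"
 by (meson indim_exists indim_mono max.cobounded1 max.cobounded2)

lift_definition mk :: "nat => (nat => nat => real) => fmat" is
 "%d f i j. if i < d \<and> j < d then f i j else 0"
 by (rule_tac x=nat in exI) auto

instantiation fmat :: "{zero, plus, minus, uminus, times, scaleR}"
begin

lift_definition zero_fmat :: fmat is "%i j. 0" by simp

lift_definition plus_fmat :: "fmat => fmat => fmat" is "%f g i j. f i j + g i j"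
proof -
 fix f g :: "nat => nat => real"
 assume "\<exists>n. zf n f" "\<exists>n. \<forall>i j. n <= i \<or> n <= j --> g i j = 0"
 then obtain m n where "\<forall>i j. m <= i \<or> m <= j --> f i j = 0" "\<forall>i j. n <= i \<or> n <= j --> g i j = 0"
  by auto
 then show "\<exists>n. \<forall>i j. n <= i \<or> n <= j --> f i j + g i j = 0"
  by (intro exI[of _ "max m n"]) auto
qed

lift_definition minus_fmat :: "fmat => fmat => fmat" is "%f g i j. f i j - g i j"
proof -
 fix f g :: "nat => nat => real"
 assume "\<exists>n. zf n f" "\<exists>n. \<forall>i j. n <= i \<or> n <= j --> g i j = 0"
 then obtain m n where "\<forall>i j. m <= i \<or> m <= j --> f i j = 0" "\<forall>i j. n <= i \<or> n <= j --> g i j = 0"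
  by auto
 then show "\<exists>n. \<forall>i j. n <= i \<or> n <= j --> f i j - g i j = 0"
  by (intro exI[of _ "max m n"]) auto
qed

lift_definition uminus_fmat :: "fmat => fmat" is "%f i j. - f i j" by auto

lift_definition scaleR_fmat :: "real => fmat => fmat" is "%c f i j. c*f i j" by auto

text \<open>The sum runs over the support of a row of the left factor, which is finite, so no
  dimension has to be chosen.\<close>

lift_definition times_fmat :: "fmat => fmat => fmat" is
 "%f g i j. \<Sum>k\<in>{k. f i k ~= 0}. f i k*g k j"
proof -
 fix f g :: "nat => nat => real"
 assume "\<exists>n. zf n f" "\<exists>n. \<forall>i j. n <= i \<or> n <= j --> g i j = 0"
 then obtain m n where *: "\<forall>i j. m <= i \<or> m <= j --> f i j = 0" "\<forall>i j. n <= i \<or> n <= j --> g i j = 0"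
  by auto
 show "\<exists>n. \<forall>i j. n <= i \<or> n <= j --> (\<Sum>k\<in>{k. f i k ~= 0}. f i k*g k j) = 0"
  using*by (intro exI[of _ "max m n"] allI impI sum.neutral ballI) auto
qed

instance ..
end

lemma ent_zero [simp]: "ent 0 i j = 0" by transfer simp
lemma ent_add [simp]: "ent (A + B) i j = ent A i j + ent B i j" by transfer simp
lemma ent_diff [simp]: "ent (A - B) i j = ent A i j - ent B i j" by transfer simp
lemma ent_uminus [simp]: "ent (- A) i j = - ent A i j" by transfer simp
lemma ent_scaleR [simp]: "ent (c *\<^sub>R A) i j = c*ent A i j" by transfer simp
lemma ent_mk: "ent (mk d f) i j = (if i < d \<and> j < d then f i j else 0)" by transfer simp

lemma ent_times:
 assumes "indim d A \<or> indim d B"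
 shows "ent (A*B) i j = (\<Sum>k<d. ent A i k*ent B k j)"
proof -
 obtain n where n: "indim n A" using indim_exists by blast
 have fin: "finite {k. ent A i k ~= 0}"
  by (rule finite_subset[of _ "{..<n}"]) (use n in \<open>auto simp: indim_def not_less[symmetric]\<close>)
 have "ent (A*B) i j = (\<Sum>k\<in>{k. ent A i k ~= 0}. ent A i k*ent B k j)" by transfer simp
 also have "... = (\<Sum>k\<in>{k. ent A i k ~= 0} \<union> {..<d}. ent A i k*ent B k j)"
  by (rule sum.mono_neutral_left) (use fin in auto)
 also have "... = (\<Sum>k<d. ent A i k*ent B k j)"
  by (rule sum.mono_neutral_right) (use fin assms in \<open>auto simp: indim_def not_less\<close>)
 finally show ?thesis .
qed

lemma indim_times1: "indim d A ==> indim d B ==> indim d (A*B)"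
 by (auto simp: indim_def ent_times[of d A])

instance fmat :: real_algebra
proof
 fix A B C :: fmat and r s :: real
 show "A + B + C = A + (B + C)" by (rule fmat_eqI) simp
 show "A + B = B + A" by (rule fmat_eqI) simp
 show "0 + A = A" by (rule fmat_eqI) simp
 show "- A + A = 0" by (rule fmat_eqI) simp
 show "A - B = A + - B" by (rule fmat_eqI) simp
 show "r *\<^sub>R (A + B) = r *\<^sub>R A + r *\<^sub>R B" by (rule fmat_eqI) (simp add: algebra_simps)
 show "(r + s) *\<^sub>R A = r *\<^sub>R A + s *\<^sub>R A" by (rule fmat_eqI) (simp add: algebra_simps)
 show "r *\<^sub>R s *\<^sub>R A = (r * s) *\<^sub>R A" by (rule fmat_eqI) (simp add: algebra_simps)
 show "1 *\<^sub>R A = A" by (rule fmat_eqI) simp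
 obtain n where A: "indim n A" and C: "indim n C" using common_indim by blast
 have AC: "indim n (r *\<^sub>R A)" "indim n (r *\<^sub>R C)" using A C by (auto simp: indim_def)
 obtain m where B: "indim m A" "indim m B" using common_indim by blast
 show "A*B*C = A*(B*C)"
 proof (rule fmat_eqI)
  fix i j
  have "ent (A*B*C) i j = (\<Sum>l<n. (\<Sum>k<n. ent A i k*ent B k l)*ent C l j)"
   using A C by (simp add: ent_times[of n])
  also have "... = (\<Sum>k<n. ent A i k*(\<Sum>l<n. ent B k l*ent C l j))"
   by (simp only: sum_distrib_left sum_distrib_right mult.assoc) (rule sum.swap)
  also have "... = ent (A*(B*C)) i j" using A C by (simp add: ent_times[of n])
  finally show "ent (A*B*C) i j = ent (A*(B*C)) i j" .
 qed
 show "(A + B)*C = A*C + B*C"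
  by (rule fmat_eqI) (simp add: ent_times[of n] C algebra_simps sum.distrib)
 show "A*(B + C) = A*B + A*C"
  by (rule fmat_eqI) (simp add: ent_times[of n] A algebra_simps sum.distrib)
 show "r *\<^sub>R A*C = r *\<^sub>R (A*C)"
  by (rule fmat_eqI) (simp add: ent_times[of n] A AC algebra_simps sum_distrib_left)
 show "A*r *\<^sub>R C = r *\<^sub>R (A*C)"
  by (rule fmat_eqI) (simp add: ent_times[of n] A algebra_simps sum_distrib_left)
qed

named_theorems indim_intros

lemma indim_0 [indim_intros, simp]: "indim d 0" by (simp add: indim_def)
lemma indim_add [indim_intros, simp]: "indim d A ==> indim d B ==> indim d (A + B)" by (simp add: indim_def)
lemma indim_diff [indim_intros, simp]: "indim d A ==> indim d B ==> indim d (A - B)" by (simp add: indim_def)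
lemma indim_scaleR [indim_intros, simp]: "indim d A ==> indim d (c *\<^sub>R A)" by (simp add: indim_def)
lemma indim_times [indim_intros, simp]: "indim d A ==> indim d B ==> indim d (A*B)" by (rule indim_times1)
lemma indim_mk [simp]: "indim d (mk d f)" by (auto simp: indim_def ent_mk)
lemma indim_sum [simp]: "(\<And>i. i \<in> I ==> indim d (F i)) ==> indim d (sum F I)"
 by (induction I rule: infinite_finite_induct) auto

lemma ent_sum: "ent (sum F I) i j = (\<Sum>k\<in>I. ent (F k) i j)"
 by (induction I rule: infinite_finite_induct) auto

lemma indim_eqI:
 assumes "indim d A" "indim d B" "\<And>i j. i < d ==> j < d ==> ent A i j = ent B i j"
 shows "A = B"
proof (rule fmat_eqI)
 fix i j show "ent A i j = ent B i j"
  using assms by (cases "i < d \<and> j < d") (auto simp: indim_def not_less)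
qed

definition idm :: "nat => fmat" where "idm d = mk d (%i j. if i = j then 1 else 0)"

lemma indim_idm [simp]: "indim d (idm d)" by (simp add: idm_def)
lemma ent_idm: "ent (idm d) i j = (if i = j \<and> i < d then 1 else 0)" by (auto simp: idm_def ent_mk)

lemma idm_left [simp]: "indim d A ==> idm d*A = A"
 by (rule indim_eqI[of d]) (auto simp: ent_times[of d] ent_idm if_distrib if_distribR sum.delta cong: if_cong)
lemma idm_right [simp]: "indim d A ==> A*idm d = A"
 by (rule indim_eqI[of d]) (auto simp: ent_times[of d] ent_idm if_distrib if_distribR sum.delta cong: if_cong)

section \<open>Traces, bilinear forms and rank-one matrices\<close>

definition trc :: "nat => fmat => real" where "trc d A = (\<Sum>i<d. ent A i i)"

lemma trc_add: "trc d (A + B) = trc d A + trc d B" by (simp add: trc_def sum.distrib)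
lemma trc_diff: "trc d (A - B) = trc d A - trc d B" by (simp add: trc_def sum_subtractf)
lemma trc_scaleR: "trc d (c *\<^sub>R A) = c*trc d A" by (simp add: trc_def sum_distrib_left)
lemma trc_zero [simp]: "trc d 0 = 0" by (simp add: trc_def)
lemma trc_sum: "trc d (sum F I) = (\<Sum>k\<in>I. trc d (F k))"
 by (simp add: trc_def ent_sum) (rule sum.swap)
lemma trc_idm [simp]: "trc d (idm d) = d" by (simp add: trc_def ent_idm)
lemma trc_comm:
 assumes "indim d A" "indim d B" shows "trc d (A*B) = trc d (B*A)"
 using assms by (simp add: trc_def ent_times[of d]) (subst sum.swap, simp add: mult.commute)

definition bil :: "nat => (nat => real) => fmat => (nat => real) => real" where
 "bil d x A y = (\<Sum>i<d. \<Sum>j<d. x i*ent A i j*y j)"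

definition ip :: "nat => (nat => real) => (nat => real) => real" where
 "ip d x y = (\<Sum>i<d. x i*y i)"

definition mv :: "nat => fmat => (nat => real) => nat => real" where
 "mv d A x i = (\<Sum>j<d. ent A i j*x j)"

definition outer :: "nat => (nat => real) => (nat => real) => fmat" where
 "outer d x y = mk d (%i j. x i*y j)"

definition trn :: "nat => fmat => fmat" where
 "trn d A = mk d (%i j. ent A j i)"

lemma indim_outer [simp]: "indim d (outer d x y)" by (simp add: outer_def)
lemma ent_outer: "ent (outer d x y) i j = (if i < d \<and> j < d then x i*y j else 0)"
 by (simp add: outer_def ent_mk)

lemma bil_add: "bil d x (A + B) y = bil d x A y + bil d x B y"
 by (simp add: bil_def algebra_simps sum.distrib)
lemma bil_diff: "bil d x (A - B) y = bil d x A y - bil d x B y"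
 by (simp add: bil_def algebra_simps sum_subtractf)
lemma bil_scaleR: "bil d x (c *\<^sub>R A) y = c*bil d x A y"
 by (simp add: bil_def algebra_simps sum_distrib_left)
lemma bil_sum: "bil d x (sum F I) y = (\<Sum>k\<in>I. bil d x (F k) y)"
 by (induction I rule: infinite_finite_induct) (auto simp: bil_add, auto simp: bil_def)
lemma bil_idm: "bil d x (idm d) y = ip d x y"
 by (auto simp: bil_def ip_def ent_idm if_distrib if_distribR sum.delta cong: if_cong)

lemma bil_mv: "bil d x A y = ip d x (mv d A y)"
 by (simp add: bil_def ip_def mv_def sum_distrib_left mult.assoc)

lemma bil_add_left: "bil d (%i. x i + y i) A z = bil d x A z + bil d y A z"
 by (simp add: bil_def algebra_simps sum.distrib)
lemma bil_add_right: "bil d z A (%i. x i + y i) = bil d z A x + bil d z A y"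
 by (simp add: bil_def algebra_simps sum.distrib)
lemma bil_smult_left: "bil d (%i. c*x i) A z = c*bil d x A z"
 by (simp add: bil_def algebra_simps sum_distrib_left)
lemma bil_smult_right: "bil d z A (%i. c*x i) = c*bil d z A x"
 by (simp add: bil_def algebra_simps sum_distrib_left)
lemma ip_comm: "ip d x y = ip d y x" by (simp add: ip_def mult.commute)
lemma ip_nonneg [simp]: "0 <= ip d x x" by (simp add: ip_def sum_nonneg)

lemma mv_times: "indim d A ==> indim d B ==> mv d (A*B) x = mv d A (mv d B x)"
 by (rule ext) (simp add: mv_def ent_times[of d] sum_distrib_left sum_distrib_right mult.assoc, rule sum.swap)

lemma bil_times: "indim d A ==> indim d B ==> bil d x (A*B) y = bil d x A (mv d B y)"
 by (simp add: bil_mv mv_times)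

lemma outer_mult:
 assumes "indim d A"
 shows "outer d x y*A * outer d u v = bil d y A u *\<^sub>R outer d x v"
proof (rule indim_eqI[of d], goal_cases)
 case (3 i j)
 have "ent (outer d x y*A * outer d u v) i j = (\<Sum>l<d. (\<Sum>k<d. x i*y k*ent A k l)*(u l * v j))"
  using assms 3 by (simp add: ent_times[of d] ent_outer)
 also have "... = x i * v j*(\<Sum>l<d. \<Sum>k<d. y k*ent A k l*u l)"
  by (simp add: sum_distrib_left sum_distrib_right algebra_simps)
 also have "(\<Sum>l<d. \<Sum>k<d. y k*ent A k l*u l) = bil d y A u"
  unfolding bil_def by (rule sum.swap)
 finally show ?case using 3 by (simp add: ent_outer mult.commute)
qed (use assms in auto)

lemma trc_outer: "indim d A ==> trc d (A * outer d x y) = bil d y A x"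
 by (simp add: trc_def ent_times[of d] ent_outer bil_def mult_ac)

lemma bil_outer: "bil d x (outer d u v) y = ip d x u*ip d v y"
proof -
 have "bil d x (outer d u v) y = (\<Sum>i<d. \<Sum>j<d. (x i*u i)*(v j*y j))"
  unfolding bil_def by (intro sum.cong refl) (auto simp: ent_outer)
 then show ?thesis by (simp add: ip_def sum_product)
qed

section \<open>Symmetric and positive semidefinite matrices\<close>

definition symm :: "nat => fmat => bool" where
 "symm d A \<longleftrightarrow> indim d A \<and> (\<forall>i j. ent A i j = ent A j i)"

definition psd :: "nat => fmat => bool" where
 "psd d A \<longleftrightarrow> symm d A \<and> (\<forall>x. 0 <= bil d x A x)"

lemma symm_indim [simp, dest]: "symm d A ==> indim d A" by (simp add: symm_def)
lemma psd_symm [dest]: "psd d A ==> symm d A" by (simp add: psd_def)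
lemma psd_indim [simp, dest]: "psd d A ==> indim d A" by (simp add: psd_def)
lemma psdD: "psd d A ==> 0 <= bil d x A x" by (simp add: psd_def)
lemma symm_add [intro]: "symm d A ==> symm d B ==> symm d (A + B)" by (auto simp: symm_def)
lemma symm_diff [intro]: "symm d A ==> symm d B ==> symm d (A - B)" by (auto simp: symm_def)
lemma symm_scaleR [intro]: "symm d A ==> symm d (c *\<^sub>R A)" by (auto simp: symm_def)
lemma symm_idm [intro]: "symm d (idm d)" by (auto simp: symm_def ent_idm)
lemma symm_outer [intro]: "symm d (outer d x x)" by (auto simp: symm_def ent_outer)
lemma symm_sum [intro]: "(\<And>i. i \<in> I ==> symm d (F i)) ==> symm d (sum F I)"
 by (auto simp: symm_def ent_sum intro!: sum.cong)

lemma symm_bil: "symm d A ==> bil d x A y = bil d y A x"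
 unfolding bil_def by (subst sum.swap) (auto simp: symm_def mult_ac intro!: sum.cong)

lemma symm_conj [intro]: "symm d R ==> symm d S ==> symm d (R*S * R)"
proof -
 assume R: "symm d R" and S: "symm d S"
 have "ent (R*S * R) i j = ent (R*S * R) j i" for i j
 proof -
  have "ent (R*S * R) i j = (\<Sum>l<d. \<Sum>k<d. ent R i k*ent S k l*ent R l j)"
   using R S by (simp add: ent_times[of d] sum_distrib_right)
  also have "... = (\<Sum>l<d. \<Sum>k<d. ent R j k*ent S k l*ent R l i)"
   by (subst sum.swap) (use R S in \<open>auto simp: symm_def mult_ac intro!: sum.cong\<close>)
  also have "... = ent (R*S * R) j i"
   using R S by (simp add: ent_times[of d] sum_distrib_right)
  finally show ?thesis .
 qed
 with R S show ?thesis by (simp add: symm_def)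
qed

lemma bil_conj:
 assumes "symm d R" "indim d S"
 shows "bil d x (R*S * R) y = bil d (mv d R x) S (mv d R y)"
proof -
 have "bil d x (R*S * R) y = bil d x R (mv d S (mv d R y))"
  using assms by (simp add: bil_mv mv_times)
 also have "... = bil d (mv d S (mv d R y)) R x" using assms by (simp add: symm_bil)
 also have "... = bil d (mv d R x) S (mv d R y)" by (simp add: bil_mv ip_comm)
 finally show ?thesis .
qed

lemma psd_conj [intro]: "symm d R ==> psd d S ==> psd d (R*S * R)"
 by (auto simp: psd_def bil_conj)
lemma psd_add [intro]: "psd d A ==> psd d B ==> psd d (A + B)" by (auto simp: psd_def bil_add)
lemma psd_scaleR [intro]: "psd d A ==> 0 <= c ==> psd d (c *\<^sub>R A)" by (auto simp: psd_def bil_scaleR)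
lemma psd_idm [intro]: "psd d (idm d)" by (auto simp: psd_def bil_idm)
lemma psd_outer [intro]: "psd d (outer d x x)" by (auto simp: psd_def bil_outer ip_comm)
lemma psd_0 [intro]: "psd d 0" by (auto simp: psd_def symm_def bil_def)
lemma psd_sum [intro]: "(\<And>i. i \<in> I ==> psd d (F i)) ==> psd d (sum F I)"
 by (induction I rule: infinite_finite_induct) auto

definition unitv :: "nat => nat => real" where "unitv k i = (if i = k then 1 else 0)"

lemma sum_unitv: "j < d ==> (\<Sum>l<d. f l*unitv j l) = (f j :: real)"
proof -
 assume "j < d"
 have "(\<Sum>l<d. f l*unitv j l) = (\<Sum>l<d. if l = j then f l else 0)"
  by (rule sum.cong) (auto simp: unitv_def)
 then show ?thesis using \<open>j < d\<close> by simp
qed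

lemma bil_unitv: "i < d ==> j < d ==> bil d (unitv i) A (unitv j) = ent A i j"
 by (simp add: bil_def sum_unitv) (subst mult.commute, simp add: sum_unitv)

lemma symm_bilI:
 assumes "indim d A" "\<And>x y. bil d x A y = bil d y A x"
 shows "symm d A"
 unfolding symm_def
proof (intro conjI allI)
 fix i j show "ent A i j = ent A j i"
 proof (cases "i < d \<and> j < d")
  case True then show ?thesis using assms(2)[of "unitv i" "unitv j"] by (simp add: bil_unitv)
 qed (use assms(1) in \<open>auto simp: indim_def not_less\<close>)
qed (rule assms(1))

section \<open>Inverses and positive definiteness\<close>

definition tomat :: "nat => fmat => real mat" where "tomat d A = mat d d (%(i, j). ent A i j)"

lemma tomat_carrier [simp]: "tomat d A \<in> carrier_mat d d" by (simp add: tomat_def)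
lemma tomat_index [simp]: "i < d ==> j < d ==> tomat d A $$ (i, j) = ent A i j" by (simp add: tomat_def)
lemma tomat_dim [simp]: "dim_row (tomat d A) = d" "dim_col (tomat d A) = d" by (simp_all add: tomat_def)

lemma tomat_times: "indim d A ==> tomat d (A*B) = tomat d A*tomat d B"
 by (rule eq_matI) (auto simp: ent_times[of d] scalar_prod_def atLeast0LessThan)

lemma tomat_inj: "indim d A ==> indim d B ==> tomat d A = tomat d B ==> A = B"
 by (rule indim_eqI[of d]) (metis tomat_index)+

lemma tomat_idm: "tomat d (idm d) = 1\<^sub>m d"
 by (rule eq_matI) (auto simp: ent_idm)

lemma fmat_left_right_inverse:
 assumes "indim d A" "indim d B" "A*B = idm d" shows "B*A = idm d"
proof -
 have "tomat d A*tomat d B = 1\<^sub>m d" using assms by (metis tomat_times tomat_idm)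
 then have "tomat d B*tomat d A = 1\<^sub>m d"
  using mat_mult_left_right_inverse[of "tomat d A" d "tomat d B"] by simp
 then show ?thesis using assms by (intro tomat_inj[of d]) (auto simp: tomat_times tomat_idm)
qed

text \<open>The adjugate formula makes every entry a rational function of the entries of the matrix,
  which settles measurability of all resolvents. For determinant 0 it returns the zero
  matrix.\<close>

definition minv :: "nat => fmat => fmat" where
 "minv d A = mk d (%i j. adj_mat (tomat d A) $$ (i, j)/det (tomat d A))"

text \<open>Deterministic equivalent of the resolvent of a sum of rank-one matrices with covariance
  \<open>S\<close>: the factor \<open>1/(1 + \<phi>)\<close> imitates the Sherman-Morrison
  denominators, \<open>\<phi>\<close> being the common value of the normalised quadratic
  forms.\<close>

abbreviation "dres d t \<phi> S \<equiv> minv d (t *\<^sub>R idm d + (1/(1 + \<phi>)) *\<^sub>R S)"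

lemma indim_minv [simp]: "indim d (minv d A)" by (simp add: minv_def)

lemma minv_right:
 assumes "indim d A" "det (tomat d A) ~= 0"
 shows "A*minv d A = idm d"
proof (rule tomat_inj[of d])
 let ?a = "tomat d A"
 have "tomat d (minv d A) = (1/det ?a) \<cdot>\<^sub>m adj_mat ?a"
  by (rule eq_matI) (auto simp: minv_def ent_mk adj_mat_def)
 then have "tomat d (A*minv d A) = (1/det ?a) \<cdot>\<^sub>m (det ?a \<cdot>\<^sub>m 1\<^sub>m d)"
  using assms adj_mat[of ?a d] by (simp add: tomat_times mult_smult_distrib[of _ d d _ d])
 then show "tomat d (A*minv d A) = tomat d (idm d)"
  using assms by (simp add: tomat_idm) (auto intro!: eq_matI)
qed (use assms in auto)

text \<open>The uniform lower bound makes every positive definite matrix below invertible without any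
 recourse to its spectrum.\<close>

definition pdef :: "nat => fmat => bool" where
 "pdef d A \<longleftrightarrow> symm d A \<and> (\<exists>c>0. \<forall>x. c*ip d x x <= bil d x A x)"

lemma ip_eq_0: "ip d x x = 0 ==> i < d ==> x i = 0"
 by (simp add: ip_def sum_nonneg_eq_0_iff)

lemma pdef_det:
 assumes "pdef d A" shows "det (tomat d A) ~= 0"
proof
 assume "det (tomat d A) = 0"
 then obtain v where v: "v \<in> carrier_vec d" "v ~= 0\<^sub>v d" "tomat d A *\<^sub>v v = 0\<^sub>v d"
  using det_0_iff_vec_prod_zero[of "tomat d A" d] by auto
 obtain c where c: "c > 0" "\<And>x. c*ip d x x <= bil d x A x" using assms by (auto simp: pdef_def)
 define x where "x = (%i. v $ i)"
 have "mv d A x i = 0" if "i < d" for i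
 proof -
  have "mv d A x i = (tomat d A *\<^sub>v v) $ i"
   using that v(1) by (simp add: mv_def x_def scalar_prod_def atLeast0LessThan)
  then show ?thesis using v(3) that by simp
 qed
 then have "bil d x A x = 0" by (simp add: bil_mv ip_def)
 with c(2)[of x] c(1) have "ip d x x <= 0" by (simp add: mult_le_0_iff)
 then have "ip d x x = 0" by (simp add: antisym)
 then have "v = 0\<^sub>v d" using v(1) ip_eq_0[of d x] by (intro eq_vecI) (auto simp: x_def)
 with v(2) show False by simp
qed

lemma pdef_symm: "pdef d A ==> symm d A" by (simp add: pdef_def)
lemma pdef_indim [simp]: "pdef d A ==> indim d A" by (simp add: pdef_def)

lemma pdef_minv:
 assumes "pdef d A"
 shows "A*minv d A = idm d" "minv d A*A = idm d"
 using minv_right[of d A] pdef_det[OF assms] fmat_left_right_inverse[of d A "minv d A"] assms by auto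

lemma inverse_unique:
 assumes "indim d A" "indim d R" "indim d S" "A * R = idm d" "S*A = idm d"
 shows "R = S"
 by (metis assms idm_left idm_right mult.assoc)

lemma mv_idm: "mv d (idm d) x i = (if i < d then x i else 0)"
 by (simp add: mv_def ent_idm if_distrib if_distribR sum.delta cong: if_cong)

lemma ip_cong: "(\<And>i. i < d ==> x i = x' i) ==> (\<And>i. i < d ==> y i = y' i) ==> ip d x y = ip d x' y'"
 by (simp add: ip_def)

lemma inverse_mv:
 assumes "indim d A" "indim d R" "A * R = idm d"
 shows "mv d A (mv d R x) i = (if i < d then x i else 0)"
proof -
 have "mv d A (mv d R x) i = mv d (idm d) x i" using assms by (simp flip: mv_times)
 then show ?thesis by (simp only: mv_idm)
qed

lemma bil_inverse:
 assumes "indim d A" "indim d R" "A * R = idm d"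
 shows "bil d y A (mv d R x) = ip d y x"
 unfolding bil_mv by (rule ip_cong) (simp_all add: inverse_mv[OF assms])

lemma inverse_symm:
 assumes A: "symm d A" and R: "indim d R" "A * R = idm d"
 shows "symm d R"
proof (rule symm_bilI[OF R(1)])
 have *: "bil d (mv d R x) A (mv d R y) = bil d y R x" for x y
  using bil_inverse[OF symm_indim[OF A] R] by (simp add: bil_mv ip_comm)
 show "bil d x R y = bil d y R x" for x y
  using symm_bil[OF A, of "mv d R x" "mv d R y"] unfolding*by simp
qed

lemma inverse_psd:
 assumes A: "psd d A" and R: "indim d R" "A * R = idm d"
 shows "psd d R"
proof -
 have s: "symm d R" by (rule inverse_symm[of d A]) (use A R in auto)
 have "R*A * R = R" using R by (metis A idm_right mult.assoc psd_indim)
 then show ?thesis using psd_conj[OF s A] by simp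
qed

lemma pdef_psd: assumes "pdef d A" shows "psd d A"
proof -
 obtain c where c: "c > 0" "\<And>x. c*ip d x x <= bil d x A x" using assms by (auto simp: pdef_def)
 have "0 <= bil d x A x" for x
  by (rule order_trans[OF _ c(2)]) (use c(1) in simp)
 then show ?thesis using assms by (simp add: psd_def pdef_def)
qed

lemma minv_psd: "pdef d A ==> psd d (minv d A)"
 by (rule inverse_psd[of d A]) (auto simp: pdef_minv pdef_psd)

lemma pdefI: "symm d A ==> c > 0 ==> (\<And>x. c*ip d x x <= bil d x A x) ==> pdef d A"
 by (auto simp: pdef_def)

lemma pdef_add_psd: "pdef d A ==> psd d B ==> pdef d (A + B)"
 unfolding pdef_def psd_def by (auto simp: bil_add intro: add_increasing2)

text \<open>A barrier step exhibits a positive semidefinite inverse of the new matrix explicitly.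
  This lemma turns that into the uniform lower bound which \<open>pdef\<close> asks for.\<close>

lemma psd_inverse_pdef:
 assumes A: "psd d A" and R: "psd d R" "A * R = idm d"
 shows "pdef d A"
proof -
 \<comment> \<open>One plus the squared Frobenius norm of \<open>R\<close> dominates its operator
   norm, and is never zero.\<close>
 define c where "c = 1/(1 + (\<Sum>i<d. \<Sum>j<d. (ent R i j)^2))"
 have c: "c > 0" unfolding c_def by (intro divide_pos_pos add_pos_nonneg sum_nonneg) auto
 show ?thesis
 proof (rule pdefI[of d A c])
  show "symm d A" using A by auto
  fix x
  \<comment> \<open>Cauchy--Schwarz for the form of A: |x|^2 = x A (R x), hence |x|^4 <= (x A x) (x R x).\<close>
  let ?z = "mv d R x"
  have AR: "bil d y A ?z = ip d y x" for y by (rule bil_inverse) (use A R in auto)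
  have xAz: "bil d x A ?z = ip d x x" by (rule AR)
  have zAz: "bil d ?z A ?z = bil d x R x" by (simp add: AR) (simp add: bil_mv ip_comm)
  have q: "0 <= bil d x A x + 2*t*ip d x x + t^2*bil d x R x" for t
  proof -
   have "0 <= bil d (%i. x i + t*?z i) A (%i. x i + t*?z i)" using A by (rule psdD)
   also have "... = bil d x A x + 2*t*bil d x A ?z + t^2*bil d ?z A ?z"
    using symm_bil[of d A x ?z] A
    by (simp add: bil_add_left bil_add_right bil_smult_left bil_smult_right algebra_simps power2_eq_square psd_symm)
   finally show ?thesis using xAz zAz by simp
  qed
  have "bil d x R x <= (1 + (\<Sum>i<d. \<Sum>j<d. (ent R i j)^2))*ip d x x"
  proof -
   have cs: "(bil d x R x)^2 <= ip d x x*ip d ?z ?z"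
    unfolding bil_mv ip_def using Cauchy_Schwarz_ineq_sum[of x ?z "{..<d}"] by (simp add: power2_eq_square)
   have "ip d ?z ?z <= (\<Sum>i<d. (\<Sum>j<d. (ent R i j)^2)*ip d x x)"
    unfolding ip_def[of d ?z] mv_def ip_def
    by (intro sum_mono) (use Cauchy_Schwarz_ineq_sum[of "ent R _" x "{..<d}"] in \<open>simp add: power2_eq_square\<close>)
   also have "... = (\<Sum>i<d. \<Sum>j<d. (ent R i j)^2)*ip d x x" by (simp add: sum_distrib_right)
   finally have "(bil d x R x)^2 <= ip d x x*((\<Sum>i<d. \<Sum>j<d. (ent R i j)^2)*ip d x x)"
    using cs by (meson ip_nonneg mult_left_mono order_trans)
   also have "... <= ((1 + (\<Sum>i<d. \<Sum>j<d. (ent R i j)^2))*ip d x x)^2"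
   proof -
    let ?s = "\<Sum>i<d. \<Sum>j<d. (ent R i j)^2"
    have "0 <= ?s" by (intro sum_nonneg) auto
    then have "?s <= (1 + ?s)^2" by (auto simp: power2_eq_square algebra_simps)
    then have "?s*(ip d x x)^2 <= (1 + ?s)^2*(ip d x x)^2" by (intro mult_right_mono) auto
    then show ?thesis by (simp add: power2_eq_square algebra_simps)
   qed
   finally show ?thesis
    by (rule power2_le_imp_le) (intro mult_nonneg_nonneg add_nonneg_nonneg sum_nonneg ip_nonneg; simp)
  qed
  then have xRx: "c*bil d x R x <= ip d x x"
   using c by (auto simp: c_def field_simps add_pos_nonneg sum_nonneg)
  have "0 <= bil d x A x + 2*(-c)*ip d x x + c^2*bil d x R x" using q[of "-c"] by simp
  also have "c^2*bil d x R x = c*(c*bil d x R x)" by (simp add: power2_eq_square)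
  also have "... <= c*ip d x x" using xRx c by (intro mult_left_mono) auto
  finally show "c*ip d x x <= bil d x A x" by simp
 qed (rule c)
qed

text \<open>The sign of \<open>c\<close> is free: \<open>c = 1/d\<close> subtracts a sample from a
  barrier, \<open>c = - 1/d\<close> adds a sample in the exchange argument.\<close>

lemma sherman_morrison:
 assumes A: "symm d A" and R: "symm d R" "A * R = idm d" and q: "c*bil d x R x ~= 1"
 shows "(A - c *\<^sub>R outer d x x)*(R + (c/(1 - c*bil d x R x)) *\<^sub>R (R * outer d x x * R)) = idm d"
proof -
 let ?X = "outer d x x" and ?q = "bil d x R x"
 let ?k = "c/(1 - c*?q)"
 have 1: "A*(R*?X * R) = ?X * R"
  by (metis A R(1,2) idm_left indim_outer mult.assoc symm_indim)
 have 2: "?X*(R*?X * R) = ?q *\<^sub>R (?X * R)"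
  using outer_mult[of d R x x x x] R(1) by (simp add: mult.assoc[symmetric])
 have "(A - c *\<^sub>R ?X)*(R + ?k *\<^sub>R (R*?X * R))
   = A * R + ?k *\<^sub>R (A*(R*?X * R)) - c *\<^sub>R (?X * R) - (c*?k) *\<^sub>R (?X*(R*?X * R))"
  by (simp only: left_diff_distrib distrib_left mult_scaleR_left mult_scaleR_right scaleR_scaleR)
   (simp add: scaleR_add_right algebra_simps)
 also have "... = idm d + (?k - c - c*?k*?q) *\<^sub>R (?X * R)"
  unfolding 1 2 R(2) by (simp add: scaleR_left.diff)
 also have "?k - c - c*?k*?q = 0" using q by (simp add: field_simps)
 finally show ?thesis by simp
qed

section \<open>Measurability of determinants and inverses\<close>

lemma measurable_det:
 fixes F :: "'a => real mat"
 assumes "\<And>w. F w \<in> carrier_mat n n"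
  and "\<And>i j. i < n ==> j < n ==> (%w. F w $$ (i, j)) \<in> borel_measurable M"
 shows "(%w. det (F w)) \<in> borel_measurable M"
proof -
 have *: "det (F w) = (\<Sum>p\<in>{p. p permutes {0..<n}}. signof p*(\<Prod>i=0..<n. F w $$ (i, p i)))" for w
  using det_def'[OF assms(1)] by simp
 show ?thesis unfolding *
 proof (intro borel_measurable_sum borel_measurable_times borel_measurable_prod borel_measurable_const)
  fix p i assume "p \<in> {p. p permutes {0..<n}}" "i \<in> {0..<n}"
  then have "p i < n" using permutes_in_image by fastforce
  then show "(%w. F w $$ (i, p i)) \<in> borel_measurable M" using assms(2)[of i "p i"] \<open>i \<in> _\<close> by simp
 qed
qed

lemma measurable_minv:
 assumes "\<And>i j. i < d ==> j < d ==> (%w. ent (A w) i j) \<in> borel_measurable M"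
 shows "(%w. ent (minv d (A w)) i j) \<in> borel_measurable M"
proof (cases "i < d \<and> j < d")
 case True
 have det: "(%w. det (tomat d (A w))) \<in> borel_measurable M"
  by (rule measurable_det[of _ d]) (use assms in auto)
 have "(%w. det (mat_delete (tomat d (A w)) j i)) \<in> borel_measurable M"
  by (rule measurable_det[of _ "d - 1"]) (use assms True in \<open>auto simp: mat_delete_def\<close>)
 with det show ?thesis using True by (simp add: minv_def ent_mk adj_mat_def cofactor_def)
next
 case False then have "ent (minv d B) i j = 0" for B
  using indim_minv[of d B] unfolding indim_def by (metis not_less)
 then show ?thesis by simp
qed

text \<open>Padding the system with zero rows gives a square matrix whose transpose kills the unit
  vector \<open>m\<close>, so its determinant is zero. This is the only dimension count; the
  comparison of eigenvalue counts rests on it.\<close>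

lemma homogeneous_solution:
 fixes A :: "nat => nat => real"
 assumes "m < n"
 shows "\<exists>v. (\<exists>j<n. v j ~= 0) \<and> (\<forall>i<m. (\<Sum>j<n. A i j * v j) = 0)"
proof -
 define M where "M = mat n n (%(i, j). if i < m then A i j else 0)"
 have M: "M \<in> carrier_mat n n" by (simp add: M_def)
 have "transpose_mat M *\<^sub>v unit_vec n m = 0\<^sub>v n"
  using assms by (intro eq_vecI) (auto simp: M_def)
 moreover have "unit_vec n m ~= (0\<^sub>v n :: real vec)" using assms by simp
 ultimately have "det (transpose_mat M) = 0"
  using det_0_iff_vec_prod_zero[of "transpose_mat M" n] M by (metis transpose_carrier_mat unit_vec_carrier)
 then have "det M = 0" using det_transpose[OF M] by simp
 then obtain v where v: "v \<in> carrier_vec n" "v ~= 0\<^sub>v n" "M *\<^sub>v v = 0\<^sub>v n"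
  using det_0_iff_vec_prod_zero[OF M] by auto
 have "(\<Sum>j<n. A i j * v $ j) = 0" if "i < m" for i
 proof -
  have "(M *\<^sub>v v) $ i = (\<Sum>j<n. A i j * v $ j)"
   using that assms v(1) by (simp add: M_def scalar_prod_def atLeast0LessThan)
  then show ?thesis using v(3) that assms by simp
 qed
 moreover have "\<exists>j<n. v $ j ~= 0" using v(1,2) by auto
 ultimately show ?thesis by (intro exI[of _ "%j. v $ j"]) auto
qed

section \<open>The spectral theorem for symmetric matrices\<close>

lemma ip_add_left: "ip d (%i. x i + y i) z = ip d x z + ip d y z"
 by (simp add: ip_def algebra_simps sum.distrib)
lemma ip_diff_right: "ip d z (%i. x i - y i) = ip d z x - ip d z y"
 by (simp add: ip_def algebra_simps sum_subtractf)
lemma ip_smult_right: "ip d z (%i. c*x i) = c*ip d z x"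
 by (simp add: ip_def algebra_simps sum_distrib_left)
lemma ip_smult_left: "ip d (%i. c*x i) z = c*ip d x z"
 by (simp add: ip_def algebra_simps sum_distrib_left)
lemma ip_add_right: "ip d z (%i. x i + y i) = ip d z x + ip d z y"
 by (simp add: ip_def algebra_simps sum.distrib)

lemma bil_cong:
 "(\<And>i. i < d ==> x i = x' i) ==> (\<And>i. i < d ==> y i = y' i) ==> bil d x A y = bil d x' A y'"
 by (simp add: bil_def)

lemma quadratic_nonneg_imp_zero:
 fixes a c :: real
 assumes "\<And>t. 0 <= 2*t*a + t^2*c" shows "a = 0"
proof (rule ccontr)
 assume "a ~= 0"
 define k where "k = 1 + \<bar>c\<bar>"
 have k: "k > 0" "c < k" by (auto simp: k_def)
 have "0 <= 2*(- a/k)*a + (- a/k)^2*c" by (rule assms)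
 also have "... = (a^2/k)*(c/k - 2)" using k by (simp add: field_simps power2_eq_square)
 also have "... < 0" using \<open>a ~= 0\<close> k by (intro mult_pos_neg) (auto simp: field_simps)
 finally show False by simp
qed

text \<open>Minimise the quadratic form over the unit vectors orthogonal to the eigenvectors already
  found. The first variation at the minimiser vanishes in all admissible directions, and the
  residual \<open>A v - l v\<close> is itself such a direction.\<close>

lemma eigen_extend:
 assumes A: "symm d A" and m: "m < d"
  and on: "\<And>i j. i < m ==> j < m ==> ip d (e i) (e j) = (if i = j then 1 else 0)"
  and ev: "\<And>i k. i < m ==> mv d A (e i) k = lam i*e i k"
 shows "\<exists>v l. ip d v v = 1 \<and> (\<forall>i<m. ip d (e i) v = 0) \<and> (\<forall>k. mv d A v k = l * v k)"
proof -
 \<comment> \<open>Coordinates beyond \<open>d\<close> are pinned to 0 and the others confined to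
   \<open>[-1, 1]\<close>, so that \<open>S\<close> is a closed subset of a compact product.\<close>
 define S where "S = {v. (\<forall>i. v i \<in> (if i < d then {-1..1} else {0})) \<and> ip d v v = 1 \<and> (\<forall>i<m. ip d (e i) v = 0)}"
 have cont: "continuous_on UNIV (%v. ip d x v)" "continuous_on UNIV (%v. ip d v v)" for x
  unfolding ip_def by (auto intro!: continuous_intros continuous_on_product_coordinates)
 have "compact (PiE UNIV (%i. if i < d then {-1..1} else {0 :: real}))"
  unfolding compactin_euclidean_iff[symmetric] euclidean_product_topology[symmetric] compactin_PiE
  by auto
 moreover have "S = PiE UNIV (%i. if i < d then {-1..1} else {0 :: real}) \<inter>
   ({v. ip d v v = 1} \<inter> (\<Inter>i\<in>{..<m}. {v. ip d (e i) v = 0}))"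
  by (auto simp: S_def PiE_def Pi_def extensional_def split: if_splits)
 moreover have "closed ({v. ip d v v = 1} \<inter> (\<Inter>i\<in>{..<m}. {v. ip d (e i) v = 0}))"
  by (intro closed_Int closed_INT ballI closed_Collect_eq continuous_on_const cont)
 ultimately have comp: "compact S" by (simp add: compact_Int_closed)
 have norm: "(%k. if k < d then w k/sqrt (ip d w w) else 0) \<in> S"
  if w: "ip d w w ~= 0" "\<And>i. i < m ==> ip d (e i) w = 0" for w
 proof -
  define w' where "w' = (%k. if k < d then w k/sqrt (ip d w w) else 0)"
  have pos: "ip d w w > 0" using w(1) ip_nonneg[of d w] by linarith
  have a: "ip d x w' = ip d x w/sqrt (ip d w w)" for x
   by (simp add: ip_def w'_def sum_divide_distrib)
  have "ip d w' w' = ip d w w/sqrt (ip d w w)/sqrt (ip d w w)"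
   unfolding a[of w'] ip_comm[of d w' w] a[of w] ..
  also have "... = 1" using pos by (simp add: divide_divide_eq_left)
  finally have 1: "ip d w' w' = 1" .
  have "w' i \<in> {-1..1}" if "i < d" for i
  proof -
   have "(w' i)^2 <= ip d w' w'"
    unfolding ip_def power2_eq_square using that by (intro member_le_sum) auto
   then have "\<bar>w' i\<bar> <= 1" using 1 by (simp add: abs_square_le_1)
   then show ?thesis by auto
  qed
  then have "w' \<in> S" using 1 w(2) by (auto simp: S_def a) (auto simp: w'_def)
  then show ?thesis by (simp add: w'_def)
 qed
 obtain w where w: "\<exists>j<d. w j ~= 0" "\<forall>i<m. (\<Sum>j<d. e i j*w j) = 0"
  using homogeneous_solution[OF m, of e] by auto
 then have "ip d w w ~= 0" using ip_eq_0 by blast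
 then have "S ~= {}" using norm[of w] w(2) by (auto simp: ip_def)
 moreover have "continuous_on S (%v. bil d v A v)"
  unfolding bil_def by (auto intro!: continuous_intros continuous_on_subset[OF continuous_on_product_coordinates])
 ultimately obtain v where v: "v \<in> S" "\<And>w. w \<in> S ==> bil d v A v <= bil d w A w"
  using continuous_attains_inf[OF comp] by blast
 define l where "l = bil d v A v"
 have v1: "ip d v v = 1" "\<And>i. i < m ==> ip d (e i) v = 0"
  using v(1) by (auto simp: S_def)
 have v3: "v k = 0" if "d <= k" for k
  using v(1) that unfolding S_def by (auto dest: spec[of _ k])
 have min: "l*ip d w w <= bil d w A w" if "\<And>i. i < m ==> ip d (e i) w = 0" for w
 proof (cases "ip d w w = 0")
  case True
  then have "bil d w A w = bil d (%i. 0) A (%i. 0)" using ip_eq_0 by (intro bil_cong) auto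
  then show ?thesis using True by (simp add: bil_def)
 next
  case False
  then have pos: "ip d w w > 0" using ip_nonneg[of d w] by linarith
  let ?c = "1/sqrt (ip d w w)"
  have "l <= bil d (%k. if k < d then w k/sqrt (ip d w w) else 0) A (%k. if k < d then w k/sqrt (ip d w w) else 0)"
   unfolding l_def using v(2)[OF norm[OF False that]] by simp
  also have "... = bil d (%k. ?c*w k) A (%k. ?c*w k)" by (rule bil_cong) auto
  also have "... = bil d w A w/ip d w w"
   unfolding bil_smult_left bil_smult_right using pos by simp
  finally show ?thesis using pos by (simp add: field_simps)
 qed
 have crit: "bil d w A v - l*ip d w v = 0" if w: "\<And>i. i < m ==> ip d (e i) w = 0" for w
 proof (rule quadratic_nonneg_imp_zero[of _ "bil d w A w - l*ip d w w"])
  fix t :: real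
  have "l*ip d (%i. v i + t*w i) (%i. v i + t*w i) <= bil d (%i. v i + t*w i) A (%i. v i + t*w i)"
   by (rule min) (simp add: ip_add_right ip_smult_right w v1)
  then show "0 <= 2*t*(bil d w A v - l*ip d w v) + t^2*(bil d w A w - l*ip d w w)"
   using symm_bil[OF A, of v w]
   by (simp add: bil_add_left bil_add_right bil_smult_left bil_smult_right ip_add_left ip_add_right
     ip_smult_left ip_smult_right l_def[symmetric] v1 ip_comm[of d v w] power2_eq_square algebra_simps)
 qed
 \<comment> \<open>The residual is orthogonal to every \<open>e i\<close> because \<open>A\<close>
   maps \<open>e i\<close> to a multiple of itself. Hence \<open>crit\<close> applies to
   \<open>r\<close> and gives \<open>ip d r r = 0\<close>.\<close>
 define r where "r = (%k. mv d A v k - l * v k)"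
 have r: "ip d x r = bil d x A v - l*ip d x v" for x
  by (simp add: r_def ip_diff_right ip_smult_right bil_mv)
 have "ip d (e i) r = 0" if "i < m" for i
 proof -
  have "bil d (e i) A v = bil d v A (e i)" using symm_bil[OF A] .
  also have "... = lam i*ip d v (e i)"
   unfolding bil_mv ip_smult_right[symmetric] using ev[OF that] by (intro arg_cong[of _ _ "ip d v"] ext)
  finally show ?thesis using v1(2)[OF that] by (simp add: r ip_comm[of d v])
 qed
 then have "ip d r r = 0" using crit[of r] by (simp add: r[of r])
 then have "r k = 0" if "k < d" for k using ip_eq_0 that by blast
 moreover have "r k = 0" if "d <= k" for k
  using that A v3 by (auto simp: r_def mv_def symm_def indim_def)
 ultimately have "r k = 0" for k using not_less by blast
 then have "\<forall>k. mv d A v k = l * v k" by (simp add: r_def)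
 with v1 show ?thesis by blast
qed

definition orthonormal :: "nat => nat => (nat => nat => real) => bool" where
 "orthonormal d m e \<longleftrightarrow> (\<forall>i<m. \<forall>j<m. ip d (e i) (e j) = (if i = j then 1 else 0))"

theorem spectral_theorem:
 assumes A: "symm d A"
 obtains e lam where "orthonormal d d e" "\<And>i k. i < d ==> mv d A (e i) k = lam i*e i k"
proof -
 have "\<exists>e lam. orthonormal d m e \<and> (\<forall>i<m. \<forall>k. mv d A (e i) k = lam i*e i k)" if "m <= d" for m
  using that
 proof (induction m)
  case 0 then show ?case by (auto simp: orthonormal_def)
 next
  case (Suc m)
  then obtain e lam where e: "orthonormal d m e" "\<forall>i<m. \<forall>k. mv d A (e i) k = lam i*e i k"
   by auto
  obtain v l where v: "ip d v v = 1" "\<forall>i<m. ip d (e i) v = 0" "\<forall>k. mv d A v k = l * v k"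
   using eigen_extend[OF A, of m e lam] Suc.prems e by (auto simp: orthonormal_def)
  have "orthonormal d (Suc m) (e(m := v))"
  proof -
   have "\<forall>i<m. ip d v (e i) = 0" using v(2) by (metis ip_comm)
   then show ?thesis using e(1) v by (auto simp: orthonormal_def less_Suc_eq)
  qed
  moreover have "\<forall>i<Suc m. \<forall>k. mv d A ((e(m := v)) i) k = (lam(m := l)) i*(e(m := v)) i k"
   using e(2) v(3) by (auto simp: less_Suc_eq)
  ultimately show ?case by blast
 qed
 from this[of d] show ?thesis using that by blast
qed

lemma orthonormal_complete:
 assumes "orthonormal d d e" "k < d" "l < d"
 shows "(\<Sum>i<d. e i k*e i l) = (if k = l then 1 else 0)"
proof -
 define U where "U = mk d e"
 define V where "V = mk d (%i j. e j i)"
 have "U*V = idm d"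
  using assms(1) by (intro indim_eqI[of d])
   (auto simp: U_def V_def ent_times[of d] ent_mk ent_idm orthonormal_def ip_def)
 then have "V*U = idm d" by (rule fmat_left_right_inverse[rotated 2]) (auto simp: U_def V_def)
 then have "ent (V*U) k l = ent (idm d) k l" by simp
 then show ?thesis using assms by (simp add: U_def V_def ent_times[of d] ent_mk ent_idm)
qed

lemma spectral_decomposition:
 assumes "indim d A" "orthonormal d d e" "\<And>i k. i < d ==> mv d A (e i) k = lam i*e i k"
 shows "A = (\<Sum>i<d. lam i *\<^sub>R outer d (e i) (e i))"
proof (rule indim_eqI[of d])
 fix k l assume kl: "k < d" "l < d"
 have "ent (\<Sum>i<d. lam i *\<^sub>R outer d (e i) (e i)) k l = (\<Sum>i<d. mv d A (e i) k*e i l)"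
  using kl by (auto simp: ent_sum ent_outer assms(3) mult.assoc intro!: sum.cong)
 also have "... = (\<Sum>j<d. ent A k j*(\<Sum>i<d. e i j*e i l))"
  unfolding mv_def sum_distrib_left sum_distrib_right by (subst sum.swap) (simp add: mult.assoc)
 also have "... = (\<Sum>j<d. ent A k j*unitv l j)"
  using kl by (intro sum.cong refl) (simp add: orthonormal_complete[OF assms(2)] unitv_def)
 also have "... = ent A k l" using kl by (simp add: sum_unitv)
 finally show "ent A k l = ent (\<Sum>i<d. lam i *\<^sub>R outer d (e i) (e i)) k l" by simp
qed (use assms in auto)

lemma eigen_bil:
 assumes "orthonormal d d e" "\<And>i k. i < d ==> mv d A (e i) k = lam i*e i k" "i < d"
 shows "bil d (e i) A (e i) = lam i"
proof -
 have "mv d A (e i) = (%k. lam i*e i k)" using assms by auto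
 then show ?thesis using assms by (simp add: bil_mv ip_smult_right orthonormal_def)
qed

text \<open>The product need not be symmetric. In an eigenbasis of \<open>A\<close>, however, its
  trace is the sum of the eigenvalues of \<open>A\<close> times values of the form of
  \<open>B\<close>.\<close>

lemma trc_psd_mult:
 assumes "psd d A" "psd d B" shows "0 <= trc d (A*B)"
proof -
 obtain e lam where e: "orthonormal d d e" "\<And>i k. i < d ==> mv d A (e i) k = lam i*e i k"
  using spectral_theorem[of d A] assms(1) by auto
 have lam: "0 <= lam i" if "i < d" for i
  using eigen_bil[OF e that] psdD[OF assms(1)] by metis
 have "trc d (A*B) = trc d (B*A)" using assms by (intro trc_comm) auto
 also have "... = trc d (B*(\<Sum>i<d. lam i *\<^sub>R outer d (e i) (e i)))"
  using spectral_decomposition[OF _ e] assms(1) by simp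
 also have "... = (\<Sum>i<d. lam i*bil d (e i) B (e i))"
  using assms(2) by (simp add: sum_distrib_left trc_sum trc_scaleR trc_outer)
 also have "... \<ge> 0" using lam assms(2) by (intro sum_nonneg mult_nonneg_nonneg psdD) auto
 finally show ?thesis .
qed

lemma trc_psd: "psd d A ==> 0 <= trc d A"
 using trc_psd_mult[of d A "idm d"] by (simp add: psd_idm)

lemma trc_mult_mono:
 assumes "psd d (B - A)" "psd d C" "indim d A" "indim d B"
 shows "trc d (A*C) <= trc d (B*C)"
 using trc_psd_mult[OF assms(1,2)] by (simp add: left_diff_distrib trc_diff)

text \<open>The 2 by 2 minors give \<open>(ent A i j)^2 <= ent A i i * ent A j j\<close>; sum over
  \<open>i\<close> and \<open>j\<close>. The barrier needs this crude bound because it sees second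
  moments only through traces.\<close>

lemma trc_square_le:
 assumes "psd d A" shows "trc d (A*A) <= (trc d A)^2"
proof -
 have diag: "0 <= ent A i i" if "i < d" for i
  using psdD[OF assms, of "unitv i"] that by (simp add: bil_unitv)
 have minor: "(ent A i j)^2 <= ent A i i*ent A j j" if ij: "i < d" "j < d" for i j
 proof -
  have sym: "ent A j i = ent A i j" using psd_symm[OF assms] unfolding symm_def by metis
  have "0 <= ent A i i * s^2 + 2 * s*t*ent A i j + t^2*ent A j j" for s t
  proof -
   have "0 <= bil d (%k. s*unitv i k + t*unitv j k) A (%k. s*unitv i k + t*unitv j k)"
    by (rule psdD[OF assms])
   also have "... = ent A i i * s^2 + 2 * s*t*ent A i j + t^2*ent A j j"
    using ij sym by (simp add: bil_add_left bil_add_right bil_smult_left bil_smult_right bil_unitv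
      power2_eq_square algebra_simps)
   finally show ?thesis .
  qed
  note q = this
  show ?thesis
  proof (cases "ent A j j = 0")
   case True
   have "ent A i j = 0"
    by (rule quadratic_nonneg_imp_zero[of _ "ent A i i"]) (use q[of _ 1] True in \<open>simp add: algebra_simps\<close>)
   then show ?thesis using True by simp
  next
   case False
   then have pos: "ent A j j > 0" using diag[OF ij(2)] by simp
   have "0 <= ent A i i*(ent A j j)^2 + 2*ent A j j*(- ent A i j)*ent A i j + (- ent A i j)^2*ent A j j"
    by (rule q)
   also have "... = ent A j j*(ent A i i*ent A j j - (ent A i j)^2)"
    by (simp add: power2_eq_square algebra_simps)
   finally show ?thesis using pos by (simp add: zero_le_mult_iff)
  qed
 qed
 have "trc d (A*A) = (\<Sum>i<d. \<Sum>j<d. (ent A i j)^2)"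
  unfolding trc_def using assms
 proof (intro sum.cong refl)
  fix i assume "i \<in> {..<d}"
  have "ent A j i = ent A i j" for j using psd_symm[OF assms] unfolding symm_def by metis
  then show "ent (A*A) i i = (\<Sum>j<d. (ent A i j)^2)"
   using assms by (simp add: ent_times[of d] power2_eq_square)
 qed
 also have "... <= (\<Sum>i<d. \<Sum>j<d. ent A i i*ent A j j)" by (intro sum_mono minor) auto
 also have "... = (trc d A)^2" by (simp add: trc_def power2_eq_square sum_product)
 finally show ?thesis .
qed

section \<open>Gaussian moments of exponential polynomials\<close>

definition gauss1 :: "real measure" where "gauss1 = density lborel (%x. ennreal (std_normal_density x))"
definition gauss :: "nat => (nat => real) measure" where "gauss d = PiM {..<d} (%_. gauss1)"

lemma prob_space_gauss1: "prob_space gauss1"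
 unfolding gauss1_def by (rule prob_space_normal_density) simp
lemma sets_gauss1 [simp, measurable_cong]: "sets gauss1 = sets borel" by (simp add: gauss1_def)
lemma space_gauss1 [simp]: "space gauss1 = UNIV" by (simp add: gauss1_def)

interpretation gauss1: prob_space gauss1 by (rule prob_space_gauss1)
interpretation gauss1_prod: product_sigma_finite "%_::nat. gauss1" ..

lemma prob_space_gauss: "prob_space (gauss d)"
 unfolding gauss_def by (rule prob_space_PiM) (rule prob_space_gauss1)
interpretation gauss: prob_space "gauss d" for d by (rule prob_space_gauss)

lemma sets_gauss [measurable_cong]: "sets (gauss d) = sets (PiM {..<d} (%_. borel))"
 unfolding gauss_def by (rule sets_PiM_cong) auto

lemma measurable_gauss_component [measurable]: "i < d ==> (%q. q i) \<in> borel_measurable (gauss d)"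
 by (subst measurable_cong_sets[OF sets_gauss refl]) (rule measurable_component_singleton, simp)

lemma measurable_ip [measurable]: "(%q. ip d x q) \<in> borel_measurable (gauss d)"
 unfolding ip_def by (intro borel_measurable_sum borel_measurable_times borel_measurable_const measurable_gauss_component) auto

lemma has_integral_gauss1:
 assumes "has_bochner_integral lborel (%x. std_normal_density x*f x) (c::real)" "f \<in> borel_measurable borel"
 shows "integrable gauss1 f" "integral\<^sup>L gauss1 f = c"
 using assms unfolding gauss1_def has_bochner_integral_iff
 by (auto simp: integrable_density integral_density)

lemma gauss1_mgf: "integrable gauss1 (%x. exp (t*x))" "integral\<^sup>L gauss1 (%x. exp (t*x)) = exp (t^2/2)"
proof -
 have "has_bochner_integral lborel (%x. exp (t^2/2)*normal_density t 1 x) (exp (t^2/2)*1)"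
  by (intro has_bochner_integral_mult_right) (simp add: has_bochner_integral_iff)
 also have "(%x. exp (t^2/2)*normal_density t 1 x) = (%x. std_normal_density x*exp (t*x))"
  by (rule ext) (simp add: normal_density_def std_normal_density_def exp_add[symmetric] power2_eq_square field_simps)
 finally have *: "has_bochner_integral lborel (%x. std_normal_density x*exp (t*x)) (exp (t^2/2))" by simp
 show "integrable gauss1 (%x. exp (t*x))" "integral\<^sup>L gauss1 (%x. exp (t*x)) = exp (t^2/2)"
  using has_integral_gauss1[OF *] by auto
qed

lemma gauss_mgf:
 "integrable (gauss d) (%q. exp (ip d \<theta> q))"
 "(\<integral>q. exp (ip d \<theta> q) \<partial>gauss d) = exp (ip d \<theta> \<theta>/2)"
proof -
 have e: "exp (ip d \<theta> q) = (\<Prod>i<d. exp (\<theta> i*q i))" for q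
  by (simp add: ip_def exp_sum)
 show "integrable (gauss d) (%q. exp (ip d \<theta> q))"
  unfolding e gauss_def by (intro gauss1_prod.product_integrable_prod gauss1_mgf) auto
 have "(\<integral>q. exp (ip d \<theta> q) \<partial>gauss d) = (\<Prod>i<d. exp ((\<theta> i)^2/2))"
  unfolding e gauss_def by (subst gauss1_prod.product_integral_prod) (auto simp: gauss1_mgf)
 also have "... = exp (ip d \<theta> \<theta>/2)"
  by (simp add: exp_sum[symmetric] ip_def power2_eq_square sum_divide_distrib)
 finally show "(\<integral>q. exp (ip d \<theta> q) \<partial>gauss d) = exp (ip d \<theta> \<theta>/2)" .
qed

text \<open>\<open>expoly d F G\<close>: the i-th partial derivative of F is G i.\<close>

inductive expoly :: "nat => ((nat => real) => real) => (nat => (nat => real) => real) => bool" for d where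
 expoly_exp: "expoly d (%q. exp (ip d \<theta> q)) (%i q. \<theta> i*exp (ip d \<theta> q))"
| expoly_const: "expoly d (%q. c) (%i q. 0)"
| expoly_add: "expoly d F G ==> expoly d F' G' ==> expoly d (%q. F q + F' q) (%i q. G i q + G' i q)"
| expoly_mult: "expoly d F G ==> expoly d F' G' ==>
  expoly d (%q. F q*F' q) (%i q. G i q*F' q + F q*G' i q)"

lemma sum_list_product:
 fixes f g :: "'a => real"
 shows "(\<Sum>p\<leftarrow>List.product xs ys. h (fst p) (snd p)) = (\<Sum>x\<leftarrow>xs. \<Sum>y\<leftarrow>ys. (h x y :: real))"
 by (induction xs) (auto simp: comp_def)

text \<open>The closure rules suit later constructions. The Poincare inequality needs the normal
  form, a finite combination of exponentials, in which function and gradient share coefficients and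
  frequencies.\<close>

lemma expoly_list:
 assumes "expoly d F G"
 shows "\<exists>L. F = (%q. \<Sum>(c, \<theta>)\<leftarrow>L. c*exp (ip d \<theta> q)) \<and>
      G = (%i q. \<Sum>(c, \<theta>)\<leftarrow>L. c*\<theta> i*exp (ip d \<theta> q))"
 using assms
proof induction
 case (expoly_exp \<theta>)
 show ?case by (rule exI[of _ "[(1, \<theta>)]"]) simp
next
 case (expoly_const c)
 show ?case by (rule exI[of _ "[(c, %_. 0)]"]) (simp add: ip_def)
next
 case (expoly_add F G F' G')
 then obtain L L' where "F = (%q. \<Sum>(c, \<theta>)\<leftarrow>L. c*exp (ip d \<theta> q))"
  "G = (%i q. \<Sum>(c, \<theta>)\<leftarrow>L. c*\<theta> i*exp (ip d \<theta> q))"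
  "F' = (%q. \<Sum>(c, \<theta>)\<leftarrow>L'. c*exp (ip d \<theta> q))"
  "G' = (%i q. \<Sum>(c, \<theta>)\<leftarrow>L'. c*\<theta> i*exp (ip d \<theta> q))" by blast
 then show ?case by (intro exI[of _ "L @ L'"]) simp
next
 case (expoly_mult F G F' G')
 then obtain L L' where L: "F = (%q. \<Sum>(c, \<theta>)\<leftarrow>L. c*exp (ip d \<theta> q))"
  "G = (%i q. \<Sum>(c, \<theta>)\<leftarrow>L. c*\<theta> i*exp (ip d \<theta> q))"
  "F' = (%q. \<Sum>(c, \<theta>)\<leftarrow>L'. c*exp (ip d \<theta> q))"
  "G' = (%i q. \<Sum>(c, \<theta>)\<leftarrow>L'. c*\<theta> i*exp (ip d \<theta> q))" by blast
 define P where "P = map (%p. (fst (fst p)*fst (snd p), %i. snd (fst p) i + snd (snd p) i)) (List.product L L')"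
 have F: "F q*F' q = (\<Sum>(c, \<theta>)\<leftarrow>P. c*exp (ip d \<theta> q))" for q
 proof -
  have "(\<Sum>(c, \<theta>)\<leftarrow>P. c*exp (ip d \<theta> q)) =
   (\<Sum>p\<leftarrow>List.product L L'. fst (fst p)*fst (snd p)*exp (ip d (%i. snd (fst p) i + snd (snd p) i) q))"
   by (simp add: P_def comp_def)
  also have "... = (\<Sum>x\<leftarrow>L. \<Sum>y\<leftarrow>L'. fst x*fst y*exp (ip d (%i. snd x i + snd y i) q))"
   by (rule sum_list_product)
  also have "... = F q*F' q"
   by (simp add: L split_def ip_add_left exp_add mult_ac flip: sum_list_mult_const sum_list_const_mult)
  finally show ?thesis by simp
 qed
 have G: "G i q*F' q + F q*G' i q = (\<Sum>(c, \<theta>)\<leftarrow>P. c*\<theta> i*exp (ip d \<theta> q))" for i q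
 proof -
  have "(\<Sum>(c, \<theta>)\<leftarrow>P. c*\<theta> i*exp (ip d \<theta> q)) =
   (\<Sum>p\<leftarrow>List.product L L'. fst (fst p)*fst (snd p)*(snd (fst p) i + snd (snd p) i)*exp (ip d (%i. snd (fst p) i + snd (snd p) i) q))"
   by (simp add: P_def comp_def)
  also have "... = (\<Sum>x\<leftarrow>L. \<Sum>y\<leftarrow>L'. fst x*fst y*(snd x i + snd y i)*exp (ip d (%i. snd x i + snd y i) q))"
   by (rule sum_list_product)
  also have "... = (\<Sum>x\<leftarrow>L. \<Sum>y\<leftarrow>L'. fst x * snd x i*exp (ip d (snd x) q)*(fst y*exp (ip d (snd y) q))
    + fst x*exp (ip d (snd x) q)*(fst y * snd y i*exp (ip d (snd y) q)))"
   by (simp add: ip_add_left exp_add algebra_simps)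
  also have "... = G i q*F' q + F q*G' i q"
   by (simp add: L split_def sum_list_addf sum_list_mult_const sum_list_const_mult)
  finally show ?thesis by simp
 qed
 show ?case by (rule exI[of _ P]) (use F G in auto)
qed

lemma expoly_sumform:
 assumes "expoly d F G"
 obtains n :: nat and c \<theta> where "F = (%q. \<Sum>a<n. c a*exp (ip d (\<theta> a) q))"
  "G = (%i q. \<Sum>a<n. c a*\<theta> a i*exp (ip d (\<theta> a) q))"
proof -
 obtain L where L: "F = (%q. \<Sum>(c, \<theta>)\<leftarrow>L. c*exp (ip d \<theta> q))"
  "G = (%i q. \<Sum>(c, \<theta>)\<leftarrow>L. c*\<theta> i*exp (ip d \<theta> q))" using expoly_list[OF assms] by blast
 show ?thesis
  by (rule that[where n="length L" and c="%a. fst (L ! a)" and \<theta>="%a. snd (L ! a)"])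
   (simp_all add: L sum_list_sum_nth split_def atLeast0LessThan)
qed

lemma expoly_integrable: "expoly d F G ==> integrable (gauss d) F"
proof -
 assume "expoly d F G"
 then obtain n :: nat and c \<theta> where F: "F = (%q. \<Sum>a<n. c a*exp (ip d (\<theta> a) q))"
  by (rule expoly_sumform)
 show ?thesis unfolding F
  by (intro integrable_sum_set integrable_mult_right gauss_mgf)
qed

definition esf :: "nat => ((nat => real) => real) => bool" where "esf d F \<longleftrightarrow> (\<exists>G. expoly d F G)"

lemma esfI: "expoly d F G ==> esf d F" by (auto simp: esf_def)
lemma esf_add: "esf d F ==> esf d H ==> esf d (%q. F q + H q)" unfolding esf_def by (blast intro: expoly_add)
lemma esf_mult: "esf d F ==> esf d H ==> esf d (%q. F q*H q)" unfolding esf_def by (blast intro: expoly_mult)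
lemma esf_const: "esf d (%q. c)" using expoly_const by (auto simp: esf_def)
lemma esf_exp: "esf d (%q. exp (ip d \<theta> q))" using expoly_exp by (auto simp: esf_def)
lemma esf_sum: "(\<And>i. i \<in> I ==> esf d (F i)) ==> esf d (%q. \<Sum>i\<in>I. F i q)"
 by (induction I rule: infinite_finite_induct) (auto intro: esf_add esf_const)
lemma esf_power: "esf d F ==> esf d (%q. F q^n)"
 by (induction n) (auto intro: esf_const esf_mult)
lemma esf_integrable: "esf d F ==> integrable (gauss d) F"
 using expoly_integrable by (auto simp: esf_def)
lemmas esf_intros = esf_add esf_mult esf_const esf_exp esf_sum esf_power

lemma expoly_grad_esf: "expoly d F G ==> esf d (G i)"
 by (induction rule: expoly.induct) (auto intro!: esf_intros intro: esfI)

section \<open>The Poincare inequality and higher moments\<close>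

lemma gram_power_psd:
 fixes g :: "nat => real"
 shows "0 <= (\<Sum>a<n. \<Sum>b<n. g a*g b*ip d (\<theta> a) (\<theta> b)^k)"
proof (induction k arbitrary: g)
 case 0
 have "(\<Sum>a<n. \<Sum>b<n. g a*g b) = (\<Sum>a<n. g a)^2" by (simp add: power2_eq_square sum_product)
 then show ?case by simp
next
 case (Suc k)
 have "(\<Sum>a<n. \<Sum>b<n. g a*g b*ip d (\<theta> a) (\<theta> b)^Suc k)
  = (\<Sum>a<n. \<Sum>b<n. \<Sum>i<d. (g a*\<theta> a i)*(g b*\<theta> b i)*ip d (\<theta> a) (\<theta> b)^k)"
  by (intro sum.cong refl) (simp add: ip_def[of d "\<theta> _" "\<theta> _"] sum_distrib_left sum_distrib_right mult_ac)
 also have "... = (\<Sum>i<d. \<Sum>a<n. \<Sum>b<n. (g a*\<theta> a i)*(g b*\<theta> b i)*ip d (\<theta> a) (\<theta> b)^k)"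
  by (simp only: sum.swap[of _ "{..<d}" "{..<n}"])
 also have "... \<ge> 0" by (intro sum_nonneg Suc.IH)
 finally show ?case .
qed

text \<open>The added 1 cancels the coefficient -1 at \<open>k = 0\<close>; the coefficient at
  \<open>k = 1\<close> is 0 and all later ones are positive. Nonnegativity is what is
  needed.\<close>

lemma poincare_series:
 fixes x :: real
 shows "(%k. (if k = 0 then 0 else real k - 1)/fact k*x^k) sums (x*exp x - exp x + 1)"
proof -
 have e: "(%k. x^k/fact k) sums exp x"
  using exp_converges[of x] by (simp add: scaleR_conv_of_real field_simps)
 have "(%k. real (Suc k)/fact (Suc k)*x^Suc k) sums (x*exp x)"
 proof -
  have "(%k. x*(x^k/fact k)) sums (x*exp x)" by (intro sums_mult e)
  also have "(%k. x*(x^k/fact k)) = (%k. real (Suc k)/fact (Suc k)*x^Suc k)"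
   by (rule ext) (simp add: field_simps del: of_nat_Suc)
  finally show ?thesis .
 qed
 then have "(%k. real k/fact k*x^k) sums (x*exp x)"
  by (subst (asm) sums_Suc_iff) simp
 from sums_add[OF sums_diff[OF this e] sums_single[of 0 "%_. 1"]]
 have "(%k. real k/fact k*x^k - x^k/fact k + (if k = 0 then 1 else 0)) sums (x*exp x - exp x + 1)" .
 then show ?thesis by (rule sums_cong[THEN iffD1, rotated]) (auto simp: field_simps)
qed

text \<open>After Gaussian integration both sides are quadratic forms in the weights
  \<open>g a\<close>, with kernels \<open>exp x - 1\<close> and \<open>x exp x\<close> at
  \<open>x = ip d (\<theta> a) (\<theta> b)\<close>. The difference
  \<open>x exp x - exp x + 1\<close> has nonnegative Taylor coefficients, and entrywise powers of a
  Gram matrix are nonnegative forms.\<close>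

theorem poincare:
 assumes "expoly d F G"
 shows "(\<integral>q. (F q)^2 \<partial>gauss d) - (\<integral>q. F q \<partial>gauss d)^2 <= (\<integral>q. (\<Sum>i<d. (G i q)^2) \<partial>gauss d)"
proof -
 obtain n :: nat and c \<theta> where F: "F = (%q. \<Sum>a<n. c a*exp (ip d (\<theta> a) q))"
  and G: "G = (%i q. \<Sum>a<n. c a*\<theta> a i*exp (ip d (\<theta> a) q))"
  using expoly_sumform[OF assms] by blast
 define g where "g a = c a*exp (ip d (\<theta> a) (\<theta> a)/2)" for a
 define x where "x a b = ip d (\<theta> a) (\<theta> b)" for a b
 have prod: "exp (ip d (\<theta> a) q)*exp (ip d (\<theta> b) q) = exp (ip d (%i. \<theta> a i + \<theta> b i) q)" for a b q
  by (simp add: ip_add_left exp_add)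
 have E2: "(\<integral>q. exp (ip d (\<theta> a) q)*exp (ip d (\<theta> b) q) \<partial>gauss d)
   = exp (x a a/2)*exp (x b b/2)*exp (x a b)" for a b
  unfolding prod gauss_mgf
  by (simp add: x_def ip_add_left ip_add_right ip_comm[of d "\<theta> b" "\<theta> a"] exp_add[symmetric] field_simps)
 have I2: "integrable (gauss d) (%q. exp (ip d (\<theta> a) q)*exp (ip d (\<theta> b) q))" for a b
  unfolding prod by (rule gauss_mgf)
 have sq: "(\<integral>q. (\<Sum>a<n. u a*exp (ip d (\<theta> a) q))^2 \<partial>gauss d)
   = (\<Sum>a<n. \<Sum>b<n. u a*u b*(exp (x a a/2)*exp (x b b/2)*exp (x a b)))" for u
 proof -
  have "(\<Sum>a<n. u a*exp (ip d (\<theta> a) q))^2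
    = (\<Sum>a<n. \<Sum>b<n. u a*u b*(exp (ip d (\<theta> a) q)*exp (ip d (\<theta> b) q)))" for q
   by (simp add: power2_eq_square sum_product mult_ac)
  then show ?thesis by (simp add: I2 E2 integrable_mult_right)
 qed
 have 1: "(\<integral>q. (F q)^2 \<partial>gauss d) = (\<Sum>a<n. \<Sum>b<n. g a*g b*exp (x a b))"
  unfolding F sq g_def x_def by (simp add: mult_ac)
 have 2: "(\<integral>q. F q \<partial>gauss d) = (\<Sum>a<n. g a)"
  unfolding F by (simp add: gauss_mgf integrable_mult_right g_def)
 have 3: "(\<integral>q. (\<Sum>i<d. (G i q)^2) \<partial>gauss d) = (\<Sum>a<n. \<Sum>b<n. g a*g b*(x a b*exp (x a b)))"
 proof -
  have int: "integrable (gauss d) (%q. (G i q)^2)" for i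
   using esf_integrable[OF esf_power[OF expoly_grad_esf[OF assms]]] .
  have "(\<integral>q. (\<Sum>i<d. (G i q)^2) \<partial>gauss d) = (\<Sum>i<d. \<integral>q. (G i q)^2 \<partial>gauss d)"
   using int by simp
  also have "... = (\<Sum>i<d. \<Sum>a<n. \<Sum>b<n. (c a*\<theta> a i)*(c b*\<theta> b i)*(exp (x a a/2)*exp (x b b/2)*exp (x a b)))"
   unfolding G sq ..
  also have "... = (\<Sum>a<n. \<Sum>b<n. \<Sum>i<d. (c a*\<theta> a i)*(c b*\<theta> b i)*(exp (x a a/2)*exp (x b b/2)*exp (x a b)))"
   by (simp only: sum.swap[of _ "{..<n}" "{..<d}"])
  also have "... = (\<Sum>a<n. \<Sum>b<n. g a*g b*(x a b*exp (x a b)))"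
   by (intro sum.cong refl) (simp add: g_def x_def ip_def[of d "\<theta> _" "\<theta> _"] sum_distrib_left sum_distrib_right mult_ac)
  finally show ?thesis .
 qed
 have S: "(%k. \<Sum>a<n. \<Sum>b<n. g a*g b*((if k = 0 then 0 else real k - 1)/fact k*x a b^k)) sums
   (\<Sum>a<n. \<Sum>b<n. g a*g b*(x a b*exp (x a b) - exp (x a b) + 1))"
  by (intro sums_sum sums_mult poincare_series)
 have NN: "0 <= (\<Sum>a<n. \<Sum>b<n. g a*g b*((if k = 0 then 0 else real k - 1)/fact k*x a b^k))" for k
 proof -
  have "(\<Sum>a<n. \<Sum>b<n. g a*g b*((if k = 0 then 0 else real k - 1)/fact k*x a b^k))
   = (if k = 0 then 0 else real k - 1)/fact k*(\<Sum>a<n. \<Sum>b<n. g a*g b*x a b^k)"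
   by (simp add: sum_distrib_left mult_ac)
  also have "... \<ge> 0" unfolding x_def by (intro mult_nonneg_nonneg gram_power_psd) auto
  finally show ?thesis .
 qed
 have "0 <= (\<Sum>a<n. \<Sum>b<n. g a*g b*(x a b*exp (x a b) - exp (x a b) + 1))"
  by (rule sums_le[OF NN sums_zero S])
 also have "... = (\<Sum>a<n. \<Sum>b<n. g a*g b*(x a b*exp (x a b))) - (\<Sum>a<n. \<Sum>b<n. g a*g b*exp (x a b)) + (\<Sum>a<n. g a)^2"
  by (simp add: power2_eq_square sum_product algebra_simps sum.distrib sum_subtractf)
 finally show ?thesis unfolding 1 2 3 by simp
qed

lemma jensen_square:
 assumes "esf d F" shows "(\<integral>q. F q \<partial>gauss d)^2 <= (\<integral>q. (F q)^2 \<partial>gauss d)"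
proof -
 let ?m = "\<integral>q. F q \<partial>gauss d"
 have int: "integrable (gauss d) F" "integrable (gauss d) (%q. (F q)^2)"
  using assms by (auto intro: esf_integrable esf_power)
 have "0 <= (\<integral>q. (F q - ?m)^2 \<partial>gauss d)" by (rule integral_nonneg_AE) simp
 also have "... = (\<integral>q. (F q)^2 - 2*?m*F q + ?m^2 \<partial>gauss d)"
  by (simp add: power2_diff algebra_simps)
 also have "... = (\<integral>q. (F q)^2 \<partial>gauss d) - ?m^2"
  using int by (simp add: gauss.prob_space power2_eq_square)
 finally show ?thesis by simp
qed

text \<open>Poincare for \<open>F^2\<close> leaves the mixed term \<open>4 F^2 V\<close>, at most
  \<open>F^4/2 + 8 V^2\<close>. Half of the left side is absorbed, whence
  \<open>18 = 2 (1 + 8)\<close>.\<close>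

lemma fourth_moment:
 assumes F: "expoly d F G" and mean: "(\<integral>q. F q \<partial>gauss d) = 0"
  and V: "\<And>q. V q = (\<Sum>i<d. (G i q)^2)"
 shows "(\<integral>q. F q^4 \<partial>gauss d) <= 18*(\<integral>q. (V q)^2 \<partial>gauss d)"
proof -
 have eF: "esf d F" using F by (rule esfI)
 have eV: "esf d V" unfolding V[abs_def] by (intro esf_intros expoly_grad_esf[OF F])
 have int: "integrable (gauss d) (%q. F q^4)" "integrable (gauss d) (%q. (V q)^2)"
  "integrable (gauss d) (%q. (F q)^2*V q)"
  by (intro esf_integrable esf_intros eF eV)+
 have F2: "(\<integral>q. (F q)^2 \<partial>gauss d) <= (\<integral>q. V q \<partial>gauss d)"
  using poincare[OF F] mean by (simp add: V)
 have "(\<integral>q. (F q*F q)^2 \<partial>gauss d) - (\<integral>q. F q*F q \<partial>gauss d)^2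
   <= (\<integral>q. (\<Sum>i<d. (G i q*F q + F q*G i q)^2) \<partial>gauss d)"
  by (rule poincare[OF expoly_mult[OF F F]])
 also have "(%q. \<Sum>i<d. (G i q*F q + F q*G i q)^2) = (%q. 4*((F q)^2*V q))"
  by (rule ext) (simp add: V sum_distrib_left power2_eq_square algebra_simps)
 finally have "(\<integral>q. F q^4 \<partial>gauss d) - (\<integral>q. (F q)^2 \<partial>gauss d)^2 <= (\<integral>q. 4*((F q)^2*V q) \<partial>gauss d)"
  by (simp add: power2_eq_square power4_eq_xxxx mult.assoc)
 also have "... <= (\<integral>q. F q^4/2 + 8*(V q)^2 \<partial>gauss d)"
 proof (intro integral_mono)
  fix q
  have "0 <= ((F q)^2 - 4*V q)^2/2" by simp
  also have "... = (F q^4/2 + 8*(V q)^2) - 4*((F q)^2*V q)"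
   by (simp add: power2_eq_square power4_eq_xxxx field_simps)
  finally show "4*((F q)^2*V q) <= F q^4/2 + 8*(V q)^2" by simp
 qed (use int in auto)
 also have "... = (\<integral>q. F q^4 \<partial>gauss d)/2 + 8*(\<integral>q. (V q)^2 \<partial>gauss d)"
  using int by simp
 finally have 1: "(\<integral>q. F q^4 \<partial>gauss d)/2 <= (\<integral>q. (F q)^2 \<partial>gauss d)^2 + 8*(\<integral>q. (V q)^2 \<partial>gauss d)"
  by simp
 have "(\<integral>q. (F q)^2 \<partial>gauss d)^2 <= (\<integral>q. V q \<partial>gauss d)^2"
  by (intro power_mono F2 integral_nonneg_AE) simp
 also have "... <= (\<integral>q. (V q)^2 \<partial>gauss d)" by (rule jensen_square[OF eV])
 finally show ?thesis using 1 by simp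
qed

text \<open>Poincare for \<open>F^4\<close> leaves \<open>16 F^6 V\<close>. Where
  \<open>F^2 >= 32 V\<close> it is at most \<open>F^8/2\<close>; elsewhere it is at most
  \<open>16 * 32^3 V^4 = 524288 V^4\<close>. The square of the fourth moment adds
  \<open>18^2 = 324\<close>, and twice the sum is below 2000000.\<close>

lemma eighth_moment:
 assumes F: "expoly d F G" and mean: "(\<integral>q. F q \<partial>gauss d) = 0"
  and V: "\<And>q. V q = (\<Sum>i<d. (G i q)^2)"
 shows "(\<integral>q. F q^8 \<partial>gauss d) <= 2000000*(\<integral>q. V q^4 \<partial>gauss d)"
proof -
 have eF: "esf d F" using F by (rule esfI)
 have eV: "esf d V" unfolding V[abs_def] by (intro esf_intros expoly_grad_esf[OF F])
 have V0: "0 <= V q" for q unfolding V by (intro sum_nonneg) simp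
 have int: "integrable (gauss d) (%q. F q^8)" "integrable (gauss d) (%q. V q^4)"
  "integrable (gauss d) (%q. F q^6*V q)"
  by (intro esf_integrable esf_intros eF eV)+
 let ?G4 = "%i q. (G i q*F q + F q*G i q)*(F q*F q) + (F q*F q)*(G i q*F q + F q*G i q)"
 have "(\<integral>q. ((F q*F q)*(F q*F q))^2 \<partial>gauss d) - (\<integral>q. (F q*F q)*(F q*F q) \<partial>gauss d)^2
   <= (\<integral>q. (\<Sum>i<d. (?G4 i q)^2) \<partial>gauss d)"
  by (rule poincare[OF expoly_mult[OF expoly_mult[OF F F] expoly_mult[OF F F]]])
 also have "(%q. \<Sum>i<d. (?G4 i q)^2) = (%q. 16*(F q^6*V q))"
  by (rule ext) (simp add: V sum_distrib_left eval_nat_numeral algebra_simps)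
 finally have "(\<integral>q. F q^8 \<partial>gauss d) - (\<integral>q. F q^4 \<partial>gauss d)^2 <= (\<integral>q. 16*(F q^6*V q) \<partial>gauss d)"
  by (simp add: eval_nat_numeral mult.assoc)
 also have "... <= (\<integral>q. F q^8/2 + 524288*V q^4 \<partial>gauss d)"
 proof (intro integral_mono)
  fix q
  define u where "u = (F q)^2"
  have u: "0 <= u" by (simp add: u_def)
  have "16*(u^3*V q) <= u^4/2 + 524288*V q^4"
  proof (cases "32*V q <= u")
   case True
   then have "u^3*(32*V q) <= u^3*u" using u by (intro mult_left_mono) auto
   then have "16*(u^3*V q) <= u^4/2" by (simp add: eval_nat_numeral)
   moreover have "0 <= V q^4" by simp
   ultimately show ?thesis by linarith
  next
   case False
   then have "u^3 <= (32*V q)^3" using u by (intro power_mono) auto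
   then have "u^3*V q <= (32*V q)^3*V q" using V0 by (intro mult_right_mono) auto
   also have "... = 32768*V q^4" by (simp add: eval_nat_numeral)
   finally have "u^3*V q <= 32768*V q^4" .
   then have "16*(u^3*V q) <= 524288*V q^4" by linarith
   moreover have "0 <= u^4" by simp
   ultimately show ?thesis by linarith
  qed
  then show "16*(F q^6*V q) <= F q^8/2 + 524288*V q^4"
   by (simp add: u_def flip: power_mult)
 qed (use int in auto)
 also have "... = (\<integral>q. F q^8 \<partial>gauss d)/2 + 524288*(\<integral>q. V q^4 \<partial>gauss d)"
  using int by simp
 finally have 1: "(\<integral>q. F q^8 \<partial>gauss d)/2 <= (\<integral>q. F q^4 \<partial>gauss d)^2 + 524288*(\<integral>q. V q^4 \<partial>gauss d)"
  by simp
 have "(\<integral>q. F q^4 \<partial>gauss d)^2 <= (18*(\<integral>q. (V q)^2 \<partial>gauss d))^2"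
  by (intro power_mono fourth_moment[OF F mean V] integral_nonneg_AE) simp
 also have "... = 324*(\<integral>q. (V q)^2 \<partial>gauss d)^2" by (simp add: power_mult_distrib)
 also have "(\<integral>q. (V q)^2 \<partial>gauss d)^2 <= (\<integral>q. ((V q)^2)^2 \<partial>gauss d)"
  by (intro jensen_square esf_intros eV)
 also have "... = (\<integral>q. V q^4 \<partial>gauss d)" by (simp flip: power_mult)
 finally have "(\<integral>q. F q^4 \<partial>gauss d)^2 <= 324*(\<integral>q. V q^4 \<partial>gauss d)" by simp
 moreover have "0 <= (\<integral>q. V q^4 \<partial>gauss d)" by (rule integral_nonneg_AE) simp
 ultimately show ?thesis using 1 by linarith
qed

section \<open>Exponential vectors and their linear and quadratic forms\<close>

lemma weighted_power4:
 fixes p Y :: "nat => real"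
 assumes "\<And>j. j < d ==> 0 <= p j"
 shows "(\<Sum>j<d. p j*Y j)^4 <= (\<Sum>j<d. p j)^3*(\<Sum>j<d. p j*Y j^4)"
proof -
 have cs: "(\<Sum>j<d. p j*Y j)^2 <= (\<Sum>j<d. p j)*(\<Sum>j<d. p j*(Y j)^2)" for Y
 proof -
  have "(\<Sum>j<d. p j*Y j) = (\<Sum>j<d. sqrt (p j)*(sqrt (p j)*Y j))"
   using assms by (intro sum.cong refl) (simp flip: mult.assoc)
  also have "...^2 <= (\<Sum>j<d. (sqrt (p j))^2)*(\<Sum>j<d. (sqrt (p j)*Y j)^2)"
   by (rule Cauchy_Schwarz_ineq_sum)
  also have "... = (\<Sum>j<d. p j)*(\<Sum>j<d. p j*(Y j)^2)"
   using assms by (simp add: power_mult_distrib)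
  finally show ?thesis .
 qed
 let ?P = "\<Sum>j<d. p j"
 have P: "0 <= ?P" using assms by (intro sum_nonneg) auto
 have "(\<Sum>j<d. p j*Y j)^4 = ((\<Sum>j<d. p j*Y j)^2)^2" by (simp flip: power_mult)
 also have "... <= (?P*(\<Sum>j<d. p j*(Y j)^2))^2" by (intro power_mono cs) simp
 also have "... = ?P^2*(\<Sum>j<d. p j*(Y j)^2)^2" by (simp add: power_mult_distrib)
 also have "... <= ?P^2*(?P*(\<Sum>j<d. p j*((Y j)^2)^2))" by (intro mult_left_mono cs) simp
 finally show ?thesis by (simp add: eval_nat_numeral mult_ac)
qed

text \<open>With \<open>th j\<close> a scaled key and \<open>q\<close> a query, these are the
  exponentiated scores divided by their means over the query.\<close>

definition yv :: "nat => (nat => nat => real) => (nat => real) => nat => real" where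
 "yv d th q j = exp (ip d (th j) q - ip d (th j) (th j)/2)"

definition zv :: "nat => (nat => nat => real) => (nat => real) => nat => real" where
 "zv d th q j = yv d th q j - 1"

lemma expoly_cong: "expoly d F G ==> F = F' ==> G = G' ==> expoly d F' G'" by simp

lemma expoly_sum:
 "(\<And>j. j \<in> I ==> expoly d (F j) (G j)) ==> expoly d (%q. \<Sum>j\<in>I. F j q) (%i q. \<Sum>j\<in>I. G j i q)"
 by (induction I rule: infinite_finite_induct) (auto intro: expoly_const expoly_add)

lemma expoly_smult: "expoly d F G ==> expoly d (%q. c*F q) (%i q. c*G i q)"
 using expoly_mult[OF expoly_const, of d F G c] by simp

lemma expoly_yv: "expoly d (%q. yv d th q j) (%i q. th j i*yv d th q j)"
 by (rule expoly_cong[OF expoly_smult[OF expoly_exp, of _ "exp (- ip d (th j) (th j)/2)" "th j"]])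
  (auto simp: yv_def exp_add[symmetric] algebra_simps)

lemma expoly_zv: "expoly d (%q. zv d th q j) (%i q. th j i*yv d th q j)"
 by (rule expoly_cong[OF expoly_add[OF expoly_yv expoly_const, of d th j "- 1"]]) (auto simp: zv_def)

lemma esf_yv: "esf d (%q. yv d th q j)" by (rule esfI[OF expoly_yv])
lemma esf_zv: "esf d (%q. zv d th q j)" by (rule esfI[OF expoly_zv])

lemma yv_expectation: "(\<integral>q. yv d th q j \<partial>gauss d) = 1"
 by (simp add: yv_def exp_diff gauss_mgf)

lemma zv_expectation: "(\<integral>q. zv d th q j \<partial>gauss d) = 0"
 using esf_integrable[OF esf_yv] by (simp add: zv_def yv_expectation gauss.prob_space)

lemma yv_product_expectation:
 "(\<integral>q. yv d th q j*yv d th q l \<partial>gauss d) = exp (ip d (th j) (th l))"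
proof -
 have "yv d th q j*yv d th q l = exp (ip d (%i. th j i + th l i) q)*exp (- (ip d (th j) (th j) + ip d (th l) (th l))/2)" for q
  by (simp add: yv_def exp_add[symmetric] ip_add_left field_simps)
 then have "(\<integral>q. yv d th q j*yv d th q l \<partial>gauss d)
  = exp (ip d (%i. th j i + th l i) (%i. th j i + th l i)/2)*exp (- (ip d (th j) (th j) + ip d (th l) (th l))/2)"
  by (simp add: gauss_mgf)
 then show ?thesis
  by (simp add: exp_add[symmetric] ip_add_left ip_add_right ip_comm[of d "th l" "th j"] field_simps)
qed

lemma zv_covariance:
 "(\<integral>q. zv d th q j*zv d th q l \<partial>gauss d) = exp (ip d (th j) (th l)) - 1"
proof -
 have int: "integrable (gauss d) (%q. yv d th q j*yv d th q l)" "integrable (gauss d) (%q. yv d th q j)" for j l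
  by (intro esf_integrable esf_intros esf_yv)+
 have "zv d th q j*zv d th q l = yv d th q j*yv d th q l - yv d th q j - yv d th q l + 1" for q
  by (simp add: zv_def algebra_simps)
 then show ?thesis using int by (simp add: yv_product_expectation yv_expectation gauss.prob_space)
qed

text \<open>The exponent is \<open>8^2/2 - 8/2 = 28\<close> times the squared length of
  \<open>th j\<close>.\<close>

lemma yv_eighth:
 assumes "ip d (th j) (th j) <= \<kappa>"
 shows "(\<integral>q. yv d th q j^8 \<partial>gauss d) <= exp (28*\<kappa>)"
proof -
 have "yv d th q j^8 = exp (ip d (%i. 8*th j i) q)*exp (- 4*ip d (th j) (th j))" for q
  by (simp add: yv_def exp_add[symmetric] ip_smult_left exp_of_nat_mult[symmetric] right_diff_distrib)
 then have "(\<integral>q. yv d th q j^8 \<partial>gauss d)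
   = exp (ip d (%i. 8*th j i) (%i. 8*th j i)/2)*exp (- 4*ip d (th j) (th j))"
  by (simp add: gauss_mgf)
 also have "... = exp (28*ip d (th j) (th j))"
  by (simp add: exp_add[symmetric] ip_smult_left ip_smult_right)
 finally show ?thesis using assms by simp
qed

text \<open>\<open>\<Lambda>\<close> bounds the operator norm of the Gram matrix of the vectors
  \<open>th j\<close>, and \<open>\<kappa>\<close> bounds their squared lengths. The moment bounds
  depend on the keys only through these two numbers, hence hold uniformly in the dimension.\<close>

locale exp_vectors =
 fixes d :: nat and th :: "nat => nat => real" and \<Lambda> \<kappa> :: real
 assumes \<Lambda>_pos: "0 < \<Lambda>"
  and gram: "\<And>v. (\<Sum>i<d. (\<Sum>j<d. v j*th j i)^2) <= \<Lambda>*ip d v v"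
  and diag: "\<And>j. j < d ==> ip d (th j) (th j) <= \<kappa>"
begin

text \<open>The squared gradient is at most \<open>\<Lambda>\<close> times the sum of
  \<open>(v j)^2 * (yv j)^2\<close>. Its fourth power, taken with weights \<open>(v j)^2\<close>,
  involves only eighth moments of single entries.\<close>

lemma linear_eighth:
 "(\<integral>q. ip d v (zv d th q)^8 \<partial>gauss d) <= 2000000*exp (28*\<kappa>)*\<Lambda>^4*ip d v v^4"
proof -
 let ?V = "%q. \<Sum>i<d. (\<Sum>j<d. v j*(th j i*yv d th q j))^2"
 have ex: "expoly d (%q. \<Sum>j<d. v j*zv d th q j) (%i q. \<Sum>j<d. v j*(th j i*yv d th q j))"
  by (intro expoly_sum expoly_smult expoly_zv)
 have int: "integrable (gauss d) (%q. zv d th q j)" for j by (rule esf_integrable[OF esf_zv])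
 have eV: "esf d ?V" by (intro esf_intros esf_yv)
 have "(\<integral>q. (\<Sum>j<d. v j*zv d th q j)^8 \<partial>gauss d) <= 2000000*(\<integral>q. ?V q^4 \<partial>gauss d)"
  by (rule eighth_moment[OF ex]) (simp_all add: int zv_expectation)
 also have "(\<integral>q. ?V q^4 \<partial>gauss d) <= (\<integral>q. \<Lambda>^4*(ip d v v^3*(\<Sum>j<d. (v j)^2*yv d th q j^8)) \<partial>gauss d)"
 proof (intro integral_mono)
  fix q
  have "?V q <= \<Lambda>*(\<Sum>j<d. (v j)^2*(yv d th q j)^2)"
   using gram[of "%j. v j*yv d th q j"] by (simp add: ip_def power2_eq_square mult_ac)
  then have "?V q^4 <= (\<Lambda>*(\<Sum>j<d. (v j)^2*(yv d th q j)^2))^4"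
   by (intro power_mono sum_nonneg) auto
  also have "... <= \<Lambda>^4*((\<Sum>j<d. (v j)^2)^3*(\<Sum>j<d. (v j)^2*((yv d th q j)^2)^4))"
   unfolding power_mult_distrib[of \<Lambda>] by (intro mult_left_mono weighted_power4) auto
  finally show "?V q^4 <= \<Lambda>^4*(ip d v v^3*(\<Sum>j<d. (v j)^2*yv d th q j^8))"
   by (simp add: ip_def power2_eq_square[of "v _"] flip: power_mult)
 qed (intro esf_integrable esf_intros eV esf_yv)+
 also have "... = \<Lambda>^4*(ip d v v^3*(\<Sum>j<d. (v j)^2*(\<integral>q. yv d th q j^8 \<partial>gauss d)))"
  using esf_integrable[OF esf_power[OF esf_yv]] by (simp add: integrable_mult_right)
 also have "... <= \<Lambda>^4*(ip d v v^3*(\<Sum>j<d. (v j)^2*exp (28*\<kappa>)))"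
  using \<Lambda>_pos by (intro mult_left_mono sum_mono yv_eighth diag) auto
 also have "... = exp (28*\<kappa>)*\<Lambda>^4*ip d v v^4"
  by (simp add: ip_def power2_eq_square eval_nat_numeral flip: sum_distrib_right)
 finally show ?thesis by (simp add: ip_def mult.assoc)
qed

text \<open>The gradient is twice the combination of the \<open>th j\<close> with coefficients
  \<open>h j * y j\<close>, where \<open>h = M z\<close> is again random. The weights
  \<open>n j\<close>, the squared row norms of \<open>M\<close>, separate \<open>h\<close> from
  \<open>y\<close>; the powers of \<open>h j\<close> are then linear forms, covered by
  \<open>linear_eighth\<close>. The sum of the \<open>n j\<close> is the trace of
  \<open>M*M\<close>.\<close>

lemma quadratic_fourth:
 assumes M: "symm d M"
 shows "(\<integral>q. (bil d (zv d th q) M (zv d th q) - (\<integral>q. bil d (zv d th q) M (zv d th q) \<partial>gauss d))^4 \<partial>gauss d)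
  <= 300000000*exp (28*\<kappa>)*\<Lambda>^4*(trc d (M*M))^2"
proof -
 let ?z = "%q. zv d th q" and ?y = "%q. yv d th q"
 let ?m = "\<integral>q. bil d (?z q) M (?z q) \<partial>gauss d"
 let ?F = "%q. bil d (?z q) M (?z q) + (- ?m)"
 let ?G = "%i q. 2*(\<Sum>j<d. mv d M (?z q) j*?y q j*th j i)"
 define n where "n j = (\<Sum>l<d. (ent M j l)^2)" for j
 define T where "T = trc d (M*M)"
 define E where "E = exp (28*\<kappa>)"
 have n0: "0 <= n j" for j unfolding n_def by (intro sum_nonneg) auto
 have sM: "ent M l j = ent M j l" for j l using M by (auto simp: symm_def)
 have T: "T = (\<Sum>j<d. n j)"
  unfolding T_def trc_def n_def using M by (simp add: ent_times[of d] power2_eq_square sM)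
 have ip_n: "ip d (ent M j) (ent M j) = n j" for j by (simp add: ip_def n_def power2_eq_square)
 have mv_ip: "mv d M x j = ip d (ent M j) x" for x j by (simp add: mv_def ip_def)
 have emv: "esf d (%q. mv d M (?z q) j)" for j unfolding mv_def by (intro esf_intros esf_zv)
 have ebil: "esf d (%q. bil d (?z q) M (?z q))" unfolding bil_def by (intro esf_intros esf_zv)
 have ex0: "expoly d (%q. bil d (?z q) M (?z q)) ?G"
 proof (rule expoly_cong)
  show "expoly d (%q. \<Sum>j<d. \<Sum>l<d. ent M j l*(?z q j*?z q l))
   (%i q. \<Sum>j<d. \<Sum>l<d. ent M j l*((th j i*?y q j)*?z q l + ?z q j*(th l i*?y q l)))"
   by (intro expoly_sum expoly_smult expoly_mult expoly_zv)
  show "(%q. \<Sum>j<d. \<Sum>l<d. ent M j l*(?z q j*?z q l)) = (%q. bil d (?z q) M (?z q))"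
   by (simp add: bil_def mult_ac)
  have "(\<Sum>j<d. \<Sum>l<d. ent M j l*((th j i*?y q j)*?z q l + ?z q j*(th l i*?y q l))) = ?G i q" for i q
  proof -
   have "(\<Sum>j<d. \<Sum>l<d. ent M j l*(?z q j*(th l i*?y q l))) = (\<Sum>j<d. \<Sum>l<d. ent M j l*((th j i*?y q j)*?z q l))"
    by (subst sum.swap) (simp add: sM mult_ac)
   then show ?thesis
    by (simp add: distrib_left sum.distrib mv_def sum_distrib_left sum_distrib_right mult_ac)
  qed
  then show "(%i q. \<Sum>j<d. \<Sum>l<d. ent M j l*((th j i*?y q j)*?z q l + ?z q j*(th l i*?y q l))) = ?G"
   by (intro ext)
 qed
 have ex: "expoly d ?F ?G"
  using expoly_add[OF ex0 expoly_const, of "- ?m"] by simp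
 let ?V = "%q. \<Sum>i<d. (?G i q)^2"
 have eV: "esf d ?V" by (intro esf_intros esf_yv emv)
 let ?U = "%q. 16*\<Lambda>^2*(T*(\<Sum>j<d. (\<Lambda>^2*n j*?y q j^8 + mv d M (?z q) j^8/(\<Lambda>^2*n j^3))/2))"
 have m4: "(\<integral>q. ?F q^4 \<partial>gauss d) <= 18*(\<integral>q. (?V q)^2 \<partial>gauss d)"
  by (rule fourth_moment[OF ex]) (use esf_integrable[OF ebil] in \<open>auto simp: gauss.prob_space\<close>)
 have "(\<integral>q. (?V q)^2 \<partial>gauss d) <= (\<integral>q. ?U q \<partial>gauss d)"
 proof (intro integral_mono)
  show "integrable (gauss d) ?U"
   unfolding divide_inverse by (intro esf_integrable esf_intros emv esf_yv)
  fix q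
  let ?h = "%j. mv d M (?z q) j"
  let ?A = "\<Sum>j<d. (?y q j)^2*(?h j)^2"
  \<comment> \<open>Rows of norm zero contribute nothing, so the division by
    \<open>sqrt (n j)\<close> below is harmless.\<close>
  have h0: "?h j = 0" if "n j = 0" "j < d" for j
  proof -
   have "ent M j l = 0" if "l < d" for l
    using \<open>n j = 0\<close> that by (auto simp: n_def sum_nonneg_eq_0_iff)
   then show ?thesis by (simp add: mv_def)
  qed
  have "?V q = 4*(\<Sum>i<d. (\<Sum>j<d. (?h j*?y q j)*th j i)^2)"
   unfolding power_mult_distrib by (simp flip: sum_distrib_left)
  also have "... <= 4*(\<Lambda>*ip d (%j. ?h j*?y q j) (%j. ?h j*?y q j))"
   by (intro mult_left_mono gram) simp
  also have "ip d (%j. ?h j*?y q j) (%j. ?h j*?y q j) = ?A"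
   by (simp add: ip_def power2_eq_square mult_ac)
  finally have "(?V q)^2 <= (4*(\<Lambda>*?A))^2"
   by (intro power_mono sum_nonneg) auto
  also have "... = 16*\<Lambda>^2*?A^2" by (simp add: power_mult_distrib)
  finally have V2: "(?V q)^2 <= 16*\<Lambda>^2*?A^2" .
  have "?A^2 <= T*(\<Sum>j<d. ?y q j^4*?h j^4/n j)"
  proof -
   have e: "?A = (\<Sum>j<d. sqrt (n j)*((?y q j)^2*(?h j)^2/sqrt (n j)))"
    using h0 by (intro sum.cong refl) (auto simp: n0)
   have "?A^2 <= (\<Sum>j<d. (sqrt (n j))^2)*(\<Sum>j<d. ((?y q j)^2*(?h j)^2/sqrt (n j))^2)"
    unfolding e by (rule Cauchy_Schwarz_ineq_sum)
   also have "... = T*(\<Sum>j<d. ?y q j^4*?h j^4/n j)"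
    by (simp add: T n0 power_divide power_mult_distrib flip: power_mult)
   finally show ?thesis .
  qed
  also have "T*(\<Sum>j<d. ?y q j^4*?h j^4/n j) <=
    T*(\<Sum>j<d. (\<Lambda>^2*n j*?y q j^8 + ?h j^8/(\<Lambda>^2*n j^3))/2)"
  proof (intro mult_left_mono sum_mono)
   fix j assume "j \<in> {..<d}"
   show "?y q j^4*?h j^4/n j <= (\<Lambda>^2*n j*?y q j^8 + ?h j^8/(\<Lambda>^2*n j^3))/2"
   proof (cases "n j = 0")
    case False
    then have nj: "0 < n j" using n0[of j] by simp
    \<comment> \<open>The weights are balanced so that, after taking expectations,
      \<open>A^2\<close> and \<open>B^2\<close> are both of order
      \<open>\<Lambda>^2 * n j\<close>.\<close>
    define A where "A = \<Lambda>*?y q j^4 * sqrt (n j)"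
    define B where "B = ?h j^4/(\<Lambda>*(n j * sqrt (n j)))"
    have sq: "sqrt (n j) * sqrt (n j) = n j" using nj by simp
    have "A*B = ?y q j^4*?h j^4/n j"
     using nj \<Lambda>_pos by (simp add: A_def B_def field_simps)
    moreover have "A^2 = \<Lambda>^2*n j*?y q j^8"
     using nj by (simp add: A_def power_mult_distrib mult_ac flip: power_mult)
    moreover have "B^2 = ?h j^8/(\<Lambda>^2*n j^3)"
    proof -
     have "B^2 = (?h j^4)^2/(\<Lambda>^2*((n j)^2*(sqrt (n j))^2))"
      by (simp add: B_def power_divide power_mult_distrib)
     also have "(n j)^2*(sqrt (n j))^2 = n j^3"
      using nj by (simp add: power3_eq_cube power2_eq_square)
     finally show ?thesis by (simp flip: power_mult)
    qed
    moreover have "A*B <= (A^2 + B^2)/2"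
     using sum_squares_ge_zero[of "A - B" 0] by (simp add: power2_eq_square algebra_simps)
    ultimately show ?thesis by simp
   qed simp
  qed (simp add: T n0 sum_nonneg)
  finally have "16*\<Lambda>^2*?A^2 <= ?U q"
   by (intro mult_left_mono) auto
  with V2 show "(?V q)^2 <= ?U q" by (rule order_trans)
 qed (intro esf_integrable esf_intros eV)
 also have "... = 16*\<Lambda>^2*(T*(\<Sum>j<d. (\<Lambda>^2*n j*(\<integral>q. ?y q j^8 \<partial>gauss d)
   + (\<integral>q. mv d M (?z q) j^8 \<partial>gauss d)/(\<Lambda>^2*n j^3))/2))"
  using esf_integrable[OF esf_power[OF esf_yv]] esf_integrable[OF esf_power[OF emv]]
  by (simp add: integrable_mult_right)
 also have "... <= 16*\<Lambda>^2*(T*(\<Sum>j<d. (\<Lambda>^2*n j*E + 2000000*E*\<Lambda>^2*n j)/2))"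
 proof (intro mult_left_mono sum_mono divide_right_mono add_mono)
  fix j assume j: "j \<in> {..<d}"
  show "(\<integral>q. ?y q j^8 \<partial>gauss d) <= E" unfolding E_def by (rule yv_eighth) (use diag j in auto)
  show "(\<integral>q. mv d M (?z q) j^8 \<partial>gauss d)/(\<Lambda>^2*n j^3) <= 2000000*E*\<Lambda>^2*n j"
  proof (cases "n j = 0")
   case False
   then have nj: "0 < n j" using n0[of j] by simp
   have "(\<integral>q. mv d M (?z q) j^8 \<partial>gauss d) <= 2000000*E*\<Lambda>^4*n j^4"
    unfolding mv_ip using linear_eighth[of "ent M j"] by (simp add: ip_n E_def)
   also have "... = (2000000*E*\<Lambda>^2*n j)*(\<Lambda>^2*n j^3)"
    by (simp add: eval_nat_numeral)
   finally show ?thesis using nj \<Lambda>_pos by (simp add: divide_le_eq)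
  qed simp
 qed (use n0 in \<open>auto simp: T sum_nonneg\<close>)
 also have "... = 16000008*E*\<Lambda>^4*T^2"
 proof -
  have S: "(\<Sum>j<d. (\<Lambda>^2*n j*E + 2000000*E*\<Lambda>^2*n j)/2) = 2000001/2*E*\<Lambda>^2*T"
   unfolding T sum_distrib_left by (intro sum.cong refl) (simp add: field_simps)
  show ?thesis unfolding S by (simp add: eval_nat_numeral)
 qed
 finally have "(\<integral>q. ?F q^4 \<partial>gauss d) <= 18*(16000008*E*\<Lambda>^4*T^2)"
  using m4 by linarith
 also have "... <= 300000000*E*\<Lambda>^4*T^2"
 proof -
  have "0 <= E*\<Lambda>^4*T^2" by (simp add: E_def)
  from mult_right_mono[OF _ this, of 288000144 300000000] show ?thesis by (simp add: mult_ac)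
 qed
 finally show ?thesis by (simp add: T_def E_def)
qed

end

section \<open>From exponential vectors to Gaussian vectors\<close>

lemma fatou_bound:
 fixes u :: "nat => 'a => real"
 assumes int: "\<And>n. integrable M (u n)" and pos: "\<And>n x. 0 <= u n x"
  and lim: "\<And>x. x \<in> space M ==> (%n. u n x) \<longlonglongrightarrow> v x"
  and bd: "\<And>n. integral\<^sup>L M (u n) <= c"
 shows "integrable M v \<and> integral\<^sup>L M v <= c"
proof -
 have [measurable]: "u n \<in> borel_measurable M" for n using int by auto
 have meas: "v \<in> borel_measurable M" by (rule borel_measurable_LIMSEQ_real[OF lim]) auto
 have v0: "0 <= v x" if "x \<in> space M" for x
  by (rule LIMSEQ_le_const[OF lim[OF that]]) (use pos in auto)
 have "0 <= integral\<^sup>L M (u 0)" by (rule integral_nonneg_AE) (use pos in auto)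
 then have c0: "0 <= c" using bd[of 0] by linarith
 have "(\<integral>\<^sup>+x. ennreal (v x) \<partial>M) = (\<integral>\<^sup>+x. liminf (%n. ennreal (u n x)) \<partial>M)"
  by (intro nn_integral_cong lim_imp_Liminf[symmetric] tendsto_ennrealI lim) auto
 also have "... <= liminf (%n. \<integral>\<^sup>+x. ennreal (u n x) \<partial>M)" by (rule nn_integral_liminf) auto
 also have "... <= liminf (%n. ennreal c)"
  by (intro Liminf_mono always_eventually allI)
   (use int pos bd in \<open>auto simp: nn_integral_eq_integral intro!: ennreal_leI\<close>)
 also have "... = ennreal c" by (simp add: Liminf_const)
 finally have *: "(\<integral>\<^sup>+x. ennreal (v x) \<partial>M) <= ennreal c" .
 have "(\<integral>\<^sup>+x. ennreal (v x) \<partial>M) < \<infinity>" using*by (rule le_less_trans) simp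
 then have i: "integrable M v"
  by (intro integrableI_nonneg) (use meas v0 in auto)
 have "ennreal (integral\<^sup>L M v) <= ennreal c"
  using*i v0 by (subst nn_integral_eq_integral[symmetric]) auto
 with i c0 show ?thesis by (simp add: ennreal_le_iff)
qed

text \<open>Moments of Gaussian vectors are the limits, as s tends to 0, of those of the vectors with
 entries (exp (s q_j - s^2/2) - 1)/s.\<close>

context
 fixes d :: nat
begin

definition gth :: "real => nat => nat => real" where "gth s j i = s*unitv j i"

lemma ip_gth_right: "j < d ==> ip d (gth s j) q = s*q j"
 using sum_unitv[of j d q] by (simp add: gth_def[abs_def] ip_smult_left) (simp add: ip_def mult.commute)

lemma ip_gth: "j < d ==> ip d (gth s j) (gth s l) = (if j = l then s^2 else 0)"
 by (subst ip_gth_right) (auto simp: gth_def unitv_def power2_eq_square)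

lemma exp_vectors_gth: "s ~= 0 ==> exp_vectors d (gth s) (s^2) (s^2)"
proof
 fix v :: "nat => real"
 have "(\<Sum>j<d. v j*gth s j i) = s * v i" if "i < d" for i
 proof -
  have "(\<Sum>j<d. v j*gth s j i) = (\<Sum>j<d. (s * v j)*unitv i j)"
   by (intro sum.cong) (auto simp: gth_def unitv_def)
  then show ?thesis using that by (simp add: sum_unitv)
 qed
 then have "(\<Sum>i<d. (\<Sum>j<d. v j*gth s j i)^2) = (\<Sum>i<d. s^2*(v i * v i))"
  by (intro sum.cong refl) (simp add: power2_eq_square)
 then show "(\<Sum>i<d. (\<Sum>j<d. v j*gth s j i)^2) <= s^2*ip d v v"
  by (simp add: ip_def sum_distrib_left)
 fix j assume "j < d"
 then show "ip d (gth s j) (gth s j) <= s^2" by (simp add: ip_gth)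
qed auto

lemma zv_gth: "j < d ==> zv d (gth s) q j = exp (s*q j - s^2/2) - 1"
 by (simp add: zv_def yv_def ip_gth_right) (simp add: gth_def unitv_def power2_eq_square)

definition sn :: "nat => real" where "sn n = 1/real (Suc n)"

lemma sn_pos: "0 < sn n" "sn n <= 1" by (auto simp: sn_def)
lemma sn_lim: "filterlim sn (at 0) sequentially"
 unfolding filterlim_at using sn_pos LIMSEQ_inverse_real_of_nat
 by (auto simp: sn_def[abs_def] inverse_eq_divide)

lemma zv_gth_lim: "j < d ==> (%n. zv d (gth (sn n)) q j/sn n) \<longlonglongrightarrow> q j"
proof -
 assume j: "j < d"
 have "((%s. exp (s*q j - s^2/2)) has_real_derivative q j) (at 0)"
  by (auto intro!: derivative_eq_intros)
 then have "((%s. (exp (s*q j - s^2/2) - 1)/s) \<longlongrightarrow> q j) (at 0)"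
  by (simp add: has_field_derivative_iff)
 from filterlim_compose[OF this sn_lim] show ?thesis by (simp add: zv_gth j)
qed

lemma exp_sn_lim: "(%n. (exp ((sn n)^2) - 1)/(sn n)^2) \<longlonglongrightarrow> 1"
proof -
 have "((%s::real. exp s) has_real_derivative 1) (at 0)"
  by (auto intro!: derivative_eq_intros)
 then have 1: "((%s::real. (exp s - 1)/s) \<longlongrightarrow> 1) (at 0)"
  by (simp add: has_field_derivative_iff)
 have "(%n. (sn n)^2) \<longlonglongrightarrow> 0^2"
  by (intro tendsto_power) (use sn_lim in \<open>simp add: filterlim_at\<close>)
 then have "filterlim (%n. (sn n)^2) (at 0) sequentially"
  unfolding filterlim_at using sn_pos by (auto simp: less_imp_neq[symmetric])
 from filterlim_compose[OF 1 this] show ?thesis .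
qed

lemma gauss_linear_eighth:
 "integrable (gauss d) (%q. ip d v q^8) \<and>
 (\<integral>q. ip d v q^8 \<partial>gauss d) <= 2000000*exp 28*ip d v v^4"
proof (rule fatou_bound)
 fix n
 let ?s = "sn n"
 interpret exp_vectors d "gth ?s" "?s^2" "?s^2" using sn_pos[of n] by (intro exp_vectors_gth) auto
 have e: "esf d (%q. ip d v (zv d (gth ?s) q)^8)"
  unfolding ip_def by (intro esf_intros esf_zv)
 have eq: "ip d v (%j. zv d (gth ?s) q j/?s)^8 = ip d v (zv d (gth ?s) q)^8/?s^8" for q
 proof -
  have "ip d v (%j. zv d (gth ?s) q j/?s) = ip d v (zv d (gth ?s) q)/?s"
   by (simp add: ip_def sum_divide_distrib)
  then show ?thesis by (simp add: power_divide)
 qed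
 show "integrable (gauss d) (%q. ip d v (%j. zv d (gth ?s) q j/?s)^8)"
  unfolding eq using esf_integrable[OF e] by simp
 have "(\<integral>q. ip d v (zv d (gth ?s) q)^8 \<partial>gauss d) <= 2000000*exp (28*?s^2)*?s\<^sup>2^4*ip d v v^4"
  by (rule linear_eighth)
 also have "... <= 2000000*exp 28*?s\<^sup>2^4*ip d v v^4"
  using sn_pos[of n] by (intro mult_right_mono mult_left_mono) (auto simp: power_le_one)
 finally show "(\<integral>q. ip d v (%j. zv d (gth ?s) q j/?s)^8 \<partial>gauss d) <= 2000000*exp 28*ip d v v^4"
  unfolding eq using sn_pos[of n] by (simp add: divide_le_eq mult_ac flip: power_mult)
next
 show "(%n. ip d v (%j. zv d (gth (sn n)) q j/sn n)^8) \<longlonglongrightarrow> ip d v q^8" for q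
  unfolding ip_def by (intro tendsto_intros zv_gth_lim) auto
qed simp

lemma gauss_quadratic_fourth:
 assumes M: "symm d M"
 shows "integrable (gauss d) (%q. (bil d q M q - trc d M)^4) \<and>
 (\<integral>q. (bil d q M q - trc d M)^4 \<partial>gauss d) <= 300000000*exp 28*(trc d (M*M))^2"
proof (rule fatou_bound)
 define m where "m n = (\<integral>q. bil d (zv d (gth (sn n)) q) M (zv d (gth (sn n)) q) \<partial>gauss d)" for n
 let ?u = "%n q. (bil d (%j. zv d (gth (sn n)) q j/sn n) M (%j. zv d (gth (sn n)) q j/sn n) - m n/(sn n)^2)^4"
 {
  fix n
  let ?s = "sn n"
  interpret exp_vectors d "gth ?s" "?s^2" "?s^2" using sn_pos[of n] by (intro exp_vectors_gth) auto
  let ?z = "zv d (gth ?s)"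
  have e: "esf d (%q. (bil d (?z q) M (?z q) + (- m n))^4)"
   unfolding bil_def by (intro esf_intros esf_zv)
  have eq: "?u n q = (bil d (?z q) M (?z q) - m n)^4/?s^8" for q
  proof -
   have "bil d (%j. ?z q j/?s) M (%j. ?z q j/?s) = bil d (?z q) M (?z q)/?s^2"
    using sn_pos[of n] by (simp add: bil_def sum_divide_distrib power2_eq_square field_simps)
   then show ?thesis
    by (simp add: diff_divide_distrib[symmetric] power_divide flip: power_mult)
  qed
  show "integrable (gauss d) (?u n)"
   unfolding eq using esf_integrable[OF e] by simp
  have "(\<integral>q. (bil d (?z q) M (?z q) - m n)^4 \<partial>gauss d) <= 300000000*exp (28*?s^2)*?s\<^sup>2^4*(trc d (M*M))^2"
   unfolding m_def by (rule quadratic_fourth[OF M])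
  also have "... <= 300000000*exp 28*?s\<^sup>2^4*(trc d (M*M))^2"
   using sn_pos[of n] by (intro mult_right_mono mult_left_mono) (auto simp: power_le_one)
  finally show "(\<integral>q. ?u n q \<partial>gauss d) <= 300000000*exp 28*(trc d (M*M))^2"
   unfolding eq using sn_pos[of n] by (simp add: divide_le_eq mult_ac flip: power_mult)
 }
 have m: "m n/(sn n)^2 = (\<Sum>j<d. ent M j j*((exp ((sn n)^2) - 1)/(sn n)^2))" for n
 proof -
  have int: "integrable (gauss d) (%q. zv d (gth (sn n)) q j*zv d (gth (sn n)) q l)" for j l
   by (intro esf_integrable esf_intros esf_zv)
  have "m n = (\<Sum>j<d. \<Sum>l<d. ent M j l*(\<integral>q. zv d (gth (sn n)) q j*zv d (gth (sn n)) q l \<partial>gauss d))"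
  proof -
   have "bil d x M x = (\<Sum>j<d. \<Sum>l<d. ent M j l*(x j*x l))" for x by (simp add: bil_def mult_ac)
   then show ?thesis using int by (simp add: m_def integrable_mult_right)
  qed
  also have "... = (\<Sum>j<d. \<Sum>l<d. (ent M j l*(exp ((sn n)^2) - 1))*unitv j l)"
   unfolding zv_covariance
   by (intro sum.cong refl) (auto simp: ip_gth unitv_def)
  also have "... = (\<Sum>j<d. ent M j j*(exp ((sn n)^2) - 1))"
   by (intro sum.cong refl) (simp add: sum_unitv)
  finally show ?thesis by (simp add: sum_divide_distrib)
 qed
 have "(%n. m n/(sn n)^2) \<longlonglongrightarrow> (\<Sum>j<d. ent M j j*1)"
  unfolding m by (intro tendsto_intros exp_sn_lim)
 then have lim: "(%n. m n/(sn n)^2) \<longlonglongrightarrow> trc d M" by (simp add: trc_def)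
 show "(%n. ?u n q) \<longlonglongrightarrow> (bil d q M q - trc d M)^4" for q
  unfolding bil_def by (intro tendsto_intros zv_gth_lim lim) auto
qed simp

end

section \<open>A barrier for sums of rank-one matrices\<close>

lemma pdef_shift:
 assumes A: "pdef d A" and S: "psd d S" and c: "0 <= c"
 shows "pdef d (A + c *\<^sub>R S)"
 using pdef_add_psd[OF A psd_scaleR[OF S c]] .

text \<open>The resolvent identity, used once from either side, gives an expansion with exact
  remainder. The remainder is a conjugate of a positive semidefinite matrix, so the first-order term
  bounds the change from one side.\<close>

lemma shift_identities:
 assumes A: "pdef d A" and S: "psd d S" and c: "0 <= c"
 defines "R \<equiv> minv d A" and "R' \<equiv> minv d (A + c *\<^sub>R S)"
 shows "R = R' + c *\<^sub>R (R'*S * R') + c^2 *\<^sub>R (R'*S * R*S * R')"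
  and "psd d (R - R')" and "psd d (R - R' - c *\<^sub>R (R'*S * R'))"
proof -
 let ?A' = "A + c *\<^sub>R S"
 have A': "pdef d ?A'" using pdef_shift[OF A S c] .
 note inv = pdef_minv[OF A, folded R_def] pdef_minv[OF A', folded R'_def]
 have dims: "indim d R" "indim d R'" "indim d S" "indim d A" using A S by (auto simp: R_def R'_def)
 have "R - R' = R'*?A' * R - R'*A * R"
  using inv dims by (simp add: mult.assoc)
 also have "... = c *\<^sub>R (R'*S * R)" by (simp add: algebra_simps)
 finally have 1: "R = R' + c *\<^sub>R (R'*S * R)" by (simp add: algebra_simps)
 have "R - R' = R*?A' * R' - R*A * R'"
  using inv dims by (simp add: mult.assoc)
 also have "... = c *\<^sub>R (R*S * R')" by (simp add: algebra_simps)
 finally have 2: "R = R' + c *\<^sub>R (R*S * R')" by (simp add: algebra_simps)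
 have "R'*S * R = R'*S*(R' + c *\<^sub>R (R*S * R'))" using 2 by simp
 also have "... = R'*S * R' + c *\<^sub>R (R'*S * R*S * R')" by (simp add: distrib_left mult.assoc)
 finally have f: "R'*S * R = R'*S * R' + c *\<^sub>R (R'*S * R*S * R')" .
 have "R' + c *\<^sub>R (R'*S * R) = R' + c *\<^sub>R (R'*S * R') + c^2 *\<^sub>R (R'*S * R*S * R')"
  by (subst f) (simp only: scaleR_add_right power2_eq_square scaleR_scaleR add.assoc)
 then show 3: "R = R' + c *\<^sub>R (R'*S * R') + c^2 *\<^sub>R (R'*S * R*S * R')"
  using 1 by metis
 have p: "psd d R" "psd d R'" using minv_psd[OF A] minv_psd[OF A'] by (simp_all add: R_def R'_def)
 have "psd d (S * R*S)" using psd_conj[OF psd_symm[OF S] p(1)] .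
 then have q: "psd d (R'*(S * R*S) * R')" by (rule psd_conj[OF psd_symm[OF p(2)]])
 have e: "R'*S * R*S * R' = R'*(S * R*S) * R'" by (simp add: mult.assoc)
 have "R - R' - c *\<^sub>R (R'*S * R') = c^2 *\<^sub>R (R'*S * R*S * R')" using 3 by (simp add: algebra_simps)
 with q show 4: "psd d (R - R' - c *\<^sub>R (R'*S * R'))" unfolding e by (simp add: psd_scaleR)
 have "psd d (R - R' - c *\<^sub>R (R'*S * R') + c *\<^sub>R (R'*S * R'))"
  by (intro psd_add 4 psd_scaleR psd_conj psd_symm[OF p(2)] S c)
 then show "psd d (R - R')" by simp
qed

text \<open>This is the gain from moving the barrier by \<open>c S\<close>: the potential drops by
  at least \<open>c\<close> times the second-order trace, and the second-order trace by at least
  \<open>2 c\<close> times the third-order one. Here the traces on the right of the gain are those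
  after the move.\<close>

lemma trc_shift:
 assumes A: "pdef d A" and S: "psd d S" and c: "0 <= c"
 defines "R \<equiv> minv d A" and "R' \<equiv> minv d (A + c *\<^sub>R S)"
 shows "trc d (S * R') + c*trc d (S * R'*(S * R')) <= trc d (S * R)"
  and "trc d (S * R'*(S * R')) + 2*c*trc d (S * R'*(S * R')*(S * R')) <= trc d (S * R*(S * R))"
proof -
 note si = shift_identities[OF A S c, folded R_def R'_def]
 have A': "pdef d (A + c *\<^sub>R S)" using pdef_shift[OF A S c] .
 have p: "psd d R" "psd d R'" using minv_psd[OF A] minv_psd[OF A'] by (simp_all add: R_def R'_def)
 have dims: "indim d R" "indim d R'" "indim d S" using p S by auto
 define D where "D = R - R'"
 have pD: "psd d D" "psd d (D - c *\<^sub>R (R'*S * R'))" using si by (auto simp: D_def)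
 have R: "R = R' + D" by (simp add: D_def)
 have "0 <= trc d (S*(D - c *\<^sub>R (R'*S * R')))" by (rule trc_psd_mult[OF S pD(2)])
 then show "trc d (S * R') + c*trc d (S * R'*(S * R')) <= trc d (S * R)"
  by (simp add: R right_diff_distrib trc_diff trc_scaleR distrib_left trc_add mult.assoc)
 have SRS: "psd d (S * R'*S)" "psd d (S*D*S)"
  using psd_conj[OF psd_symm[OF S] p(2)] psd_conj[OF psd_symm[OF S] pD(1)] by auto
 have 1: "0 <= trc d (S * R'*S*(D - c *\<^sub>R (R'*S * R')))" by (rule trc_psd_mult[OF SRS(1) pD(2)])
 have 2: "0 <= trc d (S*D*S*D)" by (rule trc_psd_mult[OF SRS(2) pD(1)])
 have 3: "trc d (S*D*(S * R')) = trc d (S * R'*(S*D))"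
  by (rule trc_comm) (use dims in \<open>auto simp: D_def\<close>)
 show "trc d (S * R'*(S * R')) + 2*c*trc d (S * R'*(S * R')*(S * R')) <= trc d (S * R*(S * R))"
  using 1 2 by (simp add: R distrib_left distrib_right trc_add 3[unfolded mult.assoc] right_diff_distrib trc_diff trc_scaleR mult.assoc)
qed

lemma rank_one_traces:
 fixes x :: "nat => real"
 assumes R: "symm d R" and S: "indim d S"
 defines "Y \<equiv> R * outer d x x * R"
 shows "trc d (S*Y) = bil d x (R*S * R) x"
  and "trc d (S * R*(S*Y)) = bil d x (R*S * R*S * R) x"
  and "trc d (S*Y*(S*Y)) = (bil d x (R*S * R) x)^2"
proof -
 let ?X = "outer d x x"
 have dR: "indim d R" using R by auto
 have "trc d (S*Y) = trc d ((S * R*?X) * R)" by (simp add: Y_def mult.assoc)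
 also have "... = trc d (R*(S * R*?X))" by (rule trc_comm) (use dR S in auto)
 also have "... = bil d x (R*S * R) x"
  using trc_outer[of d "R*S * R" x x] dR S by (simp add: mult.assoc)
 finally show 1: "trc d (S*Y) = bil d x (R*S * R) x" .
 have "trc d (S * R*(S*Y)) = trc d ((S * R*S * R*?X) * R)" by (simp add: Y_def mult.assoc)
 also have "... = trc d (R*(S * R*S * R*?X))" by (rule trc_comm) (use dR S in auto)
 also have "... = bil d x (R*S * R*S * R) x"
  using trc_outer[of d "R*S * R*S * R" x x] dR S by (simp add: mult.assoc)
 finally show "trc d (S * R*(S*Y)) = bil d x (R*S * R*S * R) x" .
 have "?X*(R*S * R)*?X = bil d x (R*S * R) x *\<^sub>R ?X"
  using outer_mult[of d "R*S * R" x x x x] dR S by simp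
 then have "S*Y*(S*Y) = bil d x (R*S * R) x *\<^sub>R (S*Y)"
  by (simp add: Y_def mult.assoc) (metis (no_types, lifting) mult.assoc mult_scaleR_left mult_scaleR_right)
 then show "trc d (S*Y*(S*Y)) = (bil d x (R*S * R) x)^2"
  by (simp add: trc_scaleR 1 power2_eq_square)
qed

section \<open>Measurability of matrix-valued expressions\<close>

definition mea :: "'a measure => ('a => fmat) => bool" where
 "mea M F \<longleftrightarrow> (\<forall>i j. (%w. ent (F w) i j) \<in> borel_measurable M)"

lemma mea_const: "mea M (%w. A)" by (simp add: mea_def)
lemma mea_add: "mea M F ==> mea M G ==> mea M (%w. F w + G w)"
 unfolding mea_def by (auto intro: borel_measurable_add)
lemma mea_diff: "mea M F ==> mea M G ==> mea M (%w. F w - G w)"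
 unfolding mea_def by (auto intro: borel_measurable_diff)
lemma mea_scaleR: "mea M F ==> mea M (%w. c *\<^sub>R F w)"
 unfolding mea_def by (auto intro!: borel_measurable_times)
lemma mea_times:
 "mea M F ==> mea M G ==> (\<And>w. indim d (F w)) ==> mea M (%w. F w*G w)"
 unfolding mea_def by (auto simp: ent_times[of d] intro!: borel_measurable_sum borel_measurable_times)
lemma mea_minv: "mea M F ==> mea M (%w. minv d (F w))"
 unfolding mea_def by (auto intro: measurable_minv)
lemma mea_outer:
 assumes "\<And>i. i < d ==> (%w. x w i) \<in> borel_measurable M"
 shows "mea M (%w. outer d (x w) (x w))"
 unfolding mea_def
proof (intro allI)
 fix i j show "(%w. ent (outer d (x w) (x w)) i j) \<in> borel_measurable M"
  using assms by (cases "i < d \<and> j < d") (auto simp: ent_outer)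
qed
lemma mea_sum: "(\<And>i. i \<in> I ==> mea M (F i)) ==> mea M (%w. \<Sum>i\<in>I. F i w)"
 unfolding mea_def by (auto simp: ent_sum intro!: borel_measurable_sum)
lemma measurable_trc: "mea M F ==> (%w. trc d (F w)) \<in> borel_measurable M"
 unfolding mea_def trc_def by (auto intro!: borel_measurable_sum)
lemma pred_le: "f \<in> borel_measurable M ==> g \<in> borel_measurable M ==> Measurable.pred M (%w. f w <= (g w :: real))"
 unfolding pred_def by (rule borel_measurable_le)
lemma measurable_bil:
 "mea M F ==> (\<And>i. i < d ==> (%w. x w i) \<in> borel_measurable M) ==> (%w. bil d (x w) (F w) (x w)) \<in> borel_measurable M"
 unfolding bil_def mea_def by (intro borel_measurable_sum borel_measurable_times) auto

text \<open>All that the barrier and the exchange argument assume about a random vector: its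
  quadratic forms concentrate, with fourth central moment at most \<open>C\<close> times the squared
  Hilbert-Schmidt norm squared. Gaussian vectors and projected exponential rows both satisfy this
  with \<open>C\<close> independent of \<open>d\<close>.\<close>

locale row_law = prob_space N for N :: "'r measure" +
 fixes d :: nat and X :: "'r => nat => real" and C :: real
 assumes d_pos: "0 < d"
  and C_nonneg: "0 <= C"
  and X_measurable [measurable]: "\<And>i. i < d ==> (%r. X r i) \<in> borel_measurable N"
  and quad_integrable: "\<And>M. psd d M ==> integrable N (%r. bil d (X r) M (X r))"
  and quad_conc_integrable: "\<And>M. psd d M ==>
   integrable N (%r. (bil d (X r) M (X r) - (\<integral>r. bil d (X r) M (X r) \<partial>N))^4)"
  and quad_conc: "\<And>M. psd d M ==>
   (\<integral>r. (bil d (X r) M (X r) - (\<integral>r. bil d (X r) M (X r) \<partial>N))^4 \<partial>N) <= C*(trc d (M*M))^2"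
begin

lemma bil_measurable [measurable]: "(%r. bil d (X r) M (X r)) \<in> borel_measurable N"
 unfolding bil_def by (intro borel_measurable_sum borel_measurable_times borel_measurable_const X_measurable) auto

lemma quad_var:
 assumes M: "psd d M"
 defines "e \<equiv> \<integral>r. bil d (X r) M (X r) \<partial>N"
 shows "integrable N (%r. (bil d (X r) M (X r) - e)^2)"
  and "(\<integral>r. (bil d (X r) M (X r) - e)^2 \<partial>N) <= sqrt C*trc d (M*M)"
proof -
 let ?Y = "%r. bil d (X r) M (X r) - e"
 have int4: "integrable N (%r. (?Y r)^4)" using quad_conc_integrable[OF M] by (simp add: e_def)
 show int2: "integrable N (%r. (?Y r)^2)"
 proof (rule Bochner_Integration.integrable_bound[of N "%r. 1 + (?Y r)^4"])
  show "AE r in N. norm ((?Y r)^2) <= norm (1 + (?Y r)^4)"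
  proof (rule AE_I2)
   fix r
   have "y^2 <= 1 + y^4" for y :: real
   proof -
    have "0 <= (y^2 - 1)^2" by simp
    then have "2*y^2 <= y^4 + 1" by (simp add: power2_diff flip: power_mult)
    moreover have "0 <= y^2" by simp
    ultimately show ?thesis by linarith
   qed
   from this[of "?Y r"] show "norm ((?Y r)^2) <= norm (1 + (?Y r)^4)" by simp
  qed
 qed (use int4 in auto)
 let ?v = "\<integral>r. (?Y r)^2 \<partial>N"
 have "0 <= (\<integral>r. ((?Y r)^2 - ?v)^2 \<partial>N)" by (rule integral_nonneg_AE) simp
 also have "... = (\<integral>r. (?Y r)^4 - 2*?v * (?Y r)^2 + ?v^2 \<partial>N)"
 proof -
  have "(y^2 - v)^2 = y^4 - 2 * v * y^2 + v^2" for y v :: real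
   by (simp add: power2_diff mult_ac flip: power_mult)
  then show ?thesis by simp
 qed
 also have "... = (\<integral>r. (?Y r)^4 \<partial>N) - ?v^2"
  using int2 int4 by (simp add: prob_space power2_eq_square)
 also have "(\<integral>r. (?Y r)^4 \<partial>N) <= C*(trc d (M*M))^2" using quad_conc[OF M] by (simp add: e_def)
 finally have "?v^2 <= C*(trc d (M*M))^2" by simp
 also have "... = (sqrt C*trc d (M*M))^2" using C_nonneg by (simp add: power_mult_distrib)
 finally show "?v <= sqrt C*trc d (M*M)"
  by (rule power2_le_imp_le) (intro mult_nonneg_nonneg real_sqrt_ge_zero C_nonneg trc_psd_mult M)
qed

lemma quad_second:
 assumes M: "psd d M"
 shows "integrable N (%r. (bil d (X r) M (X r))^2)"
  and "(\<integral>r. (bil d (X r) M (X r))^2 \<partial>N) <= sqrt C*trc d (M*M) + (\<integral>r. bil d (X r) M (X r) \<partial>N)^2"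
proof -
 define e where "e = (\<integral>r. bil d (X r) M (X r) \<partial>N)"
 note v = quad_var[OF M, folded e_def]
 have eq: "(bil d (X r) M (X r))^2 = (bil d (X r) M (X r) - e)^2 + 2*e*bil d (X r) M (X r) - e^2" for r
  by (simp add: power2_eq_square algebra_simps)
 show "integrable N (%r. (bil d (X r) M (X r))^2)"
  unfolding eq using v(1) quad_integrable[OF M] by simp
 have "(\<integral>r. (bil d (X r) M (X r))^2 \<partial>N) = (\<integral>r. (bil d (X r) M (X r) - e)^2 \<partial>N) + 2*e*e - e^2"
  unfolding eq using v(1) quad_integrable[OF M] by (simp add: prob_space e_def)
 then show "(\<integral>r. (bil d (X r) M (X r))^2 \<partial>N) <= sqrt C*trc d (M*M) + e^2"
  using v(2) by (simp add: power2_eq_square)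
qed

end

lemma (in row_law) component_measurable: "i < n ==> j < d ==> (%x. X (x i) j) \<in> borel_measurable (PiM {..<n} (%_. N))"
 by (rule measurable_compose[where f="%x. x i" and N=N and g="%r. X r j"]) (auto intro: measurable_component_singleton)

text \<open>The barrier moves by \<open>\<delta>/d S\<close> per sample, a direction adapted to the
  covariance rather than a multiple of the identity. \<open>\<phi>0\<close> is the initial
  potential, \<open>s\<close> the slack allowed both for its growth and for one quadratic form, and
  \<open>M\<close> a cap on the second-order trace. \<open>speed\<close> says that the barrier
  outruns the largest Sherman-Morrison factor.\<close>

locale barrier = row_law N d X C for N :: "'r measure" and d X C +
 fixes S :: fmat and a \<delta> \<phi>0 s M :: real
 assumes S_psd: "psd d S" and a_pos: "0 < a" and S_lower: "\<And>x. a*ip d x x <= bil d x S x"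
  and mean_le: "\<And>M. psd d M ==> (\<integral>r. bil d (X r) M (X r) \<partial>N) <= trc d (S*M)"
  and s_pos: "0 < s" and \<phi>0_nonneg: "0 <= \<phi>0" and room: "\<phi>0 + 2 * s < 1"
  and speed: "1/(1 - \<phi>0 - 2 * s) < \<delta>" and M_pos: "0 < M"
begin

definition "\<kappa> = 1/(1 - \<phi>0 - 2 * s)"
definition "C' = sqrt C/a^2 + 1"
definition "\<Lambda> = \<kappa>^2*C'/(\<delta> - \<kappa>)"

definition Ph :: "fmat => real" where "Ph A = trc d (S*minv d A)/d"
definition M2 :: "fmat => real" where "M2 A = trc d (S*minv d A*(S*minv d A))/d"
definition sh :: "fmat => fmat" where "sh A = A + (\<delta>/d) *\<^sub>R S"
definition step :: "fmat => (nat => real) => fmat" where "step A x = sh A - (1/d) *\<^sub>R outer d x x"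
definition good :: "fmat => bool" where "good A \<longleftrightarrow> pdef d A \<and> Ph A <= \<phi>0 + s \<and> M2 A <= M"
text \<open>The quadratic form of the new sample is not far above the potential. This keeps the
  Sherman-Morrison denominator at least \<open>1 - \<phi>0 - 2 * s\<close>, so its inverse is at
  most \<open>\<kappa>\<close>.\<close>

definition qok :: "fmat => (nat => real) => bool" where
 "qok A x \<longleftrightarrow> bil d x (minv d (sh A)) x/d <= Ph (sh A) + s"
text \<open>The value is at least 1 as soon as a cap is passed: by the logarithm if \<open>m\<close>
  exceeds \<open>M\<close>, by the square if \<open>p\<close> exceeds \<open>\<phi>0 + s\<close>.
  The logarithm tames the quadratic growth of \<open>M2\<close>, and the term
  \<open>\<Lambda> p\<close> pays for the remainder, \<open>\<Lambda>\<close> being chosen so that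
  \<open>\<Lambda> (\<delta> - \<kappa>) = \<kappa>^2 * C'\<close>.\<close>

definition lyap :: "real => real => real" where
 "lyap p m = (ln (1 + m) + \<Lambda>*p)/ln (1 + M) + (max 0 (p - \<phi>0))^2/s^2"

lemma \<kappa>_pos: "0 < \<kappa>" and \<kappa>_less: "\<kappa> < \<delta>" and \<delta>_pos: "0 < \<delta>"
 using room speed by (auto simp: \<kappa>_def) (smt (verit) divide_pos_pos)

lemma C'_ge1: "1 <= C'" unfolding C'_def using C_nonneg by simp
lemma \<Lambda>_nonneg: "0 <= \<Lambda>" unfolding \<Lambda>_def using C'_ge1 \<kappa>_less by (intro divide_nonneg_pos mult_nonneg_nonneg) auto

lemma trS: "psd d B ==> a*trc d B <= trc d (S*B)"
proof -
 assume B: "psd d B"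
 have "psd d (S - a *\<^sub>R idm d)"
  using S_psd S_lower by (auto simp: psd_def bil_diff bil_scaleR bil_idm)
 from trc_psd_mult[OF this B] B show ?thesis
  by (simp add: left_diff_distrib trc_diff trc_scaleR)
qed

lemma pdef_sh: "pdef d A ==> pdef d (sh A)"
 unfolding sh_def by (rule pdef_shift) (use S_psd \<delta>_pos in auto)

lemma Ph_nonneg: "pdef d A ==> 0 <= Ph A"
 unfolding Ph_def by (intro divide_nonneg_nonneg trc_psd_mult S_psd minv_psd) auto
lemma M2_nonneg: "pdef d A ==> 0 <= M2 A"
proof -
 assume "pdef d A"
 then have "0 <= trc d (S*minv d A*S*minv d A)"
  by (intro trc_psd_mult psd_conj psd_symm S_psd minv_psd)
 then show ?thesis by (simp add: M2_def mult.assoc)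
qed

text \<open>Under \<open>qok\<close> the Sherman-Morrison coefficient is at most
  \<open>\<kappa>/d\<close>. The updated inverse is then positive semidefinite, which gives positive
  definiteness of the new matrix, and both traces change by explicit rank-one terms.\<close>

lemma step_deterministic:
 assumes A: "pdef d A" "Ph A <= \<phi>0 + s" and q: "qok A x"
 defines "R \<equiv> minv d (sh A)"
 defines "\<alpha>0 \<equiv> bil d x (R*S * R) x/d" and "\<alpha>1 \<equiv> bil d x (R*S * R*S * R) x/d"
 shows "pdef d (step A x)"
  and "Ph (step A x) <= Ph (sh A) + \<kappa>*\<alpha>0/d"
  and "M2 (step A x) <= M2 (sh A) + (2*\<kappa>*\<alpha>1 + \<kappa>^2*\<alpha>0^2)/d"
proof -
 have A': "pdef d (sh A)" by (rule pdef_sh[OF A(1)])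
 have pR: "psd d R" unfolding R_def by (rule minv_psd[OF A'])
 have dR: "indim d R" "indim d S" "symm d R" using pR S_psd by auto
 have "Ph (sh A) <= Ph A"
 proof -
  have "trc d (S*minv d (sh A)) + \<delta>/d*trc d (S*minv d (sh A)*(S*minv d (sh A))) <= trc d (S*minv d A)"
   unfolding sh_def by (rule trc_shift(1)[OF A(1) S_psd]) (use \<delta>_pos in simp)
  moreover have "0 <= \<delta>/d*trc d (S*minv d (sh A)*(S*minv d (sh A)))"
   using M2_nonneg[OF A'] \<delta>_pos d_pos by (intro mult_nonneg_nonneg) (auto simp: M2_def zero_le_divide_iff)
  ultimately show ?thesis unfolding Ph_def by (intro divide_right_mono) auto
 qed
 define b where "b = bil d x R x/d"
 have b: "b <= \<phi>0 + 2 * s" using q A(2) \<open>Ph (sh A) <= Ph A\<close> by (simp add: qok_def b_def R_def)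
 then have b1: "b < 1" using room by simp
 define k where "k = (1/d)/(1 - b)"
 have k: "0 <= k" "k <= \<kappa>/d"
  using b b1 room d_pos by (auto simp: k_def \<kappa>_def intro!: divide_right_mono frac_le)
 define R1 where "R1 = R + k *\<^sub>R (R * outer d x x * R)"
 have inv: "step A x * R1 = idm d"
 proof -
  have e: "1/real d*bil d x R x = b" by (simp add: b_def)
  have "sh A * R = idm d" using pdef_minv[OF A'] by (simp add: R_def)
  from sherman_morrison[OF pdef_symm[OF A'] dR(3) this, of "1/d" x] b1
  show ?thesis unfolding e by (simp add: step_def R1_def k_def)
 qed
 have dA: "symm d (step A x)" using A' unfolding step_def by (intro symm_diff symm_scaleR symm_outer pdef_symm)
 have pR1: "psd d R1" unfolding R1_def by (intro psd_add pR psd_scaleR psd_conj dR psd_outer k)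
 have inv': "R1 * step A x = idm d"
  by (rule fmat_left_right_inverse[OF _ _ inv]) (use dA pR1 in auto)
 have pA: "psd d (step A x)" by (rule inverse_psd[OF pR1 _ inv']) (use dA in auto)
 show pd: "pdef d (step A x)" by (rule psd_inverse_pdef[OF pA pR1 inv])
 have minv: "minv d (step A x) = R1"
  by (rule inverse_unique[of d "step A x"]) (use pd pdef_minv[OF pd] inv inv' pR1 in auto)
 note tr = rank_one_traces[OF dR(3) dR(2), of x]
 let ?Y = "R * outer d x x * R"
 have \<beta>: "bil d x (R*S * R) x = d*\<alpha>0" "bil d x (R*S * R*S * R) x = d*\<alpha>1"
  using d_pos by (auto simp: \<alpha>0_def \<alpha>1_def)
 have nn: "0 <= \<alpha>0" "0 <= \<alpha>1"
 proof -
  have "psd d (R*S * R)" by (intro psd_conj dR S_psd)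
  then show "0 <= \<alpha>0" unfolding \<alpha>0_def by (intro divide_nonneg_nonneg psdD) auto
  have "psd d (R*(S * R*S) * R)" by (intro psd_conj dR psd_symm S_psd pR)
  then have "0 <= bil d x (R*(S * R*S) * R) x" by (rule psdD)
  then show "0 <= \<alpha>1" unfolding \<alpha>1_def by (simp add: mult.assoc)
 qed
 have "trc d (S * R1) = trc d (S * R) + k*(d*\<alpha>0)"
  using tr(1) by (simp add: R1_def distrib_left trc_add trc_scaleR \<beta>)
 also have "... <= trc d (S * R) + \<kappa>/d*(d*\<alpha>0)" using k nn by (intro add_left_mono mult_right_mono) auto
 finally show "Ph (step A x) <= Ph (sh A) + \<kappa>*\<alpha>0/d"
  unfolding Ph_def minv R_def[symmetric] using d_pos
  by (simp add: add_divide_distrib[symmetric] divide_right_mono)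
 have sym: "trc d (S*?Y*(S * R)) = trc d (S * R*(S*?Y))" by (rule trc_comm) (use dR in auto)
 have "trc d (S * R1*(S * R1)) = trc d (S * R*(S * R)) + 2*k*(d*\<alpha>1) + k^2*(d*\<alpha>0)^2"
 proof -
  have "S * R1 = S * R + k *\<^sub>R (S*?Y)" by (simp add: R1_def distrib_left)
  then have "trc d (S * R1*(S * R1)) = trc d (S * R*(S * R)) + k*trc d (S * R*(S*?Y))
    + k*trc d (S*?Y*(S * R)) + k*(k*trc d (S*?Y*(S*?Y)))"
   by (simp only: distrib_left distrib_right mult_scaleR_left mult_scaleR_right trc_add trc_scaleR)
  then show ?thesis unfolding sym tr(2,3) \<beta> by (simp add: power2_eq_square)
 qed
 also have "... <= trc d (S * R*(S * R)) + 2*(\<kappa>/d)*(d*\<alpha>1) + (\<kappa>/d)^2*(d*\<alpha>0)^2"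
  using k nn by (intro add_mono mult_right_mono power_mono mult_left_mono) auto
 also have "... = trc d (S * R*(S * R)) + (2*\<kappa>*\<alpha>1 + \<kappa>^2*\<alpha>0^2)"
  using d_pos by (simp add: power_mult_distrib power_divide)
 finally show "M2 (step A x) <= M2 (sh A) + (2*\<kappa>*\<alpha>1 + \<kappa>^2*\<alpha>0^2)/d"
  unfolding M2_def minv R_def[symmetric] by (simp add: add_divide_distrib[symmetric] divide_right_mono)
qed

lemma \<Lambda>_eq: "\<Lambda>*(\<delta> - \<kappa>) = \<kappa>^2*C'" using \<kappa>_less by (simp add: \<Lambda>_def)

text \<open>Error per step: the variance of the potential and the probability that
  \<open>qok\<close> fails. Both are of order \<open>M^2/d^2\<close>, so \<open>d\<close> steps cost
  order \<open>M^2/d\<close>.\<close>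

definition cost :: real where
 "cost = (\<kappa>^2*C' + \<delta>^2)*M^2/((real d)^2 * s^2) + C*M^2/(a^4 * s^4*(real d)^2)"

lemma lyap_nonneg: "0 <= p ==> 0 <= m ==> 0 <= lyap p m"
 unfolding lyap_def using \<Lambda>_nonneg M_pos by (intro add_nonneg_nonneg divide_nonneg_nonneg mult_nonneg_nonneg) auto

lemma lyap_bad:
 assumes "0 <= p" "0 <= m" "\<not> (p <= \<phi>0 + s \<and> m <= M)" shows "1 <= lyap p m"
proof (cases "m <= M")
 case True
 then have "s < p - \<phi>0" using assms by auto
 then have "s^2 <= (max 0 (p - \<phi>0))^2" using s_pos by (intro power_mono) auto
 then have "1 <= (max 0 (p - \<phi>0))^2/s^2" using s_pos by simp
 moreover have "0 <= (ln (1 + m) + \<Lambda>*p)/ln (1 + M)"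
  using assms \<Lambda>_nonneg M_pos by (intro divide_nonneg_nonneg add_nonneg_nonneg) auto
 ultimately show ?thesis by (simp add: lyap_def)
next
 case False
 then have "ln (1 + M) <= ln (1 + m)" using M_pos by simp
 moreover have "0 < ln (1 + M)" using M_pos by simp
 moreover have "0 <= \<Lambda>*p" using assms \<Lambda>_nonneg by simp
 ultimately have "1 <= (ln (1 + m) + \<Lambda>*p)/ln (1 + M)" by (simp add: le_divide_eq)
 then show ?thesis by (simp add: lyap_def add_increasing2)
qed

lemma ln_tangent: "0 <= m ==> 0 <= m1 ==> ln (1 + m1) <= ln (1 + m) + (m1 - m)/(1 + m)" for m m1 :: real
proof -
 assume m: "0 <= m" "0 <= m1"
 have "ln (1 + m1) - ln (1 + m) = ln ((1 + m1)/(1 + m))" using m by (simp add: ln_div)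
 also have "... <= (1 + m1)/(1 + m) - 1" using m by (intro ln_le_minus_one) simp
 also have "... = (m1 - m)/(1 + m)" using m by (simp add: field_simps)
 finally show ?thesis by simp
qed

text \<open>The shift lowers the potential by at least \<open>\<delta> m'/d\<close>, while a sample
  raises its mean by at most \<open>\<kappa> m'/d\<close> and \<open>\<kappa> < \<delta>\<close>.
  The surplus, weighted by \<open>\<Lambda>\<close>, absorbs the second-order growth of
  \<open>ln (1 + M2)\<close>; hence \<open>lyap\<close> is a supermartingale up to
  \<open>cost\<close>. Failure is counted as 1.\<close>

lemma one_step:
 assumes "good A"
 shows "(\<integral>\<^sup>+r. ennreal (if qok A (X r) \<and> good (step A (X r)) then lyap (Ph (step A (X r))) (M2 (step A (X r))) else 1) \<partial>N)
  <= ennreal (lyap (Ph A) (M2 A) + cost)"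
proof -
 have A: "pdef d A" "Ph A <= \<phi>0 + s" "M2 A <= M" using assms by (auto simp: good_def)
 have A': "pdef d (sh A)" by (rule pdef_sh[OF A(1)])
 define R where "R = minv d (sh A)"
 have pR: "psd d R" unfolding R_def by (rule minv_psd[OF A'])
 have dR: "indim d R" "indim d S" "symm d R" using pR S_psd by auto
 define B where "B = R*S * R"
 define B1 where "B1 = R*S * R*S * R"
 have pB: "psd d B" unfolding B_def by (intro psd_conj dR S_psd)
 have pB1: "psd d B1"
 proof -
  have "psd d (R*(S * R*S) * R)" by (intro psd_conj dR psd_symm S_psd pR)
  then show ?thesis by (simp add: B1_def mult.assoc)
 qed
 define p where "p = Ph A" define p' where "p' = Ph (sh A)"
 define m where "m = M2 A" define m' where "m' = M2 (sh A)"
 define m3 where "m3 = trc d (S * R*(S * R)*(S * R))/d"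
 define \<alpha>0 where "\<alpha>0 r = bil d (X r) B (X r)/d" for r
 define \<alpha>1 where "\<alpha>1 r = bil d (X r) B1 (X r)/d" for r
 define e where "e = (\<integral>r. bil d (X r) R (X r) \<partial>N)"
 define Z where "Z r = (bil d (X r) R (X r) - e)^4/(s*d)^4" for r
 have d0: "0 < real d" using d_pos by simp
 have m'_eq: "m' = trc d (S*B)/d" and m3_eq: "m3 = trc d (S*B1)/d"
  by (simp_all add: m'_def m3_def M2_def B_def B1_def R_def mult.assoc)
 have nn: "0 <= p" "0 <= p'" "0 <= m" "0 <= m'" "0 <= m3"
  using Ph_nonneg[OF A(1)] Ph_nonneg[OF A'] M2_nonneg[OF A(1)] M2_nonneg[OF A'] trc_psd_mult[OF S_psd pB1]
  by (simp_all add: p_def p'_def m_def m'_def m3_eq)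
 have sh1: "p' + \<delta>/d*m' <= p"
 proof -
  have "trc d (S*minv d (sh A)) + \<delta>/d*trc d (S*minv d (sh A)*(S*minv d (sh A))) <= trc d (S*minv d A)"
   unfolding sh_def by (rule trc_shift(1)[OF A(1) S_psd]) (use \<delta>_pos in simp)
  then have "(trc d (S*minv d (sh A)) + \<delta>/d*trc d (S*minv d (sh A)*(S*minv d (sh A))))/d <= p"
   unfolding p_def Ph_def by (rule divide_right_mono) simp
  then show ?thesis by (simp add: p'_def m'_def Ph_def M2_def add_divide_distrib)
 qed
 have sh2: "m' + 2*(\<delta>/d)*m3 <= m"
 proof -
  have "trc d (S * R*(S * R)) + 2*(\<delta>/d)*trc d (S * R*(S * R)*(S * R)) <= trc d (S*minv d A*(S*minv d A))"
   unfolding sh_def R_def by (rule trc_shift(2)[OF A(1) S_psd]) (use \<delta>_pos in simp)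
  then have "(trc d (S * R*(S * R)) + 2*(\<delta>/d)*trc d (S * R*(S * R)*(S * R)))/d <= m"
   unfolding m_def M2_def by (rule divide_right_mono) simp
  then show ?thesis by (simp add: m'_def m3_def M2_def R_def add_divide_distrib)
 qed
 have mm: "m' <= m"
 proof -
  have "0 <= 2*(\<delta>/d)*m3" using nn \<delta>_pos by (intro mult_nonneg_nonneg) auto
  then show ?thesis using sh2 by linarith
 qed
 have mM: "m <= M" using A by (simp add: m_def)
 have int: "integrable N \<alpha>0" "integrable N \<alpha>1" "integrable N (%r. (\<alpha>0 r)^2)" "integrable N Z"
  using quad_integrable[OF pB] quad_integrable[OF pB1] quad_second(1)[OF pB] quad_conc_integrable[OF pR]
  by (auto simp: \<alpha>0_def[abs_def] \<alpha>1_def[abs_def] Z_def[abs_def] power_divide e_def)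
 define I0 where "I0 = integral\<^sup>L N \<alpha>0" define I1 where "I1 = integral\<^sup>L N \<alpha>1"
 define I00 where "I00 = (\<integral>r. (\<alpha>0 r)^2 \<partial>N)" define I4 where "I4 = integral\<^sup>L N Z"
 have \<alpha>nn: "0 <= \<alpha>0 r" "0 <= \<alpha>1 r" "0 <= Z r" for r
  using psdD[OF pB] psdD[OF pB1] by (simp_all add: \<alpha>0_def \<alpha>1_def Z_def)
 have I0: "0 <= I0" "I0 <= m'"
  using mean_le[OF pB] d0 \<alpha>nn by (auto simp: I0_def m'_eq intro!: integral_nonneg_AE)
   (simp add: \<alpha>0_def[abs_def] divide_right_mono)
 have I1: "I1 <= m3" using mean_le[OF pB1] d0 by (simp add: I1_def m3_eq \<alpha>1_def[abs_def] divide_right_mono)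
 \<comment> \<open>The lower bound \<open>a\<close> on \<open>S\<close> enters here: the trace of
   \<open>B*B\<close> is at most that of \<open>B\<close> squared, and the trace of \<open>B\<close>
   is at most that of \<open>S*B\<close> over \<open>a\<close>. So the second moment is comparable
   with the squared bound on the mean.\<close>
 have I00: "I00 <= C'*m'^2"
 proof -
  let ?EB = "\<integral>r. bil d (X r) B (X r) \<partial>N" and ?t = "trc d (S*B)"
  have t0: "0 <= ?t" by (rule trc_psd_mult[OF S_psd pB])
  have "0 <= ?EB" by (rule integral_nonneg_AE) (use psdD[OF pB] in auto)
  then have E2: "?EB^2 <= ?t^2" by (intro power_mono mean_le[OF pB])
  have "trc d B <= ?t/a" using trS[OF pB] a_pos by (simp add: field_simps)
  then have "(trc d B)^2 <= (?t/a)^2" by (intro power_mono trc_psd[OF pB])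
  then have B2: "trc d (B*B) <= ?t^2/a^2" using trc_square_le[OF pB] by (simp add: power_divide)
  have "(\<integral>r. (bil d (X r) B (X r))^2 \<partial>N) <= sqrt C*trc d (B*B) + ?EB^2" by (rule quad_second(2)[OF pB])
  also have "... <= sqrt C*(?t^2/a^2) + ?t^2"
   by (intro add_mono E2 mult_left_mono B2) (use C_nonneg in simp)
  also have "... = C'*?t^2" by (simp add: C'_def algebra_simps)
  finally have "(\<integral>r. (bil d (X r) B (X r))^2 \<partial>N)/d^2 <= C'*?t^2/d^2" by (rule divide_right_mono) simp
  then show ?thesis by (simp add: I00_def \<alpha>0_def power_divide m'_eq)
 qed
 \<comment> \<open>\<open>Z\<close> is at least 1 when \<open>qok\<close> fails, so
   \<open>I4\<close> is a fourth-moment Markov bound for that event. Lower moments would give a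
   failure probability too large to be summed over \<open>d\<close> steps.\<close>
 have I4: "I4 <= C*M^2/(a^4 * s^4*(real d)^2)"
 proof -
  have pRR: "psd d (R * R)" using psd_conj[OF dR(3) psd_idm] dR by simp
  have "a^2*trc d (R * R) <= a*trc d (S*(R * R))"
   using trS[OF pRR] a_pos by (simp add: power2_eq_square mult.assoc)
  also have "trc d (S*(R * R)) = trc d B"
  proof -
   have "trc d (S * R * R) = trc d (R*(S * R))" by (rule trc_comm) (use dR in auto)
   then show ?thesis by (simp add: B_def mult.assoc)
  qed
  also have "a*trc d B <= d*m'" using trS[OF pB] d0 by (simp add: m'_eq)
  also have "... <= d*M" using mm mM by (intro mult_left_mono) auto
  finally have "trc d (R * R) <= d*M/a^2" using a_pos by (simp add: field_simps)
  then have "(trc d (R * R))^2 <= (d*M/a^2)^2" by (intro power_mono trc_psd[OF pRR])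
  then have "C*(trc d (R * R))^2 <= C*(d*M/a^2)^2" by (intro mult_left_mono C_nonneg)
  then have "(\<integral>r. (bil d (X r) R (X r) - e)^4 \<partial>N) <= C*(d*M/a^2)^2"
   using quad_conc[OF pR] by (simp add: e_def)
  then have "I4 <= C*(d*M/a^2)^2/(s*d)^4"
   unfolding I4_def Z_def[abs_def] by (simp add: divide_right_mono)
  also have "... = C*M^2/(a^4 * s^4*(real d)^2)"
   using d0 s_pos a_pos by (simp add: power_mult_distrib power_divide field_simps eval_nat_numeral)
  finally show ?thesis .
 qed
 define D where "D = max 0 (p - \<phi>0)"
 define l where "l = ln (1 + M)"
 have l: "0 < l" using M_pos by (simp add: l_def)
 let ?V = "%u v::real. (2*\<kappa>*u + \<kappa>^2 * v)/d" let ?U = "%u v::real. (\<kappa>^2 * v - 2*\<kappa>*\<delta>*m'*u + \<delta>^2*m'^2)/d^2"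
 let ?Q = "%u v. D^2 + 2*D*((\<kappa>*u - \<delta>*m')/d) + ?U u v" let ?LT = "%u v. ln (1 + m) + (m' + ?V u v - m)/(1 + m)"
 let ?L = "%r. (?LT (\<alpha>1 r) ((\<alpha>0 r)^2) + \<Lambda>*(p' + \<kappa>*\<alpha>0 r/d))/l
  + (?Q (\<alpha>0 r) ((\<alpha>0 r)^2))/s^2
  + Z r"
 have sqr: "?Q (\<alpha>0 r) ((\<alpha>0 r)^2)
  = (D + (\<kappa>*\<alpha>0 r - \<delta>*m')/d)^2" for r
  using d0 by (simp add: power2_eq_square field_simps)
 have intL: "integrable N ?L" using int by (simp add: integrable_mult_right)
 have tan: "ln (1 + (m' + ?V (\<alpha>1 r) ((\<alpha>0 r)^2)))
   <= ?LT (\<alpha>1 r) ((\<alpha>0 r)^2)" for r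
  by (rule ln_tangent) (use nn \<alpha>nn \<kappa>_pos in auto)
 have ln0: "0 <= ln (1 + (m' + ?V (\<alpha>1 r) ((\<alpha>0 r)^2)))" for r
  using nn \<alpha>nn[of r] \<kappa>_pos by simp
 have pw: "(if qok A (X r) \<and> good (step A (X r)) then lyap (Ph (step A (X r))) (M2 (step A (X r))) else 1) <= ?L r" for r
 proof (cases "qok A (X r)")
  case False
  have "e <= d*p'" using mean_le[OF pR] d0 by (simp add: e_def p'_def Ph_def R_def)
  moreover have "d*p' + s*d < bil d (X r) R (X r)"
   using False d0 by (simp add: qok_def not_le R_def p'_def field_simps)
  ultimately have "s*d <= bil d (X r) R (X r) - e" by simp
  then have "(s*d)^4 <= (bil d (X r) R (X r) - e)^4" using s_pos by (intro power_mono) auto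
  then have "1 <= Z r" using s_pos d0 by (simp add: Z_def)
  moreover have "0 <= (?LT (\<alpha>1 r) ((\<alpha>0 r)^2) + \<Lambda>*(p' + \<kappa>*\<alpha>0 r/d))/l"
  proof -
   have "0 <= \<Lambda>*(p' + \<kappa>*\<alpha>0 r/d)" using \<Lambda>_nonneg nn \<alpha>nn[of r] \<kappa>_pos by simp
   then show ?thesis using l order_trans[OF ln0 tan, of r]
    by (intro divide_nonneg_pos[OF _ l] add_nonneg_nonneg[of "_ + _"]) auto
  qed
  moreover have "0 <= (D + (\<kappa>*\<alpha>0 r - \<delta>*m')/d)^2/s^2" by simp
  ultimately show ?thesis unfolding sqr using False by (simp only: simp_thms if_False)
 next
  case True
  note st = step_deterministic[OF A(1,2) True, folded R_def, folded B_def B1_def, folded \<alpha>0_def \<alpha>1_def]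
  let ?p1 = "Ph (step A (X r))" and ?m1 = "M2 (step A (X r))"
  have 0: "0 <= ?p1" "0 <= ?m1" using Ph_nonneg[OF st(1)] M2_nonneg[OF st(1)] by auto
  have p1: "?p1 <= p' + \<kappa>*\<alpha>0 r/d" and m1: "?m1 <= m' + ?V (\<alpha>1 r) ((\<alpha>0 r)^2)"
   using st by (auto simp: p'_def m'_def)
  have "lyap ?p1 ?m1 <= ?L r"
  proof -
   have "ln (1 + ?m1) <= ln (1 + (m' + ?V (\<alpha>1 r) ((\<alpha>0 r)^2)))" using 0 m1 by simp
   then have x1: "ln (1 + ?m1) <= ?LT (\<alpha>1 r) ((\<alpha>0 r)^2)"
    using tan by (rule order_trans)
   have x2: "\<Lambda>*?p1 <= \<Lambda>*(p' + \<kappa>*\<alpha>0 r/d)" by (intro mult_left_mono p1 \<Lambda>_nonneg)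
   have F1: "ln (1 + ?m1) + \<Lambda>*?p1 <= ?LT (\<alpha>1 r) ((\<alpha>0 r)^2) + \<Lambda>*(p' + \<kappa>*\<alpha>0 r/d)"
    using x1 x2 by linarith
   have "?p1 - \<phi>0 <= D + (\<kappa>*\<alpha>0 r - \<delta>*m')/d"
    using p1 sh1 by (simp add: D_def diff_divide_distrib)
   then have "max 0 (?p1 - \<phi>0) <= \<bar>D + (\<kappa>*\<alpha>0 r - \<delta>*m')/d\<bar>" by auto
   then have "(max 0 (?p1 - \<phi>0))^2 <= \<bar>D + (\<kappa>*\<alpha>0 r - \<delta>*m')/d\<bar>^2" by (intro power_mono) auto
   then have F2: "(max 0 (?p1 - \<phi>0))^2 <= ?Q (\<alpha>0 r) ((\<alpha>0 r)^2)"
    unfolding sqr by simp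
   from add_mono[OF add_mono[OF divide_right_mono[OF F1 less_imp_le[OF l]] divide_right_mono[OF F2 zero_le_power2]] \<alpha>nn(3)[of r]]
   show ?thesis unfolding lyap_def l_def[symmetric] add_0_right .
  qed
  moreover have "1 <= lyap ?p1 ?m1" if "\<not> good (step A (X r))"
   using that st(1) 0 by (intro lyap_bad) (auto simp: good_def)
  ultimately show ?thesis using True by auto
 qed
 have "integral\<^sup>L N ?L = (?LT I1 I00 + \<Lambda>*(p' + \<kappa>*I0/d))/l
  + (?Q I0 I00)/s^2 + I4"
  using int by (simp add: integrable_mult_right prob_space I0_def I1_def I00_def I4_def)
 also have "... <= (ln (1 + m) + \<Lambda>*p)/l + (D^2 + (\<kappa>^2*C' + \<delta>^2)*M^2/(real d)^2)/s^2 + C*M^2/(a^4 * s^4*(real d)^2)"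
 proof -
  \<comment> \<open>The first-order rise of \<open>M2\<close> is at most
    \<open>2 \<kappa> m3/d\<close> in mean, less than the drop \<open>2 \<delta> m3/d\<close> caused
    by the shift. Only the square term survives.\<close>
  have "m' + ?V I1 I00 - m <= \<kappa>^2*C'*m'^2/d"
  proof -
   have "2*\<kappa>*I1 <= 2*\<delta>*m3"
    by (rule mult_mono) (use I1 \<kappa>_less \<kappa>_pos nn \<alpha>nn in \<open>auto simp: I1_def intro!: integral_nonneg_AE\<close>)
   then have 1: "2*\<kappa>*I1/d <= 2*(\<delta>/d)*m3" using divide_right_mono[of _ _ "real d"] by fastforce
   have "\<kappa>^2*I00 <= \<kappa>^2*(C'*m'^2)" by (intro mult_left_mono I00) simp
   then have 2: "\<kappa>^2*I00/d <= \<kappa>^2*C'*m'^2/d" using divide_right_mono[of _ _ "real d"] by (simp add: mult.assoc)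
   show ?thesis using 1 2 sh2 by (simp add: add_divide_distrib)
  qed
  then have "(m' + ?V I1 I00 - m)/(1 + m) <= (\<kappa>^2*C'*m'^2/d)/(1 + m)"
   using nn by (intro divide_right_mono) auto
  \<comment> \<open>Since \<open>m' <= m\<close>, dividing by \<open>1 + m\<close> reduces
    \<open>m'^2\<close> to \<open>m'\<close>. This is why the logarithm of \<open>M2\<close> is
    tracked.\<close>
  also have "... <= \<kappa>^2*C'*m'/d"
  proof -
   have "m'^2 <= m'*(1 + m)" unfolding power2_eq_square using nn mm by (intro mult_left_mono) auto
   then have "\<kappa>^2*C'*m'^2 <= \<kappa>^2*C'*(m'*(1 + m))" using C'_ge1 by (intro mult_left_mono) auto
   then have "\<kappa>^2*C'*m'^2/d <= \<kappa>^2*C'*(m'*(1 + m))/d" by (rule divide_right_mono) simp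
   then have "(\<kappa>^2*C'*m'^2/d)/(1 + m) <= (\<kappa>^2*C'*(m'*(1 + m))/d)/(1 + m)"
    by (rule divide_right_mono) (use nn in simp)
   moreover have "1 + m ~= 0" using nn by linarith
   ultimately show ?thesis by simp
  qed
  also have "... = \<Lambda>*((\<delta> - \<kappa>)*m'/d)" using \<Lambda>_eq by (simp flip: mult.assoc)
  finally have 1: "(m' + ?V I1 I00 - m)/(1 + m) <= \<Lambda>*((\<delta> - \<kappa>)*m'/d)" .
  have "\<kappa>*I0 <= \<kappa>*m'" using I0 \<kappa>_pos by (intro mult_left_mono) auto
  then have "\<kappa>*I0/d <= \<kappa>*m'/d" by (rule divide_right_mono) simp
  then have "p' + \<kappa>*I0/d + (\<delta> - \<kappa>)*m'/d <= p" using sh1 by (simp add: left_diff_distrib diff_divide_distrib)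
  then have "\<Lambda>*(p' + \<kappa>*I0/d + (\<delta> - \<kappa>)*m'/d) <= \<Lambda>*p" by (rule mult_left_mono[OF _ \<Lambda>_nonneg])
  then have F1: "?LT I1 I00 + \<Lambda>*(p' + \<kappa>*I0/d) <= ln (1 + m) + \<Lambda>*p"
   using 1 by (simp add: distrib_left)
  have "\<kappa>*I0 <= \<delta>*m'" using I0 \<kappa>_pos \<kappa>_less nn by (intro mult_mono) auto
  then have "(\<kappa>*I0 - \<delta>*m')/d <= 0" by (simp add: divide_le_0_iff)
  then have 2: "2*D*((\<kappa>*I0 - \<delta>*m')/d) <= 0" by (intro mult_nonneg_nonpos) (simp_all add: D_def)
  have "m'^2 <= M^2" using mm mM nn by (intro power_mono) auto
  then have "\<kappa>^2*I00 <= \<kappa>^2*(C'*M^2)" "\<delta>^2*m'^2 <= \<delta>^2*M^2"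
   using C'_ge1 by (auto intro!: mult_left_mono order_trans[OF I00])
  moreover have "0 <= 2*\<kappa>*\<delta>*m'*I0" using \<kappa>_pos \<delta>_pos nn I0 by simp
  ultimately have "\<kappa>^2*I00 - 2*\<kappa>*\<delta>*m'*I0 + \<delta>^2*m'^2 <= (\<kappa>^2*C' + \<delta>^2)*M^2"
   unfolding distrib_right mult.assoc[of _ C'] by linarith
  then have "?U I0 I00 <= (\<kappa>^2*C' + \<delta>^2)*M^2/(real d)^2"
   by (simp add: divide_right_mono)
  then have F2: "?Q I0 I00
   <= D^2 + (\<kappa>^2*C' + \<delta>^2)*M^2/(real d)^2" using 2 by linarith
  show ?thesis
   by (rule add_mono[OF add_mono[OF divide_right_mono[OF F1 less_imp_le[OF l]] divide_right_mono[OF F2 zero_le_power2]] I4])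
 qed
 also have "... = lyap (Ph A) (M2 A) + cost"
  by (simp add: lyap_def cost_def l_def D_def p_def m_def add_divide_distrib)
 finally have fin: "integral\<^sup>L N ?L <= lyap (Ph A) (M2 A) + cost" .
 have L0: "0 <= ?L r" for r
 proof -
  have "0 <= (if qok A (X r) \<and> good (step A (X r)) then lyap (Ph (step A (X r))) (M2 (step A (X r))) else 1)"
   by (auto intro!: lyap_nonneg Ph_nonneg M2_nonneg simp: good_def)
  then show ?thesis using pw by (rule order_trans)
 qed
 have "(\<integral>\<^sup>+r. ennreal (if qok A (X r) \<and> good (step A (X r)) then lyap (Ph (step A (X r))) (M2 (step A (X r))) else 1) \<partial>N)
   <= (\<integral>\<^sup>+r. ennreal (?L r) \<partial>N)"
  by (intro nn_integral_mono ennreal_leI pw)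
 also have "... = ennreal (integral\<^sup>L N ?L)"
  by (rule nn_integral_eq_integral[OF intL]) (use L0 in auto)
 also have "... <= ennreal (lyap (Ph A) (M2 A) + cost)" using fin by (rule ennreal_leI)
 finally show ?thesis .
qed

primrec st :: "fmat => nat => (nat => 'r) => fmat" where
 "st A 0 x = A"
| "st A (Suc n) x = step (st A n x) (X (x n))"

primrec ok :: "fmat => nat => (nat => 'r) => bool" where
 "ok A 0 x = True"
| "ok A (Suc n) x = (ok A n x \<and> qok (st A n x) (X (x n)) \<and>
  Ph (st A (Suc n) x) <= \<phi>0 + s \<and> M2 (st A (Suc n) x) <= M)"

lemma st_closed: "st A n x = A + (n*\<delta>/d) *\<^sub>R S - (1/d) *\<^sub>R (\<Sum>i<n. outer d (X (x i)) (X (x i)))"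
 by (induction n) (simp_all add: step_def sh_def scaleR_add_right algebra_simps add_divide_distrib scaleR_add_left)

lemma st_cong: "(\<And>i. i < n ==> x i = y i) ==> st A n x = st A n y"
 by (induction n) auto
lemma ok_cong: "(\<And>i. i < n ==> x i = y i) ==> ok A n x = ok A n y"
 by (induction n) (auto simp: st_cong[of _ x y] cong: st_cong)

lemma ok_good:
 assumes "good A" "ok A n x" shows "good (st A n x)"
 using assms(2)
proof (induction n)
 case (Suc n)
 then have "good (st A n x)" by simp
 with Suc.prems show ?case
  using step_deterministic(1)[of "st A n x" "X (x n)"] by (auto simp: good_def)
qed (use assms in simp)

lemma mea_st: "indim d A ==> k <= n ==> mea (PiM {..<n} (%_. N)) (st A k)"
 unfolding st_closed by (intro mea_diff mea_scaleR mea_const mea_sum mea_outer component_measurable) auto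

lemma mea_sh: "mea M' F ==> mea M' (%w. sh (F w))"
 unfolding sh_def by (intro mea_add mea_const)

lemma measurable_Ph: "mea M' F ==> (%w. Ph (F w)) \<in> borel_measurable M'"
 unfolding Ph_def
 by (intro borel_measurable_divide borel_measurable_const measurable_trc mea_times[of _ _ _ d] mea_const mea_minv)
  (use S_psd in auto)
lemma measurable_M2: "mea M' F ==> (%w. M2 (F w)) \<in> borel_measurable M'"
 unfolding M2_def
 by (intro borel_measurable_divide borel_measurable_const measurable_trc mea_times[of _ _ _ d] mea_const mea_minv)
  (use S_psd in auto)

lemma measurable_ok [measurable]:
 assumes "indim d A" "k <= n" shows "Measurable.pred (PiM {..<n} (%_. N)) (ok A k)"
 using assms(2)
proof (induction k)
 case (Suc k)
 have [measurable]: "(%x. bil d (X (x k)) (minv d (sh (st A k x))) (X (x k))) \<in> borel_measurable (PiM {..<n} (%_. N))"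
  using Suc.prems assms(1) by (intro measurable_bil mea_minv mea_sh mea_st component_measurable) auto
 have [measurable]: "(%x. Ph (sh (st A k x))) \<in> borel_measurable (PiM {..<n} (%_. N))"
  "(%x. Ph (st A (Suc k) x)) \<in> borel_measurable (PiM {..<n} (%_. N))"
  "(%x. M2 (st A (Suc k) x)) \<in> borel_measurable (PiM {..<n} (%_. N))"
  using Suc.prems assms(1) by (auto intro!: measurable_Ph measurable_M2 mea_sh mea_st simp del: st.simps)
 have [measurable]: "Measurable.pred (PiM {..<n} (%_. N)) (ok A k)" using Suc by auto
 show ?case unfolding ok.simps(2) qok_def
  by (intro pred_intros_logic pred_le borel_measurable_divide borel_measurable_add borel_measurable_const) fact+
qed (simp add: ok.simps(1)[abs_def])

text \<open>The stopped Lyapunov function. It takes the value 1 for ever after the first violation,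
  so its expectation bounds the probability of failure.\<close>

definition U :: "fmat => nat => (nat => 'r) => real" where
 "U A n x = (if ok A n x then lyap (Ph (st A n x)) (M2 (st A n x)) else 1)"

lemma measurable_U:
 assumes "indim d A" "k <= n" shows "U A k \<in> borel_measurable (PiM {..<n} (%_. N))"
proof -
 have [measurable]: "(%x. Ph (st A k x)) \<in> borel_measurable (PiM {..<n} (%_. N))"
  "(%x. M2 (st A k x)) \<in> borel_measurable (PiM {..<n} (%_. N))"
  "Measurable.pred (PiM {..<n} (%_. N)) (ok A k)"
  using assms by (auto intro!: measurable_Ph measurable_M2 mea_st)
 show ?thesis unfolding U_def[abs_def] lyap_def by measurable
qed

lemma cost_nonneg: "0 <= cost"
 unfolding cost_def using C'_ge1 C_nonneg a_pos s_pos
 by (intro add_nonneg_nonneg divide_nonneg_nonneg mult_nonneg_nonneg) auto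

lemma U_expectation:
 assumes A: "good A"
 shows "(\<integral>\<^sup>+x. ennreal (U A n x) \<partial>PiM {..<n} (%_. N)) <= ennreal (lyap (Ph A) (M2 A) + n*cost)"
proof (induction n)
 case 0
 show ?case by (simp add: U_def PiM_empty nn_integral_count_space_finite)
next
 case (Suc n)
 interpret product_sigma_finite "%_::nat. N" ..
 have iA: "indim d A" using A by (auto simp: good_def)
 have ins: "{..<Suc n} = insert n {..<n}" by auto
 have upd: "st A n (x(n := r)) = st A n x" "ok A n (x(n := r)) = ok A n x" for x r
  by (auto intro!: st_cong ok_cong)
 have "(\<integral>\<^sup>+x. ennreal (U A (Suc n) x) \<partial>PiM {..<Suc n} (%_. N))
   = (\<integral>\<^sup>+x. (\<integral>\<^sup>+r. ennreal (U A (Suc n) (x(n := r))) \<partial>N) \<partial>PiM {..<n} (%_. N))"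
  unfolding ins by (rule product_nn_integral_insert)
   (use measurable_U[OF iA, of "Suc n" "Suc n"] in \<open>auto simp flip: ins\<close>)
 also have "... <= (\<integral>\<^sup>+x. ennreal (U A n x) + ennreal cost \<partial>PiM {..<n} (%_. N))"
 proof (rule nn_integral_mono)
  fix x
  show "(\<integral>\<^sup>+r. ennreal (U A (Suc n) (x(n := r))) \<partial>N) <= ennreal (U A n x) + ennreal cost"
  proof (cases "ok A n x")
   case False
   then show ?thesis using cost_nonneg by (simp add: U_def upd emeasure_space_1)
  next
   case True
   let ?A = "st A n x"
   have g: "good ?A" by (rule ok_good[OF A True])
   have "U A (Suc n) (x(n := r)) = (if qok ?A (X r) \<and> good (step ?A (X r)) then lyap (Ph (step ?A (X r))) (M2 (step ?A (X r))) else 1)" for r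
   proof -
    have "pdef d (step ?A (X r))" if "qok ?A (X r)"
     using g that step_deterministic(1) by (auto simp: good_def)
    then show ?thesis using True by (auto simp: U_def upd good_def)
   qed
   then have "(\<integral>\<^sup>+r. ennreal (U A (Suc n) (x(n := r))) \<partial>N) <= ennreal (lyap (Ph ?A) (M2 ?A) + cost)"
    using one_step[OF g] by simp
   also have "... = ennreal (U A n x) + ennreal cost"
    using True cost_nonneg g by (subst ennreal_plus[symmetric])
     (auto simp: U_def good_def intro!: lyap_nonneg Ph_nonneg M2_nonneg)
   finally show ?thesis .
  qed
 qed
 also have "... = (\<integral>\<^sup>+x. ennreal (U A n x) \<partial>PiM {..<n} (%_. N)) + ennreal cost"
 proof -
  interpret P: prob_space "PiM {..<n} (%_. N)" by (rule prob_space_PiM) unfold_locales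
  show ?thesis using measurable_U[OF iA, of n n] by (simp add: nn_integral_add P.emeasure_space_1)
 qed
 also have "... <= ennreal (lyap (Ph A) (M2 A) + n*cost) + ennreal cost" by (intro add_right_mono Suc.IH)
 also have "... = ennreal (lyap (Ph A) (M2 A) + Suc n*cost)"
  using A cost_nonneg by (subst ennreal_plus[symmetric])
   (auto simp: good_def algebra_simps intro!: lyap_nonneg Ph_nonneg M2_nonneg add_nonneg_nonneg)
 finally show ?case .
qed

theorem barrier_bound:
 assumes A: "good A"
 shows "{x \<in> space (PiM {..<n} (%_. N)). \<not> ok A n x} \<in> sets (PiM {..<n} (%_. N))"
  and "measure (PiM {..<n} (%_. N)) {x \<in> space (PiM {..<n} (%_. N)). \<not> ok A n x} <= lyap (Ph A) (M2 A) + n*cost"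
proof -
 let ?P = "PiM {..<n} (%_. N)"
 interpret P: prob_space ?P by (rule prob_space_PiM) unfold_locales
 have iA: "indim d A" using A by (auto simp: good_def)
 let ?B = "{x \<in> space ?P. \<not> ok A n x}"
 show B: "?B \<in> sets ?P" using measurable_ok[OF iA, of n n] by measurable
 have "ennreal (measure ?P ?B) = (\<integral>\<^sup>+x. indicator ?B x \<partial>?P)"
  using B by (simp add: P.emeasure_eq_measure)
 also have "... <= (\<integral>\<^sup>+x. ennreal (U A n x) \<partial>?P)"
  by (rule nn_integral_mono) (auto simp: indicator_def U_def)
 also have "... <= ennreal (lyap (Ph A) (M2 A) + n*cost)" by (rule U_expectation[OF A])
 finally show "measure ?P ?B <= lyap (Ph A) (M2 A) + n*cost"
  using A cost_nonneg by (subst (asm) ennreal_le_iff)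
   (auto simp: good_def intro!: lyap_nonneg Ph_nonneg M2_nonneg add_nonneg_nonneg)
qed

end

section \<open>Exchanging rank-one matrices for their mean\<close>

lemma discriminant_nonpos:
 fixes a b c :: real
 assumes "\<And>t. 0 <= a + 2*t*b + t^2*c" shows "b^2 <= a*c"
proof (cases "c = 0")
 case True
 have "b = 0"
 proof (rule ccontr)
  assume "b ~= 0"
  have "0 <= a + 2*(- (a + 1)/(2*b))*b" using assms[of "- (a + 1)/(2*b)"] True by simp
  then show False using \<open>b ~= 0\<close> by (simp add: field_simps)
 qed
 then show ?thesis using True by simp
next
 case False
 have "0 <= c"
 proof (rule ccontr)
  assume "\<not> 0 <= c"
  define u where "u = (\<bar>a\<bar> + \<bar>b\<bar> + 1)/(- c) + 1"
  have "0 <= (\<bar>a\<bar> + \<bar>b\<bar> + 1)/(- c)" by (rule divide_nonneg_pos) (use \<open>\<not> 0 <= c\<close> in auto)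
  then have u: "1 <= u" unfolding u_def by linarith
  have "u*(- c) = \<bar>a\<bar> + \<bar>b\<bar> + 1 - c" using \<open>\<not> 0 <= c\<close> by (simp add: u_def field_simps)
  have "0 <= a + 2*(2*u)*b + (2*u)^2*c" by (rule assms)
  also have "... = a + 4*u*(b + u*c)" by (simp add: power2_eq_square algebra_simps)
  also have "b + u*c <= - (\<bar>a\<bar> + 1)" using \<open>u*(- c) = _\<close> \<open>\<not> 0 <= c\<close> by simp
  then have "4*u*(b + u*c) <= 4*u*(- (\<bar>a\<bar> + 1))" using u by (intro mult_left_mono) auto
  also have "... <= 4*1*(- (\<bar>a\<bar> + 1))" using u by (intro mult_right_mono_neg mult_left_mono) auto
  finally show False by simp
 qed
 then have c: "0 < c" using False by simp
 have "0 <= a + 2*(- b/c)*b + (- b/c)^2*c" by (rule assms)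
 also have "... = a - b^2/c" using c by (simp add: power2_eq_square field_simps)
 finally show ?thesis using c by (simp add: field_simps)
qed

lemma psd_cauchy:
 assumes "psd d S" shows "(bil d x S y)^2 <= bil d x S x*bil d y S y"
proof (rule discriminant_nonpos)
 fix t
 have "0 <= bil d (%i. x i + t*y i) S (%i. x i + t*y i)" by (rule psdD[OF assms])
 also have "... = bil d x S x + 2*t*bil d x S y + t^2*bil d y S y"
  using symm_bil[OF psd_symm[OF assms], of y x]
  by (simp add: bil_add_left bil_add_right bil_smult_left bil_smult_right power2_eq_square algebra_simps)
 finally show "0 <= bil d x S x + 2*t*bil d x S y + t^2*bil d y S y" .
qed

text \<open>For positive semidefinite matrices, a bound on the operator norm stated through the
  quadratic form.\<close>

definition upb :: "nat => fmat => real => bool" where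
 "upb d A c \<longleftrightarrow> psd d A \<and> 0 <= c \<and> (\<forall>x. bil d x A x <= c*ip d x x)"

lemma upb_psd: "upb d A c ==> psd d A" by (simp add: upb_def)
lemma upb_idm: "upb d (idm d) 1" by (auto simp: upb_def bil_idm)
lemma upb_mono: "upb d A c ==> c <= c' ==> upb d A c'"
 unfolding upb_def by (meson ip_nonneg mult_right_mono order_trans)

lemma upb_compl: "upb d A c ==> psd d (c *\<^sub>R idm d - A)"
 unfolding upb_def psd_def by (auto simp: bil_diff bil_scaleR bil_idm)

lemma upb_trc_mult: "upb d A c ==> psd d B ==> trc d (A*B) <= c*trc d B"
 using trc_psd_mult[OF upb_compl, of d A c B]
 by (simp add: left_diff_distrib trc_diff trc_scaleR)

lemma upb_trc: "upb d A c ==> trc d A <= c*d"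
 using upb_trc_mult[of d A c "idm d"] by (simp add: psd_idm upb_def)

lemma upb_trc_square: "upb d A c ==> trc d (A*A) <= c^2*d"
proof -
 assume A: "upb d A c"
 have "trc d (A*A) <= c*trc d A" by (rule upb_trc_mult[OF A upb_psd[OF A]])
 also have "... <= c*(c*d)" using A by (intro mult_left_mono upb_trc) (auto simp: upb_def)
 finally show ?thesis by (simp add: power2_eq_square mult.assoc)
qed

text \<open>Cauchy-Schwarz for the form of \<open>A\<close>, applied to \<open>A x\<close> and
  \<open>x\<close>, bounds the fourth power of the length of \<open>A x\<close>; one squared length
  cancels.\<close>

lemma upb_mv:
 assumes "upb d A c" shows "ip d (mv d A x) (mv d A x) <= c^2*ip d x x"
proof -
 have A: "psd d A" using assms by (rule upb_psd)
 let ?y = "mv d A x"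
 have e: "bil d ?y A x = ip d ?y ?y" by (simp add: bil_mv)
 have "(ip d ?y ?y)^2 <= bil d ?y A ?y*bil d x A x" using psd_cauchy[OF A, of ?y x] by (simp add: e)
 also have "... <= (c*ip d ?y ?y)*(c*ip d x x)"
  using assms by (intro mult_mono psdD[OF A]) (auto simp: upb_def)
 finally have *: "ip d ?y ?y*ip d ?y ?y <= ip d ?y ?y*(c^2*ip d x x)"
  by (simp add: power2_eq_square mult_ac)
 show ?thesis
 proof (cases "ip d ?y ?y = 0")
  case False
  then have "0 < ip d ?y ?y" using ip_nonneg[of d ?y] by linarith
  with * show ?thesis by (simp add: mult_le_cancel_left)
 qed simp
qed

lemma upb_conj:
 assumes "upb d R r" "upb d S l" shows "upb d (R*S * R) (r^2*l)"
 unfolding upb_def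
proof (intro conjI allI)
 have R: "symm d R" "psd d S" using assms by (auto simp: upb_def)
 show "psd d (R*S * R)" by (rule psd_conj[OF R])
 show "0 <= r^2*l" using assms by (simp add: upb_def)
 fix x
 have "bil d x (R*S * R) x = bil d (mv d R x) S (mv d R x)" using R by (intro bil_conj) auto
 also have "... <= l*ip d (mv d R x) (mv d R x)" using assms by (simp add: upb_def)
 also have "... <= l*(r^2*ip d x x)" using assms by (intro mult_left_mono upb_mv) (auto simp: upb_def)
 finally show "bil d x (R*S * R) x <= r^2*l*ip d x x" by (simp add: mult_ac)
qed

lemma lower_bound_minv:
 assumes A: "symm d A" and t: "0 < t" "\<And>x. t*ip d x x <= bil d x A x"
 shows "pdef d A" "upb d (minv d A) (1/t)"
proof -
 show pA: "pdef d A" using pdefI[OF A t] .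
 show "upb d (minv d A) (1/t)"
  unfolding upb_def
 proof (intro conjI allI)
  show "psd d (minv d A)" by (rule minv_psd[OF pA])
  fix x
  let ?y = "mv d (minv d A) x"
  have "t*ip d ?y ?y <= bil d ?y A ?y" by (rule t)
  also have "... = bil d x (minv d A) x"
   using bil_inverse[of d A "minv d A" ?y x] A pdef_minv[OF pA] by (simp add: bil_mv[of d x] ip_comm)
  finally have 1: "t*(t*ip d ?y ?y) <= t*ip d x ?y" using t by (simp add: bil_mv)
  have "0 <= ip d (%i. x i + (- t)*?y i) (%i. x i + (- t)*?y i)" by (rule ip_nonneg)
  also have "... = ip d x x - 2*t*ip d x ?y + t*(t*ip d ?y ?y)"
   by (simp only: ip_add_left ip_add_right ip_smult_left ip_smult_right ip_comm[of d ?y x])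
  finally have "t*ip d x ?y <= ip d x x" using 1 by linarith
  then show "bil d x (minv d A) x <= 1/t*ip d x x" using t by (simp add: bil_mv field_simps)
 qed (use t in auto)
qed

lemma ennreal_affine:
 "0 <= c ==> 0 <= u ==> 0 <= v ==> 0 <= w ==>
  ennreal (c + (u + w * v)) = ennreal c + (ennreal u + ennreal w*ennreal v)"
 by (simp add: ennreal_plus ennreal_mult)

lemma (in prob_space) nn_integral_affine:
 assumes "f \<in> borel_measurable M" "g \<in> borel_measurable M"
 shows "(\<integral>\<^sup>+r. c + (f r + w*g r) \<partial>M) = c + ((\<integral>\<^sup>+r. f r \<partial>M) + w*(\<integral>\<^sup>+r. g r \<partial>M))"
 using assms by (simp add: nn_integral_add nn_integral_cmult emeasure_space_1)

text \<open>Unlike the barrier, the exchange needs the mean from both sides, hence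
  \<open>mean_close\<close>, and an upper bound \<open>L\<close> on \<open>S\<close>.
  \<open>\<phi>\<close> is a candidate for the trace of \<open>S\<close> times the resolvent,
  divided by \<open>d\<close>; how well it fits is part of the final error bound.\<close>

locale swap = row_law N d X C for N :: "'r measure" and d X C +
 fixes S :: fmat and t \<phi> L \<epsilon> :: real
 assumes S_upb: "upb d S L" and t_pos: "0 < t" and \<phi>_nonneg: "0 <= \<phi>" and \<epsilon>_nonneg: "0 <= \<epsilon>"
  and mean_close: "\<And>M c. upb d M c ==> \<bar>(\<integral>r. bil d (X r) M (X r) \<partial>N) - trc d (S*M)\<bar> <= \<epsilon>*d*c"
begin

definition "\<kappa> = 1/(1 + \<phi>)"
text \<open>Error in mean absolute value of a normalised quadratic form:
  \<open>sqrt (sqrt C)/sqrt d\<close> is the fluctuation, \<open>\<epsilon>\<close> the error of the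
  mean.\<close>

definition "\<eta> = sqrt (sqrt C)/sqrt d + \<epsilon>"
definition "K = 2*(1 + L)^4*(1 + 1/t)^4"

definition step :: "fmat => (nat => real) => fmat" where
 "step A x = A - (\<kappa>/d) *\<^sub>R S + (1/d) *\<^sub>R outer d x x"

lemma \<kappa>_bounds: "0 < \<kappa>" "\<kappa> <= 1" using \<phi>_nonneg by (auto simp: \<kappa>_def)
lemma L_nonneg: "0 <= L" using S_upb by (simp add: upb_def)
lemma \<eta>_nonneg: "0 <= \<eta>" using \<epsilon>_nonneg C_nonneg by (simp add: \<eta>_def)

lemma quad_dev:
 assumes M: "upb d M c"
 shows "integrable N (%r. \<bar>bil d (X r) M (X r)/d - trc d (S*M)/d\<bar>)"
  and "(\<integral>r. \<bar>bil d (X r) M (X r)/d - trc d (S*M)/d\<bar> \<partial>N) <= \<eta>*c"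
proof -
 have pM: "psd d M" using M by (rule upb_psd)
 have c: "0 <= c" using M by (simp add: upb_def)
 have d0: "0 < real d" using d_pos by simp
 define e where "e = (\<integral>r. bil d (X r) M (X r) \<partial>N)"
 define Y where "Y r = bil d (X r) M (X r) - e" for r
 note v = quad_var[OF pM, folded e_def, folded Y_def]
 have iY: "integrable N Y" using quad_integrable[OF pM] by (simp add: Y_def[abs_def])
 show int: "integrable N (%r. \<bar>bil d (X r) M (X r)/d - trc d (S*M)/d\<bar>)"
  using quad_integrable[OF pM] by auto
 have "0 <= (\<integral>r. (\<bar>Y r\<bar> - (\<integral>r. \<bar>Y r\<bar> \<partial>N))^2 \<partial>N)" by (rule integral_nonneg_AE) simp
 also have "... = (\<integral>r. (Y r)^2 - 2*(\<integral>r. \<bar>Y r\<bar> \<partial>N)*\<bar>Y r\<bar> + (\<integral>r. \<bar>Y r\<bar> \<partial>N)^2 \<partial>N)"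
  by (simp add: power2_diff algebra_simps)
 also have "... = (\<integral>r. (Y r)^2 \<partial>N) - (\<integral>r. \<bar>Y r\<bar> \<partial>N)^2"
  using v(1) iY by (simp add: prob_space power2_eq_square)
 finally have "(\<integral>r. \<bar>Y r\<bar> \<partial>N)^2 <= (\<integral>r. (Y r)^2 \<partial>N)" by simp
 also have "... <= sqrt C*trc d (M*M)" by (rule v(2))
 also have "... <= sqrt C*(c^2*d)" by (intro mult_left_mono upb_trc_square[OF M]) (simp add: C_nonneg)
 also have "... = (sqrt (sqrt C)*c * sqrt d)^2" using C_nonneg by (simp add: power_mult_distrib)
 finally have 1: "(\<integral>r. \<bar>Y r\<bar> \<partial>N) <= sqrt (sqrt C)*c * sqrt d"
  by (rule power2_le_imp_le) (use c C_nonneg in simp)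
 have "(\<integral>r. \<bar>bil d (X r) M (X r)/d - trc d (S*M)/d\<bar> \<partial>N) <= (\<integral>r. \<bar>Y r\<bar>/d + \<epsilon>*c \<partial>N)"
 proof (rule integral_mono[OF int])
  fix r
  have "\<bar>bil d (X r) M (X r) - trc d (S*M)\<bar> <= \<bar>Y r\<bar> + \<epsilon>*d*c"
   using mean_close[OF M] unfolding Y_def e_def by linarith
  then have "\<bar>bil d (X r) M (X r) - trc d (S*M)\<bar>/d <= (\<bar>Y r\<bar> + \<epsilon>*d*c)/d" by (rule divide_right_mono) simp
  then show "\<bar>bil d (X r) M (X r)/d - trc d (S*M)/d\<bar> <= \<bar>Y r\<bar>/d + \<epsilon>*c"
   using d0 by (simp add: diff_divide_distrib[symmetric] add_divide_distrib)
 qed (use iY in auto)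
 also have "... = (\<integral>r. \<bar>Y r\<bar> \<partial>N)/d + \<epsilon>*c" using iY by (simp add: prob_space)
 also have "... <= sqrt (sqrt C)*c * sqrt d/d + \<epsilon>*c" by (intro add_right_mono divide_right_mono 1) simp
 also have "sqrt (sqrt C)*c * sqrt d/d = sqrt (sqrt C)/sqrt d*c"
  using d0 by (simp add: field_simps)
 finally show "(\<integral>r. \<bar>bil d (X r) M (X r)/d - trc d (S*M)/d\<bar> \<partial>N) <= \<eta>*c"
  by (simp add: \<eta>_def algebra_simps)
qed

definition fun_of :: "fmat => fmat => real" where "fun_of D A = trc d (D*minv d A)/d"

definition lo :: "fmat => bool" where
 "lo A \<longleftrightarrow> symm d A \<and> (\<forall>x. t*ip d x x <= bil d x A x)"

text \<open>\<open>A\<close> and \<open>step A x\<close> are perturbations of the same matrix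
  \<open>B\<close>, by \<open>\<kappa>/d S\<close> and by a rank-one term. To first order the traces
  fall by \<open>\<kappa> \<alpha>/d\<close> and by \<open>\<beta>/(d (1 + q))\<close>, where
  \<open>\<beta>\<close> is close to \<open>\<alpha>\<close> and \<open>q\<close> to
  \<open>fun_of S B\<close>. The mismatch is therefore governed by the distance of
  \<open>fun_of S A\<close> from \<open>\<phi>\<close>.\<close>

lemma one_step:
 assumes A: "lo (A - (\<kappa>/d) *\<^sub>R S)" and D: "upb d D l" "l <= 1 + L"
 shows "(\<integral>\<^sup>+r. ennreal \<bar>fun_of D (step A (X r)) - fun_of D A\<bar> \<partial>N) <= ennreal (K/d*(\<bar>fun_of S A - \<phi>\<bar> + \<eta> + 1/d))"
proof -
 define B where "B = A - (\<kappa>/d) *\<^sub>R S"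
 define c where "c = \<kappa>/d"
 have d0: "0 < real d" using d_pos by simp
 have c: "0 <= c" "c <= 1/d" using \<kappa>_bounds d0 by (auto simp: c_def divide_right_mono)
 have AB: "A = B + c *\<^sub>R S" by (simp add: B_def c_def)
 have B: "symm d B" "\<And>x. t*ip d x x <= bil d x B x" using A by (auto simp: lo_def B_def)
 have pS: "psd d S" and pD: "psd d D" using S_upb D by (auto simp: upb_def)
 note Bb = lower_bound_minv[OF B(1) t_pos B(2)]
 have pA: "pdef d A" unfolding AB by (rule pdef_shift[OF Bb(1) pS c(1)])
 have A2: "t*ip d x x <= bil d x A x" for x
  using B(2)[of x] mult_nonneg_nonneg[OF c(1) psdD[OF pS, of x]] by (simp add: AB bil_add bil_scaleR)
 note Ab = lower_bound_minv[OF pdef_symm[OF pA] t_pos A2]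
 define R where "R = minv d B"
 define R1 where "R1 = minv d A"
 have uR: "upb d R (1/t)" "upb d R1 (1/t)" using Bb Ab by (auto simp: R_def R1_def)
 have dims: "indim d R" "indim d R1" "indim d S" "indim d D" "symm d R"
  using upb_psd[OF uR(1)] upb_psd[OF uR(2)] pS pD by auto
 define T where "T = 1 + 1/t" define l1 where "l1 = 1 + L"
 have T: "1 <= T" "1/t <= T" and l1: "1 <= l1" "L <= l1" "l <= l1"
  using t_pos L_nonneg D by (auto simp: T_def l1_def)
 have uRT: "upb d R T" "upb d R1 T" and uS: "upb d S l1" and uD: "upb d D l1"
  using upb_mono[OF uR(1) T(2)] upb_mono[OF uR(2) T(2)] upb_mono[OF S_upb l1(2)] upb_mono[OF D(1) l1(3)] by auto
 define M where "M = R*D * R"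
 have uM: "upb d M (T^2*l1)" unfolding M_def by (rule upb_conj[OF uRT(1) uD])
 define MS where "MS = R*S * R"
 have uMS: "upb d MS (T^2*l1)" unfolding MS_def by (rule upb_conj[OF uRT(1) uS])
 have nT: "0 <= T^2*l1" using l1 by simp
 let ?T = "T^2*l1^2"
 define \<alpha> where "\<alpha> = trc d (S*M)/d"
 have \<alpha>: "0 <= \<alpha>" "\<alpha> <= ?T"
 proof -
  show "0 <= \<alpha>" unfolding \<alpha>_def by (intro divide_nonneg_nonneg trc_psd_mult pS upb_psd[OF uM]) simp
  have "trc d (S*M) <= l1*trc d M" by (rule upb_trc_mult[OF uS upb_psd[OF uM]])
  also have "... <= l1*(T^2*l1*d)" using l1 by (intro mult_left_mono upb_trc[OF uM]) auto
  finally have "trc d (S*M)/d <= l1*(T^2*l1*d)/d" by (rule divide_right_mono) simp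
  then show "\<alpha> <= ?T" using d0 by (simp add: \<alpha>_def power2_eq_square mult_ac)
 qed
 define \<gamma> where "\<gamma> E = trc d (E * R*(S * R1*S) * R)/d" for E
 have \<gamma>: "0 <= \<gamma> E" "\<gamma> E <= T^3*l1^3" if "upb d E l1" for E
 proof -
  have u: "upb d (R*(S * R1*S) * R) (T^2*(l1^2*T))" by (intro upb_conj uRT uS)
  have "0 <= trc d (E*(R*(S * R1*S) * R))" by (intro trc_psd_mult upb_psd[OF that] upb_psd[OF u])
  then show "0 <= \<gamma> E" by (simp add: \<gamma>_def mult.assoc)
  have "trc d (E*(R*(S * R1*S) * R)) <= l1*trc d (R*(S * R1*S) * R)"
   by (rule upb_trc_mult[OF that upb_psd[OF u]])
  also have "... <= l1*(T^2*(l1^2*T)*d)" using l1 by (intro mult_left_mono upb_trc[OF u]) auto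
  finally have "trc d (E*(R*(S * R1*S) * R))/d <= l1*(T^2*(l1^2*T)*d)/d" by (rule divide_right_mono) simp
  then show "\<gamma> E <= T^3*l1^3" using d0 by (simp add: \<gamma>_def mult.assoc) (simp add: eval_nat_numeral mult_ac)
 qed
 \<comment> \<open>Second-order expansion in \<open>c\<close>, which is at most \<open>1/d\<close>;
   the remainder, of order \<open>1/d^2\<close>, stays harmless after \<open>d\<close>
   exchanges.\<close>
 have swp: "fun_of E A = fun_of E B - c*(trc d (S*(R*E * R))/d) + c^2*\<gamma> E" if "indim d E" for E
 proof -
  note inv = pdef_minv[OF Bb(1), folded R_def] pdef_minv[OF pA, folded R1_def]
  have "R - R1 = R*A * R1 - R*B * R1" using inv dims by (simp add: mult.assoc)
  then have 1: "R1 = R - c *\<^sub>R (R*S * R1)" by (simp add: AB algebra_simps)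
  have "R - R1 = R1*A * R - R1*B * R" using inv dims by (simp add: mult.assoc)
  then have 2: "R1 = R - c *\<^sub>R (R1*S * R)" by (simp add: AB algebra_simps)
  have "R*S * R1 = R*S*(R - c *\<^sub>R (R1*S * R))" using 2 by simp
  also have "... = R*S * R - c *\<^sub>R (R*S * R1*S * R)" by (simp add: right_diff_distrib mult.assoc)
  finally have f: "R*S * R1 = R*S * R - c *\<^sub>R (R*S * R1*S * R)" .
  have "R - c *\<^sub>R (R*S * R1) = R - c *\<^sub>R (R*S * R) + c^2 *\<^sub>R (R*S * R1*S * R)"
   by (subst f) (simp add: scaleR_diff_right power2_eq_square)
  then have R1': "R1 = R - c *\<^sub>R (R*S * R) + c^2 *\<^sub>R (R*S * R1*S * R)" using 1 by metis
  have "trc d (E * R1) = trc d (E * R) - c*trc d (E*(R*S * R)) + c^2*trc d (E*(R*S * R1*S * R))"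
   by (subst R1') (simp add: distrib_left right_diff_distrib trc_add trc_diff trc_scaleR)
  moreover have "trc d (E*(R*S * R)) = trc d (S*(R*E * R))"
  proof -
   have "trc d ((E * R)*(S * R)) = trc d ((S * R)*(E * R))" by (rule trc_comm) (use dims that in auto)
   then show ?thesis by (simp add: mult.assoc)
  qed
  ultimately show ?thesis
   by (simp add: fun_of_def R_def[symmetric] R1_def[symmetric] \<gamma>_def add_divide_distrib diff_divide_distrib mult.assoc)
 qed
 define q where "q r = bil d (X r) R (X r)/d" for r
 define \<beta> where "\<beta> r = bil d (X r) M (X r)/d" for r
 define p where "p = trc d (S * R)/d"
 have q0: "0 <= q r" for r unfolding q_def by (intro divide_nonneg_nonneg psdD upb_psd[OF uR(1)]) simp
 have \<beta>0: "0 <= \<beta> r" for r unfolding \<beta>_def by (intro divide_nonneg_nonneg psdD upb_psd[OF uM]) simp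
 have new: "fun_of D (step A (X r)) = fun_of D B - (1/d)*(\<beta> r/(1 + q r))" for r
 proof -
  let ?X = "outer d (X r) (X r)"
  define k where "k = (- 1/d)/(1 + q r)"
  have st: "step A (X r) = B - (- 1/d) *\<^sub>R ?X" by (simp add: step_def B_def)
  have e: "- 1/d*bil d (X r) R (X r) = - q r" by (simp add: q_def)
  have "B * R = idm d" using pdef_minv[OF Bb(1)] by (simp add: R_def)
  from sherman_morrison[OF B(1) dims(5) this, of "- 1/d" "X r"] q0[of r]
  have inv: "step A (X r)*(R + k *\<^sub>R (R*?X * R)) = idm d"
   unfolding e st k_def by simp
  have s: "pdef d (step A (X r))"
  proof -
   have "step A (X r) = B + (1/d) *\<^sub>R ?X" by (simp add: st)
   then show ?thesis using pdef_add_psd[OF Bb(1) psd_scaleR[OF psd_outer]] by simp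
  qed
  have "minv d (step A (X r)) = R + k *\<^sub>R (R*?X * R)"
   by (rule inverse_unique[of d "step A (X r)", symmetric]) (use s pdef_minv[OF s] inv dims in auto)
  then have "trc d (D*minv d (step A (X r))) = trc d (D * R) + k*trc d (D*(R*?X * R))"
   by (simp add: distrib_left trc_add trc_scaleR)
  also have "trc d (D*(R*?X * R)) = bil d (X r) M (X r)"
   unfolding M_def by (rule rank_one_traces(1)) (use dims in auto)
  also have "... = d*\<beta> r" using d0 by (simp add: \<beta>_def)
  finally show ?thesis using d0 q0[of r] by (simp add: fun_of_def R_def[symmetric] k_def field_simps)
 qed
 \<comment> \<open>Transfers the deviation from \<open>A\<close> to \<open>B\<close>: the removed
   multiple of \<open>S\<close> changes the potential by order \<open>1/d\<close> only.\<close>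
 have p\<phi>: "\<bar>p - \<phi>\<bar> <= \<bar>fun_of S A - \<phi>\<bar> + ?T/d"
 proof -
  have sA: "fun_of S A = p - c*(trc d (S*MS)/d) + c^2*\<gamma> S"
   using swp[of S] dims by (simp add: p_def fun_of_def[of S B] R_def[symmetric] MS_def)
  have "trc d (S*MS) <= l1*trc d MS" by (rule upb_trc_mult[OF uS upb_psd[OF uMS]])
  also have "... <= l1*(T^2*l1*d)" using l1 by (intro mult_left_mono upb_trc[OF uMS]) auto
  finally have "trc d (S*MS)/d <= l1*(T^2*l1*d)/d" by (rule divide_right_mono) simp
  then have "trc d (S*MS)/d <= ?T" using d0 by (simp add: power2_eq_square mult_ac)
  moreover have "0 <= trc d (S*MS)/d" by (intro divide_nonneg_nonneg trc_psd_mult pS upb_psd[OF uMS]) simp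
  ultimately have "c*(trc d (S*MS)/d) <= 1/d*?T" using c by (intro mult_mono) auto
  then have "p <= fun_of S A + ?T/d" using sA mult_nonneg_nonneg[OF zero_le_power2[of c] \<gamma>(1)[OF uS]] by simp
  moreover have "fun_of S A <= p"
  proof -
   have "trc d (S*minv d (B + c *\<^sub>R S)) + c*trc d (S*minv d (B + c *\<^sub>R S)*(S*minv d (B + c *\<^sub>R S))) <= trc d (S*minv d B)"
    by (rule trc_shift(1)[OF Bb(1) pS c(1)])
   moreover have "0 <= trc d (S*minv d (B + c *\<^sub>R S)*S*minv d (B + c *\<^sub>R S))"
    by (intro trc_psd_mult psd_conj psd_symm pS minv_psd pdef_shift[OF Bb(1)] c)
   ultimately have "trc d (S*minv d A) <= trc d (S * R)"
    using c(1) by (simp add: AB R_def mult.assoc) (smt (verit) mult_nonneg_nonneg)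
   then show ?thesis by (simp add: fun_of_def p_def R1_def[symmetric] divide_right_mono)
  qed
  ultimately show ?thesis by linarith
 qed
 have \<kappa>q: "\<bar>\<kappa> - 1/(1 + q r)\<bar> <= \<bar>q r - \<phi>\<bar>" for r
 proof -
  have "\<kappa> - 1/(1 + q r) = (q r - \<phi>)/((1 + \<phi>)*(1 + q r))"
   using q0[of r] \<phi>_nonneg by (simp add: \<kappa>_def field_simps)
  also have "\<bar>...\<bar> = \<bar>q r - \<phi>\<bar>/((1 + \<phi>)*(1 + q r))" using q0[of r] \<phi>_nonneg by (simp add: abs_mult)
  also have "... <= \<bar>q r - \<phi>\<bar>/1"
   using q0[of r] \<phi>_nonneg mult_mono[of 1 "1 + \<phi>" 1 "1 + q r"] by (intro divide_left_mono) auto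
  finally show ?thesis by simp
 qed
 let ?e = "\<bar>fun_of S A - \<phi>\<bar>"
 have pw: "\<bar>fun_of D (step A (X r)) - fun_of D A\<bar> <=
  (1/d)*(?T*(\<bar>q r - p\<bar> + ?e + ?T/d) + \<bar>\<beta> r - \<alpha>\<bar> + T^3*l1^3/d)" for r
 proof -
  have "fun_of D (step A (X r)) - fun_of D A = (1/d)*(\<kappa>*\<alpha> - \<beta> r/(1 + q r)) - c^2*\<gamma> D"
   unfolding new swp[OF dims(4)] by (simp add: c_def \<alpha>_def M_def algebra_simps)
  also have "\<kappa>*\<alpha> - \<beta> r/(1 + q r) = (\<kappa> - 1/(1 + q r))*\<alpha> + (\<alpha> - \<beta> r)/(1 + q r)"
   by (simp add: algebra_simps diff_divide_distrib)
  finally have eq: "fun_of D (step A (X r)) - fun_of D A = (1/d)*((\<kappa> - 1/(1 + q r))*\<alpha> + (\<alpha> - \<beta> r)/(1 + q r)) - c^2*\<gamma> D" .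
  have "\<bar>(\<kappa> - 1/(1 + q r))*\<alpha>\<bar> <= \<bar>q r - \<phi>\<bar>*?T"
   unfolding abs_mult using \<kappa>q \<alpha> by (intro mult_mono) auto
  also have "... <= (\<bar>q r - p\<bar> + ?e + ?T/d)*?T" using p\<phi> by (intro mult_right_mono) auto
  finally have 1: "\<bar>(\<kappa> - 1/(1 + q r))*\<alpha>\<bar> <= ?T*(\<bar>q r - p\<bar> + ?e + ?T/d)" by (simp add: mult.commute)
  have 2: "\<bar>(\<alpha> - \<beta> r)/(1 + q r)\<bar> <= \<bar>\<beta> r - \<alpha>\<bar>"
  proof -
   have "\<bar>\<alpha> - \<beta> r\<bar>/(1 + q r) <= \<bar>\<alpha> - \<beta> r\<bar>/1" using q0[of r] by (intro divide_left_mono) auto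
   then show ?thesis using q0[of r] by (simp add: abs_minus_commute)
  qed
  have 3: "\<bar>c^2*\<gamma> D\<bar> <= 1/d*(T^3*l1^3/d)"
  proof -
   have "c^2*\<gamma> D <= (1/d)^2*(T^3*l1^3)" using c \<gamma>[OF uD] by (intro mult_mono power_mono) auto
   then show ?thesis using \<gamma>[OF uD] by (simp add: power2_eq_square)
  qed
  have "\<bar>(\<kappa> - 1/(1 + q r))*\<alpha> + (\<alpha> - \<beta> r)/(1 + q r)\<bar> <= ?T*(\<bar>q r - p\<bar> + ?e + ?T/d) + \<bar>\<beta> r - \<alpha>\<bar>"
   using 1 2 by linarith
  then have "\<bar>(1/d)*((\<kappa> - 1/(1 + q r))*\<alpha> + (\<alpha> - \<beta> r)/(1 + q r))\<bar> <= (1/d)*(?T*(\<bar>q r - p\<bar> + ?e + ?T/d) + \<bar>\<beta> r - \<alpha>\<bar>)"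
   unfolding abs_mult by (intro mult_mono) auto
  then show ?thesis using 3 unfolding eq distrib_left[of "1/d" _ "T^3*l1^3/d"] by linarith
 qed
 note qd = quad_dev[OF uRT(1), folded p_def, folded q_def]
 note bd = quad_dev[OF uM, folded \<alpha>_def, folded \<beta>_def]
 let ?W = "%r. (1/d)*(?T*(\<bar>q r - p\<bar> + ?e + ?T/d) + \<bar>\<beta> r - \<alpha>\<bar> + T^3*l1^3/d)"
 have "(\<integral>\<^sup>+r. ennreal \<bar>fun_of D (step A (X r)) - fun_of D A\<bar> \<partial>N) <= (\<integral>\<^sup>+r. ennreal (?W r) \<partial>N)"
  by (intro nn_integral_mono ennreal_leI pw)
 also have "... = ennreal (\<integral>r. ?W r \<partial>N)"
  by (rule nn_integral_eq_integral) (use qd bd pw in \<open>auto intro: order_trans[OF abs_ge_zero]\<close>)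
 also have "... <= ennreal (K/d*(?e + \<eta> + 1/d))"
 proof (rule ennreal_leI)
  have "(\<integral>r. ?W r \<partial>N) = (1/d)*(?T*((\<integral>r. \<bar>q r - p\<bar> \<partial>N) + ?e + ?T/d) + (\<integral>r. \<bar>\<beta> r - \<alpha>\<bar> \<partial>N) + T^3*l1^3/d)"
   using qd(1) bd(1) by (simp add: prob_space)
  also have "... <= (1/d)*(?T*(\<eta>*T + ?e + ?T/d) + \<eta>*(T^2*l1) + T^3*l1^3/d)"
   using qd(2) bd(2) by (intro mult_left_mono add_mono) auto
  also have "... <= (1/d)*(K*(?e + \<eta> + 1/d))"
  proof (intro mult_left_mono)
   define k where "k = T^4*l1^4"
   have le: "T^i*l1^j <= k" if "i <= 4" "j <= 4" for i j
    unfolding k_def using T l1 that by (intro mult_mono power_increasing) auto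
   have 1: "T^3*l1^2*\<eta> <= k*\<eta>" "T^2*l1^1*\<eta> <= k*\<eta>" "?T*?e <= k*?e"
    "T^3*l1^3*(1/d) <= k*(1/d)"
    using \<eta>_nonneg by (intro mult_right_mono le; simp)+
   have 2: "?T*(T^2*l1^2/d) = k*(1/d)" by (simp add: k_def eval_nat_numeral)
   have 3: "?T*(\<eta>*T) = T^3*l1^2*\<eta>" by (simp add: eval_nat_numeral)
   have "0 <= k*?e" using T l1 by (simp add: k_def)
   have "K = 2*k" by (simp add: K_def k_def T_def l1_def)
   then have K: "K*z = k*z + k*z" for z by simp
   have 4: "\<eta>*(T^2*l1) = T^2*l1^1*\<eta>" "T^3*l1^3/d = T^3*l1^3*(1/d)" by simp_all
   show "?T*(\<eta>*T + ?e + ?T/d) + \<eta>*(T^2*l1) + T^3*l1^3/d <= K*(?e + \<eta> + 1/d)"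
    unfolding distrib_left 2 3 4 K using 1 \<open>0 <= k*?e\<close> by linarith
  qed simp
  finally show "(\<integral>r. ?W r \<partial>N) <= K/d*(?e + \<eta> + 1/d)" by simp
 qed
 finally show ?thesis .
qed

primrec st :: "fmat => nat => (nat => 'r) => fmat" where
 "st A 0 x = A"
| "st A (Suc n) x = step (st A n x) (X (x n))"

lemma st_closed: "st A n x = A - (n*\<kappa>/d) *\<^sub>R S + (1/d) *\<^sub>R (\<Sum>i<n. outer d (X (x i)) (X (x i)))"
 by (induction n) (simp_all add: step_def scaleR_add_right algebra_simps add_divide_distrib scaleR_add_left)

lemma st_cong: "(\<And>i. i < n ==> x i = y i) ==> st A n x = st A n y"
 by (induction n) auto

lemma mea_st: "indim d A ==> k <= n ==> mea (PiM {..<n} (%_. N)) (st A k)"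
 unfolding st_closed by (intro mea_add mea_diff mea_scaleR mea_const mea_sum mea_outer component_measurable) auto

lemma measurable_fun_of: "indim d D ==> mea M F ==> (%w. fun_of D (F w)) \<in> borel_measurable M"
 unfolding fun_of_def
 by (intro borel_measurable_divide borel_measurable_const measurable_trc mea_times[of _ _ _ d] mea_const mea_minv) auto

definition A0 :: fmat where "A0 = t *\<^sub>R idm d + \<kappa> *\<^sub>R S"

text \<open>After \<open>n < d\<close> exchanges, and with one more multiple of \<open>S\<close>
  taken away, the coefficient of \<open>S\<close> is \<open>\<kappa> (d - n - 1)/d\<close>, still
  nonnegative. So \<open>t\<close> remains a lower bound along the whole path.\<close>

lemma lo_st:
 assumes "n < d" shows "lo (st A0 n x - (\<kappa>/d) *\<^sub>R S)"
 unfolding lo_def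
proof (intro conjI allI)
 have pS: "psd d S" using S_upb by (simp add: upb_def)
 have d0: "0 < real d" using d_pos by simp
 have e: "st A0 n x - (\<kappa>/d) *\<^sub>R S = t *\<^sub>R idm d + ((\<kappa>*(real d - real n - 1))/d) *\<^sub>R S + (1/d) *\<^sub>R (\<Sum>i<n. outer d (X (x i)) (X (x i)))"
 proof -
  have "(\<kappa>*(real d - real n - 1))/d = \<kappa> - n*\<kappa>/d - \<kappa>/d" using d0 by (simp add: field_simps)
  then show ?thesis by (simp add: st_closed A0_def scaleR_diff_left)
 qed
 have c: "0 <= (\<kappa>*(real d - real n - 1))/d" using assms \<kappa>_bounds by simp
 show "symm d (st A0 n x - (\<kappa>/d) *\<^sub>R S)"
  unfolding e by (intro symm_add symm_scaleR symm_idm symm_sum symm_outer psd_symm[OF pS])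
 fix y
 have "0 <= bil d y (((\<kappa>*(real d - real n - 1))/d) *\<^sub>R S + (1/d) *\<^sub>R (\<Sum>i<n. outer d (X (x i)) (X (x i)))) y"
  by (rule psdD, intro psd_add psd_scaleR psd_sum psd_outer pS c) simp
 then show "t*ip d y y <= bil d y (st A0 n x - (\<kappa>/d) *\<^sub>R S) y"
  unfolding e by (simp add: bil_add bil_scaleR bil_idm)
qed

text \<open>Weights for a discrete Gronwall argument run backwards. One exchange costs
  \<open>K/d\<close> times the deviation of \<open>fun_of S\<close>, once for that deviation itself
  and once for the trace of the resolvent, hence the factor \<open>1 + 2*K/d\<close>. With these
  weights \<open>err\<close> has nonincreasing expectation.\<close>

definition w :: "nat => real" where "w n = (1 + 2*K/d)^(d - n)"

definition err :: "nat => (nat => 'r) => real" where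
 "err n x = \<bar>fun_of (idm d) (st A0 n x) - fun_of (idm d) A0\<bar> + w n*(\<bar>fun_of S (st A0 n x) - \<phi>\<bar> + \<eta> + 1/d)"

lemma K_nonneg: "0 <= K" using L_nonneg t_pos by (simp add: K_def)

lemma w_ge1: "1 <= w n" unfolding w_def using K_nonneg by (intro one_le_power) simp

lemma indim_A0: "indim d A0" using S_upb by (auto simp: A0_def upb_def)

lemma measurable_err: "n <= m ==> err n \<in> borel_measurable (PiM {..<m} (%_. N))"
 unfolding err_def[abs_def]
 by (intro borel_measurable_add borel_measurable_abs borel_measurable_diff borel_measurable_times borel_measurable_const
   measurable_fun_of mea_st indim_A0) (use S_upb in \<open>auto simp: upb_def\<close>)

lemma err_expectation:
 "n <= d ==> (\<integral>\<^sup>+x. ennreal (err n x) \<partial>PiM {..<n} (%_. N)) <= ennreal (w 0*(\<bar>fun_of S A0 - \<phi>\<bar> + \<eta> + 1/d))"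
proof (induction n)
 case 0
 show ?case by (simp add: err_def PiM_empty nn_integral_count_space_finite)
next
 case (Suc n)
 interpret product_sigma_finite "%_::nat. N" ..
 have d0: "0 < real d" using d_pos by simp
 have pS: "psd d S" using S_upb by (simp add: upb_def)
 have ins: "{..<Suc n} = insert n {..<n}" by auto
 have upd: "st A0 n (x(n := r)) = st A0 n x" for x r by (auto intro!: st_cong)
 have "(\<integral>\<^sup>+x. ennreal (err (Suc n) x) \<partial>PiM {..<Suc n} (%_. N))
   = (\<integral>\<^sup>+x. (\<integral>\<^sup>+r. ennreal (err (Suc n) (x(n := r))) \<partial>N) \<partial>PiM {..<n} (%_. N))"
  unfolding ins by (rule product_nn_integral_insert)
   (use measurable_err[of "Suc n" "Suc n"] in \<open>auto simp flip: ins\<close>)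
 also have "... <= (\<integral>\<^sup>+x. ennreal (err n x) \<partial>PiM {..<n} (%_. N))"
 proof (intro nn_integral_mono)
  fix x
  let ?A = "st A0 n x" let ?e = "\<bar>fun_of S ?A - \<phi>\<bar>" let ?I = "idm d"
  let ?D = "%E r. \<bar>fun_of E (step ?A (X r)) - fun_of E ?A\<bar>"
  have pw: "err (Suc n) (x(n := r)) <= (\<bar>fun_of ?I ?A - fun_of ?I A0\<bar> + w (Suc n)*(?e + \<eta> + 1/d)) + (?D ?I r + w (Suc n)*?D S r)" for r
  proof -
   have "\<bar>fun_of ?I (step ?A (X r)) - fun_of ?I A0\<bar> <= \<bar>fun_of ?I ?A - fun_of ?I A0\<bar> + ?D ?I r" by linarith
   moreover have "w (Suc n)*(\<bar>fun_of S (step ?A (X r)) - \<phi>\<bar> + \<eta> + 1/d) <= w (Suc n)*((?e + \<eta> + 1/d) + ?D S r)"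
    using w_ge1[of "Suc n"] by (intro mult_left_mono) auto
   ultimately show ?thesis by (simp add: err_def upd distrib_left)
  qed
  have me: "(%r. ennreal (?D E r)) \<in> borel_measurable N" if "indim d E" for E
  proof -
   have "mea N (%r. step ?A (X r))"
    unfolding step_def by (intro mea_add mea_scaleR mea_const mea_outer X_measurable)
   from measurable_fun_of[OF that this] show ?thesis
    by (intro measurable_compose[OF _ measurable_ennreal] borel_measurable_abs borel_measurable_diff borel_measurable_const)
  qed
  have lo: "lo (?A - (\<kappa>/d) *\<^sub>R S)" by (rule lo_st) (use Suc.prems in simp)
  let ?k = "K/d*(?e + \<eta> + 1/d)"
  have k0: "0 <= ?e + \<eta> + 1/d" using \<eta>_nonneg by simp
  have b: "(\<integral>\<^sup>+r. ennreal (?D ?I r) \<partial>N) <= ennreal ?k" "(\<integral>\<^sup>+r. ennreal (?D S r) \<partial>N) <= ennreal ?k"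
   using one_step[OF lo upb_idm] one_step[OF lo S_upb] L_nonneg by auto
  let ?c = "\<bar>fun_of ?I ?A - fun_of ?I A0\<bar> + w (Suc n)*(?e + \<eta> + 1/d)"
  have w0: "0 <= w (Suc n)" using w_ge1[of "Suc n"] by simp
  have c0: "0 <= ?c" using mult_nonneg_nonneg[OF w0 k0] by simp
  have "(\<integral>\<^sup>+r. ennreal (err (Suc n) (x(n := r))) \<partial>N) <= (\<integral>\<^sup>+r. ennreal ?c + (ennreal (?D ?I r) + ennreal (w (Suc n))*ennreal (?D S r)) \<partial>N)"
  proof (intro nn_integral_mono)
   fix r
   have "ennreal (err (Suc n) (x(n := r))) <= ennreal (?c + (?D ?I r + w (Suc n)*?D S r))" by (rule ennreal_leI[OF pw])
   also have "... = ennreal ?c + (ennreal (?D ?I r) + ennreal (w (Suc n))*ennreal (?D S r))"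
    by (rule ennreal_affine[OF c0 _ _ w0]) auto
   finally show "ennreal (err (Suc n) (x(n := r))) <= ennreal ?c + (ennreal (?D ?I r) + ennreal (w (Suc n))*ennreal (?D S r))" .
  qed
  also have "... = ennreal ?c + ((\<integral>\<^sup>+r. ennreal (?D ?I r) \<partial>N) + ennreal (w (Suc n))*(\<integral>\<^sup>+r. ennreal (?D S r) \<partial>N))"
   by (rule nn_integral_affine[OF me[OF indim_idm] me[OF psd_indim[OF pS]]])
  also have "... <= ennreal ?c + (ennreal ?k + ennreal (w (Suc n))*ennreal ?k)"
   by (intro add_left_mono add_mono mult_left_mono b) simp
  also have "... = ennreal (?c + (?k + w (Suc n)*?k))"
   by (rule ennreal_affine[OF c0 _ _ w0, symmetric]) (use k0 K_nonneg in auto)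
  also have "... <= ennreal (err n x)"
  proof (rule ennreal_leI)
   let ?h = "?e + \<eta> + 1/d"
   have "d - n = Suc (d - Suc n)" using Suc.prems by simp
   then have wn: "w n = (1 + 2*K/d)*w (Suc n)" by (simp add: w_def)
   have "?k*1 <= ?k*w (Suc n)" using k0 K_nonneg w_ge1 by (intro mult_left_mono) auto
   then have "?k <= w (Suc n)*?k" by (simp add: mult.commute)
   then have "w (Suc n)*?h + (?k + w (Suc n)*?k) <= w (Suc n)*?h + 2*(w (Suc n)*?k)"
   proof -
    have "x + (k + v * k) <= x + 2*(v * k)" if "k <= v * k" for x k v :: real using that by linarith
    then show ?thesis using \<open>?k <= w (Suc n)*?k\<close> .
   qed
   also have "... = w n*?h" unfolding wn by (simp add: algebra_simps)
   finally show "?c + (?k + w (Suc n)*?k) <= err n x" by (simp add: err_def)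
  qed
  finally show "(\<integral>\<^sup>+r. ennreal (err (Suc n) (x(n := r))) \<partial>N) <= ennreal (err n x)" .
 qed
 also have "... <= ennreal (w 0*(\<bar>fun_of S A0 - \<phi>\<bar> + \<eta> + 1/d))" using Suc by simp
 finally show ?case .
qed

lemma w0_le: "w 0 <= exp (2*K)"
proof -
 have "w 0 <= exp (2*K/d)^d"
  unfolding w_def using K_nonneg by (auto intro!: power_mono simp: exp_ge_add_one_self)
 also have "... = exp (2*K)" using d_pos by (simp add: exp_of_nat_mult[symmetric])
 finally show ?thesis .
qed

definition resolvent_trace :: "(nat => 'r) => real" where
 "resolvent_trace x = trc d (minv d (t *\<^sub>R idm d + (1/d) *\<^sub>R (\<Sum>i<d. outer d (X (x i)) (X (x i)))))/d"

lemma st_d: "st A0 d x = t *\<^sub>R idm d + (1/d) *\<^sub>R (\<Sum>i<d. outer d (X (x i)) (X (x i)))"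
 using d_pos by (simp add: st_closed A0_def)

theorem swap_bound:
 assumes "0 < \<delta>"
 defines "B \<equiv> {x \<in> space (PiM {..<d} (%_. N)). \<delta> <= \<bar>resolvent_trace x - trc d (minv d A0)/d\<bar>}"
 shows "B \<in> sets (PiM {..<d} (%_. N))"
  and "measure (PiM {..<d} (%_. N)) B <= exp (2*K)*(\<bar>trc d (S*minv d A0)/d - \<phi>\<bar> + \<eta> + 1/d)/\<delta>"
proof -
 let ?P = "PiM {..<d} (%_. N)"
 interpret P: prob_space ?P by (rule prob_space_PiM) unfold_locales
 have r: "resolvent_trace x = fun_of (idm d) (st A0 d x)" for x
  by (simp add: resolvent_trace_def fun_of_def st_d)
 have r0: "trc d (minv d A0)/d = fun_of (idm d) A0" by (simp add: fun_of_def)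
 have m: "(%x. \<bar>resolvent_trace x - trc d (minv d A0)/d\<bar>) \<in> borel_measurable ?P"
  unfolding r by (intro borel_measurable_abs borel_measurable_diff measurable_fun_of mea_st indim_A0) auto
 show B: "B \<in> sets ?P" unfolding B_def using m by measurable
 let ?h = "\<bar>fun_of S A0 - \<phi>\<bar> + \<eta> + 1/d"
 have h0: "0 <= ?h" using \<eta>_nonneg by simp
 have "ennreal (\<delta>*measure ?P B) = (\<integral>\<^sup>+x. ennreal \<delta>*indicator B x \<partial>?P)"
  using B assms(1) by (simp add: P.emeasure_eq_measure nn_integral_cmult_indicator ennreal_mult)
 also have "... <= (\<integral>\<^sup>+x. ennreal (err d x) \<partial>?P)"
 proof (intro nn_integral_mono)
  fix x
  have "\<bar>resolvent_trace x - trc d (minv d A0)/d\<bar> <= err d x"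
   unfolding r r0 err_def using w_ge1[of d] \<eta>_nonneg by simp
  then show "ennreal \<delta>*indicator B x <= ennreal (err d x)"
   by (auto simp: B_def indicator_def intro!: ennreal_leI)
 qed
 also have "... <= ennreal (w 0*?h)" by (rule err_expectation) simp
 also have "... <= ennreal (exp (2*K)*?h)" by (intro ennreal_leI mult_right_mono w0_le h0)
 finally have "\<delta>*measure ?P B <= exp (2*K)*?h" using h0 by (subst (asm) ennreal_le_iff) auto
 then show "measure ?P B <= exp (2*K)*(\<bar>trc d (S*minv d A0)/d - \<phi>\<bar> + \<eta> + 1/d)/\<delta>"
  using assms(1) by (simp add: fun_of_def field_simps)
qed

end

section \<open>Moments of Gaussian vectors\<close>

lemma gauss1_moment_integrable: "integrable gauss1 (%x. x^n)"
 unfolding gauss1_def by (subst integrable_density) (auto simp: integrable_std_normal_moment)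

lemma gauss1_moments:
 "integral\<^sup>L gauss1 (%x. x) = 0" "integral\<^sup>L gauss1 (%x. x^2) = 1"
 "integral\<^sup>L gauss1 (%x. x^3) = 0" "integral\<^sup>L gauss1 (%x. x^4) = 3"
 using has_integral_gauss1(2)[OF std_normal_moment_odd[of 0]] has_integral_gauss1(2)[OF std_normal_moment_even[of 1]]
  has_integral_gauss1(2)[OF std_normal_moment_odd[of 1]] has_integral_gauss1(2)[OF std_normal_moment_even[of 2]]
 by (simp_all add: fact_numeral)

lemma gauss1_one [simp]: "measure gauss1 UNIV = 1"
 using gauss1.prob_space by simp

lemma integral_sum2:
 fixes f :: "nat => nat => 'a => real"
 assumes "\<And>a b. a < d ==> b < d ==> integrable M (f a b)"
 shows "(\<integral>q. (\<Sum>a<d. \<Sum>b<d. f a b q) \<partial>M) = (\<Sum>a<d. \<Sum>b<d. \<integral>q. f a b q \<partial>M)"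
proof -
 have "(\<integral>q. (\<Sum>a<d. \<Sum>b<d. f a b q) \<partial>M) = (\<Sum>a<d. \<integral>q. (\<Sum>b<d. f a b q) \<partial>M)"
  by (rule integral_sum_set) (auto intro!: integrable_sum_set assms)
 also have "... = (\<Sum>a<d. \<Sum>b<d. \<integral>q. f a b q \<partial>M)"
  by (intro sum.cong refl integral_sum_set) (auto intro!: assms)
 finally show ?thesis .
qed

lemma integral_sum4:
 fixes f :: "nat => nat => nat => nat => 'a => real"
 assumes "\<And>a b c e. a < d ==> b < d ==> c < d ==> e < d ==> integrable M (f a b c e)"
 shows "(\<integral>q. (\<Sum>a<d. \<Sum>b<d. \<Sum>c<d. \<Sum>e<d. f a b c e q) \<partial>M) = (\<Sum>a<d. \<Sum>b<d. \<Sum>c<d. \<Sum>e<d. \<integral>q. f a b c e q \<partial>M)"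
proof -
 have "(\<integral>q. (\<Sum>a<d. \<Sum>b<d. \<Sum>c<d. \<Sum>e<d. f a b c e q) \<partial>M) = (\<Sum>a<d. \<Sum>b<d. \<integral>q. (\<Sum>c<d. \<Sum>e<d. f a b c e q) \<partial>M)"
  by (rule integral_sum2) (auto intro!: integrable_sum_set assms)
 also have "... = (\<Sum>a<d. \<Sum>b<d. \<Sum>c<d. \<Sum>e<d. \<integral>q. f a b c e q \<partial>M)"
  by (intro sum.cong refl integral_sum2) (auto intro!: assms)
 finally show ?thesis .
qed

lemma gauss_monomial:
 "integrable (gauss d) (%q. \<Prod>k<d. q k^e k)"
 "(\<integral>q. (\<Prod>k<d. q k^e k) \<partial>gauss d) = (\<Prod>k<d. integral\<^sup>L gauss1 (%x. x^e k))"
 unfolding gauss_def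
 by (intro gauss1_prod.product_integrable_prod gauss1_prod.product_integral_prod gauss1_moment_integrable; simp)+

lemma prod_single: "a < d ==> (\<Prod>k<d. if k = a then f k else (1::real)) = f (a::nat)"
 by (simp add: prod.delta)

lemma gauss_pair:
 assumes "a < d" "b < d"
 shows "integrable (gauss d) (%q. q a*q b)"
  and "(\<integral>q. q a*q b \<partial>gauss d) = (if a = b then 1 else 0)"
proof -
 define e :: "nat => nat" where "e k = of_bool (k = a) + of_bool (k = b)" for k
 have *: "q a*q b = (\<Prod>k<d. q k^e k)" for q :: "nat => real"
  using assms by (simp add: e_def power_add prod.distrib of_bool_def if_distrib[of "power _"] prod_single cong: if_cong)
 show "integrable (gauss d) (%q. q a*q b)" unfolding*by (rule gauss_monomial)
 show "(\<integral>q. q a*q b \<partial>gauss d) = (if a = b then 1 else 0)"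
 proof (cases "a = b")
  case True
  have "(\<Prod>k<d. integral\<^sup>L gauss1 (%x. x^e k)) = (\<Prod>k<d. if k = a then 1 else 1)"
   by (intro prod.cong refl) (auto simp: e_def True gauss1_moments numeral_2_eq_2[symmetric])
  then show ?thesis unfolding*gauss_monomial using True by simp
 next
  case False
  then have "e a = 1" by (simp add: e_def)
  then have "(\<Prod>k<d. integral\<^sup>L gauss1 (%x. x^e k)) = 0"
   using assms by (intro prod_zero bexI[of _ a]) (auto simp: gauss1_moments)
  then show ?thesis unfolding*gauss_monomial using False by simp
 qed
qed

text \<open>Isserlis' formula for four factors. If all indices agree, the three pairings add up to
  the fourth moment 3.\<close>

lemma gauss_quad:
 assumes "a < d" "b < d" "c < d" "f < d"
 shows "integrable (gauss d) (%q. q a*q b*(q c*q f))"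
  and "(\<integral>q. q a*q b*(q c*q f) \<partial>gauss d)
   = of_bool (a = b \<and> c = f) + of_bool (a = c \<and> b = f) + of_bool (a = f \<and> b = c)"
proof -
 define e :: "nat => nat" where "e k = (of_bool (k = a) + of_bool (k = b)) + (of_bool (k = c) + of_bool (k = f))" for k
 have *: "q a*q b*(q c*q f) = (\<Prod>k<d. q k^e k)" for q :: "nat => real"
  using assms by (simp add: e_def power_add prod.distrib of_bool_def if_distrib[of "power _"] prod_single cong: if_cong)
 show "integrable (gauss d) (%q. q a*q b*(q c*q f))" unfolding*by (rule gauss_monomial)
 have eq: "(\<integral>q. q a*q b*(q c*q f) \<partial>gauss d) = (\<Prod>k<d. integral\<^sup>L gauss1 (%x. x^e k))"
  unfolding*by (rule gauss_monomial)
 have zero: "(\<Prod>k<d. integral\<^sup>L gauss1 (%x. x^e k)) = 0" if "k < d" "e k = 1 \<or> e k = 3" for k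
  using that by (intro prod_zero bexI[of _ k]) (auto simp: gauss1_moments)
 have two: "(\<Prod>k<d. integral\<^sup>L gauss1 (%x. x^e k)) = 1" if "\<And>k. k < d ==> e k = 0 \<or> e k = 2"
 proof (intro prod.neutral ballI)
  fix k assume "k \<in> {..<d}"
  with that[of k] have "e k = 0 \<or> e k = 2" by simp
  then show "integral\<^sup>L gauss1 (%x. x^e k) = 1" by (auto simp: gauss1_moments)
 qed
 show "(\<integral>q. q a*q b*(q c*q f) \<partial>gauss d)
   = of_bool (a = b \<and> c = f) + of_bool (a = c \<and> b = f) + of_bool (a = f \<and> b = c)"
 proof (cases "a = b \<and> b = c \<and> c = f")
  case True
  have "(\<Prod>k<d. integral\<^sup>L gauss1 (%x. x^e k)) = (\<Prod>k<d. if k = a then 3 else 1)"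
  proof (intro prod.cong refl)
   fix k
   have "e k = (if k = a then 4 else 0)" using True by (auto simp: e_def)
   then show "integral\<^sup>L gauss1 (%x. x^e k) = (if k = a then 3 else 1)" by (simp add: gauss1_moments)
  qed
  then show ?thesis unfolding eq using True assms by (simp add: prod_single)
 next
  case False
  consider "a = b" "c = f" "a ~= c" | "a = c" "b = f" "a ~= b" | "a = f" "b = c" "a ~= b"
   | "e a = 1 \<or> e b = 1 \<or> e c = 1 \<or> e f = 1" "\<not> (a = b \<and> c = f)" "\<not> (a = c \<and> b = f)" "\<not> (a = f \<and> b = c)"
  proof -
   have "e a = 1 \<or> e b = 1 \<or> e c = 1 \<or> e f = 1" if "\<not> (a = b \<and> c = f)" "\<not> (a = c \<and> b = f)" "\<not> (a = f \<and> b = c)"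
    using that by (cases "a = b"; cases "a = c"; cases "a = f"; cases "b = c"; cases "b = f"; cases "c = f"; simp add: e_def)
   then show ?thesis using False that by blast
  qed
  then show ?thesis
  proof cases
   case 1 then show ?thesis unfolding eq by (subst two) (auto simp: e_def)
  next
   case 2 then show ?thesis unfolding eq by (subst two) (auto simp: e_def)
  next
   case 3 then show ?thesis unfolding eq by (subst two) (auto simp: e_def)
  next
   case 4
   have "(\<Prod>k<d. integral\<^sup>L gauss1 (%x. x^e k)) = 0"
    using 4(1) zero[of a] zero[of b] zero[of c] zero[of f] assms by blast
   moreover have "of_bool (a = b \<and> c = f) = (0::real)" "of_bool (a = c \<and> b = f) = (0::real)" "of_bool (a = f \<and> b = c) = (0::real)"
    using 4(2-4) by simp_all
   ultimately show ?thesis unfolding eq by (simp only: add_0_right)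
  qed
 qed
qed

lemma bil_expand: "bil d q M q = (\<Sum>a<d. \<Sum>b<d. ent M a b*(q a*q b))"
 by (simp add: bil_def mult_ac)

lemma gauss_bil:
 "integrable (gauss d) (%q. bil d q M q)" "(\<integral>q. bil d q M q \<partial>gauss d) = trc d M"
proof -
 show "integrable (gauss d) (%q. bil d q M q)"
  unfolding bil_expand by (intro integrable_sum_set integrable_mult_right gauss_pair) auto
 have "(\<integral>q. bil d q M q \<partial>gauss d) = (\<Sum>a<d. \<Sum>b<d. ent M a b*(\<integral>q. q a*q b \<partial>gauss d))"
  unfolding bil_expand by (subst integral_sum2) (auto intro!: integrable_mult_right gauss_pair)
 also have "... = (\<Sum>a<d. \<Sum>b<d. ent M a b*unitv a b)"
  by (intro sum.cong refl) (simp add: gauss_pair unitv_def)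
 also have "... = trc d M" by (simp add: sum_unitv trc_def)
 finally show "(\<integral>q. bil d q M q \<partial>gauss d) = trc d M" .
qed

text \<open>Of the three pairings one gives the product of the means, and each of the other two, by
  symmetry, the trace of \<open>S*T\<close>.\<close>

lemma gauss_bil_covariance:
 assumes "symm d S" "symm d T"
 shows "integrable (gauss d) (%q. (bil d q S q - trc d S)*(bil d q T q - trc d T))"
  and "(\<integral>q. (bil d q S q - trc d S)*(bil d q T q - trc d T) \<partial>gauss d) = 2*trc d (S*T)"
proof -
 have ex: "bil d q S q*bil d q T q = (\<Sum>a<d. \<Sum>b<d. \<Sum>c<d. \<Sum>f<d. ent S a b*ent T c f*(q a*q b*(q c*q f)))" for q
  unfolding bil_expand by (simp only: sum_distrib_right) (simp add: sum_distrib_left mult_ac)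
 have int: "integrable (gauss d) (%q. bil d q S q*bil d q T q)"
  unfolding ex by (intro integrable_sum_set integrable_mult_right gauss_quad) auto
 have eq: "(bil d q S q - trc d S)*(bil d q T q - trc d T)
  = bil d q S q*bil d q T q - trc d T*bil d q S q - trc d S*bil d q T q + trc d S*trc d T" for q
  by (simp add: algebra_simps)
 show "integrable (gauss d) (%q. (bil d q S q - trc d S)*(bil d q T q - trc d T))"
  unfolding eq using int gauss_bil(1) by simp
 have sT: "ent T a b = ent T b a" for a b using assms(2) by (auto simp: symm_def)
 have dims: "indim d S" "indim d T" using assms by auto
 have "(\<integral>q. bil d q S q*bil d q T q \<partial>gauss d) = (\<Sum>a<d. \<Sum>b<d. \<Sum>c<d. \<Sum>f<d. ent S a b*ent T c f*(\<integral>q. q a*q b*(q c*q f) \<partial>gauss d))"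
  unfolding ex by (subst integral_sum4) (auto intro!: integrable_mult_right gauss_quad)
 also have "... = (\<Sum>a<d. \<Sum>b<d. \<Sum>c<d. \<Sum>f<d. ent S a b*ent T c f*(unitv a b*unitv c f)
   + ent S a b*ent T c f*(unitv a c*unitv b f) + ent S a b*ent T c f*(unitv b c*unitv a f))"
 proof (intro sum.cong refl)
  fix a b c f assume "a \<in> {..<d}" "b \<in> {..<d}" "c \<in> {..<d}" "f \<in> {..<d}"
  then have "(\<integral>q. q a*q b*(q c*q f) \<partial>gauss d) = unitv a b*unitv c f + unitv a c*unitv b f + unitv b c*unitv a f"
   by (subst gauss_quad) (auto simp: unitv_def)
  then show "ent S a b*ent T c f*(\<integral>q. q a*q b*(q c*q f) \<partial>gauss d) = ent S a b*ent T c f*(unitv a b*unitv c f)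
   + ent S a b*ent T c f*(unitv a c*unitv b f) + ent S a b*ent T c f*(unitv b c*unitv a f)"
   by (simp only: distrib_left)
 qed
 also have "... = (\<Sum>a<d. \<Sum>b<d. \<Sum>c<d. \<Sum>f<d. (ent S a b*ent T c f*unitv a b)*unitv c f)
   + (\<Sum>a<d. \<Sum>b<d. \<Sum>c<d. \<Sum>f<d. (ent S a b*ent T c f*unitv a c)*unitv b f)
   + (\<Sum>a<d. \<Sum>b<d. \<Sum>c<d. \<Sum>f<d. (ent S a b*ent T c f*unitv b c)*unitv a f)"
  by (simp only: sum.distrib mult.assoc)
 also have "(\<Sum>a<d. \<Sum>b<d. \<Sum>c<d. \<Sum>f<d. (ent S a b*ent T c f*unitv a b)*unitv c f) = trc d S*trc d T"
 proof -
  have "(\<Sum>a<d. \<Sum>b<d. \<Sum>c<d. \<Sum>f<d. (ent S a b*ent T c f*unitv a b)*unitv c f) = (\<Sum>a<d. \<Sum>b<d. (ent S a b*trc d T)*unitv a b)"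
  proof -
   have "(\<Sum>a<d. \<Sum>b<d. \<Sum>c<d. \<Sum>f<d. (ent S a b*ent T c f*unitv a b)*unitv c f) = (\<Sum>a<d. \<Sum>b<d. \<Sum>c<d. (ent S a b*ent T c c)*unitv a b)"
    by (intro sum.cong refl) (simp add: sum_unitv)
   then show ?thesis by (simp only: trc_def sum_distrib_left sum_distrib_right)
  qed
  then show ?thesis by (simp add: sum_unitv trc_def sum_distrib_right)
 qed
 also have "(\<Sum>a<d. \<Sum>b<d. \<Sum>c<d. \<Sum>f<d. (ent S a b*ent T c f*unitv a c)*unitv b f) = trc d (S*T)"
 proof -
  have "(\<Sum>a<d. \<Sum>b<d. \<Sum>c<d. \<Sum>f<d. (ent S a b*ent T c f*unitv a c)*unitv b f) = (\<Sum>a<d. \<Sum>b<d. \<Sum>c<d. (ent S a b*ent T c b)*unitv a c)"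
   by (intro sum.cong refl) (simp add: sum_unitv)
  then show ?thesis using dims sT by (simp add: sum_unitv trc_def ent_times[of d])
 qed
 also have "(\<Sum>a<d. \<Sum>b<d. \<Sum>c<d. \<Sum>f<d. (ent S a b*ent T c f*unitv b c)*unitv a f) = trc d (S*T)"
 proof -
  have "(\<Sum>a<d. \<Sum>b<d. \<Sum>c<d. \<Sum>f<d. (ent S a b*ent T c f*unitv b c)*unitv a f) = (\<Sum>a<d. \<Sum>b<d. \<Sum>c<d. (ent S a b*ent T c a)*unitv b c)"
   by (intro sum.cong refl) (simp add: sum_unitv)
  then show ?thesis using dims by (simp add: sum_unitv trc_def ent_times[of d])
 qed
 finally have 1: "(\<integral>q. bil d q S q*bil d q T q \<partial>gauss d) = trc d S*trc d T + 2*trc d (S*T)" by simp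
 show "(\<integral>q. (bil d q S q - trc d S)*(bil d q T q - trc d T) \<partial>gauss d) = 2*trc d (S*T)"
  unfolding eq using int gauss_bil by (simp add: 1 gauss.prob_space)
qed

definition proj :: "nat => fmat => bool" where
 "proj d P \<longleftrightarrow> symm d P \<and> P*P = P"

lemma proj_idm: "proj d (idm d)" by (auto simp: proj_def)

lemma proj_upb: "proj d P ==> upb d P 1"
proof -
 assume P: "proj d P"
 then have s: "symm d P" "P*P = P" by (auto simp: proj_def)
 have 1: "bil d x P x = ip d (mv d P x) (mv d P x)" for x
 proof -
  have "bil d x P x = bil d x (P*idm d*P) x" using s by simp
  also have "... = ip d (mv d P x) (mv d P x)" using s by (subst bil_conj) (auto simp: bil_idm)
  finally show ?thesis .
 qed
 have 2: "bil d x P x <= ip d x x" for x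
 proof -
  have "0 <= ip d (%i. x i - mv d P x i) (%i. x i - mv d P x i)" by (rule ip_nonneg)
  also have "... = ip d x x - 2*ip d x (mv d P x) + ip d (mv d P x) (mv d P x)"
   by (simp add: ip_def algebra_simps sum.distrib sum_subtractf sum_distrib_left)
  finally show ?thesis using 1[of x] by (simp add: bil_mv)
 qed
 show "upb d P 1" using s 1 2 by (auto simp: upb_def psd_def)
qed

lemma trc_proj_square:
 assumes P: "proj d P" and M: "psd d M"
 shows "trc d ((P*M*P)*(P*M*P)) <= trc d (M*M)"
proof -
 have s: "symm d P" "P*P = P" using P by (auto simp: proj_def)
 have dims: "indim d P" "indim d M" using s M by auto
 have PP: "P*(P*A) = P*A" for A using s by (metis mult.assoc)
 have pP: "psd d P" using proj_upb[OF P] by (rule upb_psd)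
 have "trc d ((P*M*P)*(P*M*P)) = trc d ((P*M)*(P*M*P))" by (simp add: mult.assoc PP)
 also have "... = trc d ((P*M*P)*(P*M))" by (rule trc_comm) (use dims in auto)
 also have "... = trc d (P*(M*P*M))" by (simp add: mult.assoc PP)
 also have "... <= 1*trc d (M*P*M)"
  by (rule upb_trc_mult[OF proj_upb[OF P]]) (rule psd_conj[OF psd_symm[OF M] pP])
 also have "trc d (M*P*M) = trc d (M*(M*P))" by (rule trc_comm) (use dims in auto)
 also have "... = trc d (M*M*P)" by (simp add: mult.assoc)
 also have "... = trc d (P*(M*M))" by (rule trc_comm) (use dims in auto)
 also have "... <= 1*trc d (M*M)"
 proof (rule upb_trc_mult[OF proj_upb[OF P]])
  have "psd d (M*idm d*M)" by (rule psd_conj[OF psd_symm[OF M] psd_idm])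
  then show "psd d (M*M)" using M by simp
 qed
 finally show ?thesis by simp
qed

lemma row_law_gauss:
 assumes "0 < d" and P: "proj d P"
 shows "row_law (gauss d) d (mv d P) (300000000*exp 28)"
proof -
 have s: "symm d P" using P by (auto simp: proj_def)
 have b: "bil d (mv d P q) M (mv d P q) = bil d q (P*M*P) q" if "psd d M" for q M
  using s that by (subst bil_conj) auto
 show ?thesis
 proof unfold_locales
  fix i assume "i < d"
  show "(%q. mv d P q i) \<in> borel_measurable (gauss d)"
   unfolding mv_def by (intro borel_measurable_sum borel_measurable_times borel_measurable_const measurable_gauss_component) auto
 next
  fix M assume M: "psd d M"
  have sy: "symm d (P*M*P)" using psd_conj[OF s M] by auto
  show "integrable (gauss d) (%q. bil d (mv d P q) M (mv d P q))"
   unfolding b[OF M] by (rule gauss_bil)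
  note q4 = gauss_quadratic_fourth[OF sy]
  show "integrable (gauss d) (%q. (bil d (mv d P q) M (mv d P q) - (\<integral>q. bil d (mv d P q) M (mv d P q) \<partial>gauss d))^4)"
   unfolding b[OF M] gauss_bil(2) using q4 by simp
  have "(\<integral>q. (bil d (mv d P q) M (mv d P q) - (\<integral>q. bil d (mv d P q) M (mv d P q) \<partial>gauss d))^4 \<partial>gauss d)
   <= 300000000*exp 28*(trc d (P*M*P*(P*M*P)))^2"
   unfolding b[OF M] gauss_bil(2) using q4 by simp
  also have "... <= 300000000*exp 28*(trc d (M*M))^2"
   by (intro mult_left_mono power_mono trc_proj_square P M)
    (use trc_psd_mult[OF psd_conj[OF s M] psd_conj[OF s M]] in auto)
  finally show "(\<integral>q. (bil d (mv d P q) M (mv d P q) - (\<integral>q. bil d (mv d P q) M (mv d P q) \<partial>gauss d))^4 \<partial>gauss d)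
   <= 300000000*exp 28*(trc d (M*M))^2" .
 qed (use assms in auto)
qed

lemma row_gauss_mean:
 assumes P: "proj d P" and M: "psd d M"
 shows "(\<integral>q. bil d (mv d P q) M (mv d P q) \<partial>gauss d) = trc d (P*M)"
proof -
 have s: "symm d P" "P*P = P" using P by (auto simp: proj_def)
 have "bil d (mv d P q) M (mv d P q) = bil d q (P*M*P) q" for q
  using s M by (subst bil_conj) auto
 then have "(\<integral>q. bil d (mv d P q) M (mv d P q) \<partial>gauss d) = trc d (P*M*P)" by (simp add: gauss_bil)
 also have "... = trc d (P*(P*M))" by (rule trc_comm) (use s M in auto)
 finally show ?thesis using s by (simp flip: mult.assoc)
qed

text \<open>Covariance matrix of \<open>zv\<close> over a random query, by
  \<open>zv_covariance\<close>.\<close>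

definition kernel_cov :: "nat => (nat => nat => real) => fmat" where
 "kernel_cov d th = mk d (%j l. exp (ip d (th j) (th l)) - 1)"

lemma symm_kernel_cov: "symm d (kernel_cov d th)"
 by (auto simp: symm_def kernel_cov_def ent_mk ip_comm[of d "th _" "th _"])

context exp_vectors
begin

lemma row_law_exp:
 assumes "0 < d" and P: "proj d P"
 shows "row_law (gauss d) d (%q. mv d P (zv d th q)) (300000000*exp (28*\<kappa>)*\<Lambda>^4)"
proof -
 have s: "symm d P" using P by (auto simp: proj_def)
 have b: "bil d (mv d P q) M (mv d P q) = bil d q (P*M*P) q" if "psd d M" for q M
  using s that by (subst bil_conj) auto
 have e: "esf d (%q. bil d (zv d th q) M (zv d th q))" for M unfolding bil_def by (intro esf_intros esf_zv)
 show ?thesis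
 proof unfold_locales
  fix i assume "i < d"
  have "esf d (%q. mv d P (zv d th q) i)" unfolding mv_def by (intro esf_intros esf_zv)
  then show "(%q. mv d P (zv d th q) i) \<in> borel_measurable (gauss d)" using esf_integrable by blast
 next
  fix M assume M: "psd d M"
  have sy: "symm d (P*M*P)" using psd_conj[OF s M] by auto
  show "integrable (gauss d) (%q. bil d (mv d P (zv d th q)) M (mv d P (zv d th q)))"
   unfolding b[OF M] by (rule esf_integrable[OF e])
  let ?m = "\<integral>q. bil d (zv d th q) (P*M*P) (zv d th q) \<partial>gauss d"
  have "esf d (%q. (bil d (zv d th q) (P*M*P) (zv d th q) + (- ?m))^4)" by (intro esf_intros e)
  then show "integrable (gauss d) (%q. (bil d (mv d P (zv d th q)) M (mv d P (zv d th q)) - (\<integral>q. bil d (mv d P (zv d th q)) M (mv d P (zv d th q)) \<partial>gauss d))^4)"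
   unfolding b[OF M] using esf_integrable by simp
  have "(\<integral>q. (bil d (mv d P (zv d th q)) M (mv d P (zv d th q)) - (\<integral>q. bil d (mv d P (zv d th q)) M (mv d P (zv d th q)) \<partial>gauss d))^4 \<partial>gauss d)
   <= 300000000*exp (28*\<kappa>)*\<Lambda>^4*(trc d (P*M*P*(P*M*P)))^2"
   unfolding b[OF M] by (rule quadratic_fourth[OF sy])
  also have "... <= 300000000*exp (28*\<kappa>)*\<Lambda>^4*(trc d (M*M))^2"
   by (intro mult_left_mono power_mono trc_proj_square P M)
    (use trc_psd_mult[OF psd_conj[OF s M] psd_conj[OF s M]] \<Lambda>_pos in auto)
  finally show "(\<integral>q. (bil d (mv d P (zv d th q)) M (mv d P (zv d th q)) - (\<integral>q. bil d (mv d P (zv d th q)) M (mv d P (zv d th q)) \<partial>gauss d))^4 \<partial>gauss d)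
   <= 300000000*exp (28*\<kappa>)*\<Lambda>^4*(trc d (M*M))^2" .
 qed (use assms \<Lambda>_pos in auto)
qed

end

lemma row_exp_mean:
 assumes P: "proj d P" and M: "psd d M"
 shows "(\<integral>q. bil d (mv d P (zv d th q)) M (mv d P (zv d th q)) \<partial>gauss d) = trc d (P*kernel_cov d th*P*M)"
proof -
 have s: "symm d P" using P by (auto simp: proj_def)
 let ?N = "P*M*P"
 have dims: "indim d P" "indim d M" "indim d (kernel_cov d th)" using s M symm_kernel_cov[of d th] by auto
 have "bil d (mv d P (zv d th q)) M (mv d P (zv d th q)) = (\<Sum>j<d. \<Sum>l<d. ent ?N j l*(zv d th q j*zv d th q l))" for q
  unfolding bil_expand[symmetric] using s M by (subst bil_conj) auto
 moreover have int: "integrable (gauss d) (%q. zv d th q j*zv d th q l)" for j l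
  by (intro esf_integrable esf_intros esf_zv)
 ultimately have "(\<integral>q. bil d (mv d P (zv d th q)) M (mv d P (zv d th q)) \<partial>gauss d) = (\<Sum>j<d. \<Sum>l<d. ent ?N j l*ent (kernel_cov d th) l j)"
  by (simp add: integrable_mult_right zv_covariance kernel_cov_def ent_mk ip_comm)
 also have "... = trc d (?N*kernel_cov d th)"
  using dims by (simp add: trc_def ent_times[of d ?N])
 also have "... = trc d (P*(M*P*kernel_cov d th))" by (simp add: mult.assoc)
 also have "... = trc d (M*P*kernel_cov d th*P)" by (rule trc_comm) (use dims in auto)
 also have "... = trc d (M*(P*kernel_cov d th*P))" by (simp add: mult.assoc)
 also have "... = trc d (P*kernel_cov d th*P*M)" by (rule trc_comm) (use dims in auto)
 finally show ?thesis .
qed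

section \<open>The projected Gram kernel\<close>

abbreviation "CG \<equiv> 300000000*exp 28 :: real"
abbreviation "CL \<equiv> 2000000*exp 28 :: real"

lemma CG_ge1: "1 <= CG"
proof -
 have "1 <= exp (28::real)" by simp
 then show ?thesis by linarith
qed

text \<open>The squared Gram entry with the terms depending on a single vector removed: the inner
  product of \<open>u u^T - I\<close> and \<open>v v^T - I\<close> over \<open>d^2\<close>. Its
  Gaussian mean in either argument is zero, so this is a degenerate kernel, and that makes its
  matrix small in operator norm.\<close>

definition Gam :: "nat => (nat => real) => (nat => real) => real" where
 "Gam d u v = ((ip d u v)^2 - ip d u u - ip d v v + d)/(real d)^2"

abbreviation "Gm d x j k \<equiv> Gam d (x j) (x k)"
abbreviation "cyc d x j l k m \<equiv> Gm d x j k*Gm d x k l*(Gm d x j m*Gm d x m l)"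

lemma Gam_comm: "Gam d u v = Gam d v u"
 by (simp add: Gam_def ip_comm[of d v u])

definition Su :: "nat => (nat => real) => fmat" where "Su d u = outer d u u - idm d"

lemma symm_Su: "symm d (Su d u)" unfolding Su_def by (intro symm_diff symm_outer symm_idm)

lemma bil_Su: "bil d v (Su d u) v = (ip d u v)^2 - ip d v v"
 by (simp add: Su_def bil_diff bil_outer bil_idm power2_eq_square ip_comm[of d v u])

lemma trc_outer1: "trc d (outer d u v) = ip d u v"
 by (simp add: trc_def ent_outer ip_def)

lemma trc_Su: "trc d (Su d u) = ip d u u - d"
 by (simp add: Su_def trc_diff trc_outer1)

lemma trc_Su_Su: "trc d (Su d u*Su d v) = (ip d u v)^2 - ip d u u - ip d v v + d"
proof -
 have "trc d (outer d u u * outer d v v) = (ip d u v)^2"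
  by (simp add: trc_outer bil_outer ip_comm[of d v u] power2_eq_square)
 then show ?thesis
  by (simp add: Su_def algebra_simps trc_diff trc_add trc_outer1)
qed

lemma Gam_bil: "Gam d u v = (bil d v (Su d u) v - trc d (Su d u))/(real d)^2"
 by (simp add: Gam_def bil_Su trc_Su)

text \<open>By the covariance of quadratic forms the kernel reproduces itself under integration,
  with gain \<open>2/d^2\<close>. Two factors of size \<open>1/d\<close> become one such factor
  times \<open>1/d^2\<close>: an extra \<open>1/d\<close> for each pair of edges at a free
  vertex.\<close>

lemma Gam_convolution:
 assumes "0 < d"
 shows "(\<integral>v. Gam d u v * Gam d v w \<partial>gauss d) = 2/(real d)^2*Gam d u w"
proof -
 have "Gam d u v * Gam d v w = (bil d v (Su d u) v - trc d (Su d u))*(bil d v (Su d w) v - trc d (Su d w))/(real d)^4" for v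
  unfolding Gam_comm[of d v w] unfolding Gam_bil by (simp add: eval_nat_numeral)
 then have "(\<integral>v. Gam d u v * Gam d v w \<partial>gauss d) = 2*trc d (Su d u*Su d w)/(real d)^4"
  using gauss_bil_covariance(2)[OF symm_Su symm_Su, of d u w] by simp
 also have "... = 2/(real d)^2*Gam d u w"
  by (simp add: trc_Su_Su Gam_def eval_nat_numeral)
 finally show ?thesis .
qed

lemma norm_fourth:
 "integrable (gauss d) (%u. (ip d u u - d)^4)" "(\<integral>u. (ip d u u - d)^4 \<partial>gauss d) <= CG*(real d)^2"
 using gauss_quadratic_fourth[OF symm_idm, of d] by (simp_all add: bil_idm)

lemma power4_add_le: "(x + y)^4 <= 8*(x^4 + y^4)" for x y :: real
proof -
 have sq: "(x + y)^2 <= 2*(x^2 + y^2)" for x y :: real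
  using zero_le_power2[of "x - y"] by (simp add: power2_eq_square algebra_simps)
 have "(x + y)^4 = ((x + y)^2)^2" by (simp flip: power_mult)
 also have "... <= (2*(x^2 + y^2))^2" by (intro power_mono sq) simp
 also have "... = 4*(x^2 + y^2)^2" by (simp only: power_mult_distrib) simp
 also have "... <= 4*(2*((x^2)^2 + (y^2)^2))" by (intro mult_left_mono sq) simp
 finally show ?thesis by (simp flip: power_mult)
qed

lemma norm_eighth:
 assumes "0 < d"
 shows "integrable (gauss d) (%u. ip d u u^4)" "(\<integral>u. ip d u u^4 \<partial>gauss d) <= 16*CG*real d^4"
proof -
 have d1: "1 <= real d" using assms by simp
 have le: "ip d u u^4 <= 8*(ip d u u - d)^4 + 8*real d^4" for u
  using power4_add_le[of "ip d u u - d" d] by simp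
 have [measurable]: "(%u. ip d u u) \<in> borel_measurable (gauss d)"
  unfolding ip_def by (intro borel_measurable_sum borel_measurable_times measurable_gauss_component) auto
 show int: "integrable (gauss d) (%u. ip d u u^4)"
  by (rule Bochner_Integration.integrable_bound[of _ "%u. 8*(ip d u u - d)^4 + 8*real d^4"])
   (use norm_fourth[of d] le in \<open>auto intro!: AE_I2\<close>)
 have "(\<integral>u. ip d u u^4 \<partial>gauss d) <= (\<integral>u. 8*(ip d u u - d)^4 + 8*real d^4 \<partial>gauss d)"
  by (rule integral_mono[OF int]) (use norm_fourth[of d] le in auto)
 also have "... = 8*(\<integral>u. (ip d u u - d)^4 \<partial>gauss d) + 8*real d^4"
  using norm_fourth[of d] by (simp add: gauss.prob_space)
 also have "... <= 8*(CG*(real d)^2) + 8*(CG*real d^4)"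
  using norm_fourth(2)[of d] mult_right_mono[OF CG_ge1, of "real d^4"] by simp
 also have "... <= 8*(CG*real d^4) + 8*(CG*real d^4)"
  using CG_ge1 d1 by (intro add_mono mult_left_mono power_increasing) auto
 finally show "(\<integral>u. ip d u u^4 \<partial>gauss d) <= 16*CG*real d^4" by (simp add: mult_ac)
qed

definition "C4 = 34*CG^2"

lemma Gam_fourth_given:
 assumes "0 < d"
 shows "(\<integral>\<^sup>+v. ennreal (Gam d u v^4) \<partial>gauss d) <= ennreal (CG*(2*ip d u u^4 + 2*(real d)^2)/real d^8)"
proof -
 have e: "Gam d u v^4 = (bil d v (Su d u) v - trc d (Su d u))^4/real d^8" for v
  by (simp add: Gam_bil power_divide flip: power_mult)
 note q = gauss_quadratic_fourth[OF symm_Su, of d u]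
 have "(\<integral>\<^sup>+v. ennreal (Gam d u v^4) \<partial>gauss d) = ennreal (\<integral>v. Gam d u v^4 \<partial>gauss d)"
  unfolding e by (rule nn_integral_eq_integral) (use q in auto)
 also have "... <= ennreal (CG*(2*ip d u u^4 + 2*(real d)^2)/real d^8)"
 proof (rule ennreal_leI)
  let ?n = "ip d u u"
  have T: "trc d (Su d u*Su d u) = ?n^2 - 2*?n + d" by (simp add: trc_Su_Su)
  have "0 <= ?n^2 - 2*?n + d"
   using zero_le_power2[of "?n - 1"] assms by (simp add: power2_eq_square algebra_simps)
  then have "(trc d (Su d u*Su d u))^2 <= (?n^2 + d)^2"
   unfolding T by (intro power_mono) auto
  also have "... <= 2*?n^4 + 2*(real d)^2"
   using zero_le_power2[of "?n^2 - d"] by (simp add: power2_eq_square eval_nat_numeral algebra_simps)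
  finally have "CG*(trc d (Su d u*Su d u))^2 <= CG*(2*?n^4 + 2*(real d)^2)"
   by (rule mult_left_mono) simp
  then have "(\<integral>v. (bil d v (Su d u) v - trc d (Su d u))^4 \<partial>gauss d) <= CG*(2*?n^4 + 2*(real d)^2)"
   using q by linarith
  then show "(\<integral>v. Gam d u v^4 \<partial>gauss d) <= CG*(2*?n^4 + 2*(real d)^2)/real d^8"
   unfolding e by (simp add: divide_right_mono)
 qed
 finally show ?thesis .
qed

section \<open>Independent Gaussian rows and four-cycles of the kernel\<close>

definition rows :: "nat set => nat => (nat => nat => real) measure" where
 "rows I d = PiM I (%_. gauss d)"

abbreviation "rws d \<equiv> rows {..<d} d"
abbreviation "rws2 d \<equiv> rws d \<Otimes>\<^sub>M rws d"
lemma prob_space_rows: "prob_space (rows I d)"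
 unfolding rows_def by (rule prob_space_PiM) (rule prob_space_gauss)
interpretation rows: prob_space "rows I d" for I d by (rule prob_space_rows)
interpretation rows_prod: product_sigma_finite "%_::nat. gauss d" for d ..

lemma measurable_row_entry: "j \<in> I ==> i < d ==> (%x. x j i) \<in> borel_measurable (rows I d)"
 unfolding rows_def
 by (rule measurable_compose[where f="%x. x j" and N="gauss d" and g="%q. q i"])
  (auto intro: measurable_component_singleton measurable_gauss_component)

lemma measurable_row_ip: "j \<in> I ==> k \<in> I ==> (%x. ip d (x j) (x k)) \<in> borel_measurable (rows I d)"
 unfolding ip_def by (intro borel_measurable_sum borel_measurable_times measurable_row_entry) auto

lemma measurable_Gam: "j \<in> I ==> k \<in> I ==> (%x. Gm d x j k) \<in> borel_measurable (rows I d)"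
 unfolding Gam_def
 by (intro borel_measurable_divide borel_measurable_add borel_measurable_diff borel_measurable_power
   borel_measurable_const measurable_row_ip)

lemma rows_marginal:
 assumes "finite I" "j \<in> I" "f \<in> borel_measurable (gauss d)"
 shows "(\<integral>\<^sup>+x. f (x j) \<partial>rows I d) = (\<integral>\<^sup>+q. f q \<partial>gauss d)"
proof -
 have "(\<integral>\<^sup>+q. f q \<partial>gauss d) = (\<integral>\<^sup>+q. f q \<partial>distr (rows I d) (gauss d) (%x. x j))"
  unfolding rows_def using assms by (subst distr_PiM_component) (auto intro: prob_space_gauss)
 also have "... = (\<integral>\<^sup>+x. f (x j) \<partial>rows I d)"
  unfolding rows_def using assms by (intro nn_integral_distr) auto
 finally show ?thesis ..
qed

lemma rows_peel:
 assumes "finite I" "k \<in> I" "f \<in> borel_measurable (rows I d)"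
 shows "(\<integral>\<^sup>+x. f x \<partial>rows I d) = (\<integral>\<^sup>+x. (\<integral>\<^sup>+v. f (x(k := v)) \<partial>gauss d) \<partial>rows (I - {k}) d)"
proof -
 have I: "I = insert k (I - {k})" using assms by auto
 have "f \<in> borel_measurable (PiM (insert k (I - {k})) (%_. gauss d))"
  using assms(3) unfolding rows_def by (subst (asm) I) simp
 from rows_prod.product_nn_integral_insert[OF _ _ this] assms(1) show ?thesis
  unfolding rows_def by (subst I) simp
qed

lemma rows_two:
 assumes I: "finite I" "j \<in> I" "k \<in> I" "j ~= k"
  and f: "(%x. f (x j) (x k)) \<in> borel_measurable (rows I d)"
  and g: "g \<in> borel_measurable (gauss d)"
  and le: "\<And>u. (\<integral>\<^sup>+v. f u v \<partial>gauss d) <= g u"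
 shows "(\<integral>\<^sup>+x. f (x j) (x k) \<partial>rows I d) <= (\<integral>\<^sup>+u. g u \<partial>gauss d)"
proof -
 have "(\<integral>\<^sup>+x. f (x j) (x k) \<partial>rows I d) = (\<integral>\<^sup>+x. (\<integral>\<^sup>+v. f (x j) v \<partial>gauss d) \<partial>rows (I - {k}) d)"
  using rows_peel[OF I(1,3) f] I(4) by simp
 also have "... <= (\<integral>\<^sup>+x. g (x j) \<partial>rows (I - {k}) d)" by (intro nn_integral_mono le)
 also have "... = (\<integral>\<^sup>+u. g u \<partial>gauss d)" by (rule rows_marginal) (use I g in auto)
 finally show ?thesis .
qed

lemma measurable_norm [measurable]: "(%u. ip d u u) \<in> borel_measurable (gauss d)"
 unfolding ip_def by (intro borel_measurable_sum borel_measurable_times measurable_gauss_component) auto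

lemma Gam_fourth:
 assumes "0 < d" "finite I" "j \<in> I" "k \<in> I" "j ~= k"
 shows "integrable (rows I d) (%x. Gm d x j k^4)"
  and "(\<integral>x. Gm d x j k^4 \<partial>rows I d) <= C4/real d^4"
proof -
 have d1: "1 <= real d" using assms by simp
 have m: "(%x. Gm d x j k^4) \<in> borel_measurable (rows I d)"
  by (intro borel_measurable_power measurable_Gam assms)
 have "(\<integral>\<^sup>+x. ennreal (Gm d x j k^4) \<partial>rows I d) <= (\<integral>\<^sup>+u. ennreal (CG*(2*ip d u u^4 + 2*(real d)^2)/real d^8) \<partial>gauss d)"
  by (rule rows_two) (use assms m Gam_fourth_given in auto)
 also have "... = ennreal (\<integral>u. CG*(2*ip d u u^4 + 2*(real d)^2)/real d^8 \<partial>gauss d)"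
  by (rule nn_integral_eq_integral) (use norm_eighth[OF assms(1)] in auto)
 also have "(\<integral>u. CG*(2*ip d u u^4 + 2*(real d)^2)/real d^8 \<partial>gauss d) = CG*(2*(\<integral>u. ip d u u^4 \<partial>gauss d) + 2*(real d)^2)/real d^8"
  using norm_eighth[OF assms(1)] by (simp add: gauss.prob_space)
 also have "ennreal ... <= ennreal (C4/real d^4)"
 proof (rule ennreal_leI)
  have "(real d)^2 <= CG*real d^4"
   using mult_mono[of 1 CG "(real d)^2" "real d^4"] CG_ge1 d1 by (simp add: power_increasing)
  then have "CG*(2*(\<integral>u. ip d u u^4 \<partial>gauss d) + 2*(real d)^2) <= CG*(2*(16*CG*real d^4) + 2*(CG*real d^4))"
   using norm_eighth[OF assms(1)] by (intro mult_left_mono add_mono) auto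
  also have "... = C4*real d^4" by (simp add: C4_def power2_eq_square)
  finally have "CG*(2*(\<integral>u. ip d u u^4 \<partial>gauss d) + 2*(real d)^2)/real d^8 <= C4*real d^4/real d^8"
   by (rule divide_right_mono) simp
  also have "... = C4/real d^4" using d1 by (simp add: eval_nat_numeral)
  finally show "CG*(2*(\<integral>u. ip d u u^4 \<partial>gauss d) + 2*(real d)^2)/real d^8 <= C4/real d^4" .
 qed
 finally have *: "(\<integral>\<^sup>+x. ennreal (Gm d x j k^4) \<partial>rows I d) <= ennreal (C4/real d^4)" .
 have c: "0 <= C4/real d^4" by (simp add: C4_def)
 show int: "integrable (rows I d) (%x. Gm d x j k^4)"
  by (rule integrableI_nonneg[OF m]) (use le_less_trans[OF *] in auto)
 have "ennreal (\<integral>x. Gm d x j k^4 \<partial>rows I d) <= ennreal (C4/real d^4)"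
  using*by (subst nn_integral_eq_integral[OF int, symmetric]) auto
 then show "(\<integral>x. Gm d x j k^4 \<partial>rows I d) <= C4/real d^4" using c by simp
qed

lemma abs_prod4_le: "\<bar>a*b*(c*e)\<bar> <= a^4 + b^4 + c^4 + e^4" for a b c e :: real
proof -
 have p: "\<bar>x*y\<bar> <= x^2/2 + y^2/2" for x y :: real
  using zero_le_power2[of "\<bar>x\<bar> - \<bar>y\<bar>"] by (simp add: power2_eq_square abs_mult algebra_simps)
 have "\<bar>a*b*(c*e)\<bar> <= (a*b)^2/2 + (c*e)^2/2" by (rule p)
 also have "(a*b)^2 <= a^4/2 + b^4/2" using p[of "a^2" "b^2"] by (simp add: power_mult_distrib flip: power_mult)
 also have "(c*e)^2 <= c^4/2 + e^4/2" using p[of "c^2" "e^2"] by (simp add: power_mult_distrib flip: power_mult)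
 finally have "\<bar>a*b*(c*e)\<bar> <= (a^4/2 + b^4/2)/2 + (c^4/2 + e^4/2)/2" by simp
 moreover have "(A/2 + B/2)/2 + (C/2 + E/2)/2 <= A + B + C + E"
  if "0 <= A" "0 <= B" "0 <= C" "0 <= E" for A B C E :: real using that by (simp add: field_simps)
 ultimately show ?thesis by (rule order_trans) simp_all
qed

definition "C5 = 4*C4 + 1"

text \<open>Each edge has size \<open>1/d\<close> in the fourth mean, so any four-cycle is of order
  \<open>1/d^4\<close>. If all four vertices differ, integrating out vertex \<open>k\<close> by
  \<open>Gam_convolution\<close> gains the further factor \<open>1/d\<close>.\<close>

lemma cycle_expectation:
 assumes "0 < d" and jk: "j < d" "l < d" "k < d" "m < d" "k ~= j" "k ~= l" "m ~= j" "m ~= l"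
 shows "integrable (rws d) (%x. cyc d x j l k m)"
  and "(\<integral>x. cyc d x j l k m \<partial>rws d)
   <= C5/real d^4"
  and "j ~= l ==> k ~= m ==> (\<integral>x. cyc d x j l k m \<partial>rws d)
   <= 2*C5/real d^5"
proof -
 have d0: "0 < real d" using assms by simp
 let ?F = "%x. cyc d x j l k m"
 let ?B = "%x. Gm d x j k^4 + Gm d x k l^4 + Gm d x j m^4 + Gm d x m l^4"
 note G4 = Gam_fourth[OF assms(1), of "{..<d}"]
 have intB: "integrable (rws d) ?B" using jk by (intro Bochner_Integration.integrable_add G4) auto
 have mF: "?F \<in> borel_measurable (rws d)" using jk by (intro borel_measurable_times measurable_Gam) auto
 show int: "integrable (rws d) ?F"
 proof (rule Bochner_Integration.integrable_bound[OF intB mF], rule AE_I2)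
  fix x
  have "norm (?F x) <= ?B x" unfolding real_norm_def by (rule abs_prod4_le)
  also have "... <= norm (?B x)" by simp
  finally show "norm (?F x) <= norm (?B x)" .
 qed
 have "integral\<^sup>L (rws d) ?F <= integral\<^sup>L (rws d) ?B"
  by (rule integral_mono[OF int intB]) (rule order_trans[OF abs_ge_self abs_prod4_le])
 also have "... = (\<integral>x. Gm d x j k^4 \<partial>rws d) + (\<integral>x. Gm d x k l^4 \<partial>rws d)
   + (\<integral>x. Gm d x j m^4 \<partial>rws d) + (\<integral>x. Gm d x m l^4 \<partial>rws d)"
  using jk G4(1) by simp
 also have "... <= C4/real d^4 + C4/real d^4 + C4/real d^4 + C4/real d^4"
  using jk by (intro add_mono G4(2)) auto
 also have "... <= C5/real d^4" by (simp add: C5_def add_divide_distrib)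
 finally show "integral\<^sup>L (rws d) ?F <= C5/real d^4" .
 assume jl: "j ~= l" "k ~= m"
 let ?I = "{..<d} - {k}"
 have I: "{..<d} = insert k ?I" using jk by auto
 have int': "integrable (PiM (insert k ?I) (%_. gauss d)) ?F" using int unfolding rows_def by (subst (asm) I)
 have "integral\<^sup>L (rws d) ?F = (\<integral>x. (\<integral>v. ?F (x(k := v)) \<partial>gauss d) \<partial>rows ?I d)"
  unfolding rows_def by (subst I) (rule rows_prod.product_integral_insert[OF _ _ int'], auto)
 also have "... = (\<integral>x. 2/(real d)^2*(Gm d x j l*Gm d x j m*Gm d x m l) \<partial>rows ?I d)"
 proof (intro Bochner_Integration.integral_cong refl)
  fix x :: "nat => nat => real"
  have "(\<integral>v. ?F (x(k := v)) \<partial>gauss d) = (\<integral>v. Gam d (x j) v * Gam d v (x l) \<partial>gauss d)*(Gm d x j m*Gm d x m l)"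
   using jk jl by simp
  then show "(\<integral>v. ?F (x(k := v)) \<partial>gauss d) = 2/(real d)^2*(Gm d x j l*Gm d x j m*Gm d x m l)"
   unfolding Gam_convolution[OF assms(1)] by simp
 qed
 \<comment> \<open>The remaining three-cycle is bounded by fourth powers of its edges:
   \<open>abs_prod4_le\<close> is applied to \<open>d\<close> times each edge and to the factor 1,
   so that all four terms have order 1.\<close>
 also have "... <= (\<integral>x. 2/(real d)^2*((real d*(Gm d x j l^4 + Gm d x j m^4 + Gm d x m l^4) + 1/real d^3)) \<partial>rows ?I d)"
 proof (rule integral_mono_AE')
  note G4' = Gam_fourth[OF assms(1), of ?I]
  show "integrable (rows ?I d) (%x. 2/(real d)^2*((real d*(Gm d x j l^4 + Gm d x j m^4 + Gm d x m l^4) + 1/real d^3)))"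
   using jk jl by (intro integrable_mult_right Bochner_Integration.integrable_add G4') auto
  show "AE x in rows ?I d. 2/(real d)^2*(Gm d x j l*Gm d x j m*Gm d x m l)
   <= 2/(real d)^2*((real d*(Gm d x j l^4 + Gm d x j m^4 + Gm d x m l^4) + 1/real d^3))"
  proof (intro AE_I2 mult_left_mono)
   fix x
   let ?a = "Gm d x j l" let ?b = "Gm d x j m" let ?c = "Gm d x m l"
   have "(d*?a)*(d*?b)*((d*?c)*1) <= (d*?a)^4 + (d*?b)^4 + (d*?c)^4 + 1^4"
    by (rule order_trans[OF abs_ge_self abs_prod4_le])
   then have "real d^3*(?a*?b*?c) <= real d^3*(d*(?a^4 + ?b^4 + ?c^4) + 1/real d^3)"
    using d0 by (simp add: power_mult_distrib algebra_simps eval_nat_numeral)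
   then show "?a*?b*?c <= d*(?a^4 + ?b^4 + ?c^4) + 1/real d^3"
    using d0 by (simp add: mult_le_cancel_left)
  qed simp
  show "AE x in rows ?I d. 0 <= 2/(real d)^2*((real d*(Gm d x j l^4 + Gm d x j m^4 + Gm d x m l^4) + 1/real d^3))"
   by simp
 qed
 also have "... = 2/(real d)^2*((real d*((\<integral>x. Gm d x j l^4 \<partial>rows ?I d) + (\<integral>x. Gm d x j m^4 \<partial>rows ?I d) + (\<integral>x. Gm d x m l^4 \<partial>rows ?I d)) + 1/real d^3))"
 proof -
  have "integrable (rows ?I d) (%x. Gm d x j l^4)" "integrable (rows ?I d) (%x. Gm d x j m^4)"
   "integrable (rows ?I d) (%x. Gm d x m l^4)"
   using jk jl by (intro Gam_fourth(1) assms(1); simp)+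
  then show ?thesis by (simp add: rows.prob_space)
 qed
 also have "... <= 2/(real d)^2*((real d*(C4/real d^4 + C4/real d^4 + C4/real d^4) + 1/real d^3))"
  using jk jl by (intro mult_left_mono add_mono Gam_fourth(2) assms(1)) auto
 also have "... = 2*(3*C4 + 1)/real d^5" using d0 by (simp add: field_simps eval_nat_numeral)
 also have "... <= 2*C5/real d^5" by (intro divide_right_mono) (auto simp: C5_def C4_def)
 finally show "integral\<^sup>L (rws d) ?F <= 2*C5/real d^5" .
qed

text \<open>One number that controls the keys: the squared Frobenius norm of the square of the
  off-diagonal \<open>Gam\<close> matrix, the eighth powers of the off-diagonal Gram entries with
  weight \<open>d\<close>, and the deviation of the diagonal from 1. Each part has mean of order
  \<open>1/d\<close>.\<close>

definition kstat :: "nat => (nat => nat => real) => real" where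
 "kstat d x = (\<Sum>j<d. \<Sum>l<d. (\<Sum>k\<in>{..<d} - {j, l}. Gm d x j k*Gm d x k l)^2)
  + d*(\<Sum>j<d. \<Sum>l\<in>{..<d} - {j}. (ip d (x j) (x l)/d)^8)
  + (\<Sum>j<d. (ip d (x j) (x j)/d - 1)^4)"

definition "C6 = 6*C5 + 16*CL*CG + CG"

lemma C5_pos: "0 < C5" by (simp add: C5_def C4_def add_nonneg_pos)

text \<open>For \<open>j = l\<close> there are at most \<open>d^2\<close> cycles of order
  \<open>1/d^4\<close>. For \<open>j ~= l\<close> only the at most \<open>d\<close> pairs with
  \<open>k = m\<close> have that order, the others being of order \<open>1/d^5\<close>. After
  summation over \<open>j\<close> and \<open>l\<close> both cases contribute order
  \<open>1/d\<close>.\<close>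

lemma cycle_sum_expectation:
 assumes "0 < d" "j < d" "l < d"
 shows "integrable (rws d) (%x. (\<Sum>k\<in>{..<d} - {j, l}. Gm d x j k*Gm d x k l)^2)"
  and "(\<integral>x. (\<Sum>k\<in>{..<d} - {j, l}. Gm d x j k*Gm d x k l)^2 \<partial>rws d)
   <= (if j = l then C5/(real d)^2 else 3*C5/real d^3)"
proof -
 let ?J = "{..<d} - {j, l}"
 have d0: "0 < real d" using assms by simp
 have card: "real (card ?J) <= d" using card_mono[of "{..<d}" ?J] by (simp del: card_Diff_insert)
 have ex: "(\<Sum>k\<in>?J. Gm d x j k*Gm d x k l)^2 = (\<Sum>k\<in>?J. \<Sum>m\<in>?J. cyc d x j l k m)" for x
  by (simp add: power2_eq_square sum_product)
 have int: "integrable (rws d) (%x. cyc d x j l k m)"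
  if "k \<in> ?J" "m \<in> ?J" for k m using that assms by (intro cycle_expectation) auto
 show "integrable (rws d) (%x. (\<Sum>k\<in>?J. Gm d x j k*Gm d x k l)^2)"
  unfolding ex by (intro integrable_sum_set int)
 have "(\<integral>x. (\<Sum>k\<in>?J. Gm d x j k*Gm d x k l)^2 \<partial>rws d)
  = (\<Sum>k\<in>?J. \<integral>x. (\<Sum>m\<in>?J. cyc d x j l k m) \<partial>rws d)"
  unfolding ex by (rule integral_sum_set) (intro integrable_sum_set int)
 also have "... = (\<Sum>k\<in>?J. \<Sum>m\<in>?J. \<integral>x. cyc d x j l k m \<partial>rws d)"
  by (intro sum.cong refl integral_sum_set int)
 also have "... <= (if j = l then C5/(real d)^2 else 3*C5/real d^3)"
 proof (cases "j = l")
  case True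
  have "(\<Sum>k\<in>?J. \<Sum>m\<in>?J. \<integral>x. cyc d x j l k m \<partial>rws d)
   <= (\<Sum>k\<in>?J. \<Sum>m\<in>?J. C5/real d^4)" using assms by (intro sum_mono cycle_expectation(2)) auto
  also have "... = real (card ?J)*(real (card ?J)*(C5/real d^4))" by simp
  also have "... <= d*(d*(C5/real d^4))" using C5_pos by (intro mult_mono card mult_nonneg_nonneg) auto
  also have "... = C5/(real d)^2" using d0 by (simp add: eval_nat_numeral)
  finally show ?thesis using True by simp
 next
  case False
  have "(\<Sum>k\<in>?J. \<Sum>m\<in>?J. \<integral>x. cyc d x j l k m \<partial>rws d)
   <= (\<Sum>k\<in>?J. \<Sum>m\<in>?J. (if k = m then C5/real d^4 else 0) + 2*C5/real d^5)"
  proof (intro sum_mono)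
   fix k m assume km: "k \<in> ?J" "m \<in> ?J"
   show "(\<integral>x. cyc d x j l k m \<partial>rws d)
    <= (if k = m then C5/real d^4 else 0) + 2*C5/real d^5"
   proof (cases "k = m")
    case True
    have "0 <= 2*C5/real d^5" using C5_pos by simp
    then show ?thesis using cycle_expectation(2)[OF assms(1-3), of k m] km True by force
   next
    case ne: False
    then show ?thesis using cycle_expectation(3)[OF assms(1-3), of k m] km False by force
   qed
  qed
  also have "... = (\<Sum>k\<in>?J. C5/real d^4 + card ?J*(2*C5/real d^5))"
   by (intro sum.cong refl) (simp add: sum.distrib)
  also have "... = card ?J*(C5/real d^4 + card ?J*(2*C5/real d^5))" by simp
  also have "... <= d*(C5/real d^4 + d*(2*C5/real d^5))"
   using C5_pos by (intro mult_mono card add_mono add_nonneg_nonneg mult_nonneg_nonneg) auto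
  also have "... = 3*C5/real d^3" using d0 by (simp add: field_simps eval_nat_numeral)
  finally show ?thesis using False by simp
 qed
 finally show "(\<integral>x. (\<Sum>k\<in>?J. Gm d x j k*Gm d x k l)^2 \<partial>rws d)
   <= (if j = l then C5/(real d)^2 else 3*C5/real d^3)" .
qed

lemma nn_bound_integral:
 fixes f :: "'a => real"
 assumes "f \<in> borel_measurable M" "\<And>x. 0 <= f x" "(\<integral>\<^sup>+x. ennreal (f x) \<partial>M) <= ennreal c" "0 <= c"
 shows "integrable M f" "integral\<^sup>L M f <= c"
proof -
 show int: "integrable M f"
  by (rule integrableI_nonneg[OF assms(1)]) (use assms le_less_trans[OF assms(3)] in auto)
 have "ennreal (integral\<^sup>L M f) <= ennreal c"
  using assms by (subst nn_integral_eq_integral[OF int, symmetric]) auto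
 then show "integral\<^sup>L M f <= c" using assms(4) by simp
qed

lemma gram_eighth:
 assumes "0 < d" "j < d" "l < d" "j ~= l"
 shows "integrable (rws d) (%x. (ip d (x j) (x l)/d)^8)"
  and "(\<integral>x. (ip d (x j) (x l)/d)^8 \<partial>rws d) <= 16*CL*CG/real d^4"
proof -
 have m: "(%x. (ip d (x j) (x l)/d)^8) \<in> borel_measurable (rws d)"
  using assms by (intro borel_measurable_power borel_measurable_divide measurable_row_ip borel_measurable_const) auto
 have "(\<integral>\<^sup>+x. ennreal ((ip d (x j) (x l)/d)^8) \<partial>rws d) <= (\<integral>\<^sup>+u. ennreal (CL*ip d u u^4/real d^8) \<partial>gauss d)"
 proof (rule rows_two)
  fix u
  note e = gauss_linear_eighth[of d u]
  have "(\<integral>\<^sup>+v. ennreal ((ip d u v/d)^8) \<partial>gauss d) = ennreal (\<integral>v. (ip d u v/d)^8 \<partial>gauss d)"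
   by (rule nn_integral_eq_integral) (use e in \<open>auto simp: power_divide\<close>)
  also have "... <= ennreal (CL*ip d u u^4/real d^8)"
   using e by (intro ennreal_leI) (simp add: power_divide divide_right_mono)
  finally show "(\<integral>\<^sup>+v. ennreal ((ip d u v/d)^8) \<partial>gauss d) <= ennreal (CL*ip d u u^4/real d^8)" .
 qed (use assms m in auto)
 also have "... = ennreal (\<integral>u. CL*ip d u u^4/real d^8 \<partial>gauss d)"
  by (rule nn_integral_eq_integral) (use norm_eighth[OF assms(1)] in auto)
 also have "... <= ennreal (16*CL*CG/real d^4)"
 proof (rule ennreal_leI)
  have "(\<integral>u. CL*ip d u u^4/real d^8 \<partial>gauss d) = CL*(\<integral>u. ip d u u^4 \<partial>gauss d)/real d^8" by simp
  also have "... <= CL*(16*CG*real d^4)/real d^8"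
   by (intro divide_right_mono mult_left_mono norm_eighth assms) auto
  also have "... = 16*CL*CG/real d^4" using assms(1) by (simp add: eval_nat_numeral)
  finally show "(\<integral>u. CL*ip d u u^4/real d^8 \<partial>gauss d) <= 16*CL*CG/real d^4" .
 qed
 finally have "(\<integral>\<^sup>+x. ennreal ((ip d (x j) (x l)/d)^8) \<partial>rws d) <= ennreal (16*CL*CG/real d^4)" .
 from nn_bound_integral[OF m _ this]
 show "integrable (rws d) (%x. (ip d (x j) (x l)/d)^8)"
  "(\<integral>x. (ip d (x j) (x l)/d)^8 \<partial>rws d) <= 16*CL*CG/real d^4" by auto
qed

lemma diagonal_fourth:
 assumes "0 < d" "j < d"
 shows "integrable (rws d) (%x. (ip d (x j) (x j)/d - 1)^4)"
  and "(\<integral>x. (ip d (x j) (x j)/d - 1)^4 \<partial>rws d) <= CG/(real d)^2"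
proof -
 have m: "(%x. (ip d (x j) (x j)/d - 1)^4) \<in> borel_measurable (rws d)"
  using assms by (intro borel_measurable_power borel_measurable_divide borel_measurable_diff measurable_row_ip borel_measurable_const) auto
 have e: "(ip d u u/d - 1)^4 = (ip d u u - d)^4/real d^4" for u
  using assms by (simp add: diff_divide_distrib flip: power_divide)
 have "(\<integral>\<^sup>+x. ennreal ((ip d (x j) (x j)/d - 1)^4) \<partial>rws d) = (\<integral>\<^sup>+u. ennreal ((ip d u u/d - 1)^4) \<partial>gauss d)"
  by (rule rows_marginal) (use assms in auto)
 also have "... = ennreal (\<integral>u. (ip d u u/d - 1)^4 \<partial>gauss d)"
  unfolding e by (rule nn_integral_eq_integral) (use norm_fourth in auto)
 also have "... <= ennreal (CG/(real d)^2)"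
 proof (rule ennreal_leI)
  have "(\<integral>u. (ip d u u/d - 1)^4 \<partial>gauss d) <= CG*(real d)^2/real d^4"
   unfolding e using norm_fourth(2)[of d] by (simp add: divide_right_mono)
  also have "... = CG/(real d)^2" using assms by (simp add: eval_nat_numeral)
  finally show "(\<integral>u. (ip d u u/d - 1)^4 \<partial>gauss d) <= CG/(real d)^2" .
 qed
 finally have "(\<integral>\<^sup>+x. ennreal ((ip d (x j) (x j)/d - 1)^4) \<partial>rws d) <= ennreal (CG/(real d)^2)" .
 from nn_bound_integral[OF m _ this]
 show "integrable (rws d) (%x. (ip d (x j) (x j)/d - 1)^4)"
  "(\<integral>x. (ip d (x j) (x j)/d - 1)^4 \<partial>rws d) <= CG/(real d)^2" by auto
qed

lemma kstat_expectation:
 assumes "0 < d"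
 shows "integrable (rws d) (kstat d)" and "integral\<^sup>L (rws d) (kstat d) <= C6/d"
proof -
 have d0: "0 < real d" using assms by simp
 let ?N = "rws d"
 let ?A = "%j l x. (\<Sum>k\<in>{..<d} - {j, l}. Gm d x j k*Gm d x k l)^2"
 let ?B = "%j l x. (ip d (x j) (x l)/d)^8" let ?D = "%j x. (ip d (x j) (x j)/d - 1)^4"
 have iA: "integrable ?N (%x. \<Sum>j<d. \<Sum>l<d. ?A j l x)"
  by (intro integrable_sum_set cycle_sum_expectation assms) auto
 have iB: "integrable ?N (%x. \<Sum>j<d. \<Sum>l\<in>{..<d} - {j}. ?B j l x)"
  by (intro integrable_sum_set gram_eighth assms) auto
 have iD: "integrable ?N (%x. \<Sum>j<d. ?D j x)"
  by (intro integrable_sum_set diagonal_fourth assms) auto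
 show "integrable ?N (kstat d)" unfolding kstat_def[abs_def] using iA iB iD by simp
 have E: "integral\<^sup>L ?N (kstat d) = (\<integral>x. (\<Sum>j<d. \<Sum>l<d. ?A j l x) \<partial>?N) + d*(\<integral>x. (\<Sum>j<d. \<Sum>l\<in>{..<d} - {j}. ?B j l x) \<partial>?N) + (\<integral>x. (\<Sum>j<d. ?D j x) \<partial>?N)"
  unfolding kstat_def[abs_def] using iA iB iD by simp
 have A: "(\<integral>x. (\<Sum>j<d. \<Sum>l<d. ?A j l x) \<partial>?N) <= 6*C5/d"
 proof -
  have "(\<integral>x. (\<Sum>j<d. \<Sum>l<d. ?A j l x) \<partial>?N) = (\<Sum>j<d. \<Sum>l<d. integral\<^sup>L ?N (?A j l))"
   by (rule integral_sum2) (intro cycle_sum_expectation assms)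
  also have "... <= (\<Sum>j<d. \<Sum>l<d. (if l = j then C5/(real d)^2 else 0) + 3*C5/real d^3)"
  proof (intro sum_mono)
   fix j l assume jl: "j \<in> {..<d}" "l \<in> {..<d}"
   have "0 <= 3*C5/real d^3" using C5_pos by simp
   then show "integral\<^sup>L ?N (?A j l) <= (if l = j then C5/(real d)^2 else 0) + 3*C5/real d^3"
    using cycle_sum_expectation(2)[OF assms, of j l] jl by (auto split: if_splits)
  qed
  also have "... = d*(C5/(real d)^2 + d*(3*C5/real d^3))" by (simp add: sum.distrib)
  also have "... = 4*C5/d" using d0 by (simp add: field_simps eval_nat_numeral)
  also have "... <= 6*C5/d" using C5_pos by (intro divide_right_mono) auto
  finally show ?thesis .
 qed
 have B: "(\<integral>x. (\<Sum>j<d. \<Sum>l\<in>{..<d} - {j}. ?B j l x) \<partial>?N) <= (real d)^2*(16*CL*CG/real d^4)"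
 proof -
  have "(\<integral>x. (\<Sum>j<d. \<Sum>l\<in>{..<d} - {j}. ?B j l x) \<partial>?N) = (\<Sum>j<d. \<integral>x. (\<Sum>l\<in>{..<d} - {j}. ?B j l x) \<partial>?N)"
   by (rule integral_sum_set) (intro integrable_sum_set gram_eighth assms; auto)
  also have "... = (\<Sum>j<d. \<Sum>l\<in>{..<d} - {j}. integral\<^sup>L ?N (?B j l))"
   by (intro sum.cong refl integral_sum_set gram_eighth assms) auto
  also have "... <= (\<Sum>j<d. \<Sum>l\<in>{..<d} - {j}. 16*CL*CG/real d^4)"
   by (intro sum_mono gram_eighth assms) auto
  also have "... <= (\<Sum>j<d. \<Sum>l<d. 16*CL*CG/real d^4)"
   by (intro sum_mono sum_mono2) auto
  also have "... = (real d)^2*(16*CL*CG/real d^4)" by (simp add: power2_eq_square)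
  finally show ?thesis .
 qed
 have D: "(\<integral>x. (\<Sum>j<d. ?D j x) \<partial>?N) <= CG/d"
 proof -
  have "(\<integral>x. (\<Sum>j<d. ?D j x) \<partial>?N) = (\<Sum>j<d. integral\<^sup>L ?N (?D j))"
   by (rule integral_sum_set) (intro diagonal_fourth assms; auto)
  also have "... <= (\<Sum>j<d. CG/(real d)^2)" by (intro sum_mono diagonal_fourth assms) auto
  also have "... = CG/d" using d0 by (simp add: power2_eq_square)
  finally show ?thesis .
 qed
 have "6*C5/d + d*((real d)^2*(16*CL*CG/real d^4)) + CG/d = C6/d"
  using d0 by (simp add: C6_def field_simps eval_nat_numeral)
 with E A mult_left_mono[OF B, of d] D show "integral\<^sup>L ?N (kstat d) <= C6/d" by simp
qed

lemma kstat_nonneg: "0 <= kstat d x"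
 unfolding kstat_def by (intro add_nonneg_nonneg mult_nonneg_nonneg sum_nonneg) auto

theorem kstat_markov:
 assumes "0 < d" "0 < \<epsilon>"
 shows "{x \<in> space (rws d). \<epsilon> <= kstat d x} \<in> sets (rws d)"
  and "measure (rws d) {x \<in> space (rws d). \<epsilon> <= kstat d x} <= C6/(d*\<epsilon>)"
proof -
 note k = kstat_expectation[OF assms(1)]
 have [measurable]: "kstat d \<in> borel_measurable (rws d)" using k by auto
 show "{x \<in> space (rws d). \<epsilon> <= kstat d x} \<in> sets (rws d)" by measurable
 have "measure (rws d) {x \<in> space (rws d). \<epsilon> <= kstat d x} <= integral\<^sup>L (rws d) (kstat d)/\<epsilon>"
  by (rule integral_Markov_inequality_measure[OF k(1), where A = "space (rws d)"]) (use kstat_nonneg assms in auto)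
 also have "... <= C6/d/\<epsilon>" using k(2) assms by (intro divide_right_mono) auto
 finally show "measure (rws d) {x \<in> space (rws d). \<epsilon> <= kstat d x} <= C6/(d*\<epsilon>)"
  by (simp add: field_simps)
qed

lemma bil_frobenius: "(bil d x A y)^2 <= ip d x x*ip d y y*(\<Sum>i<d. \<Sum>j<d. (ent A i j)^2)"
proof -
 have "(bil d x A y)^2 <= ip d x x*ip d (mv d A y) (mv d A y)"
  unfolding bil_mv ip_def using Cauchy_Schwarz_ineq_sum[of x "mv d A y" "{..<d}"] by (simp add: power2_eq_square)
 also have "ip d (mv d A y) (mv d A y) <= (\<Sum>i<d. (\<Sum>j<d. (ent A i j)^2)*ip d y y)"
  unfolding ip_def[of d "mv d A y"] mv_def ip_def
  by (intro sum_mono) (use Cauchy_Schwarz_ineq_sum[of "ent A _" y "{..<d}"] in \<open>simp add: power2_eq_square\<close>)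
 also have "... = ip d y y*(\<Sum>i<d. \<Sum>j<d. (ent A i j)^2)" unfolding sum_distrib_right[symmetric] by (rule mult.commute)
 finally show ?thesis by (simp add: mult.assoc mult_left_mono)
qed

text \<open>With \<open>H\<close> the off-diagonal matrix, \<open>(w H w)^2\<close> is at most
  \<open>ip d w w\<close> times \<open>w H H w\<close>, and the latter is bounded by the Frobenius
  norm of \<open>H*H\<close>. Two Cauchy-Schwarz steps produce the fourth root. The Frobenius norm
  of \<open>H\<close> itself would not be small.\<close>

lemma gamma_form_bound:
 assumes "kstat d x <= \<epsilon>"
 shows "\<bar>\<Sum>j<d. \<Sum>l\<in>{..<d} - {j}. w j*w l*Gm d x j l\<bar> <= sqrt (sqrt \<epsilon>)*ip d w w"
proof -
 define H where "H = mk d (%j l. if j = l then 0 else Gm d x j l)"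
 have iH: "indim d H" by (simp add: H_def)
 have sH: "symm d H" by (auto simp: symm_def H_def ent_mk Gam_comm)
 have HH: "ent (H*H) j l = (\<Sum>k\<in>{..<d} - {j, l}. Gm d x j k*Gm d x k l)" if "j < d" "l < d" for j l
 proof -
  have "ent (H*H) j l = (\<Sum>k<d. ent H j k*ent H k l)" using iH by (simp add: ent_times[of d])
  also have "... = (\<Sum>k\<in>{..<d} - {j, l}. ent H j k*ent H k l)"
   by (rule sum.mono_neutral_right) (auto simp: H_def ent_mk)
  also have "... = (\<Sum>k\<in>{..<d} - {j, l}. Gm d x j k*Gm d x k l)"
   using that by (intro sum.cong refl) (auto simp: H_def ent_mk)
  finally show ?thesis .
 qed
 have "0 <= d*(\<Sum>j<d. \<Sum>l\<in>{..<d} - {j}. (ip d (x j) (x l)/d)^8)" "0 <= (\<Sum>j<d. (ip d (x j) (x j)/d - 1)^4)"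
  by (intro mult_nonneg_nonneg sum_nonneg; simp)+
 then have F: "(\<Sum>j<d. \<Sum>l<d. (ent (H*H) j l)^2) <= \<epsilon>"
  using assms by (simp add: kstat_def HH)
 have e0: "0 <= \<epsilon>" using F by (rule order_trans[rotated]) (intro sum_nonneg, simp)
 have n: "0 <= ip d w w" by simp
 have "(bil d w (H*H) w)^2 <= ip d w w*ip d w w*\<epsilon>"
  by (rule order_trans[OF bil_frobenius mult_left_mono[OF F]]) simp
 also have "... = (ip d w w * sqrt \<epsilon>)^2" using e0 by (simp add: power2_eq_square)
 finally have 1: "bil d w (H*H) w <= ip d w w * sqrt \<epsilon>" by (rule power2_le_imp_le) (use e0 in simp)
 have "(bil d w H w)^2 <= ip d w w*ip d (mv d H w) (mv d H w)"
  unfolding bil_mv ip_def using Cauchy_Schwarz_ineq_sum[of w "mv d H w" "{..<d}"] by (simp add: power2_eq_square)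
 also have "ip d (mv d H w) (mv d H w) = bil d w (H*H) w"
  using bil_conj[OF sH indim_idm, of w w] iH by (simp add: bil_idm)
 also have "ip d w w*bil d w (H*H) w <= ip d w w*(ip d w w * sqrt \<epsilon>)" by (intro mult_left_mono 1 n)
 also have "... = (sqrt (sqrt \<epsilon>)*ip d w w)^2" using e0 by (simp add: power2_eq_square)
 finally have "\<bar>bil d w H w\<bar>^2 <= (sqrt (sqrt \<epsilon>)*ip d w w)^2" by (simp only: power2_abs)
 then have "\<bar>bil d w H w\<bar> <= sqrt (sqrt \<epsilon>)*ip d w w"
  by (rule power2_le_imp_le) (intro mult_nonneg_nonneg real_sqrt_ge_zero e0 n)
 moreover have "bil d w H w = (\<Sum>j<d. \<Sum>l\<in>{..<d} - {j}. w j*w l*Gm d x j l)"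
  unfolding bil_def
 proof (rule sum.cong[OF refl])
  fix j assume "j \<in> {..<d}"
  have "(\<Sum>l<d. w j*ent H j l*w l) = (\<Sum>l\<in>{..<d} - {j}. w j*ent H j l*w l)"
   by (rule sum.mono_neutral_right) (auto simp: H_def ent_mk)
  also have "... = (\<Sum>l\<in>{..<d} - {j}. w j*w l*Gm d x j l)"
   using \<open>j \<in> _\<close> by (intro sum.cong refl) (auto simp: H_def ent_mk)
  finally show "(\<Sum>l<d. w j*ent H j l*w l) = (\<Sum>l\<in>{..<d} - {j}. w j*w l*Gm d x j l)" .
 qed
 ultimately show ?thesis by simp
qed

section \<open>The exponential kernel on vectors with sum zero\<close>

lemma exp_cubic_remainder: "\<bar>exp t - 1 - t - t^2/2\<bar> <= \<bar>t\<bar>^3*exp \<bar>t\<bar>" for t :: real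
proof -
 obtain u where u: "\<bar>u\<bar> <= \<bar>t\<bar>" "exp t = (\<Sum>m<3. t^m/fact m) + exp u/fact 3*t^3"
  using Maclaurin_exp_le[of t 3] by blast
 have "exp t - 1 - t - t^2/2 = exp u/6*t^3"
  using u(2) by (simp add: eval_nat_numeral fact_numeral)
 then have "\<bar>exp t - 1 - t - t^2/2\<bar> = exp u/6*\<bar>t\<bar>^3" by (simp only: abs_mult power_abs) simp
 also have "... <= exp \<bar>t\<bar>*\<bar>t\<bar>^3" proof (intro mult_right_mono)
  have "exp u <= exp \<bar>t\<bar>" using u(1) by simp
  then show "exp u/6 <= exp \<bar>t\<bar>" using exp_gt_zero[of u] by linarith
 qed simp
 finally show ?thesis by (simp add: mult.commute)
qed

text \<open>Off the diagonal, \<open>exp (b G)\<close> is expanded to second order. The quadratic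
  term is \<open>Gam\<close> plus terms in one index, which cancel because \<open>w\<close> has sum
  zero; the cubic remainder is small in Frobenius norm. On the diagonal \<open>G\<close> is near 1,
  whence \<open>a = exp b - 1 - b\<close>.\<close>

lemma kernel_form_bound:
 fixes x :: "nat => nat => real" and b :: real
 assumes d: "0 < d" and b: "0 < b" and k: "kstat d x <= \<epsilon>" and \<epsilon>: "\<epsilon> <= 1" and w: "(\<Sum>j<d. w j) = 0"
 defines "G \<equiv> %j l. ip d (x j) (x l)/d" and "a \<equiv> exp b - 1 - b"
 shows "\<And>j. j < d ==> \<bar>G j j - 1\<bar> <= sqrt (sqrt \<epsilon>)"
  and "\<bar>\<Sum>j<d. \<Sum>l<d. w j*w l*(exp (b*G j l) - 1 - b*G j l - (if l = j then a else 0))\<bar>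
   <= (b*exp (2*b) * sqrt (sqrt \<epsilon>) + b^2/2*(sqrt (sqrt \<epsilon>) + 5/d) + b^3*exp (2*b) * sqrt (1/d + \<epsilon>))*ip d w w"
proof -
 define e where "e = sqrt (sqrt \<epsilon>)"
 have d0: "0 < real d" using d by simp
 have p1: "0 <= (\<Sum>j<d. \<Sum>l<d. (\<Sum>k\<in>{..<d} - {j, l}. Gm d x j k*Gm d x k l)^2)"
  and p2: "0 <= d*(\<Sum>j<d. \<Sum>l\<in>{..<d} - {j}. (G j l)^8)"
  and p3: "0 <= (\<Sum>j<d. (G j j - 1)^4)"
  by (intro mult_nonneg_nonneg sum_nonneg; simp)+
 have k2: "d*(\<Sum>j<d. \<Sum>l\<in>{..<d} - {j}. (G j l)^8) <= \<epsilon>" and k3: "(\<Sum>j<d. (G j j - 1)^4) <= \<epsilon>"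
  using k p1 p2 p3 by (simp_all add: kstat_def G_def)
 have e0: "0 <= \<epsilon>" using k3 p3 by linarith
 have "e^4 = (e^2)^2" by (simp flip: power_mult)
 then have e4: "e^4 = \<epsilon>" "0 <= e" "e <= 1" using e0 \<epsilon> by (simp_all add: e_def)
 have diag: "\<bar>G j j - 1\<bar> <= e" if "j < d" for j
 proof -
  have "(G j j - 1)^4 <= (\<Sum>j<d. (G j j - 1)^4)" by (rule member_le_sum) (use that in auto)
  then have "\<bar>G j j - 1\<bar>^4 <= e^4" using k3 e4 by (simp add: power_even_abs)
  then show ?thesis using power_less_imp_less_base[of e 4 "\<bar>G j j - 1\<bar>"] power_strict_mono[of e "\<bar>G j j - 1\<bar>" 4] e4 by (meson not_le zero_less_numeral)
 qed
 then show "\<And>j. j < d ==> \<bar>G j j - 1\<bar> <= sqrt (sqrt \<epsilon>)" by (simp add: e_def)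
 have G2: "0 <= G j j" "G j j <= 2" if "j < d" for j using diag[OF that] e4 by linarith+
 have Gb: "\<bar>G j l\<bar> <= 2" if "j < d" "l < d" for j l
 proof -
  have "(ip d (x j) (x l))^2 <= ip d (x j) (x j)*ip d (x l) (x l)"
   unfolding ip_def using Cauchy_Schwarz_ineq_sum[of "x j" "x l" "{..<d}"] by (simp add: power2_eq_square)
  then have "(G j l)^2 <= G j j*G l l" using d0 by (simp add: G_def power2_eq_square divide_right_mono)
  also have "... <= 2*2" using G2 that by (intro mult_mono) auto
  finally have "\<bar>G j l\<bar>^2 <= 2^2" by simp
  then show ?thesis by (rule power2_le_imp_le) simp
 qed
 define r where "r j l = exp (b*G j l) - 1 - b*G j l - (b*G j l)^2/2" for j l
 have ipw: "ip d w w = (\<Sum>j<d. (w j)^2)" by (simp add: ip_def power2_eq_square)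
 let ?S = "%f. \<Sum>j<d. \<Sum>l\<in>{..<d} - {j}. w j*w l*f j l"
 have split: "(\<Sum>j<d. \<Sum>l<d. w j*w l*f j l) = (\<Sum>j<d. (w j)^2*f j j) + ?S f" for f :: "nat => nat => real"
 proof -
  have "(\<Sum>l<d. w j*w l*f j l) = (w j)^2*f j j + (\<Sum>l\<in>{..<d} - {j}. w j*w l*f j l)" if "j < d" for j
   using that by (subst sum.remove[of _ j]) (auto simp: power2_eq_square)
  then show ?thesis by (simp add: sum.distrib)
 qed
 have G2dec: "(G j l)^2 = Gm d x j l + (G j j/d + G l l/d - 1/d)" for j l
  using d0 by (simp add: G_def Gam_def field_simps power2_eq_square)
 \<comment> \<open>Each term depends on only one of the two indices, so summation over the other
   gives the factor \<open>\<Sum>j<d. w j\<close>, which is zero.\<close>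
 have zero: "(\<Sum>j<d. \<Sum>l<d. w j*w l*(G j j/d + G l l/d - 1/d)) = 0"
 proof -
  have "(\<Sum>j<d. \<Sum>l<d. w j*w l*(G j j/d + G l l/d - 1/d))
   = (\<Sum>j<d. \<Sum>l<d. (w j*(G j j/d - 1/d))*w l) + (\<Sum>j<d. \<Sum>l<d. w j*(w l*(G l l/d)))"
   by (simp add: sum.distrib[symmetric] algebra_simps)
  also have "... = (\<Sum>j<d. w j*(G j j/d - 1/d))*(\<Sum>l<d. w l) + (\<Sum>j<d. w j)*(\<Sum>l<d. w l*(G l l/d))"
   by (simp only: sum_product)
  finally show ?thesis using w by simp
 qed
 have off: "?S (%j l. (G j l)^2) = ?S (%j l. Gm d x j l) - (\<Sum>j<d. (w j)^2*((2*G j j - 1)/d))"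
 proof -
  have "?S (%j l. (G j l)^2) = ?S (%j l. Gm d x j l) + ?S (%j l. G j j/d + G l l/d - 1/d)"
   unfolding G2dec by (simp add: distrib_left sum.distrib)
  moreover have "(\<Sum>j<d. (w j)^2*(G j j/d + G j j/d - 1/d)) + ?S (%j l. G j j/d + G l l/d - 1/d) = 0"
   using split[of "%j l. G j j/d + G l l/d - 1/d"] zero by simp
  ultimately show ?thesis by (simp add: add_divide_distrib diff_divide_distrib)
 qed
 let ?h = "%t. exp (b*t) - 1 - b*t"
 have main: "(\<Sum>j<d. \<Sum>l<d. w j*w l*(?h (G j l) - (if l = j then a else 0)))
  = (\<Sum>j<d. (w j)^2*(?h (G j j) - a)) + (b^2/2*?S (%j l. (G j l)^2) + ?S r)"
 proof -
  have "?S (%j l. ?h (G j l) - (if l = j then a else 0)) = ?S (%j l. b^2/2*(G j l)^2 + r j l)"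
   by (intro sum.cong refl) (auto simp: r_def power_mult_distrib)
  also have "... = b^2/2*?S (%j l. (G j l)^2) + ?S r"
   by (simp add: distrib_left sum.distrib sum_distrib_left mult_ac)
  finally show ?thesis by (subst split) simp
 qed
 have T1: "\<bar>\<Sum>j<d. (w j)^2*(?h (G j j) - a)\<bar> <= (b*exp (2*b)*e)*ip d w w"
 proof -
  have h: "\<bar>?h t - a\<bar> <= b*exp (2*b)*\<bar>t - 1\<bar>" if "0 <= t" "t <= 2" for t
  proof -
   have "\<bar>?h t - ?h 1\<bar> <= (b*exp (2*b))*\<bar>t - 1\<bar>"
   proof (rule field_differentiable_bound[of "{0..2::real}" ?h "%t. b*exp (b*t) - b" _ t 1, unfolded real_norm_def])
    fix z :: real assume "z \<in> {0..2}"
    then show "(?h has_field_derivative b*exp (b*z) - b) (at z within {0..2})"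
     by (auto intro!: derivative_eq_intros)
    have "1 <= exp (b*z)" "exp (b*z) <= exp (2*b)" using \<open>z \<in> _\<close> b by auto
    then have "b*1 <= b*exp (b*z)" "b*exp (b*z) <= b*exp (2*b)" using b by (intro mult_left_mono; simp)+
    then show "\<bar>b*exp (b*z) - b\<bar> <= b*exp (2*b)" using b by linarith
   qed (use that in auto)
   then show ?thesis by (simp add: a_def)
  qed
  have "\<bar>\<Sum>j<d. (w j)^2*(?h (G j j) - a)\<bar> <= (\<Sum>j<d. \<bar>(w j)^2*(?h (G j j) - a)\<bar>)" by (rule sum_abs)
  also have "... <= (\<Sum>j<d. (w j)^2*(b*exp (2*b)*e))"
  proof (intro sum_mono)
   fix j assume j: "j \<in> {..<d}"
   have "\<bar>?h (G j j) - a\<bar> <= b*exp (2*b)*\<bar>G j j - 1\<bar>" using h G2 j by auto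
   also have "... <= b*exp (2*b)*e" using diag j b by (intro mult_left_mono) auto
   finally show "\<bar>(w j)^2*(?h (G j j) - a)\<bar> <= (w j)^2*(b*exp (2*b)*e)"
    unfolding abs_mult by (simp add: mult_left_mono)
  qed
  also have "... = (b*exp (2*b)*e)*ip d w w" unfolding ipw sum_distrib_right[symmetric] by (rule mult.commute)
  finally show ?thesis .
 qed
 have T2: "\<bar>?S (%j l. Gm d x j l)\<bar> <= e*ip d w w" unfolding e_def by (rule gamma_form_bound[OF k])
 have T3: "\<bar>\<Sum>j<d. (w j)^2*((2*G j j - 1)/d)\<bar> <= 5/d*ip d w w"
 proof -
  have "\<bar>\<Sum>j<d. (w j)^2*((2*G j j - 1)/d)\<bar> <= (\<Sum>j<d. \<bar>(w j)^2*((2*G j j - 1)/d)\<bar>)" by (rule sum_abs)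
  also have "... <= (\<Sum>j<d. (w j)^2*(5/d))"
  proof (intro sum_mono)
   fix j assume j: "j \<in> {..<d}"
   have "\<bar>2*G j j - 1\<bar> <= 5" using G2[of j] j by auto
   then have "\<bar>(2*G j j - 1)/d\<bar> <= 5/d" using d0 by (simp add: divide_right_mono)
   then show "\<bar>(w j)^2*((2*G j j - 1)/d)\<bar> <= (w j)^2*(5/d)"
    unfolding abs_mult by (intro mult_mono) auto
  qed
  also have "... = 5/d*ip d w w" unfolding ipw sum_distrib_right[symmetric] by (rule mult.commute)
  finally show ?thesis .
 qed
 have T4: "\<bar>?S r\<bar> <= b^3*exp (2*b) * sqrt (1/d + \<epsilon>)*ip d w w"
 proof -
  define c where "c = b^3*exp (2*b)"
  have c: "0 <= c" using b by (simp add: c_def)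
  \<comment> \<open>The squared remainder is of order \<open>G^6\<close>, but \<open>kstat\<close>
    controls eighth powers. Splitting at \<open>G^2 = 1/d\<close> gives
    \<open>G^6 <= 1/d^3 + d G^8\<close>, and the first term sums to at most
    \<open>1/d\<close>.\<close>
  have r6: "(r j l)^2 <= c^2*(1/real d^3 + d*(G j l)^8)" if "j < d" "l < d" for j l
  proof -
   let ?g = "\<bar>G j l\<bar>"
   have "\<bar>r j l\<bar> <= \<bar>b*G j l\<bar>^3*exp \<bar>b*G j l\<bar>" unfolding r_def by (rule exp_cubic_remainder)
   also have "... = b^3*?g^3*exp (b*?g)" using b by (simp add: abs_mult power_mult_distrib)
   also have "... <= b^3*?g^3*exp (2*b)" using Gb[OF that] b by (intro mult_left_mono) auto
   finally have "\<bar>r j l\<bar> <= c*?g^3" by (simp add: c_def mult_ac)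
   then have "(r j l)^2 <= (c*?g^3)^2" by (rule abs_le_square_iff[THEN iffD1, OF order_trans]) (rule abs_ge_self)
   also have "... = c^2*(?g^2)^3" by (simp add: power_mult_distrib flip: power_mult)
   also have "... <= c^2*(1/real d^3 + d*(G j l)^8)"
   proof (rule mult_left_mono)
    define u where "u = ?g^2"
    have u: "0 <= u" "(G j l)^8 = u^4" by (simp_all add: u_def flip: power_mult)
    show "(?g^2)^3 <= 1/real d^3 + d*(G j l)^8"
     unfolding u(2) u_def[symmetric]
    proof (cases "u <= 1/d")
     case True
     then have "u^3 <= (1/d)^3" using u by (intro power_mono) auto
     then show "u^3 <= 1/real d^3 + d*u^4" using u by (simp add: power_one_over add_increasing2)
    next
     case False
     then have "1 <= d*u" using d0 by (simp add: field_simps)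
     then have "1*u^3 <= (d*u)*u^3" using u by (intro mult_right_mono) auto
     then have "u^3 <= d*u^4" by (simp add: eval_nat_numeral)
     then show "u^3 <= 1/real d^3 + d*u^4" using d0 by (simp add: add_increasing)
    qed
   qed simp
   finally show ?thesis .
  qed
  define A where "A = mk d (%j l. if j = l then 0 else r j l)"
  have SA: "?S r = bil d w A w"
   unfolding bil_def
  proof (rule sum.cong[OF refl])
   fix j assume "j \<in> {..<d}"
   have "(\<Sum>l<d. w j*ent A j l*w l) = (\<Sum>l\<in>{..<d} - {j}. w j*ent A j l*w l)"
    by (rule sum.mono_neutral_right) (auto simp: A_def ent_mk)
   also have "... = (\<Sum>l\<in>{..<d} - {j}. w j*w l*r j l)"
    using \<open>j \<in> _\<close> by (intro sum.cong refl) (auto simp: A_def ent_mk)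
   finally show "(\<Sum>l\<in>{..<d} - {j}. w j*w l*r j l) = (\<Sum>l<d. w j*ent A j l*w l)" ..
  qed
  have "(\<Sum>j<d. \<Sum>l<d. (ent A j l)^2) = (\<Sum>j<d. \<Sum>l\<in>{..<d} - {j}. (r j l)^2)"
  proof (rule sum.cong[OF refl])
   fix j assume "j \<in> {..<d}"
   have "(\<Sum>l<d. (ent A j l)^2) = (\<Sum>l\<in>{..<d} - {j}. (ent A j l)^2)"
    by (rule sum.mono_neutral_right) (auto simp: A_def ent_mk)
   also have "... = (\<Sum>l\<in>{..<d} - {j}. (r j l)^2)"
    using \<open>j \<in> _\<close> by (intro sum.cong refl) (auto simp: A_def ent_mk)
   finally show "(\<Sum>l<d. (ent A j l)^2) = (\<Sum>l\<in>{..<d} - {j}. (r j l)^2)" .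
  qed
  also have "... <= (\<Sum>j<d. \<Sum>l\<in>{..<d} - {j}. c^2*(1/real d^3 + d*(G j l)^8))"
   by (intro sum_mono r6) auto
  also have "... = c^2*((\<Sum>j<d. \<Sum>l\<in>{..<d} - {j}. 1/real d^3) + d*(\<Sum>j<d. \<Sum>l\<in>{..<d} - {j}. (G j l)^8))"
   by (simp only: sum_distrib_left[symmetric] sum.distrib)
  also have "... <= c^2*(1/d + \<epsilon>)"
  proof (intro mult_left_mono add_mono k2)
   have "(\<Sum>j<d. \<Sum>l\<in>{..<d} - {j}. 1/real d^3) <= (\<Sum>j<d. \<Sum>l<d. 1/real d^3)"
    by (intro sum_mono sum_mono2) auto
   also have "... = 1/d" using d0 by (simp add: eval_nat_numeral)
   finally show "(\<Sum>j<d. \<Sum>l\<in>{..<d} - {j}. 1/real d^3) <= 1/d" .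
  qed simp
  finally have F: "(\<Sum>j<d. \<Sum>l<d. (ent A j l)^2) <= c^2*(1/d + \<epsilon>)" .
  have "(bil d w A w)^2 <= ip d w w*ip d w w*(c^2*(1/d + \<epsilon>))"
   by (rule order_trans[OF bil_frobenius mult_left_mono[OF F]]) simp
  also have "... = (c * sqrt (1/d + \<epsilon>)*ip d w w)^2" using e0 d0 by (simp add: power_mult_distrib power2_eq_square)
  finally have "\<bar>bil d w A w\<bar> <= \<bar>c * sqrt (1/d + \<epsilon>)*ip d w w\<bar>" by (simp only: abs_le_square_iff)
  also have "... = c * sqrt (1/d + \<epsilon>)*ip d w w" using c e0 d0 by (intro abs_of_nonneg mult_nonneg_nonneg) auto
  finally show ?thesis by (simp add: SA c_def)
 qed
 have "\<bar>b^2/2*?S (%j l. (G j l)^2)\<bar> <= b^2/2*((e + 5/d)*ip d w w)"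
  unfolding abs_mult
 proof (rule mult_mono)
  show "\<bar>?S (%j l. (G j l)^2)\<bar> <= (e + 5/d)*ip d w w"
   unfolding off distrib_right using T2 T3 by linarith
 qed auto
 then show "\<bar>\<Sum>j<d. \<Sum>l<d. w j*w l*(exp (b*G j l) - 1 - b*G j l - (if l = j then a else 0))\<bar>
   <= (b*exp (2*b) * sqrt (sqrt \<epsilon>) + b^2/2*(sqrt (sqrt \<epsilon>) + 5/d) + b^3*exp (2*b) * sqrt (1/d + \<epsilon>))*ip d w w"
  unfolding main e_def[symmetric] distrib_right[of _ _ "ip d w w"] mult.assoc[of "b^2/2"] using T1 T4 by linarith
qed

lemma kernel_approximation:
 fixes b \<delta> :: real
 assumes b: "0 < b" and \<delta>: "0 < \<delta>"
 obtains \<epsilon> d0 where "0 < \<epsilon>" "0 < d0"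
  "\<And>d x j. d0 <= d ==> kstat d x < \<epsilon> ==> j < d ==> \<bar>ip d (x j) (x j)/d - 1\<bar> <= \<delta>"
  "\<And>d x w. d0 <= d ==> kstat d x < \<epsilon> ==> (\<Sum>j<d. w j) = 0 ==>
   \<bar>\<Sum>j<d. \<Sum>l<d. w j*w l*(exp (b*(ip d (x j) (x l)/d)) - 1 - b*(ip d (x j) (x l)/d) - (if l = j then exp b - 1 - b else 0))\<bar> <= \<delta>*ip d w w"
proof -
 define c where "c = b*exp (2*b) + b^2 + b^3*exp (2*b)"
 have c0: "0 < c" using b by (simp add: c_def add_pos_pos)
 \<comment> \<open>\<open>c\<close> collects the coefficients of the three error terms. With
   \<open>\<epsilon> = \<eta>^4\<close> the fourth root of \<open>\<epsilon>\<close> is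
   \<open>\<eta>\<close>, and \<open>d0\<close> makes \<open>5/d\<close> and
   \<open>sqrt (1/d + \<epsilon>)\<close> at most \<open>\<eta>\<close> as well.\<close>
 define \<eta> where "\<eta> = min (min (1/2) \<delta>) (\<delta>/c)"
 have \<eta>: "0 < \<eta>" "\<eta> <= 1/2" "\<eta> <= \<delta>" "c*\<eta> <= \<delta>"
  using \<delta> c0 by (auto simp: \<eta>_def min_def field_simps split: if_splits)
 define \<epsilon> where "\<epsilon> = \<eta>^4"
 define d0 where "d0 = Suc (nat \<lceil>max (5/\<eta>) (2/\<eta>^2)\<rceil>)"
 have \<epsilon>: "0 < \<epsilon>" "\<epsilon> <= 1" "sqrt (sqrt \<epsilon>) = \<eta>"
 proof -
  show "0 < \<epsilon>" "\<epsilon> <= 1" using \<eta> by (auto simp: \<epsilon>_def power_le_one)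
  have "\<epsilon> = (\<eta>^2)^2" by (simp add: \<epsilon>_def flip: power_mult)
  then show "sqrt (sqrt \<epsilon>) = \<eta>" using \<eta> by (simp only: real_sqrt_abs abs_power2 abs_of_pos)
 qed
 have big: "0 < real d" "5/d <= \<eta>" "1/d + \<epsilon> <= \<eta>^2" if "d0 <= d" for d
 proof -
  have "max (5/\<eta>) (2/\<eta>^2) <= real d" using that unfolding d0_def by linarith
  then have m: "5/\<eta> <= d" "2/\<eta>^2 <= d" by auto
  have "0 < 5/\<eta>" using \<eta> by simp
  then show d: "0 < real d" using m by linarith
  show "5/d <= \<eta>" using m d \<eta> by (simp add: field_simps)
  have "1/d <= \<eta>^2/2" using m d \<eta> by (simp add: field_simps)
  moreover have "\<epsilon> <= \<eta>^2/2"
  proof -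
   have "\<epsilon> = \<eta>^2*(\<eta>*\<eta>)" by (simp add: \<epsilon>_def eval_nat_numeral)
   also have "... <= \<eta>^2*((1/2)*1)" using \<eta> by (intro mult_left_mono mult_mono) auto
   finally show ?thesis by simp
  qed
  ultimately show "1/d + \<epsilon> <= \<eta>^2" by simp
 qed
 show ?thesis
 proof (rule that[of \<epsilon> d0])
  show "0 < \<epsilon>" "0 < d0" using \<epsilon> by (auto simp: d0_def)
  fix d :: nat and x :: "nat => nat => real"
  assume dx: "d0 <= d" "kstat d x < \<epsilon>"
  have d: "0 < d" using big[OF dx(1)] by simp
  {
   fix j assume "j < d"
   from kernel_form_bound(1)[OF d b less_imp_le[OF dx(2)] \<epsilon>(2) _ this, of "%_. 0"]
   show "\<bar>ip d (x j) (x j)/d - 1\<bar> <= \<delta>" using \<epsilon>(3) \<eta> by simp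
  }
  fix w :: "nat => real" assume w: "(\<Sum>j<d. w j) = 0"
  have "b*exp (2*b)*\<eta> + b^2/2*(\<eta> + 5/d) + b^3*exp (2*b) * sqrt (1/d + \<epsilon>)
   <= b*exp (2*b)*\<eta> + b^2/2*(\<eta> + \<eta>) + b^3*exp (2*b)*\<eta>"
  proof (intro add_mono mult_left_mono order_refl big[OF dx(1)])
   show "sqrt (1/d + \<epsilon>) <= \<eta>" using big[OF dx(1)] \<eta> by (intro real_le_lsqrt) auto
  qed (use b in auto)
  also have "... = c*\<eta>" by (simp add: c_def algebra_simps)
  finally have le: "b*exp (2*b)*\<eta> + b^2/2*(\<eta> + 5/d) + b^3*exp (2*b) * sqrt (1/d + \<epsilon>) <= \<delta>"
   using \<eta> by linarith
  from kernel_form_bound(2)[OF d b less_imp_le[OF dx(2)] \<epsilon>(2) w] mult_right_mono[OF le ip_nonneg[of d w]]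
  show "\<bar>\<Sum>j<d. \<Sum>l<d. w j*w l*(exp (b*(ip d (x j) (x l)/d)) - 1 - b*(ip d (x j) (x l)/d) - (if l = j then exp b - 1 - b else 0))\<bar> <= \<delta>*ip d w w"
   unfolding \<epsilon>(3) by linarith
 qed
qed

section \<open>Resolvents of sums of independent rank-one matrices\<close>

definition sw :: "nat => (nat => nat => real) => fmat" where
 "sw d X = (1/d) *\<^sub>R (\<Sum>i<d. outer d (X i) (X i))"

lemma psd_sw: "psd d (sw d X)" unfolding sw_def by (intro psd_scaleR psd_sum psd_outer) simp

lemma bil_sw: "bil d v (sw d X) v = (\<Sum>i<d. (ip d (X i) v)^2)/d"
 by (simp add: sw_def bil_scaleR bil_sum bil_outer ip_comm[of d v] power2_eq_square)

text \<open>The property holds outside a measurable set of measure at most \<open>\<eta>\<close>.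
  Asking for measurability of the exceptional set only, not of \<open>P\<close>, admits properties
  quantified over all vectors.\<close>

definition whp :: "'x measure => real => ('x => bool) => bool" where
 "whp N \<eta> P \<longleftrightarrow> (\<exists>B\<in>sets N. measure N B <= \<eta> \<and> (\<forall>x\<in>space N - B. P x))"

lemma whpI: "B \<in> sets N ==> measure N B <= \<eta> ==> (\<And>x. x \<in> space N ==> x \<notin> B ==> P x) ==> whp N \<eta> P"
 unfolding whp_def by blast

lemma whp_mono: "whp N \<eta> P ==> (\<And>x. x \<in> space N ==> P x ==> Q x) ==> whp N \<eta> Q"
 unfolding whp_def by blast

lemma (in prob_space) whp_conj: "whp M \<eta> P ==> whp M \<eta>' Q ==> whp M (\<eta> + \<eta>') (%x. P x \<and> Q x)"
 unfolding whp_def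
proof safe
 fix B B' assume "B \<in> events" "prob B <= \<eta>" "\<forall>x\<in>space M - B. P x" "B' \<in> events" "prob B' <= \<eta>'" "\<forall>x\<in>space M - B'. Q x"
 then show "\<exists>B\<in>events. prob B <= \<eta> + \<eta>' \<and> (\<forall>x\<in>space M - B. P x \<and> Q x)"
  using measure_Un_le[of B M B'] by (intro bexI[of _ "B \<union> B'"]) auto
qed

lemma (in prob_space) whp_ball:
 assumes "finite T" "\<And>t. t \<in> T ==> whp M \<eta> (P t)"
 shows "whp M (real (card T)*\<eta>) (%x. \<forall>t\<in>T. P t x)"
 using assms
proof (induction T rule: finite_induct)
 case (insert t T)
 then show ?case using whp_conj[of \<eta> "P t" "real (card T)*\<eta>" "%x. \<forall>t\<in>T. P t x"] by (simp add: distrib_right)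
qed (auto intro: whpI[of "{}"])

text \<open>The threshold on \<open>d\<close> is uniform in the law, the covariance and the starting
  matrix, because the theorem is applied to rows conditioned on random keys. The cap
  \<open>M\<close> is the fourth root of \<open>d\<close>: the initial value of \<open>lyap\<close>
  decays like \<open>1/ln d\<close>, and the \<open>d\<close> costs add up to order
  \<open>M^2/d = 1/sqrt d\<close>.\<close>

theorem barrier_limit:
 fixes C a \<delta> \<phi>0 s m0 \<eta> :: real
 assumes C: "0 <= C" and a: "0 < a" and s: "0 < s" and \<phi>: "0 <= \<phi>0" and room: "\<phi>0 + 2 * s < 1"
  and speed: "1/(1 - \<phi>0 - 2 * s) < \<delta>" and \<eta>: "0 < \<eta>"
 shows "EV d. \<forall>(N :: 'r measure) X S A. row_law N d X C --> psd d S -->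
  (\<forall>x. a*ip d x x <= bil d x S x) -->
  (\<forall>M. psd d M --> (\<integral>r. bil d (X r) M (X r) \<partial>N) <= trc d (S*M)) -->
  pdef d A --> trc d (S*minv d A)/d <= \<phi>0 --> trc d (S*minv d A*(S*minv d A))/d <= m0 -->
  whp (PiM {..<d} (%_. N)) \<eta> (%x. pdef d (A + \<delta> *\<^sub>R S - sw d (%i. X (x i))) \<and>
   trc d (S*minv d (A + \<delta> *\<^sub>R S - sw d (%i. X (x i))))/d <= \<phi>0 + s)"
proof -
 define k where "k = 1/(1 - \<phi>0 - 2 * s)"
 define c where "c = sqrt C/a^2 + 1"
 define l where "l = k^2*c/(\<delta> - k)"
 define c1 where "c1 = ln (1 + m0) + l*\<phi>0"
 define c2 where "c2 = (k^2*c + \<delta>^2)/s^2 + C/(a^4 * s^4)"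
 have "(%d. c1*(1/ln (1 + sqrt (sqrt (real d)))) + c2*(1/sqrt (real d))) \<longlonglongrightarrow> c1*0 + c2*0"
  by (intro tendsto_intros; real_asymp)
 then have "EV d. c1*(1/ln (1 + sqrt (sqrt (real d)))) + c2*(1/sqrt (real d)) < \<eta>"
  using \<eta> by (intro order_tendstoD) auto
 moreover have "EV d. m0 < sqrt (sqrt (real d))" by real_asymp
 ultimately show ?thesis
  using eventually_gt_at_top[of "0::nat"]
 proof eventually_elim
  case (elim d)
  then have d: "0 < real d" by simp
  show ?case
  proof (intro allI impI)
   fix N :: "'r measure" and X S A
   assume h: "row_law N d X C" "psd d S" "\<forall>x. a*ip d x x <= bil d x S x"
    "\<forall>M. psd d M --> (\<integral>r. bil d (X r) M (X r) \<partial>N) <= trc d (S*M)"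
    "pdef d A" "trc d (S*minv d A)/d <= \<phi>0" "trc d (S*minv d A*(S*minv d A))/d <= m0"
   interpret row_law N d X C by fact
   interpret barrier N d X C S a \<delta> \<phi>0 s "sqrt (sqrt d)"
    by unfold_locales (use h a s \<phi> room speed d in auto)
   have g: "good A" using h elim s by (auto simp: good_def Ph_def M2_def)
   have m: "0 <= M2 A" using M2_nonneg h by simp
   have kcl: "\<kappa> = k" "C' = c" "\<Lambda> = l"
    by (simp_all add: \<kappa>_def C'_def \<Lambda>_def k_def c_def l_def)
   have "lyap (Ph A) (M2 A) = (ln (1 + M2 A) + l*Ph A)/ln (1 + sqrt (sqrt d))"
    using h by (simp add: lyap_def kcl Ph_def)
   also have "... <= c1/ln (1 + sqrt (sqrt d))"
    unfolding c1_def using h d m \<Lambda>_nonneg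
    by (intro divide_right_mono add_mono mult_left_mono) (auto simp: kcl Ph_def M2_def)
   finally have 1: "lyap (Ph A) (M2 A) <= c1*(1/ln (1 + sqrt (sqrt d)))" by simp
   define q where "q = sqrt d"
   have q: "0 < q" "real d = q*q" using d by (simp_all add: q_def)
   have "d*cost = c2*(1/q)"
    using q(1) unfolding cost_def unfolding kcl c2_def q_def[symmetric]
    by (simp add: q(2) add_divide_distrib field_simps power2_eq_square)
   with 1 elim q_def have "lyap (Ph A) (M2 A) + d*cost <= \<eta>" by simp
   then show "whp (PiM {..<d} (%_. N)) \<eta> (%x. pdef d (A + \<delta> *\<^sub>R S - sw d (%i. X (x i))) \<and>
    trc d (S*minv d (A + \<delta> *\<^sub>R S - sw d (%i. X (x i))))/d <= \<phi>0 + s)"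
    using barrier_bound[OF g, of d] ok_good[OF g, of d] d
    by (intro whpI[of "{x \<in> space (PiM {..<d} (%_. N)). \<not> ok A d x}"])
     (auto simp: st_closed good_def Ph_def sw_def)
  qed
 qed
qed

text \<open>\<open>\<epsilon>\<close> is fixed before \<open>d\<close> and the law. It serves as
  tolerance both for the mean and for the fixed-point equation of \<open>\<phi>\<close>; the factor
  \<open>exp (2*k)\<close> in its choice undoes the Gronwall growth.\<close>

theorem swap_limit:
 fixes C t \<phi> L \<delta> \<rho> :: real
 assumes C: "0 <= C" and t: "0 < t" and \<phi>: "0 <= \<phi>" and \<delta>: "0 < \<delta>" and \<rho>: "0 < \<rho>"
 shows "\<exists>\<epsilon>>(0::real). EV d. \<forall>(N :: 'r measure) X S. row_law N d X C --> upb d S L -->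
  (\<forall>M (c::real). upb d M c --> \<bar>(\<integral>r. bil d (X r) M (X r) \<partial>N) - trc d (S*M)\<bar> <= \<epsilon>*d*c) -->
  \<bar>trc d (S*dres d t \<phi> S)/d - \<phi>\<bar> <= \<epsilon> -->
  whp (PiM {..<d} (%_. N)) \<rho> (%x. \<bar>trc d (minv d (t *\<^sub>R idm d + sw d (%i. X (x i))))/d
   - trc d (dres d t \<phi> S)/d\<bar> < \<delta>)"
proof -
 define k where "k = 2*(1 + L)^4*(1 + 1/t)^4"
 define \<epsilon> where "\<epsilon> = \<rho>*\<delta>/(4*exp (2*k))"
 have \<epsilon>: "0 < \<epsilon>" using \<delta> \<rho> by (simp add: \<epsilon>_def)
 have "(%d. sqrt (sqrt C)*(1/sqrt (real d)) + 1/real d) \<longlonglongrightarrow> sqrt (sqrt C)*0 + 0"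
  by (intro tendsto_intros; real_asymp)
 then have "EV d. sqrt (sqrt C)*(1/sqrt (real d)) + 1/real d < \<epsilon>"
  using \<epsilon> by (intro order_tendstoD) auto
 then have "EV d. \<forall>(N :: 'r measure) X S. row_law N d X C --> upb d S L -->
  (\<forall>M (c::real). upb d M c --> \<bar>(\<integral>r. bil d (X r) M (X r) \<partial>N) - trc d (S*M)\<bar> <= \<epsilon>*d*c) -->
  \<bar>trc d (S*dres d t \<phi> S)/d - \<phi>\<bar> <= \<epsilon> -->
  whp (PiM {..<d} (%_. N)) \<rho> (%x. \<bar>trc d (minv d (t *\<^sub>R idm d + sw d (%i. X (x i))))/d
   - trc d (dres d t \<phi> S)/d\<bar> < \<delta>)"
 proof eventually_elim
  case (elim d)
  show ?case
  proof (intro allI impI)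
   fix N :: "'r measure" and X S
   assume h: "row_law N d X C" "upb d S L"
    "\<forall>M c. upb d M c --> \<bar>(\<integral>r. bil d (X r) M (X r) \<partial>N) - trc d (S*M)\<bar> <= \<epsilon>*d*c"
    "\<bar>trc d (S*dres d t \<phi> S)/d - \<phi>\<bar> <= \<epsilon>"
   interpret row_law N d X C by fact
   interpret swap N d X C S t \<phi> L \<epsilon>
    by unfold_locales (use h t \<phi> \<epsilon> in auto)
   note b = swap_bound[OF \<delta>, unfolded A0_def \<kappa>_def]
   have "exp (2*K)*(\<bar>trc d (S*dres d t \<phi> S)/d - \<phi>\<bar> + \<eta> + 1/d)/\<delta>
    <= exp (2*K)*(4*\<epsilon>)/\<delta>"
    using h(4) elim \<delta> \<epsilon> unfolding \<eta>_def by (intro divide_right_mono mult_left_mono) auto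
   also have "... = \<rho>" using \<delta> by (simp add: \<epsilon>_def K_def k_def)
   finally have "exp (2*K)*(\<bar>trc d (S*dres d t \<phi> S)/d - \<phi>\<bar> + \<eta> + 1/d)/\<delta> <= \<rho>" .
   note b(2)[THEN order_trans, OF this]
   with b(1) show "whp (PiM {..<d} (%_. N)) \<rho> (%x. \<bar>trc d (minv d (t *\<^sub>R idm d + sw d (%i. X (x i))))/d
   - trc d (dres d t \<phi> S)/d\<bar> < \<delta>)"
    by (rule whpI) (auto simp: resolvent_trace_def sw_def)
  qed
 qed
 with \<epsilon> show ?thesis by (intro exI conjI)
qed

section \<open>Resolvents of the Wishart matrix of the keys\<close>

lemma minv_scaled_idm: "0 < c ==> minv d (c *\<^sub>R idm d) = (1/c) *\<^sub>R idm d"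
proof -
 assume c: "0 < c"
 have p: "pdef d (c *\<^sub>R idm d)" by (rule pdefI[OF _ c]) (auto simp: bil_scaleR bil_idm)
 show ?thesis
  by (rule inverse_unique[of d "c *\<^sub>R idm d"]) (use pdef_minv[OF p] c in auto)
qed

definition unit1 :: "nat => nat => real" where "unit1 d = (%_. 1/sqrt d)"
definition cproj :: "nat => fmat" where "cproj d = idm d - outer d (unit1 d) (unit1 d)"

lemma ip_unit1: "ip d (unit1 d) x = (\<Sum>i<d. x i)/sqrt d"
 by (simp add: ip_def unit1_def sum_divide_distrib)

lemma ip_unit1_self: "0 < d ==> ip d (unit1 d) (unit1 d) = 1"
 by (simp add: ip_def unit1_def)

lemma proj_cproj: "0 < d ==> proj d (cproj d)"
proof -
 assume d: "0 < d"
 have "outer d (unit1 d) (unit1 d) * outer d (unit1 d) (unit1 d) = outer d (unit1 d) (unit1 d)"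
  using outer_mult[of d "idm d" "unit1 d" "unit1 d" "unit1 d" "unit1 d"] d by (simp add: bil_idm ip_unit1_self)
 then show ?thesis unfolding proj_def cproj_def by (auto simp: algebra_simps)
qed

lemma trc_cproj_mult:
 assumes "upb d M c" "0 < d" shows "\<bar>trc d (cproj d*M) - trc d M\<bar> <= c"
proof -
 have "trc d (outer d (unit1 d) (unit1 d)*M) = trc d (M * outer d (unit1 d) (unit1 d))"
  by (rule trc_comm) (use assms in \<open>auto simp: upb_def\<close>)
 also have "... = bil d (unit1 d) M (unit1 d)" by (rule trc_outer) (use assms in \<open>auto simp: upb_def\<close>)
 finally have 1: "trc d (cproj d*M) - trc d M = - bil d (unit1 d) M (unit1 d)"
  using assms by (auto simp: cproj_def left_diff_distrib trc_diff upb_def)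
 have "bil d (unit1 d) M (unit1 d) <= c" "0 <= bil d (unit1 d) M (unit1 d)"
  using assms ip_unit1_self[of d] unfolding upb_def by (metis mult.right_neutral, metis psdD)
 with 1 show ?thesis by simp
qed

abbreviation "gm d P x \<equiv> sw d (%i. mv d P (x i))"

text \<open>The barrier with \<open>S = idm d\<close>, started at \<open>1/g\<close>, where the
  potential is \<open>g\<close> and the second-order trace is \<open>g*g\<close>. A total shift just
  above \<open>1/(1 - g)\<close> suffices, so the barrier ends near
  \<open>1/g + 1/(1 - g) = 1/(g (1 - g))\<close>.\<close>

lemma gram_upper:
 fixes g s \<delta> \<rho> :: real
 assumes g: "0 < g" and s: "0 < s" and room: "g + 2 * s < 1"
  and speed: "1/(1 - g - 2 * s) < \<delta>" and \<rho>: "0 < \<rho>"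
 shows "EV d. \<forall>P. proj d P --> whp (rws d) \<rho>
  (%x. pdef d ((1/g + \<delta>) *\<^sub>R idm d - gm d P x) \<and> trc d (minv d ((1/g + \<delta>) *\<^sub>R idm d - gm d P x))/d <= g + s)"
proof -
 have "EV d. \<forall>(N :: (nat => real) measure) X S A. row_law N d X (300000000*exp 28) --> psd d S -->
  (\<forall>x. 1*ip d x x <= bil d x S x) -->
  (\<forall>M. psd d M --> (\<integral>r. bil d (X r) M (X r) \<partial>N) <= trc d (S*M)) -->
  pdef d A --> trc d (S*minv d A)/d <= g --> trc d (S*minv d A*(S*minv d A))/d <= g*g -->
  whp (PiM {..<d} (%_. N)) \<rho> (%x. pdef d (A + \<delta> *\<^sub>R S - sw d (%i. X (x i))) \<and>
   trc d (S*minv d (A + \<delta> *\<^sub>R S - sw d (%i. X (x i))))/d <= g + s)"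
  by (rule barrier_limit) (use assms in auto)
 then show ?thesis
  using eventually_gt_at_top[of "0::nat"]
 proof eventually_elim
  case (elim d)
  show ?case
  proof (intro allI impI)
   fix P assume P: "proj d P"
   have p: "pdef d ((1/g) *\<^sub>R idm d)" by (rule pdefI[of _ _ "1/g"]) (use g in \<open>auto simp: bil_scaleR bil_idm\<close>)
   have "whp (PiM {..<d} (%_. gauss d)) \<rho> (%x. pdef d ((1/g) *\<^sub>R idm d + \<delta> *\<^sub>R idm d - gm d P x) \<and>
    trc d (idm d*minv d ((1/g) *\<^sub>R idm d + \<delta> *\<^sub>R idm d - gm d P x))/d <= g + s)"
    using elim(2) g p upb_trc_mult[OF proj_upb[OF P]]
    by (intro elim(1)[rule_format] row_law_gauss P)
     (auto simp: bil_idm row_gauss_mean[OF P] minv_scaled_idm trc_scaleR)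
   then show "whp (rws d) \<rho> (%x. pdef d ((1/g + \<delta>) *\<^sub>R idm d - gm d P x) \<and>
    trc d (minv d ((1/g + \<delta>) *\<^sub>R idm d - gm d P x))/d <= g + s)"
    by (simp add: rows_def scaleR_add_left)
  qed
 qed
qed

text \<open>The equation for \<open>m\<close> is that of the Marchenko-Pastur transform with ratio 1
  at the point \<open>- t\<close>. It says that \<open>m = 1/(t + 1/(1 + m))\<close>, the
  fixed-point condition of the exchange for \<open>S = idm d\<close>. The projection is absorbed
  into the mean error.\<close>

lemma gram_lower:
 fixes t m \<delta> \<rho> :: real
 assumes t: "0 < t" and m: "0 < m" and eq: "t*m*(1 + m) = 1" and \<delta>: "0 < \<delta>" and \<rho>: "0 < \<rho>"
 shows "EV d. whp (rws d) \<rho>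
  (%x. \<bar>trc d (minv d (t *\<^sub>R idm d + gm d (cproj d) x))/d - m\<bar> < \<delta>)"
proof -
 have C: "0 <= 300000000*exp (28 :: real)" by simp
 obtain \<epsilon> :: real where \<epsilon>: "0 < \<epsilon>" and
  ev: "EV d. \<forall>(N :: (nat => real) measure) X S. row_law N d X (300000000*exp 28) --> upb d S 1 -->
  (\<forall>M (c::real). upb d M c --> \<bar>(\<integral>r. bil d (X r) M (X r) \<partial>N) - trc d (S*M)\<bar> <= \<epsilon>*d*c) -->
  \<bar>trc d (S*minv d (t *\<^sub>R idm d + (1/(1 + m)) *\<^sub>R S))/d - m\<bar> <= \<epsilon> -->
  whp (PiM {..<d} (%_. N)) \<rho> (%x. \<bar>trc d (minv d (t *\<^sub>R idm d + sw d (%i. X (x i))))/d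
   - trc d (minv d (t *\<^sub>R idm d + (1/(1 + m)) *\<^sub>R S))/d\<bar> < \<delta>)"
  using swap_limit[where 'r="nat => real", OF C t less_imp_le[OF m] \<delta> \<rho>, of 1] by (elim exE conjE) (rule that)
 have "EV d. 1/\<epsilon> < real d" by real_asymp
 then show ?thesis
  using eventually_gt_at_top[of "0::nat"] ev
 proof eventually_elim
  case (elim d)
  then have d: "0 < real d" by simp
  have c: "t *\<^sub>R idm d + (1/(1 + m)) *\<^sub>R idm d = (t + 1/(1 + m)) *\<^sub>R idm d" by (simp add: scaleR_add_left)
  have pos: "0 < t + 1/(1 + m)" using t m by (simp add: add_pos_pos)
  have "m*(t + 1/(1 + m)) = 1" using eq m by (simp add: field_simps)
  then have inv: "trc d (minv d (t *\<^sub>R idm d + (1/(1 + m)) *\<^sub>R idm d))/d = m"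
   using d pos unfolding c minv_scaled_idm[OF pos] by (simp add: trc_scaleR eq_divide_eq divide_eq_eq mult.commute)
  have e1: "1 <= \<epsilon>*d" using elim(1) \<epsilon> by (simp add: field_simps)
  have "whp (PiM {..<d} (%_. gauss d)) \<rho> (%x. \<bar>trc d (minv d (t *\<^sub>R idm d + gm d (cproj d) x))/d
   - trc d (minv d (t *\<^sub>R idm d + (1/(1 + m)) *\<^sub>R idm d))/d\<bar> < \<delta>)"
  proof (intro elim(3)[rule_format] row_law_gauss proj_cproj upb_idm elim(2))
   fix M c assume M: "upb d M c"
   then have "\<bar>trc d (cproj d*M) - trc d M\<bar> <= 1*c" using trc_cproj_mult elim by simp
   also have "... <= \<epsilon>*d*c" using e1 M by (intro mult_right_mono) (auto simp: upb_def)
   finally show "\<bar>(\<integral>r. bil d (mv d (cproj d) r) M (mv d (cproj d) r) \<partial>gauss d) - trc d (idm d*M)\<bar> <= \<epsilon>*d*c"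
    using M elim by (simp add: row_gauss_mean[OF proj_cproj upb_psd[OF M]] upb_def psd_indim)
  qed (use inv \<epsilon> in simp)
  then show ?case unfolding inv by (simp add: rows_def)
 qed
qed

section \<open>The rows of the attention matrix given the keys\<close>

definition sc :: "real => nat => (nat => nat => real) => nat => nat => real" where
 "sc \<beta> d x = (%j i. \<beta>*x j i/sqrt d)"
definition xv :: "real => nat => (nat => nat => real) => (nat => real) => nat => real" where
 "xv \<beta> d x q = mv d (cproj d) (zv d (sc \<beta> d x) q)"
text \<open>The Gram matrix of the keys is a sum of rank-one matrices over coordinates. Its samples
  are therefore the columns of the key array, not the keys themselves.\<close>

definition colm :: "(nat => nat => real) => nat => nat => real" where "colm x = (%m j. x j m)"

abbreviation "sxv \<beta> d x q \<equiv> sw d (%i. xv \<beta> d x (q i))"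

lemma ip_sc: "0 < d ==> ip d (sc \<beta> d x j) (sc \<beta> d x l) = \<beta>^2*(ip d (x j) (x l)/d)"
 by (simp add: ip_def sc_def sum_divide_distrib sum_distrib_left power2_eq_square mult_ac)

lemma symm_proj: "proj d P ==> symm d P" by (simp add: proj_def)

lemma bil_gm:
 assumes "proj d P"
 shows "bil d v (gm d P (colm x)) v = (\<Sum>j<d. \<Sum>l<d. mv d P v j*mv d P v l*(ip d (x j) (x l)/d))"
proof -
 let ?w = "mv d P v"
 have "ip d (mv d P (colm x i)) v = (\<Sum>j<d. ?w j*x j i)" for i
  using symm_bil[OF symm_proj[OF assms], of v "colm x i"]
  by (simp add: bil_mv ip_comm[of d _ v]) (simp add: ip_def colm_def mult.commute)
 then have "bil d v (gm d P (colm x)) v = (\<Sum>i<d. \<Sum>j<d. \<Sum>l<d. ?w j*x j i*(?w l*x l i))/d"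
  by (simp add: bil_sw power2_eq_square sum_product)
 also have "... = (\<Sum>j<d. \<Sum>l<d. \<Sum>i<d. ?w j*x j i*(?w l*x l i))/d"
  by (subst sum.swap, subst (2) sum.swap) simp
 finally show ?thesis by (simp add: ip_def sum_divide_distrib sum_distrib_left mult_ac)
qed

lemma ip_proj: "proj d P ==> ip d (mv d P v) (mv d P v) = bil d v P v"
 using bil_conj[of d P "idm d" v v] by (simp add: proj_def bil_idm symm_indim)

lemma sum_mv_cproj: "0 < d ==> (\<Sum>j<d. mv d (cproj d) v j) = 0"
proof -
 assume d: "0 < d"
 have "ip d (unit1 d) (mv d (cproj d) v) = 0"
  using ip_unit1_self[OF d] by (simp add: cproj_def bil_diff bil_idm bil_outer flip: bil_mv)
 then show ?thesis using d by (simp add: ip_unit1)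
qed

text \<open>Deterministic conditions on the keys under which the law of a row is under control. The
  Gram bound without projection feeds the moment bounds of the exponential vectors; the projected
  one bounds the covariance. \<open>form\<close> is restricted to sum zero, since the centred
  expansion of the kernel holds only there.\<close>

locale good_keys =
 fixes \<beta> \<delta> X :: real and d :: nat and x :: "nat => nat => real"
 assumes \<beta>: "0 < \<beta>" and d: "0 < d" and \<delta>: "0 <= \<delta>" "\<delta> <= 1" and X: "0 < X"
  and diag: "\<And>j. j < d ==> \<bar>ip d (x j) (x j)/d - 1\<bar> <= \<delta>"
  and form: "\<And>w. (\<Sum>j<d. w j) = 0 ==>
   \<bar>\<Sum>j<d. \<Sum>l<d. w j*w l*(exp (\<beta>^2*(ip d (x j) (x l)/d)) - 1 - \<beta>^2*(ip d (x j) (x l)/d)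
    - (if l = j then exp (\<beta>^2) - 1 - \<beta>^2 else 0))\<bar> <= \<delta>*ip d w w"
  and gram: "psd d (X *\<^sub>R idm d - gm d (idm d) (colm x))" "psd d (X *\<^sub>R idm d - gm d (cproj d) (colm x))"
begin

abbreviation "b \<equiv> \<beta>^2"
definition "a = exp b - 1 - b"
abbreviation "P \<equiv> cproj d"
abbreviation "G \<equiv> gm d P (colm x)"
abbreviation "Kc \<equiv> kernel_cov d (sc \<beta> d x)"

lemma b: "0 < b" using \<beta> by simp
lemma a: "0 < a" using exp_lower_Taylor_quadratic[of b] b zero_less_power[of b 2] unfolding a_def by linarith
lemma projP: "proj d P" by (rule proj_cproj[OF d])

lemma kernel_form: "\<bar>bil d v (P*Kc*P) v - a*bil d v P v - b*bil d v G v\<bar> <= \<delta>*bil d v P v"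
proof -
 let ?w = "mv d P v" let ?r = "%j l. ip d (x j) (x l)/d"
 have s: "(\<Sum>j<d. ?w j) = 0" by (rule sum_mv_cproj[OF d])
 have "bil d v (P*Kc*P) v = (\<Sum>j<d. \<Sum>l<d. ?w j*?w l*(exp (b*?r j l) - 1))"
  using symm_proj[OF projP] d
  by (subst bil_conj) (auto simp: bil_def kernel_cov_def ent_mk ip_sc mult_ac intro!: sum.cong)
 moreover have "a*bil d v P v = (\<Sum>j<d. \<Sum>l<d. ?w j*?w l*(if l = j then a else 0))"
  by (simp add: ip_proj[OF projP, symmetric] ip_def sum_distrib_left if_distrib mult_ac cong: if_cong)
 moreover have "b*bil d v G v = (\<Sum>j<d. \<Sum>l<d. ?w j*?w l*(b*?r j l))"
  by (simp add: bil_gm[OF projP] sum_distrib_left mult_ac)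
 ultimately have E: "bil d v (P*Kc*P) v - b*bil d v G v - a*bil d v P v
  = (\<Sum>j<d. \<Sum>l<d. ?w j*?w l*(exp (b*?r j l) - 1 - b*?r j l - (if l = j then a else 0)))"
  by (simp only: sum_subtractf[symmetric] right_diff_distrib)
 show ?thesis using form[OF s, folded a_def] unfolding ip_proj[OF projP] E[symmetric] by (simp only: diff_right_commute)
qed

lemma G_upb: "upb d G X"
 using gram(2) X psd_sw by (auto simp: upb_def psd_def bil_diff bil_scaleR bil_idm)

lemma P_le: "bil d v P v <= ip d v v" "0 <= bil d v P v"
 using proj_upb[OF projP] by (auto simp: upb_def psd_def)

lemma dims [simp]: "indim d P" "indim d Kc" "indim d G"
 using projP psd_sw by (auto simp: proj_def kernel_cov_def)

lemma symm_PKP: "symm d (P*Kc*P)" by (intro symm_conj symm_proj[OF projP] symm_kernel_cov)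

text \<open>The scaled keys have Gram matrix \<open>b G\<close> with \<open>G\<close> at most
  \<open>X\<close>, and squared lengths at most \<open>2 b\<close> because the diagonal of
  \<open>G\<close> is at most 2.\<close>

sublocale exp_vectors d "sc \<beta> d x" "b*X" "2*b"
proof
 show "0 < b*X" using b X by simp
 show "ip d (sc \<beta> d x j) (sc \<beta> d x j) <= 2*b" if "j < d" for j
  using diag[OF that] \<delta> b unfolding ip_sc[OF d] by (subst mult.commute) (intro mult_right_mono, auto)
 fix v
 have "(\<Sum>i<d. (\<Sum>j<d. v j * sc \<beta> d x j i)^2) = b*bil d v (gm d (idm d) (colm x)) v"
 proof -
  have "ip d (mv d (idm d) (colm x i)) v = (\<Sum>j<d. v j*x j i)" for i
   by (simp add: ip_def mv_idm colm_def mult.commute)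
  moreover have "(\<Sum>j<d. v j * sc \<beta> d x j i)^2 = b*(\<Sum>j<d. v j*x j i)^2/d" for i
   using d by (simp add: sc_def sum_divide_distrib[symmetric] power_divide mult.left_commute[of _ \<beta>]
     power_mult_distrib sum_distrib_left[symmetric])
  ultimately show ?thesis by (simp add: bil_sw sum_distrib_left sum_divide_distrib)
 qed
 also have "... <= b*(X*ip d v v)"
  using psdD[OF gram(1), of v] b by (intro mult_left_mono) (auto simp: bil_diff bil_scaleR bil_idm)
 finally show "(\<Sum>i<d. (\<Sum>j<d. v j * sc \<beta> d x j i)^2) <= b*X*ip d v v" by simp
qed

lemma row_law_xv: "row_law (gauss d) d (xv \<beta> d x) (300000000*exp (28*(2*b))*(b*X)^4)"
 unfolding xv_def[abs_def] by (rule row_law_exp[OF d projP])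

lemma mean_upper:
 assumes "psd d M"
 shows "(\<integral>q. bil d (xv \<beta> d x q) M (xv \<beta> d x q) \<partial>gauss d) <= trc d (((a + \<delta>) *\<^sub>R idm d + b *\<^sub>R G)*M)"
 unfolding xv_def row_exp_mean[OF projP assms]
proof (rule trc_mult_mono)
 show "psd d ((a + \<delta>) *\<^sub>R idm d + b *\<^sub>R G - P*Kc*P)"
  unfolding psd_def
 proof (intro conjI allI)
  show "symm d ((a + \<delta>) *\<^sub>R idm d + b *\<^sub>R G - P*Kc*P)"
   using psd_sw symm_PKP by (intro symm_add symm_diff symm_scaleR symm_idm) auto
  fix v
  have "0 <= (a + \<delta>)*(ip d v v - bil d v P v)" using P_le[of v] a \<delta> by simp
  then show "0 <= bil d v ((a + \<delta>) *\<^sub>R idm d + b *\<^sub>R G - P*Kc*P) v"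
   using kernel_form[of v] by (simp add: bil_add bil_diff bil_scaleR bil_idm algebra_simps abs_le_iff)
 qed
qed (use assms in auto)

text \<open>Two errors: \<open>\<delta>\<close> from the kernel approximation, and
  \<open>a/d\<close> from writing \<open>idm d\<close> for the projection, which differs from it by
  rank one.\<close>

lemma mean_lower:
 assumes "upb d M c"
 shows "\<bar>(\<integral>q. bil d (xv \<beta> d x q) M (xv \<beta> d x q) \<partial>gauss d) - trc d ((a *\<^sub>R idm d + b *\<^sub>R G)*M)\<bar> <= (\<delta> + a/d)*d*c"
proof -
 have M: "psd d M" "indim d M" using assms by (auto simp: upb_def)
 let ?E = "P*Kc*P - a *\<^sub>R P - b *\<^sub>R G"
 have sE: "symm d ?E" using psd_sw symm_PKP symm_proj[OF projP] by (intro symm_diff symm_scaleR) auto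
 have fE: "\<bar>bil d v ?E v\<bar> <= \<delta>*ip d v v" for v
  using kernel_form[of v] mult_left_mono[OF P_le(1)[of v] \<delta>(1)] by (simp add: bil_diff bil_scaleR)
 have "0 <= \<delta>*ip d v v - bil d v ?E v" "0 <= \<delta>*ip d v v + bil d v ?E v" for v using fE[of v] by linarith+
 then have "psd d (\<delta> *\<^sub>R idm d - ?E)" "psd d (\<delta> *\<^sub>R idm d + ?E)"
  unfolding psd_def using sE by (auto simp only: bil_diff[of d _ "_ *\<^sub>R idm d"] bil_add[of d _ "_ *\<^sub>R idm d"] bil_scaleR[of d _ _ "idm d"] bil_idm
   intro!: symm_add symm_diff[of d "_ *\<^sub>R idm d"] symm_scaleR symm_idm)
 from this[THEN trc_psd_mult, OF M(1)] have "\<bar>trc d (?E*M)\<bar> <= \<delta>*trc d M"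
  using M by (simp add: left_diff_distrib[of "\<delta> *\<^sub>R idm d"] distrib_right trc_add trc_diff[of d "_ *\<^sub>R M"] trc_scaleR)
 also have "... <= \<delta>*(c*d)" using upb_trc[OF assms] \<delta> by (intro mult_left_mono)
 finally have 1: "\<bar>trc d (?E*M)\<bar> <= \<delta>*(c*d)" .
 have 2: "a*\<bar>trc d (P*M) - trc d M\<bar> <= a*c" using trc_cproj_mult[OF assms d] a by (intro mult_left_mono) auto
 have "trc d (P*Kc*P*M) - trc d ((a *\<^sub>R idm d + b *\<^sub>R G)*M) = trc d (?E*M) + a*(trc d (P*M) - trc d M)"
  using M by (simp add: left_diff_distrib distrib_right trc_add trc_diff trc_scaleR right_diff_distrib)
 then have "\<bar>trc d (P*Kc*P*M) - trc d ((a *\<^sub>R idm d + b *\<^sub>R G)*M)\<bar> <= \<delta>*(c*d) + a*c"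
  using abs_triangle_ineq[of "trc d (?E*M)" "a*(trc d (P*M) - trc d M)"] 1 2 a by (simp only: abs_mult abs_of_pos)
 then show ?thesis unfolding xv_def row_exp_mean[OF projP M(1)] using d by (simp add: algebra_simps)
qed

end

lemma minv_scaleR:
 assumes "pdef d A" "0 < c"
 shows "pdef d (c *\<^sub>R A)" "minv d (c *\<^sub>R A) = (1/c) *\<^sub>R minv d A"
proof -
 obtain e where "e > 0" "\<And>x. e*ip d x x <= bil d x A x" using assms by (auto simp: pdef_def)
 then show p: "pdef d (c *\<^sub>R A)"
  by (intro pdefI[of _ _ "c*e"] symm_scaleR) (use assms in \<open>auto simp: bil_scaleR mult.assoc mult_le_cancel_left_pos pdef_symm\<close>)
 show "minv d (c *\<^sub>R A) = (1/c) *\<^sub>R minv d A"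
  by (rule inverse_unique[of d "c *\<^sub>R A"]) (use assms pdef_minv[OF p] pdef_minv[OF assms(1)] in auto)
qed

lemma trc_resolvent_product:
 assumes "pdef d Y" "0 < k"
 shows "trc d ((l *\<^sub>R idm d - c *\<^sub>R Y)*minv d (k *\<^sub>R Y)) = (l*trc d (minv d Y) - c*d)/k"
 using pdef_minv[OF assms(1)] unfolding minv_scaleR[OF assms]
 by (simp add: left_diff_distrib trc_diff trc_scaleR diff_divide_distrib)

text \<open>At \<open>\<tau> = 0\<close> the expression equals
  \<open>g/b (a + b/(g (1 - g)))^2\<close>; continuity leaves room for a positive slack.\<close>

lemma upper_parameters:
 fixes a b g u :: real
 assumes "0 < a" and b: "0 < b" and g: "0 < g" "g < 1" and u: "g/b*(a + b/(g*(1 - g)))^2 < u"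
 obtains \<tau> where "0 < \<tau>" "\<tau> < 1/2" "g + 2*\<tau> < 1"
  "let L = a + \<tau> + b*(1/g + (1/(1 - g - 2*\<tau>) + \<tau>) + \<tau>) in (L*(g + \<tau>)/b + \<tau>)/(1 - 2*\<tau>)*L < u"
proof -
 let ?L = "%\<tau>. a + \<tau> + b*(1/g + (1/(1 - g - 2*\<tau>) + \<tau>) + \<tau>)"
 let ?Z = "a + 0 + b*(1/g + (1/(1 - g - 2*0) + 0) + 0)"
 have "((%\<tau>. (?L \<tau>*(g + \<tau>)/b + \<tau>)/(1 - 2*\<tau>)*?L \<tau>) \<longlongrightarrow> (?Z*(g + 0)/b + 0)/(1 - 2*0)*?Z) (at_right 0)"
  using g b by (intro tendsto_intros) auto
 moreover have "?Z = a + b/(g*(1 - g))" using g by (simp add: field_simps)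
 ultimately have "((%\<tau>. (?L \<tau>*(g + \<tau>)/b + \<tau>)/(1 - 2*\<tau>)*?L \<tau>) \<longlongrightarrow> g/b*(a + b/(g*(1 - g)))^2) (at_right 0)"
  by (simp add: power2_eq_square mult_ac)
 then have "\<forall>\<^sub>F \<tau> in at_right 0. (?L \<tau>*(g + \<tau>)/b + \<tau>)/(1 - 2*\<tau>)*?L \<tau> < u"
  using u by (rule order_tendstoD)
 moreover have "\<forall>\<^sub>F \<tau> in at_right 0. 0 < \<tau> \<and> \<tau> < min (1/2) ((1 - g)/2)"
  using g by (intro eventually_at_rightI[of 0 "min (1/2) ((1 - g)/2)"]) auto
 ultimately have "\<forall>\<^sub>F \<tau> in at_right 0. (?L \<tau>*(g + \<tau>)/b + \<tau>)/(1 - 2*\<tau>)*?L \<tau> < u \<and> 0 < \<tau> \<and> \<tau> < min (1/2) ((1 - g)/2)"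
  by eventually_elim blast
 from eventually_happens'[OF trivial_limit_at_right_real this] obtain \<tau>
  where "(?L \<tau>*(g + \<tau>)/b + \<tau>)/(1 - 2*\<tau>)*?L \<tau> < u" "0 < \<tau>" and m: "\<tau> < min (1/2) ((1 - g)/2)" by blast
 moreover from m have "\<tau> < 1/2" "g + 2*\<tau> < 1" by auto
 ultimately show ?thesis by (intro that[of \<tau>]) (simp_all only: Let_def)
qed

text \<open>The starting matrix \<open>\<delta> b Y\<close> is complementary to the covariance:
  since \<open>S = L I - b Y\<close>, the total shift \<open>\<delta> S\<close> makes it
  \<open>\<delta> L I\<close>, a scalar. Its potential is an affine function of the trace of the
  inverse of \<open>Y\<close>, which the Gram barrier has already bounded. Without slack,
  \<open>\<delta> (1 - \<phi>) = 1\<close> gives \<open>\<delta> = L g/b\<close>, hence the edge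
  \<open>L^2 g/b\<close>.\<close>

theorem sample_upper:
 fixes \<beta> g u \<rho> :: real
 defines "b \<equiv> \<beta>^2" defines "a \<equiv> exp b - 1 - b"
 assumes \<beta>: "0 < \<beta>" and g: "0 < g" "g < 1" and u: "g/b*(a + b/(g*(1 - g)))^2 < u" and \<rho>: "0 < \<rho>"
 obtains \<tau> where "0 < \<tau>" "\<tau> < 1/2" "g + 2*\<tau> < 1"
  "EV d. \<forall>x. let X = 1/g + (1/(1 - g - 2*\<tau>) + \<tau>); Y = X *\<^sub>R idm d - gm d (cproj d) (colm x) in
   good_keys \<beta> \<tau> X d x --> pdef d Y --> trc d (minv d Y)/d <= g + \<tau> -->
   whp (rws d) \<rho> (%q. \<forall>v. bil d v (sxv \<beta> d x q) v <= u*ip d v v)"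
proof -
 have b: "0 < b" using \<beta> by (simp add: b_def)
 have a: "0 < a" using exp_lower_Taylor_quadratic[of b] b zero_less_power[of b 2] unfolding a_def by linarith
 obtain \<tau> where \<tau>: "0 < \<tau>" "\<tau> < 1/2" "g + 2*\<tau> < 1"
  "let L = a + \<tau> + b*(1/g + (1/(1 - g - 2*\<tau>) + \<tau>) + \<tau>) in (L*(g + \<tau>)/b + \<tau>)/(1 - 2*\<tau>)*L < u"
  using upper_parameters[OF a b g u] .
 define X where "X = 1/g + (1/(1 - g - 2*\<tau>) + \<tau>)"
 define L where "L = a + \<tau> + b*(X + \<tau>)"
 \<comment> \<open>\<open>\<phi>\<close> depends on \<open>\<delta>\<close>. This value solves
   \<open>\<delta> (1 - \<phi> - 2 \<tau>) = 1 + \<tau>\<close>, just above what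
   \<open>speed\<close> requires.\<close>
 define \<delta> where "\<delta> = (L*(g + \<tau>)/b + \<tau>)/(1 - 2*\<tau>)"
 define \<phi> where "\<phi> = (L*(g + \<tau>)/b - 1)/\<delta>"
 have Xg: "1/g <= X" using \<tau> g by (simp add: X_def)
 have X: "0 < X" using Xg g by (smt (verit) divide_pos_pos)
 have L: "0 < L" using a \<tau> b X by (simp add: L_def add_pos_pos)
 have "1 = b*(1/g)*g/b" using b g by simp
 also have "... <= L*(g + \<tau>)/b"
 proof (intro divide_right_mono mult_mono)
  have "b*(1/g) <= b*X" "0 < b*\<tau>" using mult_left_mono[OF Xg, of b] b \<tau> by auto
  then show "b*(1/g) <= L" unfolding L_def distrib_left[of b] using a \<tau>(1) by linarith
 qed (use b g \<tau> L in auto)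
 finally have Lg: "1 <= L*(g + \<tau>)/b" .
 have \<delta>: "0 < \<delta>" using Lg \<tau> by (simp add: \<delta>_def)
 have u': "\<delta>*L < u" using \<tau>(4) by (simp add: \<delta>_def L_def X_def Let_def)
 have \<delta>': "\<delta>*(1 - \<phi> - 2*\<tau>) = 1 + \<tau>"
 proof -
  have "\<delta>*\<phi> = L*(g + \<tau>)/b - 1" "\<delta>*(1 - 2*\<tau>) = L*(g + \<tau>)/b + \<tau>"
   using \<delta> by (simp add: \<phi>_def) (use \<tau> in \<open>simp add: \<delta>_def\<close>)
  then show ?thesis by (simp add: algebra_simps)
 qed
 then have pos: "0 < 1 - \<phi> - 2*\<tau>" using \<delta> \<tau> by (smt (verit) zero_less_mult_pos)
 then have speed: "1/(1 - \<phi> - 2*\<tau>) < \<delta>" using \<delta>' \<tau> by (simp add: divide_less_eq)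
 define C where "C = 300000000*exp (28*(2*b))*(b*X)^4"
 define m0 where "m0 = L^2*(1/(\<delta>*b*\<tau>))^2"
 have "EV d. \<forall>(N :: (nat => real) measure) X S A. row_law N d X C --> psd d S -->
  (\<forall>x. a*ip d x x <= bil d x S x) -->
  (\<forall>M. psd d M --> (\<integral>r. bil d (X r) M (X r) \<partial>N) <= trc d (S*M)) -->
  pdef d A --> trc d (S*minv d A)/d <= \<phi> --> trc d (S*minv d A*(S*minv d A))/d <= m0 -->
  whp (PiM {..<d} (%_. N)) \<rho> (%x. pdef d (A + \<delta> *\<^sub>R S - sw d (%i. X (x i))) \<and>
   trc d (S*minv d (A + \<delta> *\<^sub>R S - sw d (%i. X (x i))))/d <= \<phi> + \<tau>)"
  using Lg \<delta> pos by (intro barrier_limit a \<tau> speed \<rho>) (auto simp: C_def \<phi>_def)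
 then have "EV d. \<forall>x. let Y = X *\<^sub>R idm d - gm d (cproj d) (colm x) in
   good_keys \<beta> \<tau> X d x --> pdef d Y --> trc d (minv d Y)/d <= g + \<tau> -->
   whp (rws d) \<rho> (%q. \<forall>v. bil d v (sxv \<beta> d x q) v <= u*ip d v v)"
 proof eventually_elim
  case (elim d)
  show ?case
   unfolding Let_def
  proof (intro allI impI)
   fix x
   assume K: "good_keys \<beta> \<tau> X d x" and pY0: "pdef d (X *\<^sub>R idm d - gm d (cproj d) (colm x))"
    and tr: "trc d (minv d (X *\<^sub>R idm d - gm d (cproj d) (colm x)))/d <= g + \<tau>"
   interpret K: good_keys \<beta> \<tau> X d x by fact
   define S where "S = (a + \<tau>) *\<^sub>R idm d + b *\<^sub>R K.G"
   \<comment> \<open>The added \<open>\<tau>\<close> keeps \<open>Y\<close> away from zero, so that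
     its inverse, and with it the initial second-order trace, is bounded independently of
     \<open>d\<close>.\<close>
   define Y where "Y = X *\<^sub>R idm d - K.G + \<tau> *\<^sub>R idm d"
   have G: "psd d K.G" by (rule psd_sw)
   have dd: "0 < real d" using K.d by simp
   have pY: "pdef d Y" unfolding Y_def using \<tau> by (intro pdef_shift pY0 psd_idm) simp
   have trY: "trc d (minv d Y)/d <= g + \<tau>"
   proof -
    have "0 <= trc d (minv d (X *\<^sub>R idm d - K.G) - minv d Y)"
     unfolding Y_def using \<tau> by (intro trc_psd shift_identities(2) pY0 psd_idm) simp
    then show ?thesis using tr dd by (simp add: trc_diff divide_le_eq)
   qed
   have SY: "S = L *\<^sub>R idm d - b *\<^sub>R Y"
    by (simp add: S_def L_def Y_def algebra_simps scaleR_add_left)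
   have kpos: "0 < \<delta>*b" using \<delta> b by simp
   note pA = minv_scaleR[OF pY kpos]
   have psdS: "psd d S" unfolding S_def using a \<tau> b G by (intro psd_add psd_scaleR psd_idm) auto
   have upbS: "upb d S L" unfolding upb_def
    using psdS L psdD[OF pdef_psd[OF pY]] b by (auto simp: SY bil_diff bil_scaleR bil_idm)
   have upbR: "upb d (minv d ((\<delta>*b) *\<^sub>R Y)) (1/(\<delta>*b*\<tau>))"
   proof (rule lower_bound_minv[OF pdef_symm[OF pA(1)]])
    fix v
    have "0 <= bil d v (X *\<^sub>R idm d - K.G) v" by (rule psdD[OF pdef_psd[OF pY0]])
    then show "\<delta>*b*\<tau>*ip d v v <= bil d v ((\<delta>*b) *\<^sub>R Y) v"
     using \<delta> b by (simp add: bil_scaleR Y_def bil_add bil_idm mult.assoc mult_le_cancel_left_pos)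
   qed (use kpos \<tau> in simp)
   let ?R = "minv d ((\<delta>*b) *\<^sub>R Y)"
   have ph: "trc d (S*?R)/d <= \<phi>"
   proof -
    have "trc d (S*?R)/d = (L*(trc d (minv d Y)/d) - b)/(\<delta>*b)"
     unfolding SY trc_resolvent_product[OF pY kpos] using dd by (simp add: field_simps)
    also have "... <= (L*(g + \<tau>) - b)/(\<delta>*b)"
     using kpos L trY by (intro divide_right_mono diff_right_mono mult_left_mono) auto
    also have "... = \<phi>" using \<delta> b by (simp add: \<phi>_def field_simps)
    finally show ?thesis .
   qed
   have m2: "trc d (S*?R*(S*?R))/d <= m0"
   proof -
    have sR: "symm d ?R" "symm d S" using upbR psdS by (auto simp: upb_def)
    have "trc d (S*?R*(S*?R)) = trc d (S*(?R*S*?R))" by (simp add: mult.assoc)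
    also have "... <= L*trc d (?R*S*?R)" by (rule upb_trc_mult[OF upbS psd_conj[OF sR(1) psdS]])
    also have "trc d (?R*S*?R) = trc d (S*(?R*?R))"
     using sR by (subst mult.assoc, subst trc_comm[of d ?R]) (auto simp: mult.assoc)
    also have "L*... <= L*(L*trc d (?R*?R))"
     using L psd_conj[OF sR(1) psd_idm] sR by (intro mult_left_mono upb_trc_mult[OF upbS]) auto
    also have "... <= L*(L*((1/(\<delta>*b*\<tau>))^2*d))" using L by (intro mult_left_mono upb_trc_square[OF upbR]) auto
    finally show ?thesis using dd by (simp add: m0_def power2_eq_square field_simps)
   qed
   have "whp (PiM {..<d} (%_. gauss d)) \<rho> (%q. pdef d ((\<delta>*b) *\<^sub>R Y + \<delta> *\<^sub>R S - sxv \<beta> d x q) \<and>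
    trc d (S*minv d ((\<delta>*b) *\<^sub>R Y + \<delta> *\<^sub>R S - sxv \<beta> d x q))/d <= \<phi> + \<tau>)"
   proof (rule elim[rule_format])
    show "row_law (gauss d) d (xv \<beta> d x) C" using K.row_law_xv by (simp add: C_def b_def)
    show "a*ip d v v <= bil d v S v" for v
     using psdD[OF G, of v] b \<tau> ip_nonneg[of d v] by (simp add: S_def bil_add bil_scaleR bil_idm distrib_right)
    show "(\<integral>r. bil d (xv \<beta> d x r) M (xv \<beta> d x r) \<partial>gauss d) <= trc d (S*M)" if "psd d M" for M
     using K.mean_upper[OF that] by (simp add: S_def a_def b_def K.a_def)
   qed (use psdS pA ph m2 in auto)
   then show "whp (rws d) \<rho> (%q. \<forall>v. bil d v (sxv \<beta> d x q) v <= u*ip d v v)"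
    unfolding rows_def
   proof (rule whp_mono, elim conjE, intro allI)
    fix q v assume "pdef d ((\<delta>*b) *\<^sub>R Y + \<delta> *\<^sub>R S - sxv \<beta> d x q)"
    from psdD[OF pdef_psd[OF this], of v]
    have "bil d v (sxv \<beta> d x q) v <= \<delta>*L*ip d v v"
     by (simp add: SY bil_add bil_diff bil_scaleR bil_idm algebra_simps)
    also have "... <= u*ip d v v" using u' by (intro mult_right_mono) auto
    finally show "bil d v (sxv \<beta> d x q) v <= u*ip d v v" .
   qed
  qed
 qed
 then show ?thesis using \<tau> by (intro that[of \<tau>]) (auto simp: X_def Let_def)
qed

lemma good_keys_mono:
 assumes "good_keys \<beta> \<delta> X d x" "\<delta> <= \<delta>'" "\<delta>' <= 1" shows "good_keys \<beta> \<delta>' X d x"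
proof -
 interpret good_keys \<beta> \<delta> X d x by fact
 show ?thesis
 proof
  show "\<bar>ip d (x j) (x j)/d - 1\<bar> <= \<delta>'" if "j < d" for j using diag[OF that] assms by simp
 next
  fix w :: "nat => real" assume "(\<Sum>j<d. w j) = 0"
  from form[OF this] mult_right_mono[OF assms(2) ip_nonneg[of d w]]
  show "\<bar>\<Sum>j<d. \<Sum>l<d. w j*w l*(exp (\<beta>^2*(ip d (x j) (x l)/d)) - 1 - \<beta>^2*(ip d (x j) (x l)/d)
    - (if l = j then exp (\<beta>^2) - 1 - \<beta>^2 else 0))\<bar> <= \<delta>'*ip d w w" by linarith
 qed (use \<beta> d X gram assms \<delta> in auto)
qed

text \<open>The exchange with \<open>S = a I + b G\<close> and \<open>1/(1 + \<phi>) = t g\<close>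
  leads to \<open>t I + t g S = k (t' I + G)\<close> for \<open>k = t g b\<close> and
  \<open>t' = (1/g + a)/b\<close>, again a resolvent of the Gram matrix. Its trace is asymptotically
  \<open>m = b t g^2\<close>: the assumption \<open>eq\<close> is the equation
  \<open>t' m (1 + m) = 1\<close>. Division by \<open>k\<close> gives
  \<open>m/k = g\<close>.\<close>

theorem sample_lower:
 fixes \<beta> t g \<delta> \<rho> X :: real
 defines "b \<equiv> \<beta>^2" defines "a \<equiv> exp b - 1 - b"
 assumes \<beta>: "0 < \<beta>" and t: "0 < t" and g: "0 < g" and eq: "(1 + b*t*g^2)*(t*g*(1 + a*g)) = 1"
  and \<delta>: "0 < \<delta>" and \<rho>: "0 < \<rho>" and X: "0 < X"
 shows "\<exists>\<epsilon>>(0::real). \<epsilon> <= 1 \<and> (EV d. \<forall>x. good_keys \<beta> \<epsilon> X d x -->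
   \<bar>trc d (minv d (((1/g + a)/b) *\<^sub>R idm d + gm d (cproj d) (colm x)))/d - b*t*g^2\<bar> <= \<epsilon> -->
   whp (rws d) \<rho> (%q. \<bar>trc d (minv d (t *\<^sub>R idm d + sxv \<beta> d x q))/d - g\<bar> < \<delta>))"
proof -
 have b: "0 < b" using \<beta> by (simp add: b_def)
 have a: "0 < a" using exp_lower_Taylor_quadratic[of b] b zero_less_power[of b 2] unfolding a_def by linarith
 define \<phi> where "\<phi> = 1/(t*g) - 1"
 define C where "C = 300000000*exp (28*(2*b))*(b*X)^4"
 have tg0: "0 < t*g" using t g by simp
 have "1*(t*g*1) <= (1 + b*t*g^2)*(t*g*(1 + a*g))"
  using t g a b by (intro mult_mono) auto
 \<comment> \<open>This makes \<open>\<phi> = 1/(t*g) - 1\<close> nonnegative, as the exchange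
   requires.\<close>
 then have tg: "t*g <= 1" using eq by simp
 have \<phi>: "0 <= \<phi>" "1/(1 + \<phi>) = t*g" using tg tg0 by (auto simp: \<phi>_def)
 define k where "k = t*g*b"
 have k: "0 < k" using tg0 b by (simp add: k_def)
 have C: "0 <= C" by (simp add: C_def)
 have \<delta>2: "0 < \<delta>/2" using \<delta> by simp
 obtain e :: real where e: "0 < e" and
  ev: "EV d. \<forall>(N :: (nat => real) measure) X' S. row_law N d X' C --> upb d S (a + b*X) -->
  (\<forall>M (c::real). upb d M c --> \<bar>(\<integral>r. bil d (X' r) M (X' r) \<partial>N) - trc d (S*M)\<bar> <= e*d*c) -->
  \<bar>trc d (S*dres d t \<phi> S)/d - \<phi>\<bar> <= e -->
  whp (PiM {..<d} (%_. N)) \<rho> (%x. \<bar>trc d (minv d (t *\<^sub>R idm d + sw d (%i. X' (x i))))/d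
   - trc d (dres d t \<phi> S)/d\<bar> < \<delta>/2)"
  using swap_limit[where 'r="nat => real", OF C t \<phi>(1) \<delta>2 \<rho>, of "a + b*X"] by (elim exE conjE) (rule that)
 define \<epsilon> where "\<epsilon> = min (min 1 (e/2)) (min (e*(g*k)) (\<delta>/2*k))"
 have \<epsilon>: "0 < \<epsilon>" "\<epsilon> <= e/2" "\<epsilon> <= 1" "\<epsilon>/(g*k) <= e" "\<epsilon>/k <= \<delta>/2"
  using e \<delta> k g by (auto simp: \<epsilon>_def pos_divide_le_eq)
 have "(%d. a*(1/real d)) \<longlonglongrightarrow> a*0" by (intro tendsto_intros; real_asymp)
 then have "EV d. a*(1/real d) < e/2" using e by (intro order_tendstoD) auto
 with ev have "EV d. \<forall>x. good_keys \<beta> \<epsilon> X d x -->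
   \<bar>trc d (minv d (((1/g + a)/b) *\<^sub>R idm d + gm d (cproj d) (colm x)))/d - b*t*g^2\<bar> <= \<epsilon> -->
   whp (rws d) \<rho> (%q. \<bar>trc d (minv d (t *\<^sub>R idm d + sxv \<beta> d x q))/d - g\<bar> < \<delta>)"
 proof eventually_elim
  case (elim d)
  show ?case
  proof (intro allI impI)
   fix x
   assume K: "good_keys \<beta> \<epsilon> X d x" and
    m: "\<bar>trc d (minv d (((1/g + a)/b) *\<^sub>R idm d + gm d (cproj d) (colm x)))/d - b*t*g^2\<bar> <= \<epsilon>"
   interpret K: good_keys \<beta> \<epsilon> X d x by fact
   define t' where "t' = (1/g + a)/b"
   define Y where "Y = t' *\<^sub>R idm d + K.G"
   define S where "S = a *\<^sub>R idm d + b *\<^sub>R K.G"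
   define m where "m = trc d (minv d Y)/d"
   have m: "\<bar>m - b*t*g^2\<bar> <= \<epsilon>" using m by (simp add: m_def Y_def t'_def)
   have dd: "0 < real d" using K.d by simp
   have G: "psd d K.G" by (rule psd_sw)
   have t': "0 < t'" "b*t' = 1/g + a" using a b g by (simp_all add: t'_def add_pos_pos)
   have pY: "pdef d Y" unfolding Y_def
    by (rule pdef_add_psd[OF pdefI[of _ _ t'] G]) (use t' in \<open>auto simp: bil_scaleR bil_idm\<close>)
   have SY: "S = (a - b*t') *\<^sub>R idm d - (- b) *\<^sub>R Y" by (simp add: S_def Y_def algebra_simps)
   have "k*t' = t*g*(b*t')" by (simp add: k_def)
   also have "... = t + t*g*a" unfolding t'(2) using g by (simp add: field_simps)
   finally have A0: "t *\<^sub>R idm d + (1/(1 + \<phi>)) *\<^sub>R S = k *\<^sub>R Y"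
    unfolding \<phi>(2) by (simp add: S_def Y_def scaleR_add_right k_def add.assoc[symmetric] scaleR_add_left[symmetric])
   have 1: "trc d (minv d (k *\<^sub>R Y))/d - g = (m - b*t*g^2)/k"
    unfolding minv_scaleR[OF pY k] using k g t b by (simp add: trc_scaleR m_def k_def field_simps power2_eq_square)
   have "trc d (S*minv d (k *\<^sub>R Y))/d = (- (1/g)*m + b)/k"
    unfolding SY trc_resolvent_product[OF pY k] using dd t' by (simp add: m_def diff_divide_distrib mult_ac)
   also have "... - \<phi> = - ((m - b*t*g^2)/(g*k))"
    using k g t b by (simp add: \<phi>_def k_def field_simps power2_eq_square)
   finally have 2: "trc d (S*minv d (k *\<^sub>R Y))/d - \<phi> = - ((m - b*t*g^2)/(g*k))" .
   have "\<bar>m - b*t*g^2\<bar>/k <= \<epsilon>/k" "\<bar>m - b*t*g^2\<bar>/(g*k) <= \<epsilon>/(g*k)"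
    using m k g by (auto intro!: divide_right_mono)
   then have 3: "\<bar>trc d (minv d (k *\<^sub>R Y))/d - g\<bar> <= \<delta>/2" "\<bar>trc d (S*minv d (k *\<^sub>R Y))/d - \<phi>\<bar> <= e"
    unfolding 1 2 abs_minus_cancel abs_divide using \<epsilon> k g by (simp_all only: abs_of_pos mult_pos_pos)
   have "whp (PiM {..<d} (%_. gauss d)) \<rho> (%q. \<bar>trc d (minv d (t *\<^sub>R idm d + sxv \<beta> d x q))/d
    - trc d (dres d t \<phi> S)/d\<bar> < \<delta>/2)"
   proof (rule elim(1)[rule_format])
    show "row_law (gauss d) d (xv \<beta> d x) C" using K.row_law_xv by (simp add: C_def b_def)
    show "upb d S (a + b*X)"
     using K.G_upb a b G unfolding upb_def S_def
     by (auto intro!: psd_add psd_scaleR psd_idm simp: bil_add bil_scaleR bil_idm distrib_right mult.assoc)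
    show "\<bar>trc d (S*dres d t \<phi> S)/d - \<phi>\<bar> <= e" using 3 by (simp only: A0)
    fix M and c :: real assume M: "upb d M c"
    have "a/d = a*(1/d)" by simp
    then have "\<epsilon> + a/d <= e" using \<epsilon>(2) elim(2) by linarith
    then have "(\<epsilon> + a/d)*(d*c) <= e*(d*c)"
     using M by (intro mult_right_mono) (auto simp: upb_def)
    then show "\<bar>(\<integral>r. bil d (xv \<beta> d x r) M (xv \<beta> d x r) \<partial>gauss d) - trc d (S*M)\<bar> <= e*d*c"
     using K.mean_lower[OF M] by (simp add: S_def a_def b_def K.a_def mult.assoc)
   qed
   then show "whp (rws d) \<rho> (%q. \<bar>trc d (minv d (t *\<^sub>R idm d + sxv \<beta> d x q))/d - g\<bar> < \<delta>)"
    unfolding rows_def A0 by (rule whp_mono) (use 3(1) in linarith)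
  qed
 qed
 with \<epsilon>(1,3) show ?thesis by blast
qed

lemma whp_le: "whp N \<eta> P ==> \<eta> <= \<eta>' ==> whp N \<eta>' P"
 unfolding whp_def by (meson order_trans)

lemma whp_distr:
 assumes "f \<in> measurable M N" "whp (distr M N f) \<eta> P" shows "whp M \<eta> (%x. P (f x))"
proof -
 obtain B where B: "B \<in> sets N" "measure (distr M N f) B <= \<eta>" "\<forall>x\<in>space N - B. P x"
  using assms(2) by (auto simp: whp_def)
 then show ?thesis using assms(1) measurable_space[OF assms(1)]
  by (intro whpI[of "f -` B \<inter> space M"]) (auto simp: measure_distr)
qed

lemma whp_row: "finite I ==> i \<in> I ==> whp (gauss d) \<eta> P ==> whp (rows I d) \<eta> (%q. P (q i))"
 unfolding rows_def
 by (rule whp_distr[where N="gauss d"]) (auto simp: distr_PiM_component[where M="%_. gauss d"] prob_space_gauss)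

text \<open>The normalisation of row \<open>i\<close> is a constant plus this linear form. Its
  eighth moment is of order \<open>d^4\<close>, so it exceeds \<open>\<epsilon> d\<close> with
  probability of order \<open>1/d^4\<close>, and the union over \<open>d\<close> rows still
  vanishes.\<close>

lemma row_sums:
 fixes \<beta> \<delta> X \<epsilon> \<rho> :: real
 assumes "0 < \<epsilon>" "0 < \<rho>"
 shows "EV d. \<forall>x. good_keys \<beta> \<delta> X d x -->
  whp (rws d) \<rho> (%q. \<forall>i<d. \<bar>ip d (%j. exp (\<beta>^2*(ip d (x j) (x j)/d)/2)) (zv d (sc \<beta> d x) (q i))\<bar> < \<epsilon>*d)"
proof -
 let ?b = "\<beta>^2"
 define C where "C = 2000000*exp (28*(2*?b))*(?b*X)^4*exp (2*?b)^4/\<epsilon>^8"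
 have "(%d. C*(1/real d^3)) \<longlonglongrightarrow> C*0" by (intro tendsto_intros; real_asymp)
 then have "EV d. C*(1/real d^3) < \<rho>" using assms by (intro order_tendstoD) auto
 then show ?thesis
 proof eventually_elim
  case (elim d)
  show ?case
  proof (intro allI impI)
   fix x assume "good_keys \<beta> \<delta> X d x"
   then interpret good_keys \<beta> \<delta> X d x .
   let ?T = "%j. exp (b*(ip d (x j) (x j)/d)/2)" let ?f = "%q. ip d ?T (zv d (sc \<beta> d x) q)"
   have dd: "0 < real d" using d by simp
   have "ip d ?T ?T <= (\<Sum>j<d. exp (2*b))"
    unfolding ip_def[of d ?T]
   proof (intro sum_mono)
    fix j assume "j \<in> {..<d}"
    then have "ip d (x j) (x j)/d <= 2" using diag[of j] \<delta> by auto
    then have "b*(ip d (x j) (x j)/d) <= b*2" by (rule mult_left_mono) simp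
    then show "?T j*?T j <= exp (2*b)" by (simp flip: exp_add)
   qed
   then have T: "ip d ?T ?T^4 <= (d*exp (2*b))^4" by (intro power_mono) auto
   have e: "esf d (%q. ?f q^8)" unfolding ip_def by (intro esf_intros esf_zv)
   note i = esf_integrable[OF e]
   have "measure (gauss d) {q \<in> space (gauss d). (\<epsilon>*d)^8 <= ?f q^8} <= (\<integral>q. ?f q^8 \<partial>gauss d)/(\<epsilon>*d)^8"
    by (rule integral_Markov_inequality_measure[OF i, where A = "space (gauss d)"]) (use assms dd in auto)
   also have "... <= 2000000*exp (28*(2*b))*(b*X)^4*(d*exp (2*b))^4/(\<epsilon>*d)^8"
    using assms dd by (intro divide_right_mono order_trans[OF linear_eighth] mult_left_mono T) auto
   also have "... = C/real d^4" using dd assms by (simp add: C_def field_simps eval_nat_numeral)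
   finally have "whp (gauss d) (C/real d^4) (%q. \<bar>?f q\<bar> < \<epsilon>*d)"
   proof (rule whpI[rotated])
    show "{q \<in> space (gauss d). (\<epsilon>*d)^8 <= ?f q^8} \<in> sets (gauss d)"
     using i by (intro borel_measurable_le) auto
    fix q assume "q \<in> space (gauss d)" "q \<notin> {q \<in> space (gauss d). (\<epsilon>*d)^8 <= ?f q^8}"
    then have "\<bar>?f q\<bar>^8 < (\<epsilon>*d)^8" by (simp add: power_even_abs)
    then show "\<bar>?f q\<bar> < \<epsilon>*d" by (rule power_less_imp_less_base) (use assms in simp)
   qed
   then have "whp (rws d) (C/real d^4) (%q. \<bar>?f (q i)\<bar> < \<epsilon>*d)" if "i \<in> {..<d}" for i
    using that by (intro whp_row) auto
   from prob_space.whp_ball[OF prob_space_rows _ this, of "{..<d}" "%i. i"]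
   have w: "whp (rws d) (d*(C/real d^4)) (%q. \<forall>i\<in>{..<d}. \<bar>?f (q i)\<bar> < \<epsilon>*d)" by simp
   have "d*(C/real d^4) <= \<rho>" using elim dd by (simp add: eval_nat_numeral field_simps)
   then show "whp (rws d) \<rho> (%q. \<forall>i<d. \<bar>?f (q i)\<bar> < \<epsilon>*d)"
    by (intro whp_mono[OF whp_le[OF w]]) auto
  qed
 qed
qed

lemma kernel_keys:
 fixes \<beta> \<delta> \<rho> :: real
 assumes \<beta>: "0 < \<beta>" and \<delta>: "0 < \<delta>" and \<rho>: "0 < \<rho>"
 shows "EV d. whp (rws d) \<rho> (%x. (\<forall>j<d. \<bar>ip d (x j) (x j)/d - 1\<bar> <= \<delta>) \<and>
  (\<forall>w. (\<Sum>j<d. w j) = 0 -->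
   \<bar>\<Sum>j<d. \<Sum>l<d. w j*w l*(exp (\<beta>^2*(ip d (x j) (x l)/d)) - 1 - \<beta>^2*(ip d (x j) (x l)/d)
    - (if l = j then exp (\<beta>^2) - 1 - \<beta>^2 else 0))\<bar> <= \<delta>*ip d w w))"
proof -
 have b: "0 < \<beta>^2" using \<beta> by simp
 obtain \<epsilon> :: real and d0 :: nat where \<epsilon>: "0 < \<epsilon>" "0 < d0"
  "\<And>d x j. d0 <= d ==> kstat d x < \<epsilon> ==> j < d ==> \<bar>ip d (x j) (x j)/d - 1\<bar> <= \<delta>"
  "\<And>d x w. d0 <= d ==> kstat d x < \<epsilon> ==> (\<Sum>j<d. w j) = 0 ==>
   \<bar>\<Sum>j<d. \<Sum>l<d. w j*w l*(exp (\<beta>^2*(ip d (x j) (x l)/d)) - 1 - \<beta>^2*(ip d (x j) (x l)/d) - (if l = j then exp (\<beta>^2) - 1 - \<beta>^2 else 0))\<bar> <= \<delta>*ip d w w"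
  by (rule kernel_approximation[OF b \<delta>]) (rule that; blast)
 have "(%d. C6/\<epsilon>*(1/real d)) \<longlonglongrightarrow> C6/\<epsilon>*0" by (intro tendsto_intros; real_asymp)
 then have "EV d. C6/\<epsilon>*(1/real d) < \<rho>" using \<rho> by (intro order_tendstoD) auto
 then show ?thesis using eventually_ge_at_top[of d0]
 proof eventually_elim
  case (elim d)
  then have d: "0 < d" using \<epsilon> by simp
  show ?case
   by (rule whpI[OF kstat_markov(1)[OF d \<epsilon>(1)]])
    (use elim kstat_markov(2)[OF d \<epsilon>(1)] \<epsilon>(3,4) in \<open>auto simp: field_simps not_le\<close>)
 qed
qed

section \<open>The variational formula for the edge\<close>

lemma gbar_exists:
 fixes a b t :: real
 assumes "0 < a" "0 < b" "0 < t"
 shows "\<exists>g>0. (1 + b*t*g^2)*(t*g*(1 + a*g)) = 1"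
proof -
 let ?f = "%g. (1 + b*t*g^2)*(t*g*(1 + a*g))"
 have "1*(1*1) <= ?f (1/t)" using assms by (intro mult_mono) auto
 moreover have "continuous_on {0..1/t} ?f" by (intro continuous_intros)
 ultimately obtain g where g: "0 <= g" "?f g = 1"
  using IVT'[of ?f 0 1 "1/t"] assms by auto
 then have "g ~= 0" by auto
 with g show ?thesis by (intro exI[of _ g]) auto
qed

text \<open>\<open>K_fun\<close> with the first and last summands over a common denominator.\<close>

definition kc :: "real => real => real => real" where "kc a b w = a*w + 1/(w*(1 - b*w^2))"

lemma K_fun_kc: "0 < w ==> \<beta>^2*w^2 < 1 ==> K_fun \<beta> w = kc (exp (\<beta>^2) - 1 - \<beta>^2) (\<beta>^2) w"
 by (simp add: K_fun_def kc_def Let_def divide_simps) (simp add: algebra_simps power2_eq_square)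

text \<open>The derivative \<open>D\<close> is strictly increasing because \<open>- 1/w^2\<close>
  and \<open>b (1 + b w^2)/(1 - b w^2)^2\<close> both increase. So its zero is unique, which gives
  sense to the definite description, and it is the minimum.\<close>

lemma w_star_minimizer:
 fixes \<beta> :: real
 assumes \<beta>: "0 < \<beta>"
 shows "0 < w_star \<beta>" "\<beta>^2*(w_star \<beta>)^2 < 1" "\<And>w. 0 < w ==> \<beta>^2*w^2 < 1 ==> K_fun \<beta> (w_star \<beta>) <= K_fun \<beta> w"
proof -
 define b where "b = \<beta>^2"
 define a where "a = exp b - 1 - b"
 have b: "0 < b" using \<beta> by (simp add: b_def)
 let ?K = "K_fun \<beta>" let ?I = "%w. 0 < w \<and> b*w^2 < 1"
 define D where "D w = - 1/w^2 + a + b*(1 + b*w^2)/(1 - b*w^2)^2" for w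
 have p: "b powr (- 1/2) = 1/\<beta>"
  using \<beta> powr_powr[of \<beta> 2 "- 1/2"] by (simp add: b_def powr_minus_divide flip: powr_numeral)
 moreover have "w < 1/\<beta> \<longleftrightarrow> b*w^2 < 1" if "0 < w" for w
  using \<beta> that abs_square_less_1[of "\<beta>*w"] by (simp add: b_def power_mult_distrib less_divide_eq mult.commute)
 ultimately have I: "(0 < w \<and> w < b powr (- 1/2)) \<longleftrightarrow> ?I w" for w by auto
 have KD: "(?K has_real_derivative D w) (at w)" if "?I w" for w
 proof -
  have "((%w. 1/w + a*w + b*w/(1 - b*w^2)) has_real_derivative
   - 1/w^2 + a + (b*(1 - b*w^2) - b*w*- (b*(2*w)))/((1 - b*w^2)*(1 - b*w^2))) (at w)"
   using that by (auto intro!: derivative_eq_intros simp: power2_eq_square)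
  moreover have "b*(1 - b*w^2) - b*w*- (b*(2*w)) = b*(1 + b*w^2)" by (simp add: algebra_simps power2_eq_square)
  ultimately show ?thesis unfolding K_fun_def[abs_def] Let_def b_def[symmetric] a_def[symmetric] D_def
   by (simp only: power2_eq_square)
 qed
 have mono: "D v < D w" if "?I v" "?I w" "v < w" for v w
 proof -
  have vw: "v^2 < w^2" using that by (intro power_strict_mono) auto
  then have bvw: "b * v^2 < b*w^2" using b by simp
  have "- 1/v^2 < - 1/w^2" using that vw by (simp add: frac_less2)
  moreover have "b*(1 + b * v^2)/(1 - b * v^2)^2 <= b*(1 + b*w^2)/(1 - b*w^2)^2"
   using that b bvw by (intro frac_le mult_left_mono power_mono) auto
  ultimately show ?thesis by (simp add: D_def)
 qed
 \<comment> \<open>\<open>D w\<close> multiplied by \<open>w^2 (1 - b w^2)^2\<close>, free of poles: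
   it is -1 at 0 and 2 at \<open>1/\<beta>\<close>, so it has a zero between them.\<close>
 let ?p = "%w. - ((1 - b*w^2)^2) + a*w^2*(1 - b*w^2)^2 + b*w^2*(1 + b*w^2)"
 have b1: "b*(1/\<beta>)^2 = 1" using \<beta> by (simp add: b_def power_divide)
 have "continuous_on {0..1/\<beta>} ?p" by (intro continuous_intros)
 then obtain w0 where w0: "0 <= w0" "w0 <= 1/\<beta>" "?p w0 = 0"
  using IVT'[of ?p 0 0 "1/\<beta>"] \<beta> b1 by auto
 have "w0 ~= 0" "w0 ~= 1/\<beta>" using w0(3) b1 by (auto simp del: power_divide)
 then have Iw0: "?I w0" using w0 I[of w0] p by auto
 then have "D w0*(w0^2*(1 - b*w0^2)^2) = ?p w0"
  by (simp add: D_def field_simps)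
 then have Dw0: "D w0 = 0" using w0(3) Iw0 by simp
 have uniq: "v = w0" if "?I v" "(?K has_real_derivative 0) (at v)" for v
 proof (rule ccontr)
  have "D v = 0" using DERIV_unique[OF that(2) KD[OF that(1)]] by simp
  moreover assume "v ~= w0"
  ultimately show False
   using mono[OF that(1) Iw0] mono[OF Iw0 that(1)] Dw0 by (cases "v < w0") auto
 qed
 have ws: "w_star \<beta> = w0"
  unfolding w_star_def b_def[symmetric]
 proof (rule the_equality)
  show "0 < w0 \<and> w0 < b powr (- 1/2) \<and> (?K has_real_derivative 0) (at w0)"
   using KD[OF Iw0] Iw0 I[of w0] unfolding Dw0 by blast
  show "v = w0" if "0 < v \<and> v < b powr (- 1/2) \<and> (?K has_real_derivative 0) (at v)" for v
   using that I[of v] by (intro uniq) blast+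
 qed
 show "0 < w_star \<beta>" "\<beta>^2*(w_star \<beta>)^2 < 1" using Iw0 by (auto simp: ws b_def)
 fix w assume w: "0 < w" "\<beta>^2*w^2 < 1"
 then have Iw: "?I w" by (simp add: b_def)
 have Iz: "?I z" if "?I v" "?I v'" "v <= z" "z <= v'" for v v' z
 proof -
  have "z^2 <= v'^2" using that by (intro power_mono) auto
  then have "b*z^2 <= b * v'^2" using b by simp
  then show ?thesis using that by linarith
 qed
 consider "w < w0" | "w = w0" | "w0 < w" by linarith
 then show "?K (w_star \<beta>) <= ?K w"
 proof cases
  case 1
  obtain z where z: "w < z" "z < w0" "?K w0 - ?K w = (w0 - w)*D z"
   using MVT2[OF 1, of ?K D] KD Iz[OF Iw Iw0] by blast
  then have "D z < 0" using mono[OF Iz[OF Iw Iw0] Iw0] Dw0 by simp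
  then have "(w0 - w)*D z <= 0" using 1 by (simp add: mult_nonneg_nonpos)
  then show ?thesis using z by (simp add: ws)
 next
  case 3
  obtain z where z: "w0 < z" "z < w" "?K w - ?K w0 = (w - w0)*D z"
   using MVT2[OF 3, of ?K D] KD Iz[OF Iw0 Iw] by blast
  then have "0 < D z" using mono[OF Iw0 Iz[OF Iw0 Iw]] Dw0 by simp
  then have "0 <= (w - w0)*D z" using 3 by simp
  then show ?thesis using z by (simp add: ws)
 qed (simp add: ws)
qed

text \<open>If the claim failed, some configurations would match the resolvent limit at more and
  more points with a vanishing fraction of eigenvalues above \<open>r\<close>. Dropping those
  eigenvalues leaves transforms holomorphic on a half plane that reaches beyond the edge. A
  normal-family limit satisfies the algebraic equation there, but on the negative axis that equation
  amounts to \<open>kc a b w = 1 / sqrt x\<close>, and \<open>kc\<close> never falls below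
  \<open>k\<close>.\<close>

theorem resolvent_count:
 fixes a b r k :: real and gb :: "real => real"
 assumes a: "0 < a" and b: "0 < b" and r: "0 < r" and k: "0 < k" "r < k^2"
  and K: "\<And>w. 0 < w ==> b*w^2 < 1 ==> k <= kc a b w"
  and gb: "\<And>t. 0 < t ==> (1 + b*t*(gb t)^2)*(t*gb t*(1 + a*gb t)) = 1"
 obtains c \<epsilon> T where "0 < c" "0 < \<epsilon>" "finite T" "\<And>t. t \<in> T ==> 0 < t"
  "\<And>n \<mu>. 0 < n ==> (\<And>i. i < n ==> 0 <= \<mu> i) ==> (\<And>t. t \<in> T ==> \<bar>(\<Sum>i<n. 1/(t + \<mu> i))/real n - gb t\<bar> < \<epsilon>) ==>
   c*real n <= real (count_gt n r \<mu>)"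
proof (rule ccontr)
 let ?e = "%N::nat. 1/real (Suc N)"
 assume no: "\<not> thesis"
 \<comment> \<open>The transform is taken in the variable \<open>1/t\<close>. The points
   \<open>s j\<close> accumulate at 1 inside the domain, which is enough for the identity
   theorem.\<close>
 define s where "s j = 1 + 1/real (Suc j)" for j
 have s: "1 < s j" and s0: "0 < s j" for j by (simp_all add: s_def add_pos_pos)
 define R where "R N n \<mu> \<longleftrightarrow> 0 < n \<and> (\<forall>i<n. 0 <= \<mu> i) \<and> (\<forall>j\<le>N. \<bar>(\<Sum>i<n. 1/(1/s j + \<mu> i))/real n - gb (1/s j)\<bar> < ?e N) \<and>
   real (count_gt n r \<mu>) < ?e N*real n" for N n and \<mu> :: "nat => real"
 have "\<exists>n \<mu>. R N n \<mu>" for N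
 proof (rule ccontr)
  assume c: "\<not> ?thesis"
  have thesis
  proof (rule that[of "?e N" "?e N" "(%j. 1/s j) ` {..N}"])
   fix m \<nu> assume h: "0 < m" "\<And>i. i < m ==> 0 <= \<nu> i"
    "\<And>t. t \<in> (%j. 1/s j) ` {..N} ==> \<bar>(\<Sum>i<m. 1/(t + \<nu> i))/real m - gb t\<bar> < ?e N"
   show "?e N*real m <= real (count_gt m r \<nu>)"
   proof (rule ccontr)
    assume "\<not> ?thesis"
    then have "real (count_gt m r \<nu>) < ?e N*real m" by simp
    moreover have "\<forall>j\<le>N. \<bar>(\<Sum>i<m. 1/(1/s j + \<nu> i))/real m - gb (1/s j)\<bar> < ?e N"
     using h(3) by blast
    ultimately have "R N m \<nu>" unfolding R_def using h(1,2) by simp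
    with c show False by blast
   qed
  next
   show "0 < t" if "t \<in> (%j. 1/s j) ` {..N}" for t using that s0 by auto
  qed auto
  with no show False by contradiction
 qed
 then obtain n \<mu> where R: "\<And>N. R N (n N) (\<mu> N)" by metis
 have n: "\<And>N. 0 < n N" and \<mu>: "\<And>N i. i < n N ==> 0 <= \<mu> N i"
  and cl: "\<And>N j. j <= N ==> \<bar>(\<Sum>i<n N. 1/(1/s j + \<mu> N i))/real (n N) - gb (1/s j)\<bar> < ?e N"
  and cd: "\<And>N. real (card {i. i < n N \<and> r < \<mu> N i}) < ?e N*real (n N)"
  using R unfolding R_def by blast+
 define A where "A N = {i. i < n N \<and> \<mu> N i <= r}" for N
 have fA: "finite (A N)" "A N \<subseteq> {..<n N}" for N by (auto simp: A_def)
 \<comment> \<open>Only eigenvalues at most \<open>r\<close> are kept, but the sum is divided by the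
   full \<open>n N\<close>. The poles lie to the left of \<open>- 1/r\<close>, outside the half
   plane \<open>\<Omega>\<close>.\<close>
 define h where "h N z = (\<Sum>i\<in>A N. 1/(1 + z*complex_of_real (\<mu> N i)))/of_nat (n N)" for N z
 define \<Omega> where "\<Omega> = {z. - 1/r < Re z}"
 have pos: "z \<in> \<Omega>" if "0 <= Re z" for z
 proof -
  have "- 1/r < 0" using r by simp
  then show ?thesis unfolding \<Omega>_def mem_Collect_eq using that by (rule less_le_trans)
 qed
 have \<Omega>: "open \<Omega>" "connected \<Omega>" unfolding \<Omega>_def
  by (auto intro!: convex_connected convex_halfspace_Re_gt open_halfspace_Re_gt)
 have re: "min 1 (1 + r*m) <= Re (1 + z*complex_of_real (\<mu> N i))" if "i \<in> A N" "m <= Re z" for N i z m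
 proof -
  have u: "0 <= \<mu> N i" "\<mu> N i <= r" using that \<mu> by (auto simp: A_def)
  have "\<mu> N i*m <= \<mu> N i * Re z" using u that by (intro mult_left_mono)
  moreover have "min 0 (r*m) <= \<mu> N i*m" using u
   by (cases "0 <= m") (auto simp: min_le_iff_disj mult_right_mono_neg)
  ultimately show ?thesis by (auto simp: mult.commute min_def split: if_splits)
 qed
 have nz: "1 + z*complex_of_real (\<mu> N i) ~= 0" if "i \<in> A N" "z \<in> \<Omega>" for N i z
 proof -
  have "0 < 1 + r * Re z" using that r by (simp add: \<Omega>_def field_simps)
  then have "0 < Re (1 + z*complex_of_real (\<mu> N i))" using re[OF that(1) order_refl, of z] by linarith
  then show ?thesis by (metis less_irrefl zero_complex.sel(1))
 qed
 have hol: "h N holomorphic_on \<Omega>" for N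
  unfolding h_def by (intro holomorphic_intros) (use nz n in auto)
 have bdd: "\<exists>B. \<forall>f\<in>range h. \<forall>z\<in>L. norm (f z) <= B" if L: "compact L" "L \<subseteq> \<Omega>" for L
 proof (cases "L = {}")
  case False
  obtain z0 where z0: "z0 \<in> L" "\<And>z. z \<in> L ==> Re z0 <= Re z"
   using continuous_attains_inf[OF L(1) False continuous_on_Re[OF continuous_on_id]] by auto
  define c where "c = min 1 (1 + r * Re z0)"
  have c: "0 < c" using z0(1) L r by (auto simp: c_def \<Omega>_def field_simps)
  have "norm (h N z) <= 1/c" if z: "z \<in> L" for N z
  proof -
   have "norm (1/(1 + z*complex_of_real (\<mu> N i))) <= 1/c" if "i \<in> A N" for i
   proof -
    have "c <= norm (1 + z*complex_of_real (\<mu> N i))"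
     using re[OF that z0(2)[OF z]] complex_Re_le_cmod order_trans unfolding c_def by blast
    then show ?thesis using c by (simp add: norm_divide frac_le)
   qed
   then have "norm (\<Sum>i\<in>A N. 1/(1 + z*complex_of_real (\<mu> N i))) <= real (card (A N))*(1/c)"
    by (rule sum_norm_bound)
   also have "... <= real (n N)*(1/c)"
    using c card_mono[OF _ fA(2)[of N]] by (intro mult_right_mono) auto
   finally show ?thesis using n[of N] by (simp add: h_def norm_divide field_simps)
  qed
  then show ?thesis by blast
 qed auto
 obtain H \<rho> where H: "H holomorphic_on \<Omega>" "strict_mono (\<rho> :: nat => nat)" "\<And>z. z \<in> \<Omega> ==> (%N. h (\<rho> N) z) \<longlonglongrightarrow> H z"
 proof (rule Montel[OF \<Omega>(1), of "range h" h])
  show "f holomorphic_on \<Omega>" if "f \<in> range h" for f using that hol by auto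
  fix g and r' :: "nat => nat"
  assume "g holomorphic_on \<Omega>" "strict_mono r'" "\<And>z. z \<in> \<Omega> ==> (%N. h (r' N) z) \<longlonglongrightarrow> g z"
  then show thesis by (rule that)
 qed (use bdd in auto)
 have lim0: "(%N. 1/real (Suc (\<rho> N))) \<longlonglongrightarrow> 0"
  by (rule LIMSEQ_subseq_LIMSEQ[OF LIMSEQ_Suc[OF lim_1_over_n] H(2), unfolded o_def])
 have AB: "{..<n N} = A N \<union> {i. i < n N \<and> r < \<mu> N i}" "A N \<inter> {i. i < n N \<and> r < \<mu> N i} = {}" for N
  by (auto simp: A_def)
 have eB: "real (card {i. i < n N \<and> r < \<mu> N i})/n N < ?e N" for N
  using cd[of N] n[of N] by (simp only: pos_divide_less_eq of_nat_0_less_iff)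
 have cA: "1 - ?e N <= card (A N)/n N" for N
 proof -
  have "card {..<n N} = card (A N) + card {i. i < n N \<and> r < \<mu> N i}"
   unfolding AB(1) by (rule card_Un_disjoint[OF fA(1) _ AB(2)]) simp
  then have c: "n N = card (A N) + card {i. i < n N \<and> r < \<mu> N i}" by simp
  note eB[of N]
  moreover have "real (card (A N))/n N + real (card {i. i < n N \<and> r < \<mu> N i})/n N = 1"
   using n[of N] c by (simp flip: add_divide_distrib of_nat_add)
  ultimately show ?thesis by linarith
 qed
 \<comment> \<open>Since \<open>1/(1 + s \<mu>) = (1/(t + \<mu>))/s\<close> for
   \<open>t = 1/s\<close>, the limit is \<open>gb (1/s)/s\<close>. Each omitted term lies between 0
   and 1 and their fraction tends to 0.\<close>
 have Hs: "H (of_real (s j)) = of_real (gb (1/s j)/s j)" for j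
 proof (rule LIMSEQ_unique[OF H(3)])
  show "of_real (s j) \<in> \<Omega>" using s0[of j] by (intro pos) simp
  have nb: "norm (h N (of_real (s j)) - of_real (gb (1/s j)/s j)) <= 2*(?e N)" if "j <= N" for N
  proof -
   let ?B = "{i. i < n N \<and> r < \<mu> N i}"
   let ?f = "%i. 1/(1 + s j*\<mu> N i)"
   have f: "?f i = 1/(1/s j + \<mu> N i)/s j" for i
   proof -
    have "(1/s j + \<mu> N i) * s j = 1 + s j*\<mu> N i" unfolding distrib_right using s[of j] by simp
    then show ?thesis by (simp only: divide_divide_eq_left)
   qed
   have h: "h N (of_real (s j)) = of_real ((\<Sum>i\<in>A N. ?f i)/n N)" by (simp add: h_def)
   have "(\<Sum>i<n N. ?f i) = (\<Sum>i\<in>A N. ?f i) + (\<Sum>i\<in>?B. ?f i)"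
    using sum.union_disjoint[OF fA(1)[of N] _ AB(2), of ?f] AB(1)[of N] by simp
   moreover have "(\<Sum>i<n N. ?f i)/n N = (\<Sum>i<n N. 1/(1/s j + \<mu> N i))/n N/s j"
    unfolding f sum_divide_distrib[symmetric] by simp
   moreover have "0 <= (\<Sum>i\<in>?B. ?f i)/n N" "(\<Sum>i\<in>?B. ?f i)/n N <= ?e N"
   proof -
    have f01: "0 <= ?f i" "?f i <= 1" if "i \<in> ?B" for i
    proof -
     have "0 <= s j*\<mu> N i" using \<mu>[of i N] that s0[of j] by (intro mult_nonneg_nonneg) auto
     then show "0 <= ?f i" "?f i <= 1" by simp_all
    qed
    then show "0 <= (\<Sum>i\<in>?B. ?f i)/n N" by (intro divide_nonneg_nonneg sum_nonneg) auto
    have "(\<Sum>i\<in>?B. ?f i) <= real (card ?B)*1" by (rule sum_bounded_above) (rule f01(2))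
    then have "(\<Sum>i\<in>?B. ?f i)/n N <= real (card ?B)/n N" by (intro divide_right_mono) auto
    also have "... <= ?e N" by (rule less_imp_le[OF eB])
    finally show "(\<Sum>i\<in>?B. ?f i)/n N <= ?e N" .
   qed
   moreover have "\<bar>(\<Sum>i<n N. 1/(1/s j + \<mu> N i))/n N/s j - gb (1/s j)/s j\<bar> <= ?e N"
   proof -
    have "\<bar>(\<Sum>i<n N. 1/(1/s j + \<mu> N i))/n N/s j - gb (1/s j)/s j\<bar>
     = \<bar>(\<Sum>i<n N. 1/(1/s j + \<mu> N i))/n N - gb (1/s j)\<bar>/s j"
     unfolding diff_divide_distrib[symmetric] abs_divide using s0[of j] by simp
    also have "... <= (?e N)/1" using cl[OF that] s[of j] by (intro frac_le) auto
    finally show ?thesis by simp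
   qed
   ultimately have "\<bar>(\<Sum>i\<in>A N. ?f i)/n N - gb (1/s j)/s j\<bar> <= ?e N + ?e N"
    by (simp only: add_divide_distrib)
   then show ?thesis unfolding h of_real_diff[symmetric] norm_of_real by simp
  qed
  then have "EV N. norm (h (\<rho> N) (of_real (s j)) - of_real (gb (1/s j)/s j)) <= 2*(1/real (Suc (\<rho> N)))"
   by (intro eventually_sequentiallyI[of j] nb) (rule order_trans[OF _ seq_suble[OF H(2)]])
  moreover have "(%N. 2*(1/real (Suc (\<rho> N)))) \<longlonglongrightarrow> 0" using tendsto_mult_right_zero[OF lim0, of 2] by simp
  ultimately have "(%N. h (\<rho> N) (of_real (s j)) - of_real (gb (1/s j)/s j)) \<longlonglongrightarrow> 0"
   by (rule Lim_null_comparison)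
  then show "(%N. h (\<rho> N) (of_real (s j))) \<longlonglongrightarrow> of_real (gb (1/s j)/s j)" by (rule LIM_zero_cancel)
 qed
 \<comment> \<open>The equation of \<open>gb\<close> rewritten for \<open>H z = gb (1/z)/z\<close>;
   it is polynomial in \<open>z\<close> and \<open>H z\<close>, so it continues
   analytically.\<close>
 define F where "F z = (1 + b*z*(H z)^2)*(H z*(1 + a*z*H z)) - 1" for z :: complex
 have F0: "F z = 0" if "z \<in> \<Omega>" for z
 proof (rule analytic_continuation[OF _ \<Omega>, of F "range (%j. complex_of_real (s j))" 1])
  show "F holomorphic_on \<Omega>" unfolding F_def by (intro holomorphic_intros H)
  show "range (%j. complex_of_real (s j)) \<subseteq> \<Omega>" by (intro image_subsetI pos) (simp add: less_imp_le[OF s0])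
  show "1 \<in> \<Omega>" by (rule pos) simp
  show "1 islimpt range (%j. complex_of_real (s j))"
   unfolding islimpt_sequential
  proof (intro exI conjI allI)
   show "complex_of_real (s j) \<in> range (%j. complex_of_real (s j)) - {1}" for j
    using s[of j] of_real_eq_1_iff[of "s j", where 'a=complex] by auto
   have "s \<longlonglongrightarrow> 1 + 0" unfolding s_def by (intro tendsto_intros LIMSEQ_Suc[OF lim_1_over_n])
   then show "(%j. complex_of_real (s j)) \<longlonglongrightarrow> 1" using tendsto_of_real[of s 1] by simp
  qed
  fix z assume "z \<in> range (%j. complex_of_real (s j))"
  then obtain j where j: "z = of_real (s j)" by blast
  have "(1 + b * s j*(gb (1/s j)/s j)^2)*(gb (1/s j)/s j*(1 + a * s j*(gb (1/s j)/s j))) = 1"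
   using gb[of "1/s j"] s[of j] by (simp add: power2_eq_square)
  from arg_cong[OF this, of complex_of_real]
  show "F z = 0" unfolding F_def j Hs by (simp only: of_real_add of_real_mult of_real_power of_real_1) simp
 qed (rule that)
 define y where "y x = Re (H (of_real (- x)))" for x
 have in\<Omega>: "complex_of_real (- x) \<in> \<Omega>" if "x < 1/r" for x using that by (simp add: \<Omega>_def)
 \<comment> \<open>On \<open>[0, 1/r)\<close> each retained denominator \<open>1 - x \<mu>\<close>
   lies in \<open>(0, 1]\<close>. Hence the limit is real and, as almost all eigenvalues are
   retained, at least 1.\<close>
 have y: "H (of_real (- x)) = of_real (y x)" "1 <= y x" if x: "0 <= x" "x < 1/r" for x
 proof -
  have hr: "h N (of_real (- x)) = of_real ((\<Sum>i\<in>A N. 1/(1 - x*\<mu> N i))/n N)" for N by (simp add: h_def)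
  have "1 - ?e N <= (\<Sum>i\<in>A N. 1/(1 - x*\<mu> N i))/n N" for N
  proof (rule order_trans[OF cA divide_right_mono])
   have "1 <= 1/(1 - x*\<mu> N i)" if "i \<in> A N" for i
   proof -
    have "x*\<mu> N i <= x*r" using that x by (intro mult_left_mono) (auto simp: A_def)
    also have "... < 1" using x r by (simp add: field_simps)
    finally have "x*\<mu> N i < 1" .
    moreover have "0 <= x*\<mu> N i" using that x \<mu> by (auto simp: A_def)
    ultimately show ?thesis by simp
   qed
   then have "of_nat (card (A N))*1 <= (\<Sum>i\<in>A N. 1/(1 - x*\<mu> N i))" by (rule sum_bounded_below)
   then show "real (card (A N)) <= (\<Sum>i\<in>A N. 1/(1 - x*\<mu> N i))" by simp
  qed simp
  then have ge: "1 - ?e N <= Re (h N (of_real (- x)))" for N unfolding hr by simp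
  have lim: "(%N. h (\<rho> N) (of_real (- x))) \<longlonglongrightarrow> H (of_real (- x))" by (rule H(3)[OF in\<Omega>[OF x(2)]])
  have "(%N. Im (h (\<rho> N) (of_real (- x)))) \<longlonglongrightarrow> Im (H (of_real (- x)))" by (rule tendsto_Im[OF lim])
  then have "Im (H (of_real (- x))) = 0" unfolding hr by (simp add: LIMSEQ_const_iff)
  then show "H (of_real (- x)) = of_real (y x)" by (simp add: y_def complex_eq_iff)
  have "(%N. 1 - 1/real (Suc (\<rho> N))) \<longlonglongrightarrow> 1 - 0" by (intro tendsto_intros lim0)
  then show "1 <= y x" unfolding y_def using LIMSEQ_le[OF _ tendsto_Re[OF lim], of _ "1 - 0"] ge by auto
 qed
 have eq: "(1 - b*x*(y x)^2)*(y x*(1 - a*x*y x)) = 1" if x: "0 <= x" "x < 1/r" for x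
 proof -
  have "F (of_real (- x)) = 0" by (rule F0[OF in\<Omega>[OF x(2)]])
  then have "complex_of_real ((1 - b*x*(y x)^2)*(y x*(1 - a*x*y x))) = of_real 1"
   unfolding F_def y(1)[OF x] by simp
  then show ?thesis by (simp only: of_real_eq_iff)
 qed
 \<comment> \<open>Any point strictly between \<open>1/k^2\<close> and \<open>1/r\<close> would do;
   the interval is nonempty because \<open>r < k^2\<close>.\<close>
 define \<sigma> where "\<sigma> = (1/k^2 + 1/r)/2"
 have \<sigma>: "1/k^2 < \<sigma>" "\<sigma> < 1/r" "0 < \<sigma>" using k r by (auto simp: \<sigma>_def field_simps add_pos_pos)
 \<comment> \<open>The function \<open>b x (y x)^2\<close> is continuous, starts at 0 and never
   takes the value 1, where the equation would read \<open>0 = 1\<close>.\<close>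
 have lt: "b*\<sigma>*(y \<sigma>)^2 < 1"
 proof (rule ccontr)
  assume "\<not> b*\<sigma>*(y \<sigma>)^2 < 1"
  moreover have cy: "continuous_on {0..\<sigma>} y" unfolding y_def
  proof (intro continuous_on_Re continuous_on_compose2[OF holomorphic_on_imp_continuous_on[OF H(1)]] continuous_intros)
   show "(%x. complex_of_real (- x)) ` {0..\<sigma>} \<subseteq> \<Omega>" using in\<Omega> \<sigma> by force
  qed
  moreover from cy have "continuous_on {0..\<sigma>} (%x. b*x*(y x)^2)" by (intro continuous_intros)
  ultimately obtain x where x: "0 <= x" "x <= \<sigma>" "b*x*(y x)^2 = 1"
   using IVT'[of "%x. b*x*(y x)^2" 0 1 \<sigma>] \<sigma> by auto
  then show False using eq[of x] \<sigma> by simp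
 qed
 define q where "q = sqrt \<sigma>"
 \<comment> \<open>With \<open>q = sqrt \<sigma>\<close> this substitution turns the equation into
   \<open>q * kc a b w = 1\<close>, while \<open>\<sigma> > 1/k^2\<close> forces
   \<open>1/q < k\<close>.\<close>
 define w where "w = q*y \<sigma>"
 have q: "0 < q" "\<sigma> = q*q" using \<sigma> by (auto simp: q_def)
 have w: "0 < w" using q y(2)[of \<sigma>] \<sigma> by (simp add: w_def)
 have w1: "b*w^2 < 1" using lt q by (simp add: w_def power2_eq_square mult_ac)
 have "(1 - b*w^2)*(w*(1 - a*q*w)) = q*((1 - b*\<sigma>*(y \<sigma>)^2)*(y \<sigma>*(1 - a*\<sigma>*y \<sigma>)))"
  unfolding w_def q(2) by (simp add: power2_eq_square algebra_simps)
 then have "(1 - b*w^2)*(w*(1 - a*q*w)) = q" using eq[of \<sigma>] \<sigma> by simp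
 moreover define m where "m = w*(1 - b*w^2)"
 ultimately have "m*(1 - a*q*w) = q" by (simp add: mult_ac)
 then have "m = q*(a*w*m + 1)" by (simp add: algebra_simps)
 moreover have nz: "m ~= 0" using w w1 by (simp add: m_def)
 moreover have "kc a b w*m = a*w*m + 1" using nz by (simp add: kc_def m_def distrib_right)
 ultimately have "m = q*kc a b w*m" by (metis mult.assoc)
 then have "q*kc a b w = 1" using nz by simp
 then have "k*q <= 1" using mult_right_mono[OF K[OF w w1], of q] q by (simp add: mult.commute)
 then have "k <= 1/q" using q by (simp add: field_simps)
 then have "k^2 <= (1/q)^2" using k by (intro power_mono) auto
 also have "... = 1/\<sigma>" using q by (simp add: power_divide power2_eq_square)
 finally show False using \<sigma> k by (simp add: field_simps)
qed

section \<open>Singular values and eigenvalue counts\<close>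

definition eig :: "nat => fmat => (nat => nat => real) => (nat => real) => bool" where
 "eig d W e \<mu> \<longleftrightarrow> symm d W \<and> orthonormal d d e \<and> (\<forall>i<d. \<forall>k. mv d W (e i) k = \<mu> i*e i k)"

lemma eig_exists: "symm d W ==> \<exists>e \<mu>. eig d W e \<mu>"
 using spectral_theorem[of d W] unfolding eig_def by metis

lemma eig_decomposition: "eig d W e \<mu> ==> W = (\<Sum>i<d. \<mu> i *\<^sub>R outer d (e i) (e i))"
 by (rule spectral_decomposition) (auto simp: eig_def)

lemma eig_nonneg: "eig d W e \<mu> ==> psd d W ==> i < d ==> 0 <= \<mu> i"
 using eigen_bil[of d e W \<mu> i] psdD[of d W "e i"] by (simp add: eig_def)

lemma idm_orthonormal: "orthonormal d d e ==> idm d = (\<Sum>i<d. outer d (e i) (e i))"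
 by (rule indim_eqI[of d]) (auto simp: ent_sum ent_outer ent_idm orthonormal_complete)

lemma parseval: "orthonormal d d e ==> ip d x x = (\<Sum>i<d. (ip d (e i) x)^2)"
 using idm_orthonormal[of d e] bil_idm[of d x x]
 by (simp add: bil_sum bil_outer power2_eq_square ip_comm[of d x "e _"])

lemma bil_eig: "eig d W e \<mu> ==> bil d x W x = (\<Sum>i<d. \<mu> i*(ip d (e i) x)^2)"
 by (subst eig_decomposition, assumption)
  (simp add: bil_sum bil_scaleR bil_outer power2_eq_square ip_comm[of d x "e _"])

lemma trc_orthonormal: "orthonormal d d e ==> indim d A ==> trc d A = (\<Sum>i<d. bil d (e i) A (e i))"
proof -
 assume e: "orthonormal d d e" and A: "indim d A"
 have "trc d A = trc d (A*(\<Sum>i<d. outer d (e i) (e i)))" using A by (simp flip: idm_orthonormal[OF e])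
 then show ?thesis using A by (simp add: sum_distrib_left trc_sum trc_outer)
qed

lemma trc_resolvent:
 assumes W: "eig d W e \<mu>" "psd d W" and t: "0 < t"
 shows "trc d (minv d (t *\<^sub>R idm d + W)) = (\<Sum>i<d. 1/(t + \<mu> i))"
proof -
 have o: "orthonormal d d e" using W by (simp add: eig_def)
 let ?A = "t *\<^sub>R idm d + W"
 have p: "pdef d ?A" by (rule pdef_add_psd[OF pdefI[of _ _ t] W(2)]) (use t in \<open>auto simp: bil_scaleR bil_idm\<close>)
 have "bil d (e i) (minv d ?A) (e i) = 1/(t + \<mu> i)" if i: "i < d" for i
 proof -
  have "bil d (e i) (minv d ?A*?A) (e i) = bil d (e i) (minv d ?A) (mv d ?A (e i))"
   using p by (intro bil_times) auto
  also have "... = bil d (e i) (minv d ?A) (%k. (t + \<mu> i)*e i k)"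
  proof (rule bil_cong)
   fix k assume k: "k < d"
   have "mv d ?A (e i) k = t*mv d (idm d) (e i) k + mv d W (e i) k"
    by (simp add: mv_def distrib_right sum.distrib sum_distrib_left mult.assoc)
   then show "mv d ?A (e i) k = (t + \<mu> i)*e i k" using k W i by (simp add: mv_idm eig_def distrib_right)
  qed auto
  also have "... = (t + \<mu> i)*bil d (e i) (minv d ?A) (e i)" by (rule bil_smult_right)
  finally have "(t + \<mu> i)*bil d (e i) (minv d ?A) (e i) = 1"
   using i o by (simp add: pdef_minv[OF p] bil_idm orthonormal_def)
  moreover have "0 < t + \<mu> i" using eig_nonneg[OF W i] t by simp
  ultimately show ?thesis by (simp add: field_simps)
 qed
 then show ?thesis by (simp add: trc_orthonormal[OF o])
qed

lemma card_split: "card {i. i < d \<and> P i} + card {i. i < d \<and> \<not> P i} = d"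
proof -
 have "card {..<d} = card ({i. i < d \<and> P i} \<union> {i. i < d \<and> \<not> P i})" by (rule arg_cong[of _ _ card]) auto
 also have "... = card {i. i < d \<and> P i} + card {i. i < d \<and> \<not> P i}" by (rule card_Un_disjoint) auto
 finally show ?thesis by simp
qed

text \<open>The easy half of the minimax principle. If more than \<open>m\<close> eigenvalues exceed
  \<open>c\<close>, some nonzero vector is orthogonal to all \<open>f i\<close> and to the
  eigenvectors of the other eigenvalues, and on it the form exceeds \<open>c\<close> times the
  squared length.\<close>

lemma eig_count_le:
 assumes W: "eig d W e \<mu>"
  and f: "\<And>v. (\<And>i. i < m ==> ip d (f i) v = 0) ==> bil d v W v <= c*ip d v v"
 shows "count_gt d c \<mu> <= m"
proof (rule ccontr)
 assume n: "\<not> ?thesis"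
 let ?J = "{i. i < d \<and> c < \<mu> i}" let ?I = "{i. i < d \<and> \<not> c < \<mu> i}"
 have o: "orthonormal d d e" using W by (simp add: eig_def)
 have lt: "card ?I + m < d" using n card_split[of d "%i. c < \<mu> i"] by linarith
 obtain h where h: "bij_betw h {0..<card ?I} ?I" using ex_bij_betw_nat_finite[of ?I] by auto
 obtain v where v: "\<exists>j<d. v j ~= 0"
  "\<And>i. i < card ?I + m ==> (\<Sum>j<d. (if i < card ?I then e (h i) j else f (i - card ?I) j) * v j) = 0"
  using homogeneous_solution[OF lt, of "%i j. if i < card ?I then e (h i) j else f (i - card ?I) j"] by auto
 have ve: "ip d (e i) v = 0" if "i \<in> ?I" for i
 proof -
  obtain l where "l < card ?I" "h l = i" using h \<open>i \<in> ?I\<close> unfolding bij_betw_def by (metis (no_types, lifting) atLeastLessThan_iff imageE)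
  then show ?thesis using v(2)[of l] by (simp add: ip_def)
 qed
 have "ip d (f i) v = 0" if "i < m" for i using v(2)[of "card ?I + i"] that by (simp add: ip_def)
 then have le: "bil d v W v <= c*ip d v v" by (rule f)
 have eqs: "(\<mu> i - c)*(ip d (e i) v)^2 = 0 \<or> 0 < (\<mu> i - c)*(ip d (e i) v)^2" if "i < d" for i
  using ve[of i] that by (cases "c < \<mu> i"; cases "ip d (e i) v = 0") auto
 have "(\<Sum>i<d. (\<mu> i - c)*(ip d (e i) v)^2) = bil d v W v - c*ip d v v"
  unfolding bil_eig[OF W] parseval[OF o] by (simp add: left_diff_distrib sum_subtractf sum_distrib_left)
 then have "(\<Sum>i<d. (\<mu> i - c)*(ip d (e i) v)^2) <= 0" using le by simp
 moreover have "0 <= (\<Sum>i<d. (\<mu> i - c)*(ip d (e i) v)^2)" using eqs by (intro sum_nonneg) force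
 ultimately have "(\<Sum>i<d. (\<mu> i - c)*(ip d (e i) v)^2) = 0" by linarith
 then have "\<forall>i<d. (\<mu> i - c)*(ip d (e i) v)^2 = 0"
  using eqs by (subst (asm) sum_nonneg_eq_0_iff) force+
 then have "\<forall>i<d. ip d (e i) v = 0" using ve by (metis (mono_tags, lifting) diff_gt_0_iff_gt less_irrefl mem_Collect_eq mult_eq_0_iff power_eq_0_iff)
 then have "ip d v v = 0" by (simp add: parseval[OF o])
 then show False using v(1) ip_eq_0 by blast
qed

text \<open>Constraints on \<open>v\<close>: orthogonality to \<open>h\<close>, and orthogonality of
  the rescaled vector to the eigenvectors of \<open>B2\<close> with eigenvalue above
  \<open>c\<close>. The single functional \<open>h\<close> accounts for the
  \<open>+ 1\<close>.\<close>

lemma eig_compare: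
 assumes B1: "eig d B1 e1 \<mu>1" and B2: "eig d B2 e2 \<mu>2" and c: "0 <= c" and \<rho>1: "0 <= \<rho>1"
  and le1: "\<And>v. ip d h v = 0 ==> bil d v B1 v <= \<rho>1*bil d (%k. \<tau> k * v k) B2 (%k. \<tau> k * v k)"
  and le2: "\<And>v. ip d (%k. \<tau> k * v k) (%k. \<tau> k * v k) <= \<rho>2*ip d v v"
 shows "count_gt d (c*\<rho>1*\<rho>2) \<mu>1 <= count_gt d c \<mu>2 + 1"
proof -
 let ?J = "{i. i < d \<and> c < \<mu>2 i}"
 have o: "orthonormal d d e2" using B2 by (simp add: eig_def)
 obtain g where g: "bij_betw g {0..<card ?J} ?J" using ex_bij_betw_nat_finite[of ?J] by auto
 let ?f = "%i. if i = card ?J then h else (%k. \<tau> k*e2 (g i) k)"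
 show ?thesis
 proof (rule eig_count_le[OF B1, of _ ?f])
  fix v assume v: "\<And>i. i < card ?J + 1 ==> ip d (?f i) v = 0"
  let ?w = "%k. \<tau> k * v k"
  have w: "ip d (e2 i) ?w = 0" if "i \<in> ?J" for i
  proof -
   obtain l where "l < card ?J" "g l = i" using g \<open>i \<in> ?J\<close> unfolding bij_betw_def by (metis (no_types, lifting) atLeastLessThan_iff imageE)
   then show ?thesis using v[of l] by (simp add: ip_def mult_ac)
  qed
  have "bil d ?w B2 ?w <= c*ip d ?w ?w"
   unfolding bil_eig[OF B2] parseval[OF o] sum_distrib_left
  proof (rule sum_mono)
   fix i assume "i \<in> {..<d}"
   then show "\<mu>2 i*(ip d (e2 i) ?w)^2 <= c*(ip d (e2 i) ?w)^2"
    using w[of i] by (cases "c < \<mu>2 i") (auto intro: mult_right_mono)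
  qed
  also have "... <= c*(\<rho>2*ip d v v)" by (rule mult_left_mono[OF le2 c])
  finally have "\<rho>1*bil d ?w B2 ?w <= \<rho>1*(c*(\<rho>2*ip d v v))" by (rule mult_left_mono[OF _ \<rho>1])
  with le1[of v] v[of "card ?J"] show "bil d v B1 v <= c*\<rho>1*\<rho>2*ip d v v" by (simp add: mult_ac)
 qed
qed

section \<open>Gram matrices and singular values\<close>

definition Gr :: "nat => real mat => fmat" where
 "Gr d A = mk d (%j l. \<Sum>i<d. A $$ (i, j)*A $$ (i, l))"

lemma bil_Gr: "bil d v (Gr d A) v = (\<Sum>i<d. (\<Sum>j<d. A $$ (i, j) * v j)^2)"
proof -
 have "bil d v (Gr d A) v = (\<Sum>j<d. \<Sum>l<d. \<Sum>i<d. A $$ (i, j) * v j*(A $$ (i, l) * v l))"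
  by (auto simp: bil_def Gr_def ent_mk sum_distrib_left sum_distrib_right mult_ac intro!: sum.cong)
 also have "... = (\<Sum>i<d. \<Sum>j<d. \<Sum>l<d. A $$ (i, j) * v j*(A $$ (i, l) * v l))"
  by (subst (2) sum.swap, subst sum.swap) simp
 finally show ?thesis by (simp add: power2_eq_square sum_product)
qed

lemma psd_Gr: "psd d (Gr d A)"
proof -
 have "symm d (Gr d A)" by (auto simp: symm_def Gr_def ent_mk mult.commute)
 then show ?thesis unfolding psd_def by (auto simp: bil_Gr intro!: sum_nonneg)
qed

lemma tomat_Gr: "A \<in> carrier_mat d d ==> tomat d (Gr d A) = transpose_mat A*A"
 by (rule eq_matI) (auto simp: Gr_def ent_mk scalar_prod_def atLeast0LessThan)

text \<open>The orthonormal basis gives a similarity to a diagonal matrix, so the roots with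
  multiplicity are the eigenvalues. This links the definition of \<open>singular_values\<close> to
  spectral decompositions.\<close>

lemma proots_eig:
 assumes W: "eig d W e \<mu>"
 shows "proots (char_poly (tomat d W)) = image_mset \<mu> (mset_set {..<d})"
proof -
 have o: "orthonormal d d e" using W by (simp add: eig_def)
 define U V D where "U = mk d e" and "V = mk d (%i j. e j i)" and "D = mk d (%i j. if i = j then \<mu> i else 0)"
 have dims: "indim d U" "indim d V" "indim d D" by (auto simp: U_def V_def D_def)
 have UV: "U*V = idm d"
  using o by (intro indim_eqI[of d]) (auto simp: U_def V_def ent_times[of d] ent_mk ent_idm orthonormal_def ip_def)
 have VU: "V*U = idm d" by (rule fmat_left_right_inverse[OF _ _ UV]) (use dims in auto)
 have "W = V*D*U"
 proof (rule indim_eqI[of d])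
  fix k l assume kl: "k < d" "l < d"
  have "ent (V*D) k i = e i k*\<mu> i" if "i < d" for i
  proof -
   have "ent (V*D) k i = (\<Sum>j<d. ent V k j*ent D j i)" using kl that dims by (simp add: ent_times[of d])
   also have "... = (\<Sum>j<d. if j = i then e i k*\<mu> i else 0)"
    by (rule sum.cong[OF refl]) (use kl that in \<open>auto simp: V_def D_def ent_mk\<close>)
   finally show ?thesis using that by simp
  qed
  then have "ent (V*D*U) k l = (\<Sum>i<d. \<mu> i*(e i k*e i l))"
   using kl dims by (subst ent_times[of d]) (auto simp: U_def ent_mk mult_ac intro!: sum.cong)
  then show "ent W k l = ent (V*D*U) k l"
   using kl by (subst eig_decomposition[OF W]) (simp add: ent_sum ent_outer)
 qed (use W dims in \<open>auto simp: eig_def\<close>)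
 then have "tomat d W = tomat d V*tomat d D*tomat d U" using dims by (simp add: tomat_times)
 then have "similar_mat (tomat d W) (tomat d D)"
  using UV VU dims by (intro similar_matI[of _ _ "tomat d V" "tomat d U" d]) (auto simp: tomat_idm simp flip: tomat_times)
 then have "char_poly (tomat d W) = (\<Prod>a\<leftarrow>diag_mat (tomat d D). [:- a, 1:])"
  by (subst char_poly_similar, assumption, intro char_poly_upper_triangular[of _ d])
   (auto simp: upper_triangular_def D_def ent_mk)
 also have "diag_mat (tomat d D) = map \<mu> [0..<d]" by (auto simp: diag_mat_def D_def ent_mk)
 finally have "char_poly (tomat d W) = (\<Prod>i\<leftarrow>[0..<d]. [:- \<mu> i, 1:])" by (simp add: o_def)
 also have "... = (\<Prod>i<d. [:- \<mu> i, 1:])"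
  by (simp add: prod.distinct_set_conv_list[symmetric] atLeast0LessThan)
 finally have "proots (char_poly (tomat d W)) = (\<Sum>i<d. {#\<mu> i#})" by (simp add: proots_prod)
 also have "... = image_mset \<mu> (mset_set {..<d})" by (induction d) (simp_all add: lessThan_Suc)
 finally show ?thesis .
qed

lemma singular_values_eig:
 assumes "A \<in> carrier_mat d d" "eig d (Gr d A) e \<mu>"
 shows "mset (singular_values A) = image_mset (%i. sqrt (\<mu> i)) (mset_set {..<d})" "length (singular_values A) = d"
proof -
 show "mset (singular_values A) = image_mset (%i. sqrt (\<mu> i)) (mset_set {..<d})"
  using proots_eig[OF assms(2)] by (simp add: singular_values_def tomat_Gr[OF assms(1)] multiset.map_comp o_def)
 then show "length (singular_values A) = d" by (metis card_lessThan size_image_mset size_mset size_mset_set)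
qed

lemma singular_value_nonneg: "A \<in> carrier_mat d d ==> 0 <= singular_value k A"
proof -
 assume A: "A \<in> carrier_mat d d"
 obtain e \<mu> where e: "eig d (Gr d A) e \<mu>" using eig_exists psd_symm[OF psd_Gr] by blast
 have "set (singular_values A) = (%i. sqrt (\<mu> i)) ` {..<d}"
  using arg_cong[OF singular_values_eig(1)[OF A e], of set_mset] by simp
 then have "\<forall>x\<in>set (singular_values A). 0 <= x" using eig_nonneg[OF e psd_Gr] by auto
 then show ?thesis by (auto simp: singular_value_def)
qed

text \<open>The list is sorted in decreasing order, so its entries above \<open>sqrt c\<close> form
  an initial segment, whose length is the eigenvalue count. Everything below argues with counts
  instead of ordered lists.\<close>

lemma singular_value_gt_iff:
 assumes A: "A \<in> carrier_mat d d" and e: "eig d (Gr d A) e \<mu>" and c: "0 <= c" and k: "1 <= k"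
 shows "c < (singular_value k A)^2 \<longleftrightarrow> k <= count_gt d c \<mu>"
proof -
 let ?xs = "singular_values A" let ?P = "%x. sqrt c < x"
 note ms = singular_values_eig[OF A e]
 have srt: "sorted (rev ?xs)" by (simp add: singular_values_def)
 have "length (filter ?P ?xs) = size (filter_mset ?P (mset ?xs))" by (simp flip: size_mset mset_filter)
 also have "... = count_gt d c \<mu>"
  unfolding ms by (simp add: filter_mset_image_mset filter_mset_mset_set)
 finally have len: "length (takeWhile ?P ?xs) = count_gt d c \<mu>"
  using filter_equals_takeWhile_sorted_rev[of "%x. x" ?xs "sqrt c"] srt by simp
 have "k <= length (takeWhile ?P ?xs) \<longleftrightarrow> k <= length ?xs \<and> ?P (?xs ! (k - 1))"
 proof
  assume a: "k <= length (takeWhile ?P ?xs)"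
  then have "takeWhile ?P ?xs ! (k - 1) \<in> set (takeWhile ?P ?xs)" using k by (intro nth_mem) simp
  then have "?P (takeWhile ?P ?xs ! (k - 1))" using set_takeWhileD by fast
  moreover have "takeWhile ?P ?xs ! (k - 1) = ?xs ! (k - 1)" using a k by (intro takeWhile_nth) simp
  ultimately show "k <= length ?xs \<and> ?P (?xs ! (k - 1))" using a length_takeWhile_le[of ?P ?xs] by simp
 next
  assume a: "k <= length ?xs \<and> ?P (?xs ! (k - 1))"
  show "k <= length (takeWhile ?P ?xs)"
  proof (rule ccontr)
   assume "\<not> ?thesis"
   then have l: "length (takeWhile ?P ?xs) <= k - 1" "length (takeWhile ?P ?xs) < length ?xs" using a k by auto
   have "\<not> ?P (?xs ! length (takeWhile ?P ?xs))" using nth_length_takeWhile[OF l(2)] .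
   moreover have "?xs ! (k - 1) <= ?xs ! length (takeWhile ?P ?xs)"
    using a k by (intro sorted_rev_nth_mono srt l(1)) auto
   ultimately show False using a by simp
  qed
 qed
 moreover have "c < (singular_value k A)^2 \<longleftrightarrow> sqrt c < singular_value k A"
  using singular_value_nonneg[OF A, of k] c by (metis real_less_rsqrt real_sqrt_abs abs_of_nonneg real_sqrt_less_iff)
 moreover have "sqrt c < singular_value k A \<longleftrightarrow> k <= length ?xs \<and> ?P (?xs ! (k - 1))"
  using k c by (auto simp: singular_value_def)
 ultimately show ?thesis using len by simp
qed

section \<open>Measurability and laws\<close>

definition powm :: "nat => fmat => nat => fmat" where "powm d W r = (((*) W) ^^ r) (idm d)"

lemma powm_Suc: "powm d W (Suc r) = W*powm d W r" and powm_0: "powm d W 0 = idm d"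
 by (simp_all add: powm_def)

lemma indim_powm: "indim d W ==> indim d (powm d W r)"
 by (induction r) (auto simp: powm_Suc powm_0)

lemma trc_powm: assumes W: "eig d W e \<mu>" shows "trc d (powm d W r) = (\<Sum>i<d. \<mu> i^r)"
proof -
 have o: "orthonormal d d e" and iW: "indim d W" using W by (auto simp: eig_def)
 have "mv d (powm d W r) (e i) k = \<mu> i^r*e i k" if "i < d" "k < d" for i k
  using that(2)
 proof (induction r arbitrary: k)
  case (Suc r)
  have "mv d (powm d W (Suc r)) (e i) k = (\<Sum>l<d. ent W k l*mv d (powm d W r) (e i) l)"
   unfolding powm_Suc using iW by (simp add: mv_times indim_powm) (simp add: mv_def)
  also have "... = (\<Sum>l<d. \<mu> i^r*(ent W k l*e i l))" using Suc.IH by (intro sum.cong) auto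
  also have "... = \<mu> i^r*mv d W (e i) k" by (simp add: mv_def sum_distrib_left)
  finally show ?case using W that by (simp add: eig_def)
 qed (simp add: powm_0 mv_idm)
 then have "bil d (e i) (powm d W r) (e i) = ip d (e i) (%k. \<mu> i^r*e i k)" if "i < d" for i
  unfolding bil_mv using that by (intro ip_cong) auto
 then show ?thesis
  using o by (simp add: trc_orthonormal[OF o indim_powm[OF iW]] ip_smult_right orthonormal_def)
qed

lemma mea_powm: "mea M W ==> (\<And>w. indim d (W w)) ==> mea M (%w. powm d (W w) r)"
 by (induction r) (auto simp: powm_Suc powm_0 intro!: mea_times[of _ _ _ d] mea_const)

text \<open>The number of eigenvalues \<open>\<ge> c\<close> is a limit of sums of \<open>1 - exp (- m (\<mu>/c)^m)\<close>,
 and these are power series in the measurable traces of powers.\<close>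

lemma measurable_eig_count:
 assumes W: "\<And>w. eig d (W w) (e w) (\<mu> w)" "\<And>w. psd d (W w)" "mea M W" and c: "0 < c"
 shows "(%w. real (card {i. i < d \<and> c <= \<mu> w i})) \<in> borel_measurable M"
proof -
 have dim: "indim d (W w)" for w using W(2) by auto
 define g where "g m w = (\<Sum>r. (- (real m/c^m))^r/fact r*trc d (powm d (W w) (m*r)))" for m w
 have g: "g m w = (\<Sum>i<d. exp (- (real m*(\<mu> w i/c)^m)))" for m w
 proof -
  have "(%r. \<Sum>i<d. (- (real m*(\<mu> w i/c)^m))^r /\<^sub>R fact r) sums (\<Sum>i<d. exp (- (real m*(\<mu> w i/c)^m)))"
   by (intro sums_sum exp_converges)
  moreover have "(\<Sum>i<d. (- (real m*(\<mu> w i/c)^m))^r /\<^sub>R fact r)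
   = (- (real m/c^m))^r/fact r*trc d (powm d (W w) (m*r))" for r
  proof -
   have "- (real m*(x/c)^m) = - (real m/c^m)*x^m" for x by (simp add: power_divide)
   then show ?thesis
    unfolding trc_powm[OF W(1)] by (simp only: power_mult_distrib sum_distrib_left power_mult scaleR_conv_of_real) (simp add: field_simps)
  qed
  ultimately show ?thesis unfolding g_def by (simp add: sums_unique[symmetric])
 qed
 have "(%w. real d - g m w) \<in> borel_measurable M" for m
  unfolding g_def by (intro borel_measurable_diff borel_measurable_const borel_measurable_suminf
    borel_measurable_times measurable_trc mea_powm W(3) dim)
 moreover have "(%m. real d - g m w) \<longlonglongrightarrow> real (card {i. i < d \<and> c <= \<mu> w i})" for w
 proof -
  have "(%m. exp (- (real m*(\<mu> w i/c)^m))) \<longlonglongrightarrow> (if c <= \<mu> w i then 0 else 1)" if i: "i < d" for i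
  proof (cases "c <= \<mu> w i")
   case True
   have "(%m. exp (- real m)) \<longlonglongrightarrow> 0" by real_asymp
   moreover have "exp (- (real m*(\<mu> w i/c)^m)) <= exp (- real m)" for m
    using True c one_le_power[of "\<mu> w i/c" m] by (simp add: mult_le_cancel_left1)
   ultimately show ?thesis
    using True by (auto intro!: tendsto_sandwich[OF _ _ tendsto_const, where h="%m. exp (- real m)"])
  next
   case False
   have "0 <= \<mu> w i" by (rule eig_nonneg[OF W(1,2) i])
   then have "(%m. exp (- (of_nat m*(\<mu> w i/c)^m))) \<longlonglongrightarrow> exp (- 0)"
    using False c by (intro tendsto_intros powser_times_n_limit_0) (simp add: field_simps)
   then show ?thesis using False by simp
  qed
  then have "(%m. real d - g m w) \<longlonglongrightarrow> real d - (\<Sum>i<d. if c <= \<mu> w i then 0 else 1)"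
   unfolding g by (intro tendsto_intros) auto
  also have "(\<Sum>i<d. if c <= \<mu> w i then 0 else (1::real)) = card {i. i < d \<and> \<not> c <= \<mu> w i}"
   by (simp add: sum.If_cases Int_def flip: not_le)
  also have "real d - ... = real (card {i. i < d \<and> c <= \<mu> w i})"
   using card_split[of d "%i. c <= \<mu> w i"] by linarith
  finally show ?thesis .
 qed
 ultimately show ?thesis by (rule borel_measurable_LIMSEQ_real[rotated])
qed

text \<open>Measurability is available for counts with \<open>c <= \<mu> i\<close>, whereas singular
  values are governed by strict counts. With finitely many eigenvalues a small gap
  \<open>1/(n + 1)\<close> bridges the two.\<close>

lemma card_gt_limit:
 fixes \<mu> :: "nat => real"
 shows "k <= count_gt d c \<mu> \<longleftrightarrow> (\<exists>n. real k <= real (card {i. i < d \<and> c + 1/real (Suc n) <= \<mu> i}))"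
proof
 assume k: "k <= count_gt d c \<mu>"
 have "\<forall>i. c < \<mu> i --> (\<exists>n. c + 1/real (Suc n) <= \<mu> i)"
  by (metis diff_gt_0_iff_gt reals_Archimedean inverse_eq_divide less_diff_eq add.commute less_imp_le)
 then obtain n where n: "\<And>i. c < \<mu> i ==> c + 1/real (Suc (n i)) <= \<mu> i" by metis
 define N where "N = Max (insert 0 (n ` {..<d}))"
 have "c + 1/real (Suc N) <= \<mu> i" if "i < d" "c < \<mu> i" for i
 proof -
  have "n i <= N" unfolding N_def using that by (intro Max_ge) auto
  then have "1/real (Suc N) <= 1/real (Suc (n i))" by (intro divide_left_mono) auto
  then show ?thesis using n[OF that(2)] by linarith
 qed
 then have "{i. i < d \<and> c < \<mu> i} \<subseteq> {i. i < d \<and> c + 1/real (Suc N) <= \<mu> i}" by auto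
 then have "count_gt d c \<mu> <= card {i. i < d \<and> c + 1/real (Suc N) <= \<mu> i}" by (intro card_mono) auto
 then show "\<exists>n. real k <= real (card {i. i < d \<and> c + 1/real (Suc n) <= \<mu> i})" using k by (intro exI[of _ N]) linarith
next
 assume "\<exists>n. real k <= real (card {i. i < d \<and> c + 1/real (Suc n) <= \<mu> i})"
 then obtain n where n: "k <= card {i. i < d \<and> c + 1/real (Suc n) <= \<mu> i}" by auto
 have "c < x" if "c + 1/real (Suc n) <= x" for x
  by (rule less_le_trans[OF _ that]) simp
 then have "{i. i < d \<and> c + 1/real (Suc n) <= \<mu> i} \<subseteq> {i. i < d \<and> c < \<mu> i}" by blast
 then have "card {i. i < d \<and> c + 1/real (Suc n) <= \<mu> i} <= count_gt d c \<mu>" by (intro card_mono) auto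
 then show "k <= count_gt d c \<mu>" using n by simp
qed

lemma measurable_singular_value:
 assumes A: "\<And>w. w \<in> space M ==> A w \<in> carrier_mat d d"
  and m: "\<And>i j. i < d ==> j < d ==> (%w. A w $$ (i, j)) \<in> borel_measurable M"
 shows "(%w. singular_value k (A w)) \<in> borel_measurable M"
proof (cases "k = 0")
 case False
 have "\<forall>w. \<exists>e \<mu>. eig d (Gr d (A w)) e \<mu>" using eig_exists psd_symm[OF psd_Gr] by blast
 then obtain e \<mu> where e: "\<And>w. eig d (Gr d (A w)) (e w) (\<mu> w)" by metis
 have W: "mea M (%w. Gr d (A w))"
  unfolding mea_def Gr_def ent_mk
 proof (intro allI)
  fix i j show "(%w. if i < d \<and> j < d then \<Sum>k<d. A w $$ (k, i)*A w $$ (k, j) else 0) \<in> borel_measurable M"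
   using m by (cases "i < d \<and> j < d") (auto intro!: borel_measurable_sum borel_measurable_times)
 qed
 have "{w \<in> space M. t < singular_value k (A w)} \<in> sets M" for t
 proof (cases "t < 0")
  case True
  then have "{w \<in> space M. t < singular_value k (A w)} = space M"
   using singular_value_nonneg[OF A] less_le_trans by blast
  then show ?thesis by simp
 next
  case False
  then have t: "0 <= t" by simp
  have N: "{w \<in> space M. real k <= real (card {i. i < d \<and> t^2 + 1/real (Suc n) <= \<mu> w i})} \<in> sets M" for n
   by (intro borel_measurable_le borel_measurable_const measurable_eig_count[OF e psd_Gr W]) (simp add: add_nonneg_pos)
  have "t < singular_value k (A w) \<longleftrightarrow> (\<exists>n. real k <= real (card {i. i < d \<and> t^2 + 1/real (Suc n) <= \<mu> w i}))" if "w \<in> space M" for w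
  proof -
   have "t < singular_value k (A w) \<longleftrightarrow> t^2 < (singular_value k (A w))^2"
    using t singular_value_nonneg[OF A[OF that], of k] power2_less_imp_less[of t "singular_value k (A w)"]
     power_strict_mono[of t "singular_value k (A w)" 2] by auto
   then show ?thesis using singular_value_gt_iff[OF A[OF that] e] \<open>k ~= 0\<close> card_gt_limit by simp
  qed
  then have "{w \<in> space M. t < singular_value k (A w)}
   = (\<Union>n. {w \<in> space M. real k <= real (card {i. i < d \<and> t^2 + 1/real (Suc n) <= \<mu> w i})})" by auto
  also have "... \<in> sets M"
   by (rule sets.countable_UN) (use N in blast)
  finally show ?thesis .
 qed
 then show ?thesis by (subst borel_measurable_iff_greater) auto
qed (simp add: singular_value_def)

text \<open>The injection \<open>\<rho>\<close> says which variable sits at which place. Different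
  choices read the same family as the rows of the query matrix, the rows of the key matrix or its
  columns.\<close>

lemma (in prob_space) rows_distr:
 assumes ind: "indep_vars (%_. borel) V I" and n: "0 < n" and d: "0 < d"
  and V: "\<And>i. i \<in> I ==> distributed M lborel (V i) std_normal_density"
  and \<rho>: "inj_on \<rho> ({..<n} \<times> {..<d})" "\<rho> ` ({..<n} \<times> {..<d}) \<subseteq> I"
 shows "distr M (rows {..<n} d) (%w. \<lambda>j\<in>{..<n}. \<lambda>i\<in>{..<d}. V (\<rho> (j, i)) w) = rows {..<n} d"
  and "(%w. \<lambda>j\<in>{..<n}. \<lambda>i\<in>{..<d}. V (\<rho> (j, i)) w) \<in> measurable M (rows {..<n} d)"
proof -
 have \<rho>I: "\<rho> (j, i) \<in> I" if "j < n" "i < d" for i j using \<rho>(2) that by auto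
 have mV: "random_variable borel (V i)" if "i \<in> I" for i using ind that by (simp add: indep_vars_def)
 have dV: "distr M borel (V i) = gauss1" if "i \<in> I" for i
 proof -
  have "distr M borel (V i) = distr M lborel (V i)" by (rule distr_cong) auto
  then show ?thesis using V[OF that] by (simp add: distributed_def gauss1_def)
 qed
 let ?R = "%j w. \<lambda>i\<in>{..<d}. V (\<rho> (j, i)) w"
 have mR: "?R j \<in> measurable M (gauss d)" if "j < n" for j
  unfolding measurable_cong_sets[OF refl sets_gauss] using that by (intro measurable_restrict mV \<rho>I) auto
 have dR: "distr M (gauss d) (?R j) = gauss d" if "j < n" for j
 proof -
  have "indep_vars (%i. PiM {\<rho> (j, i)} (%_. borel)) (%i w. restrict (%k. V k w) {\<rho> (j, i)}) {..<d}"
   using \<rho>I \<rho>(1) that by (intro indep_vars_restrict[OF ind]) (auto simp: disjoint_family_on_def inj_on_def)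
  then have "indep_vars (%_. borel) (%i w. (%f. f (\<rho> (j, i))) (restrict (%k. V k w) {\<rho> (j, i)})) {..<d}"
   by (rule indep_vars_compose2) (auto intro!: measurable_component_singleton)
  then have "indep_vars (%_. borel) (%i. V (\<rho> (j, i))) {..<d}" by simp
  then have "distr M (PiM {..<d} (%_. borel)) (?R j) = PiM {..<d} (%i. distr M borel (V (\<rho> (j, i))))"
   using d that mV \<rho>I by (subst (asm) indep_vars_iff_distr_eq_PiM') auto
  also have "... = gauss d" unfolding gauss_def using dV \<rho>I that by (intro PiM_cong) auto
  finally show ?thesis using distr_cong[OF refl sets_gauss, of M "?R j" "?R j" d] by simp
 qed
 define B where "B j = (%i. \<rho> (j, i)) ` {..<d}" for j
 have "indep_vars (%j. PiM (B j) (%_. borel)) (%j w. restrict (%k. V k w) (B j)) {..<n}"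
 proof (rule indep_vars_restrict[OF ind])
  show "B j \<subseteq> I" if "j \<in> {..<n}" for j using that \<rho>I by (auto simp: B_def)
  show "disjoint_family_on B {..<n}" using \<rho>(1) by (auto simp: disjoint_family_on_def B_def inj_on_def)
 qed
 then have "indep_vars (%_. gauss d) (%j w. (%f. \<lambda>i\<in>{..<d}. f (\<rho> (j, i))) (restrict (%k. V k w) (B j))) {..<n}"
  by (rule indep_vars_compose2)
   (unfold measurable_cong_sets[OF refl sets_gauss], intro measurable_restrict measurable_component_singleton, simp add: B_def)
 then have "indep_vars (%_. gauss d) ?R {..<n}"
  by (rule indep_vars_cong[THEN iffD1, rotated -1]) (auto simp: B_def fun_eq_iff restrict_def)
 then have "distr M (PiM {..<n} (%_. gauss d)) (%w. \<lambda>j\<in>{..<n}. ?R j w) = PiM {..<n} (%j. distr M (gauss d) (?R j))"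
  using n mR by (subst (asm) indep_vars_iff_distr_eq_PiM') auto
 also have "... = rows {..<n} d" unfolding rows_def using dR by (intro PiM_cong) auto
 finally show "distr M (rows {..<n} d) (%w. \<lambda>j\<in>{..<n}. ?R j w) = rows {..<n} d" by (simp add: rows_def)
 show "(%w. \<lambda>j\<in>{..<n}. ?R j w) \<in> measurable M (rows {..<n} d)"
  unfolding rows_def using mR by (intro measurable_restrict) auto
qed

definition entries :: "nat => real mat => nat => nat => real" where
 "entries d A = (\<lambda>j\<in>{..<d}. \<lambda>i\<in>{..<d}. A $$ (j, i))"
definition tr :: "nat => (nat => nat => real) => nat => nat => real" where
 "tr d x = (\<lambda>m\<in>{..<d}. \<lambda>j\<in>{..<d}. x j m)"

lemma measurable_rows: "(\<And>j i. j < n ==> i < d ==> (%w. f w j i) \<in> borel_measurable M) ==>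
  (%w. \<lambda>j\<in>{..<n}. \<lambda>i\<in>{..<d}. f w j i) \<in> measurable M (rows {..<n} d)"
 unfolding rows_def gauss_def by (intro measurable_restrict) (simp add: measurable_cong_sets[OF refl sets_gauss1])

lemma measurable_tr: "tr d \<in> measurable (rws d) (rws d)"
 unfolding tr_def by (intro measurable_rows measurable_row_entry) auto

lemma (in prob_space) gaussian_pair_law:
 assumes QK: "indep_gaussian_pair M d Q K" and d: "0 < d"
 shows "distr M (rws2 d) (%w. (entries d (K w), entries d (Q w))) = rws2 d"
  and "(%w. (entries d (K w), entries d (Q w))) \<in> measurable M (rws2 d)"
  and "distr (rws d) (rws d) (tr d) = rws d"
proof -
 let ?V = "case_sum (%(i, j) \<omega>. Q \<omega> $$ (i, j)) (%(i, j) \<omega>. K \<omega> $$ (i, j))"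
 let ?D = "{..<d} \<times> {..<d}"
 let ?I = "?D <+> ?D"
 have ind: "indep_vars (%_. borel) ?V ?I" using QK by (simp add: indep_gaussian_pair_def)
 have V: "distributed M lborel (?V i) std_normal_density" if "i \<in> ?I" for i
  using QK that by (auto simp: indep_gaussian_pair_def)
 have K: "distr M (rws d) (%w. entries d (K w)) = rws d" "(%w. entries d (K w)) \<in> measurable M (rws d)"
  using rows_distr[OF ind d d V, of Inr] by (auto simp: entries_def image_subset_iff)
 have Q: "distr M (rws d) (%w. entries d (Q w)) = rws d"
  using rows_distr(1)[OF ind d d V, of Inl] by (auto simp: entries_def image_subset_iff)
 \<comment> \<open>Reading the key matrix by columns gives the same law as reading it by rows, hence
   invariance of the product law under transposition.\<close>
 have "inj_on (%(i, j). Inr (j, i)) ?D" "(%(i, j). Inr (j, i)) ` ?D \<subseteq> ?I" by (auto simp: inj_on_def)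
 from rows_distr(1)[OF ind d d V this]
 have "distr M (rws d) (%w. \<lambda>j\<in>{..<d}. \<lambda>i\<in>{..<d}. K w $$ (i, j)) = rws d" by simp
 moreover have "(%w. \<lambda>j\<in>{..<d}. \<lambda>i\<in>{..<d}. K w $$ (i, j)) = tr d \<circ> (%w. entries d (K w))"
  by (auto simp: tr_def entries_def fun_eq_iff)
 ultimately show "distr (rws d) (rws d) (tr d) = rws d"
  using distr_distr[OF measurable_tr K(2)] K(1) by simp
 have "indep_var (PiM (Inr ` ?D) (%_. borel)) (%w. restrict (%i. ?V i w) (Inr ` ?D))
  (PiM (Inl ` ?D) (%_. borel)) (%w. restrict (%i. ?V i w) (Inl ` ?D))"
  by (rule indep_var_restrict[OF ind]) auto
 then have "indep_var (rws d) ((%f. \<lambda>j\<in>{..<d}. \<lambda>i\<in>{..<d}. f (Inr (j, i))) \<circ> (%w. restrict (%i. ?V i w) (Inr ` ?D)))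
  (rws d) ((%f. \<lambda>j\<in>{..<d}. \<lambda>i\<in>{..<d}. f (Inl (j, i))) \<circ> (%w. restrict (%i. ?V i w) (Inl ` ?D)))"
  by (rule indep_var_compose) (auto intro!: measurable_rows measurable_component_singleton)
 moreover have "(%f. \<lambda>j\<in>{..<d}. \<lambda>i\<in>{..<d}. f (Inr (j, i))) \<circ> (%w. restrict (%i. ?V i w) (Inr ` ?D)) = (%w. entries d (K w))"
  "(%f. \<lambda>j\<in>{..<d}. \<lambda>i\<in>{..<d}. f (Inl (j, i))) \<circ> (%w. restrict (%i. ?V i w) (Inl ` ?D)) = (%w. entries d (Q w))"
  by (auto simp: fun_eq_iff entries_def restrict_def)
 ultimately have "indep_var (rws d) (%w. entries d (K w)) (rws d) (%w. entries d (Q w))" by simp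
 then show "distr M (rws2 d) (%w. (entries d (K w), entries d (Q w))) = rws2 d"
  and "(%w. (entries d (K w), entries d (Q w))) \<in> measurable M (rws2 d)"
  using K Q by (auto simp: indep_var_distribution_eq)
qed

text \<open>Fubini: for good keys the exceptional set of queries is small. These sets need not
  depend measurably on the keys, so measurability of the joint event is assumed instead.\<close>

lemma whp_pair:
 assumes "whp (rws d) \<eta>1 Gd" and \<eta>2: "0 <= \<eta>2" and q: "\<And>x. Gd x ==> whp (rws d) \<eta>2 (P x)"
  and m: "Measurable.pred (rws2 d) (%(x, q). P x q)"
 shows "whp (rws2 d) (\<eta>1 + \<eta>2) (%(x, q). P x q)"
proof -
 obtain B where B: "B \<in> sets (rws d)" "measure (rws d) B <= \<eta>1" "\<And>x. x \<in> space (rws d) ==> x \<notin> B ==> Gd x"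
  using assms(1) by (auto simp: whp_def)
 interpret pair_prob_space "rws d" "rws d" ..
 let ?N = "rws2 d"
 let ?A = "{z \<in> space ?N. \<not> (case z of (x, q) => P x q)}"
 have A: "?A \<in> sets ?N" using m by measurable
 have \<eta>1: "0 <= \<eta>1" using B(2) measure_nonneg order_trans by blast
 have "emeasure ?N ?A = (\<integral>\<^sup>+x. emeasure (rws d) (Pair x -` ?A) \<partial>rws d)" by (rule rows.emeasure_pair_measure_alt[OF A])
 also have "... <= (\<integral>\<^sup>+x. indicator B x + ennreal (\<eta>2) \<partial>rws d)"
 proof (rule nn_integral_mono)
  fix x assume x: "x \<in> space (rws d)"
  show "emeasure (rws d) (Pair x -` ?A) <= indicator B x + ennreal (\<eta>2)"
  proof (cases "x \<in> B")
   case True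
   then show ?thesis using prob_space.emeasure_le_1[OF prob_space_rows, of _ d "Pair x -` ?A"] by (simp add: add_increasing2)
  next
   case False
   obtain B' where B': "B' \<in> sets (rws d)" "measure (rws d) B' <= \<eta>2" "\<And>q. q \<in> space (rws d) ==> q \<notin> B' ==> P x q"
    using q[OF B(3)[OF x False]] by (auto simp: whp_def)
   have "emeasure (rws d) (Pair x -` ?A) <= emeasure (rws d) B'"
    using B' by (intro emeasure_mono) (auto simp: space_pair_measure)
   also have "... <= ennreal (\<eta>2)" using B'(2) by (simp add: rows.emeasure_eq_measure ennreal_leI)
   finally show ?thesis using False by simp
  qed
 qed
 also have "... = emeasure (rws d) B + ennreal (\<eta>2)"
  using B(1) by (simp add: nn_integral_add rows.emeasure_space_1)
 also have "... <= ennreal (\<eta>1 + \<eta>2)"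
  using B(2) \<eta>1 \<eta>2 by (simp add: rows.emeasure_eq_measure ennreal_leI flip: ennreal_plus)
 finally have "measure ?N ?A <= \<eta>1 + \<eta>2" using \<eta>1 \<eta>2 by (simp add: P.emeasure_eq_measure del: ennreal_plus)
 then show ?thesis using A \<eta>2 by (intro whpI[of ?A]) auto
qed

section \<open>From exponential rows to softmax rows\<close>

definition attf :: "real => nat => (nat => nat => real) => (nat => nat => real) => real mat" where
 "attf \<beta> d x q = mat d d (%(i, j). exp (ip d (sc \<beta> d x j) (q i))/(\<Sum>r<d. exp (ip d (sc \<beta> d x r) (q i))))"

lemma attf_carrier [simp]: "attf \<beta> d x q \<in> carrier_mat d d" by (simp add: attf_def)

lemma attention_attf:
 assumes "Q \<in> carrier_mat d d" "K \<in> carrier_mat d d"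
 shows "attention \<beta> d Q K = attf \<beta> d (entries d K) (entries d Q)"
proof -
 have "\<beta> * score d Q K $$ (i, j) = ip d (sc \<beta> d (entries d K) j) (entries d Q i)" if "i < d" "j < d" for i j
  using assms that by (auto simp: score_def ip_def sc_def entries_def scalar_prod_def sum_distrib_left
    atLeast0LessThan mult_ac intro!: sum.cong)
 then show ?thesis by (auto simp: attention_def attf_def intro!: eq_matI arg_cong2[of _ _ _ _ "(/)"] sum.cong)
qed

lemma measurable_attf: "i < d ==> j < d ==>
 (%(x, q). attf \<beta> d x q $$ (i, j)) \<in> borel_measurable (rws2 d)"
proof -
 assume ij: "i < d" "j < d"
 have [measurable]: "(%z. fst z a k) \<in> borel_measurable (rws2 d)"
  "(%z. snd z a k) \<in> borel_measurable (rws2 d)" if "a < d" "k < d" for a k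
  using that by (auto intro: measurable_compose[OF measurable_fst measurable_row_entry] measurable_compose[OF measurable_snd measurable_row_entry])
 have "(%z. exp (ip d (sc \<beta> d (fst z) a) (snd z i))) \<in> borel_measurable (rws2 d)" if "a < d" for a
  unfolding ip_def sc_def using ij that
  by (intro borel_measurable_exp[THEN measurable_compose[rotated]] borel_measurable_sum borel_measurable_times borel_measurable_divide borel_measurable_const) auto
 then show ?thesis using ij unfolding attf_def case_prod_unfold by (simp add: borel_measurable_divide borel_measurable_sum)
qed

lemma ip_xv: "0 < d ==> (\<Sum>j<d. w j) = 0 ==> ip d (xv \<beta> d x q) w = ip d (zv d (sc \<beta> d x) q) w"
proof -
 assume "0 < d" "(\<Sum>j<d. w j) = 0"
 then have "ip d w (unit1 d) = 0" using ip_unit1[of d w] by (simp add: ip_comm)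
 then have "bil d w (cproj d) (zv d (sc \<beta> d x) q) = ip d w (zv d (sc \<beta> d x) q)"
  by (simp add: cproj_def bil_diff bil_idm bil_outer)
 then show ?thesis by (simp add: xv_def bil_mv ip_comm)
qed

text \<open>With \<open>T j = exp (b G j j/2)\<close>, entry \<open>(i, j)\<close> is
  \<open>(1 + z i j) * T j/D i\<close>. On vectors orthogonal to \<open>T\<close> the 1 disappears
  and only the projected rows act, rescaled by \<open>T\<close> inside and by \<open>1/D i\<close>
  outside. Both factors are nearly constant, so the counts agree up to a factor near 1 in the level
  and one eigenvalue.\<close>

lemma spectrum_transfer:
 assumes K: "good_keys \<beta> \<delta> X d x"
  and rs: "\<And>i. i < d ==> \<bar>ip d (%j. exp (\<beta>^2*(ip d (x j) (x j)/d)/2)) (zv d (sc \<beta> d x) (q i))\<bar> < \<epsilon>*d"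
  and \<epsilon>: "0 < \<epsilon>"
 defines "lo \<equiv> exp (\<beta>^2*(1 - \<delta>)/2)" and "hi \<equiv> exp (\<beta>^2*(1 + \<delta>)/2)"
 assumes lo: "\<epsilon> < lo" and A: "eig d (Gr d (attf \<beta> d x q)) e \<mu>"
  and W: "eig d (sxv \<beta> d x q) e' \<nu>" and c: "0 <= c"
 shows "count_gt d (c*(1/(d*(lo - \<epsilon>)^2))*hi^2) \<mu> <= count_gt d c \<nu> + 1"
  and "count_gt d (c*(d*(hi + \<epsilon>)^2)*(1/lo^2)) \<nu> <= count_gt d c \<mu> + 1"
proof -
 interpret good_keys \<beta> \<delta> X d x by fact
 have dd: "0 < real d" using d by simp
 define T where "T j = exp (b*(ip d (x j) (x j)/d)/2)" for j
 let ?z = "%i. zv d (sc \<beta> d x) (q i)"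
 let ?x = "%i. xv \<beta> d x (q i)"
 define D where "D i = (\<Sum>r<d. exp (ip d (sc \<beta> d x r) (q i)))" for i
 have T: "lo <= T j" "T j <= hi" "0 < T j" if "j < d" for j
 proof -
  have "1 - \<delta> <= ip d (x j) (x j)/d" "ip d (x j) (x j)/d <= 1 + \<delta>" using diag[OF that] by auto
  from this[THEN mult_left_mono, of b] show "lo <= T j" "T j <= hi" "0 < T j" by (auto simp: T_def lo_def hi_def)
 qed
 have ex: "exp (ip d (sc \<beta> d x j) (q i)) = (1 + ?z i j)*T j" for i j
  by (simp add: zv_def yv_def T_def exp_diff ip_sc[OF d])
 have Dz: "D i = (\<Sum>j<d. T j) + ip d T (?z i)" for i
  unfolding D_def ex distrib_right by (simp add: ip_def[of d T] sum.distrib mult.commute)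
 have sT: "d*lo <= (\<Sum>j<d. T j)" "(\<Sum>j<d. T j) <= d*hi"
  using sum_bounded_below[of "{..<d}" lo T] sum_bounded_above[of "{..<d}" T hi] T by auto
 have D: "d*(lo - \<epsilon>) <= D i" "D i <= d*(hi + \<epsilon>)" "0 < D i" if "i < d" for i
 proof -
  have "\<bar>ip d T (?z i)\<bar> < \<epsilon>*d" using rs[OF that] by (simp add: T_def[abs_def])
  then show 1: "d*(lo - \<epsilon>) <= D i" "D i <= d*(hi + \<epsilon>)" using sT unfolding Dz by (auto simp: algebra_simps)
  show "0 < D i" by (rule less_le_trans[OF _ 1(1)]) (use dd lo in simp)
 qed
 have Aij: "attf \<beta> d x q $$ (i, j) = (1 + ?z i j)*T j/D i" if "i < d" "j < d" for i j
  using that by (simp add: attf_def D_def ex)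
 have Av: "(\<Sum>j<d. attf \<beta> d x q $$ (i, j) * v j) = ip d (?x i) (%j. T j * v j)/D i"
  if "ip d T v = 0" "i < d" for v i
 proof -
  have "(\<Sum>j<d. attf \<beta> d x q $$ (i, j) * v j) = (\<Sum>j<d. T j * v j + ?z i j*(T j * v j))/D i"
   unfolding sum_divide_distrib
   by (intro sum.cong refl) (use that(2) in \<open>simp add: Aij algebra_simps add_divide_distrib\<close>)
  also have "... = ip d (?z i) (%j. T j * v j)/D i" using that(1) by (simp add: sum.distrib ip_def)
  finally show ?thesis using that(1) by (simp add: ip_xv[OF d] ip_def[of d T])
 qed
 have Gv: "bil d v (Gr d (attf \<beta> d x q)) v = (\<Sum>i<d. (ip d (?x i) (%j. T j * v j))^2/(D i)^2)" if "ip d T v = 0" for v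
  unfolding bil_Gr using Av[OF that] by (intro sum.cong) (auto simp: power_divide)
 show "count_gt d (c*(1/(d*(lo - \<epsilon>)^2))*hi^2) \<mu> <= count_gt d c \<nu> + 1"
 proof (rule eig_compare[OF A W c, of _ T T])
  fix v :: "nat => real"
  have "(T k * v k)^2 <= hi^2*(v k)^2" if "k < d" for k
   unfolding power_mult_distrib using T[OF that] by (intro mult_right_mono power_mono) auto
  then show "ip d (%k. T k * v k) (%k. T k * v k) <= hi^2*ip d v v"
   by (simp add: ip_def sum_distrib_left flip: power2_eq_square) (intro sum_mono, simp)
  assume v: "ip d T v = 0"
  have "bil d v (Gr d (attf \<beta> d x q)) v <= (\<Sum>i<d. (ip d (?x i) (%j. T j * v j))^2/(d*(lo - \<epsilon>))^2)"
   unfolding Gv[OF v] using D dd lo by (intro sum_mono divide_left_mono power_mono mult_pos_pos zero_less_power) auto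
  also have "... = 1/(d*(lo - \<epsilon>)^2)*bil d (%k. T k * v k) (sw d ?x) (%k. T k * v k)"
   by (simp add: bil_sw sum_divide_distrib[symmetric] power2_eq_square)
  finally show "bil d v (Gr d (attf \<beta> d x q)) v <= 1/(d*(lo - \<epsilon>)^2)*bil d (%k. T k * v k) (sw d ?x) (%k. T k * v k)" .
 qed simp
 show "count_gt d (c*(d*(hi + \<epsilon>)^2)*(1/lo^2)) \<nu> <= count_gt d c \<mu> + 1"
 proof (rule eig_compare[OF W A c, of _ "%_. 1" "%k. 1/T k"])
  fix v :: "nat => real"
  let ?w = "%k. 1/T k * v k"
  have l0: "0 < lo" by (simp add: lo_def)
  have "(?w k)^2 <= 1/lo^2*(v k)^2" if "k < d" for k
   unfolding power_mult_distrib power_divide using T[OF that] l0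
   by (intro mult_right_mono frac_le power_mono) auto
  then show "ip d ?w ?w <= 1/lo^2*ip d v v"
   unfolding ip_def sum_distrib_left power2_eq_square by (intro sum_mono) auto
  assume v: "ip d (%_. 1) v = 0"
  have Tw: "T j*?w j = v j" if "j < d" for j using T(3)[OF that] by simp
  have "ip d T ?w = ip d (%_. 1) v"
   unfolding ip_def by (rule sum.cong[OF refl]) (simp only: Tw lessThan_iff mult_1)
  then have w: "ip d T ?w = 0" using v by simp
  have "ip d (?x i) (%j. T j*?w j) = ip d (?x i) v" for i by (rule ip_cong[OF refl Tw])
  then have g: "bil d ?w (Gr d (attf \<beta> d x q)) ?w = (\<Sum>i<d. (ip d (?x i) v)^2/(D i)^2)" using Gv[OF w] by simp
  have "bil d v (sw d ?x) v = (\<Sum>i<d. (D i)^2/d*((ip d (?x i) v)^2/(D i)^2))"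
   unfolding bil_sw sum_divide_distrib using D(3) by (intro sum.cong) (auto simp: less_imp_neq[symmetric])
  also have "... <= (\<Sum>i<d. (d*(hi + \<epsilon>))^2/d*((ip d (?x i) v)^2/(D i)^2))"
   using D by (intro sum_mono mult_right_mono divide_right_mono power_mono) (auto simp: less_imp_le)
  also have "... = d*(hi + \<epsilon>)^2*bil d ?w (Gr d (attf \<beta> d x q)) ?w"
   unfolding g sum_distrib_left using dd by (simp add: power2_eq_square mult_ac)
  finally show "bil d v (sw d ?x) v <= d*(hi + \<epsilon>)^2*bil d ?w (Gr d (attf \<beta> d x q)) ?w" .
 qed simp
qed

text \<open>As \<open>\<delta>\<close> tends to 0 both distortion ratios from
  \<open>spectrum_transfer\<close> tend to 1, so one \<open>\<delta>\<close> makes them at most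
  \<open>\<theta>\<close>.\<close>

lemma delta_choice:
 fixes b \<theta> \<tau> :: real
 assumes \<theta>: "1 < \<theta>" and \<tau>: "0 < \<tau>"
 obtains \<delta> where "0 < \<delta>" "\<delta> <= \<tau>" "\<delta> <= 1" "\<delta> < exp (b*(1 - \<delta>)/2)"
  "(exp (b*(1 + \<delta>)/2))^2/(exp (b*(1 - \<delta>)/2) - \<delta>)^2 <= \<theta>"
  "(exp (b*(1 + \<delta>)/2) + \<delta>)^2/(exp (b*(1 - \<delta>)/2))^2 <= \<theta>"
proof -
 let ?hi = "%\<delta>. exp (b*(1 + \<delta>)/2)" let ?lo = "%\<delta>. exp (b*(1 - \<delta>)/2)"
 have "((%\<delta>. (?hi \<delta>)^2/(?lo \<delta> - \<delta>)^2) \<longlongrightarrow> (?hi 0)^2/(?lo 0 - 0)^2) (at_right 0)"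
  by (intro tendsto_intros) auto
 then have "\<forall>\<^sub>F \<delta> in at_right 0. (?hi \<delta>)^2/(?lo \<delta> - \<delta>)^2 < \<theta>" using \<theta> by (intro order_tendstoD) auto
 moreover have "((%\<delta>. (?hi \<delta> + \<delta>)^2/(?lo \<delta>)^2) \<longlongrightarrow> (?hi 0 + 0)^2/(?lo 0)^2) (at_right 0)"
  by (intro tendsto_intros) auto
 then have "\<forall>\<^sub>F \<delta> in at_right 0. (?hi \<delta> + \<delta>)^2/(?lo \<delta>)^2 < \<theta>" using \<theta> by (intro order_tendstoD) auto
 moreover have "((%\<delta>. ?lo \<delta> - \<delta>) \<longlongrightarrow> ?lo 0 - 0) (at_right 0)" by (intro tendsto_intros) auto
 then have "\<forall>\<^sub>F \<delta> in at_right 0. 0 < ?lo \<delta> - \<delta>" by (intro order_tendstoD) auto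
 moreover have "\<forall>\<^sub>F \<delta> in at_right 0. 0 < \<delta> \<and> \<delta> < min \<tau> 1"
  using \<tau> by (intro eventually_at_rightI[of 0 "min \<tau> 1"]) auto
 ultimately have "\<forall>\<^sub>F \<delta> in at_right 0. (?hi \<delta>)^2/(?lo \<delta> - \<delta>)^2 < \<theta> \<and> (?hi \<delta> + \<delta>)^2/(?lo \<delta>)^2 < \<theta> \<and> 0 < ?lo \<delta> - \<delta> \<and> 0 < \<delta> \<and> \<delta> < min \<tau> 1"
  by eventually_elim simp
 from eventually_happens'[OF trivial_limit_at_right_real this] obtain \<delta>
  where "(?hi \<delta>)^2/(?lo \<delta> - \<delta>)^2 < \<theta> \<and> (?hi \<delta> + \<delta>)^2/(?lo \<delta>)^2 < \<theta> \<and> 0 < ?lo \<delta> - \<delta> \<and> 0 < \<delta> \<and> \<delta> < min \<tau> 1"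
  by blast
 then show ?thesis by (intro that[of \<delta>]) auto
qed

lemma mv_cong: "(\<And>i. i < d ==> x i = y i) ==> mv d A x = mv d A y"
 by (auto simp: mv_def intro!: sum.cong)

lemma gm_tr: "gm d P (tr d x) = gm d P (colm x)"
 unfolding sw_def by (intro arg_cong[of _ _ "(*\<^sub>R) _"] sum.cong refl arg_cong2[of _ _ _ _ "outer d"] mv_cong)
  (auto simp: tr_def colm_def)

lemma whp_columns:
 assumes "distr (rws d) (rws d) (tr d) = rws d" "whp (rws d) \<eta> (%x. R (gm d P x))"
 shows "whp (rws d) \<eta> (%x. R (gm d P (colm x)))"
 using whp_distr[OF measurable_tr, of d \<eta> "%x. R (gm d P x)"] assms by (simp add: gm_tr)

lemma measurable_attf_singular: "(%(x, q). singular_value k (attf \<beta> d x q)) \<in> borel_measurable (rws2 d)"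
 unfolding case_prod_unfold
 by (rule measurable_singular_value[of _ _ d]) (use measurable_attf in \<open>auto simp: case_prod_unfold\<close>)

text \<open>Three events share the budget: the kernel conditions and the Gram barrier for the
  centring projection and for the identity.\<close>

lemma keys_whp:
 fixes \<beta> \<delta> \<rho> g s \<delta>' :: real
 assumes \<beta>: "0 < \<beta>" and \<delta>: "0 < \<delta>" "\<delta> <= 1" and \<rho>: "0 < \<rho>" and g: "0 < g" and s: "0 < s" and room: "g + 2 * s < 1"
  and speed: "1/(1 - g - 2 * s) < \<delta>'"
  and trl: "\<forall>d>0. distr (rws d) (rws d) (tr d) = rws d"
 defines "X \<equiv> 1/g + \<delta>'"
 shows "EV d. whp (rws d) (3*\<rho>) (%x. good_keys \<beta> \<delta> X d x \<and>
  pdef d (X *\<^sub>R idm d - gm d (cproj d) (colm x)) \<and> trc d (minv d (X *\<^sub>R idm d - gm d (cproj d) (colm x)))/d <= g + s)"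
 using kernel_keys[OF \<beta> \<delta>(1) \<rho>] gram_upper[OF g s room speed \<rho>, folded X_def] eventually_gt_at_top[of "0::nat"]
proof eventually_elim
 case (elim d)
 have "0 < 1/(1 - g - 2 * s)" using room by simp
 then have "0 < \<delta>'" using speed by linarith
 then have X: "0 < X" using g by (simp add: X_def add_pos_pos)
 note c = whp_columns[OF trl[rule_format, OF elim(3)] elim(2)[rule_format]]
 note w = rows.whp_conj[OF elim(1) rows.whp_conj[OF c[OF proj_cproj[OF elim(3)]] c[OF proj_idm]]]
 show ?case
  by (rule whp_mono[OF whp_le[OF w]]) (use \<beta> \<delta> X elim(3) in \<open>auto intro!: good_keys.intro pdef_psd\<close>)
qed

theorem second_value_upper:
 fixes \<beta> w u \<eta> :: real
 defines "b \<equiv> \<beta>^2" defines "a \<equiv> exp b - 1 - b"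
 assumes \<beta>: "0 < \<beta>" and w: "0 < w" "b*w^2 < 1" and u: "(kc a b w)^2 < u" and \<eta>: "0 < \<eta>"
  and trl: "\<forall>d>0. distr (rws d) (rws d) (tr d) = rws d"
 shows "EV d. whp (rws2 d) \<eta> (%(x, q). d*(singular_value 2 (attf \<beta> d x q))^2 <= u)"
proof -
 have b: "0 < b" using \<beta> by (simp add: b_def)
 \<comment> \<open>With this parameter \<open>(kc a b w)^2\<close> is the value
   \<open>g/b (a + b/(g (1 - g)))^2\<close> of the row barrier.\<close>
 define g where "g = b*w^2"
 have g: "0 < g" "g < 1" using b w by (auto simp: g_def)
 \<comment> \<open>The bound for the sample matrix is placed strictly below \<open>u\<close>; the
   ratio \<open>u/u'\<close> is spent on the softmax normalisation.\<close>
 define u' where "u' = ((kc a b w)^2 + u)/2"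
 have u': "(kc a b w)^2 < u'" "u' < u" using u by (auto simp: u'_def)
 have u'0: "0 < u'" using u'(1) by (rule le_less_trans[OF zero_le_power2])
 have "kc a b w = w*(a + b/(g*(1 - g)))"
  using w b by (simp add: kc_def g_def distrib_left power2_eq_square)
 then have "g/b*(a + b/(g*(1 - g)))^2 = (kc a b w)^2" using b by (simp add: g_def power_mult_distrib)
 then have gu: "g/b*(a + b/(g*(1 - g)))^2 < u'" using u' by simp
 define \<rho> where "\<rho> = \<eta>/5"
 have \<rho>: "0 < \<rho>" using \<eta> by (simp add: \<rho>_def)
 obtain \<tau> where \<tau>: "0 < \<tau>" "\<tau> < 1/2" "g + 2*\<tau> < 1"
  and samp: "EV d. \<forall>x. let X = 1/g + (1/(1 - g - 2*\<tau>) + \<tau>); Y = X *\<^sub>R idm d - gm d (cproj d) (colm x) in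
   good_keys \<beta> \<tau> X d x --> pdef d Y --> trc d (minv d Y)/d <= g + \<tau> -->
   whp (rws d) \<rho> (%q. \<forall>v. bil d v (sxv \<beta> d x q) v <= u'*ip d v v)"
  by (rule sample_upper[OF \<beta> g, folded b_def, folded a_def, OF gu \<rho>]) (rule that; assumption)
 define X where "X = 1/g + (1/(1 - g - 2*\<tau>) + \<tau>)"
 have uu: "1 < u/u'" using u' u'0 by simp
 obtain \<delta> where \<delta>: "0 < \<delta>" "\<delta> <= \<tau>" "\<delta> <= 1" "\<delta> < exp (b*(1 - \<delta>)/2)"
  "(exp (b*(1 + \<delta>)/2))^2/(exp (b*(1 - \<delta>)/2) - \<delta>)^2 <= u/u'"
  by (rule delta_choice[OF uu \<tau>(1), where b = b]) (rule that; assumption)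
 have speed: "1/(1 - g - 2*\<tau>) < 1/(1 - g - 2*\<tau>) + \<tau>" using \<tau> by simp
 show ?thesis
  using keys_whp[OF \<beta> \<delta>(1,3) \<rho> g(1) \<tau>(1,3) speed trl, folded X_def] samp[folded X_def] row_sums[OF \<delta>(1) \<rho>, of \<beta> \<delta> X]
   eventually_gt_at_top[of "0::nat"]
 proof eventually_elim
  case (elim d)
  have "whp (rws2 d) (3*\<rho> + 2*\<rho>) (%(x, q). d*(singular_value 2 (attf \<beta> d x q))^2 <= u)"
  proof (rule whp_pair[OF elim(1)])
   show "Measurable.pred (rws2 d) (%(x, q). d*(singular_value 2 (attf \<beta> d x q))^2 <= u)"
    using measurable_attf_singular[of 2 \<beta> d] unfolding case_prod_unfold
    by (intro pred_le borel_measurable_times borel_measurable_power borel_measurable_const)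
   fix x assume K: "good_keys \<beta> \<delta> X d x \<and> pdef d (X *\<^sub>R idm d - gm d (cproj d) (colm x)) \<and>
    trc d (minv d (X *\<^sub>R idm d - gm d (cproj d) (colm x)))/d <= g + \<tau>"
   then have K1: "good_keys \<beta> \<delta> X d x" and K2: "good_keys \<beta> \<tau> X d x" using good_keys_mono \<delta>(2) \<tau>(2) by auto
   have "whp (rws d) (\<rho> + \<rho>) (%q. (\<forall>v. bil d v (sxv \<beta> d x q) v <= u'*ip d v v) \<and>
    (\<forall>i<d. \<bar>ip d (%j. exp (\<beta>^2*(ip d (x j) (x j)/d)/2)) (zv d (sc \<beta> d x) (q i))\<bar> < \<delta>*d))"
    using elim(2,3) K K1 K2 by (intro rows.whp_conj) (auto simp: Let_def)
   then show "whp (rws d) (2*\<rho>) (%q. d*(singular_value 2 (attf \<beta> d x q))^2 <= u)"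
   proof (rule whp_mono[OF whp_le], goal_cases)
    case (2 q)
    let ?W = "sxv \<beta> d x q"
    obtain e \<mu> where e: "eig d (Gr d (attf \<beta> d x q)) e \<mu>" using eig_exists psd_symm[OF psd_Gr] by blast
    obtain e' \<nu> where e': "eig d ?W e' \<nu>" using eig_exists psd_symm[OF psd_sw] by blast
    let ?c = "u'*(1/(d*(exp (b*(1 - \<delta>)/2) - \<delta>)^2))*(exp (b*(1 + \<delta>)/2))^2"
    have "count_gt d (?c) \<mu> <= count_gt d u' \<nu> + 1"
     unfolding b_def by (rule spectrum_transfer(1)[OF K1 _ \<delta>(1) \<delta>(4)[unfolded b_def] e e']) (use 2 u'0 in auto)
    also have "count_gt d u' \<nu> <= 0" by (rule eig_count_le[OF e', where f = "%_ _. 0"]) (use 2 in blast)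
    finally have "count_gt d (?c) \<mu> <= 1" by simp
    then have "\<not> ?c < (singular_value 2 (attf \<beta> d x q))^2"
     using u'0 by (subst singular_value_gt_iff[OF attf_carrier e]) auto
    then have "d*(singular_value 2 (attf \<beta> d x q))^2 <= d*?c" by (intro mult_left_mono) auto
    also have "... = u'*((exp (b*(1 + \<delta>)/2))^2/(exp (b*(1 - \<delta>)/2) - \<delta>)^2)" using elim(4) by simp
    also have "... <= u'*(u/u')" using \<delta>(5) u'0 by (intro mult_left_mono) auto
    also have "... = u" using u'0 by simp
    finally show ?case .
   qed simp
  qed (use \<rho> in simp)
  then show ?case by (simp add: \<rho>_def)
 qed
qed

text \<open>The index may grow with \<open>d\<close>, up to a fixed fraction of it. Constant indices
  give the limits in probability, and proportional ones give moment bounds for the bulk law.\<close>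

theorem singular_values_lower:
 fixes \<beta> r k :: real
 defines "b \<equiv> \<beta>^2" defines "a \<equiv> exp b - 1 - b"
 assumes \<beta>: "0 < \<beta>" and r: "0 < r" "r < k^2" and k: "0 < k" "\<And>w. 0 < w ==> b*w^2 < 1 ==> k <= kc a b w"
  and trl: "\<forall>d>0. distr (rws d) (rws d) (tr d) = rws d"
 shows "\<exists>c>0. \<forall>\<eta>>0. \<forall>n :: nat => nat. (EV d. 1 <= n d \<and> real (n d) <= c*real d) -->
  (EV d. whp (rws2 d) \<eta> (%(x, q). r <= d*(singular_value (n d) (attf \<beta> d x q))^2))"
proof -
 have b: "0 < b" using \<beta> by (simp add: b_def)
 have a: "0 < a" using exp_lower_Taylor_quadratic[of b] b zero_less_power[of b 2] unfolding a_def by linarith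
 define r' where "r' = (r + k^2)/2"
 have r': "0 < r'" "r < r'" "r' < k^2" using r by (auto simp: r'_def)
 obtain gb where gb: "\<And>t. 0 < t ==> 0 < gb t \<and> (1 + b*t*(gb t)^2)*(t*gb t*(1 + a*gb t)) = 1"
  using gbar_exists[OF a b] by metis
 have gb': "\<And>t. 0 < t ==> (1 + b*t*(gb t)^2)*(t*gb t*(1 + a*gb t)) = 1" using gb by blast
 obtain c0 \<epsilon>0 T where c0: "0 < c0" and \<epsilon>0: "0 < \<epsilon>0" and T: "finite T" "\<And>t. t \<in> T ==> 0 < t" and
  cnt: "\<And>n \<mu>. 0 < n ==> (\<And>i. i < n ==> 0 <= \<mu> i) ==> (\<And>t. t \<in> T ==> \<bar>(\<Sum>i<n. 1/(t + \<mu> i))/real n - gb t\<bar> < \<epsilon>0) ==>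
   c0*real n <= real (count_gt n r' \<mu>)"
 proof (rule resolvent_count[OF a b r'(1) k(1) r'(3) _ gb'])
  fix c \<epsilon> and T :: "real set"
  assume h: "0 < c" "0 < \<epsilon>" "finite T" "\<And>t. t \<in> T ==> 0 < t"
   "\<And>n \<mu>. 0 < n ==> (\<And>i. i < n ==> 0 <= \<mu> i) ==> (\<And>t. t \<in> T ==> \<bar>(\<Sum>i<n. 1/(t + \<mu> i))/real n - gb t\<bar> < \<epsilon>) ==>
   c*real n <= real (count_gt n r' \<mu>)"
  show thesis by (rule that[OF h])
 qed (rule k(2))
 have "EV d. whp (rws2 d) \<eta> (%(x, q). r <= d*(singular_value (n d) (attf \<beta> d x q))^2)"
  if \<eta>: "0 < \<eta>" and n: "EV d. 1 <= n d \<and> real (n d) <= c0/2*d" for \<eta> and n :: "nat => nat"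
 proof -
  define \<rho> where "\<rho> = \<eta>/(4 + 2*card T)"
  have \<rho>: "0 < \<rho>" using \<eta> by (simp add: \<rho>_def)
  let ?samp = "%t \<epsilon>. EV d. \<forall>x. good_keys \<beta> \<epsilon> 7 d x -->
   \<bar>trc d (minv d (((1/gb t + a)/b) *\<^sub>R idm d + gm d (cproj d) (colm x)))/d - b*t*(gb t)^2\<bar> <= \<epsilon> -->
   whp (rws d) \<rho> (%q. \<bar>trc d (minv d (t *\<^sub>R idm d + sxv \<beta> d x q))/d - gb t\<bar> < \<epsilon>0)"
  have "\<forall>t\<in>T. \<exists>\<epsilon>>(0::real). \<epsilon> <= 1 \<and> ?samp t \<epsilon>"
  proof
   fix t assume "t \<in> T"
   then have g: "0 < t" "0 < gb t" using T(2) gb by auto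
   show "\<exists>\<epsilon>>(0::real). \<epsilon> <= 1 \<and> ?samp t \<epsilon>"
    using sample_lower[OF \<beta> g gb'[OF g(1), unfolded b_def a_def] \<epsilon>0 \<rho>, of 7] by (simp add: a_def b_def)
  qed
  from bchoice[OF this] obtain \<epsilon> where \<epsilon>: "\<forall>t\<in>T. 0 < \<epsilon> t \<and> \<epsilon> t <= 1 \<and> ?samp t (\<epsilon> t)" ..
  then have samp: "\<forall>t\<in>T. ?samp t (\<epsilon> t)" by blast
  have M: "0 < Min (insert 1 (\<epsilon> ` T))" using \<epsilon> T by (subst Min_gr_iff) auto
  have rr: "1 < r'/r" using r r' by simp
  obtain \<delta> where \<delta>: "0 < \<delta>" "\<delta> <= Min (insert 1 (\<epsilon> ` T))" "\<delta> <= 1" "\<delta> < exp (b*(1 - \<delta>)/2)"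
   "(exp (b*(1 + \<delta>)/2) + \<delta>)^2/(exp (b*(1 - \<delta>)/2))^2 <= r'/r"
   by (rule delta_choice[OF rr M, where b = b]) (rule that; assumption)
  have \<delta>\<epsilon>: "\<delta> <= \<epsilon> t" if "t \<in> T" for t using \<delta>(2) that T by auto
  have "\<forall>t\<in>T. EV d. whp (rws d) \<rho>
   (%x. \<bar>trc d (minv d (((1/gb t + a)/b) *\<^sub>R idm d + gm d (cproj d) x))/d - b*t*(gb t)^2\<bar> < \<delta>)"
  proof
   fix t assume t: "t \<in> T"
   let ?g = "gb t"
   have g: "0 < ?g" "0 < t" using gb T t by auto
   have "(1/?g + a)/b*(b*t*?g^2)*(1 + b*t*?g^2) = (1 + b*t*?g^2)*(t*?g*(1 + a*?g))"
    using b g by (simp add: power2_eq_square field_simps)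
   then show "EV d. whp (rws d) \<rho>
    (%x. \<bar>trc d (minv d (((1/?g + a)/b) *\<^sub>R idm d + gm d (cproj d) x))/d - b*t*?g^2\<bar> < \<delta>)"
    using gb[OF g(2)] g a b by (intro gram_lower \<delta>(1) \<rho>) (auto intro!: divide_pos_pos add_pos_pos)
  qed
  then have "EV d. \<forall>t\<in>T. whp (rws d) \<rho>
   (%x. \<bar>trc d (minv d (((1/gb t + a)/b) *\<^sub>R idm d + gm d (cproj d) x))/d - b*t*(gb t)^2\<bar> < \<delta>)"
   using T(1) by (simp add: eventually_ball_finite)
  moreover have "EV d. \<forall>t\<in>T. \<forall>x. good_keys \<beta> (\<epsilon> t) 7 d x -->
   \<bar>trc d (minv d (((1/gb t + a)/b) *\<^sub>R idm d + gm d (cproj d) (colm x)))/d - b*t*(gb t)^2\<bar> <= \<epsilon> t -->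
   whp (rws d) \<rho> (%q. \<bar>trc d (minv d (t *\<^sub>R idm d + sxv \<beta> d x q))/d - gb t\<bar> < \<epsilon>0)"
   using T(1) samp by (simp add: eventually_ball_finite)
  \<comment> \<open>Any fixed Gram bound serves here. The number 7 is \<open>1/g + 3\<close> for
    \<open>g = 1/4\<close>; the shift 3 exceeds \<open>1/(1 - 1/4 - 2/8) = 2\<close>.\<close>
  moreover have "EV d. whp (rws d) (3*\<rho>) (%x. good_keys \<beta> \<delta> 7 d x)"
   by (rule eventually_mono[OF keys_whp[OF \<beta> \<delta>(1,3) \<rho> _ _ _ _ trl, of "1/4" "1/8" 3]]) (auto elim!: whp_mono)
  \<comment> \<open>Then \<open>c0 d - 1\<close> is at least \<open>c0/2 * d\<close>, which absorbs
    the eigenvalue lost to the rank-one perturbation.\<close>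
  moreover have "EV d. 2/c0 < real d" by real_asymp
  ultimately show ?thesis
   using row_sums[OF \<delta>(1) \<rho>, of \<beta> \<delta> 7] n eventually_gt_at_top[of "0::nat"]
  proof eventually_elim
   case (elim d)
   have "whp (rws2 d) ((3*\<rho> + card T*\<rho>) + (card T*\<rho> + \<rho>)) (%(x, q). r <= d*(singular_value (n d) (attf \<beta> d x q))^2)"
   proof (rule whp_pair[OF rows.whp_conj[OF elim(3) rows.whp_ball[OF T(1) whp_columns[OF trl[rule_format, OF elim(7)] elim(1)[rule_format]]]]])
    show "Measurable.pred (rws2 d) (%(x, q). r <= d*(singular_value (n d) (attf \<beta> d x q))^2)"
     using measurable_attf_singular[of "n d" \<beta> d] unfolding case_prod_unfold
     by (intro pred_le borel_measurable_times borel_measurable_power borel_measurable_const)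
    fix x assume K: "good_keys \<beta> \<delta> 7 d x \<and> (\<forall>t\<in>T. \<bar>trc d (minv d (((1/gb t + a)/b) *\<^sub>R idm d + gm d (cproj d) (colm x)))/d - b*t*(gb t)^2\<bar> < \<delta>)"
    have K': "good_keys \<beta> (\<epsilon> t) 7 d x" if "t \<in> T" for t
     using good_keys_mono[OF _ \<delta>\<epsilon>[OF that]] \<epsilon> that K by blast
    have "whp (rws d) (card T*\<rho> + \<rho>) (%q. (\<forall>t\<in>T. \<bar>trc d (minv d (t *\<^sub>R idm d + sxv \<beta> d x q))/d - gb t\<bar> < \<epsilon>0) \<and>
    (\<forall>i<d. \<bar>ip d (%j. exp (\<beta>^2*(ip d (x j) (x j)/d)/2)) (zv d (sc \<beta> d x) (q i))\<bar> < \<delta>*d))"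
     using elim(2,5) K K' \<delta>\<epsilon> by (intro rows.whp_conj rows.whp_ball T(1)) fastforce+
    then show "whp (rws d) (card T*\<rho> + \<rho>) (%q. r <= d*(singular_value (n d) (attf \<beta> d x q))^2)"
    proof (rule whp_mono, goal_cases)
     case (1 q)
     let ?W = "sxv \<beta> d x q"
     have K1: "good_keys \<beta> \<delta> 7 d x" using K by blast
     obtain e \<mu> where e: "eig d (Gr d (attf \<beta> d x q)) e \<mu>" using eig_exists psd_symm[OF psd_Gr] by blast
     obtain e' \<nu> where e': "eig d ?W e' \<nu>" using eig_exists psd_symm[OF psd_sw] by blast
     let ?lo = "exp (b*(1 - \<delta>)/2)" let ?hi = "exp (b*(1 + \<delta>)/2)"
     have d: "0 < real d" using elim by simp
     have "c0*real d <= real (count_gt d r' \<nu>)"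
      using 1 T(2) elim(7) by (intro cnt eig_nonneg[OF e' psd_sw]) (auto simp: trc_resolvent[OF e' psd_sw])
     also have "count_gt d r' \<nu> <= count_gt d (r/d*(d*(?hi + \<delta>)^2)*(1/?lo^2)) \<nu>"
     proof (intro card_mono)
      have "r/d*(d*(?hi + \<delta>)^2)*(1/?lo^2) = r*((?hi + \<delta>)^2/?lo^2)" using d by simp
      also have "... <= r*(r'/r)" using \<delta>(5) r by (intro mult_left_mono) auto
      also have "... = r'" using r by simp
      finally show "{i. i < d \<and> r' < \<nu> i} \<subseteq> {i. i < d \<and> r/d*(d*(?hi + \<delta>)^2)*(1/?lo^2) < \<nu> i}" by auto
     qed simp
     also have "... <= count_gt d (r/d) \<mu> + 1"
      unfolding b_def by (rule spectrum_transfer(2)[OF K1 _ \<delta>(1) \<delta>(4)[unfolded b_def] e e']) (use 1 r d in auto)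
     finally have "c0*real d <= count_gt d (r/d) \<mu> + 1" by simp
     moreover have "2 < c0*d" using elim(4) c0 by (simp add: field_simps)
     ultimately have "real (n d) <= count_gt d (r/d) \<mu>" using elim(6) by linarith
     then have "r/d < (singular_value (n d) (attf \<beta> d x q))^2"
      using r d elim(6) by (subst singular_value_gt_iff[OF attf_carrier e]) auto
     then show ?case using d by (simp add: field_simps)
    qed
   qed (use \<rho> in \<open>auto intro!: add_nonneg_nonneg mult_nonneg_nonneg\<close>)
   moreover have "(3*\<rho> + card T*\<rho>) + (card T*\<rho> + \<rho>) = \<rho>*(4 + 2*card T)" by (simp add: algebra_simps)
   moreover have "0 < 4 + 2*real (card T)" by (simp add: add_pos_nonneg)
   then have "\<rho>*(4 + 2*card T) = \<eta>" by (simp add: \<rho>_def)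
   ultimately show ?case by simp
  qed
 qed
 then show ?thesis using c0 by (intro exI[of _ "c0/2"]) auto
qed

section \<open>The limits in probability\<close>

lemma empirical_moment:
 assumes A: "A \<in> carrier_mat d d" and e: "eig d (Gr d A) e \<mu>" and d: "0 < d"
 shows "measure_pmf.expectation (empirical_law (map (%s. s^2) (singular_values A))) (%x. x^m) = (\<Sum>i<d. \<mu> i^m)/d"
proof -
 let ?xs = "singular_values A" let ?f = "%s. (s^2)^m"
 note sv = singular_values_eig[OF A e]
 have "{..<d} ~= {}" using d by auto
 then have "measure_pmf.expectation (empirical_law (map (%s. s^2) ?xs)) (%x. x^m) = (\<Sum>j<d. ?f (?xs ! j))/d"
  using sv(2) by (simp add: empirical_law_def integral_pmf_of_set)
 also have "(\<Sum>j<d. ?f (?xs ! j)) = sum_list (map ?f ?xs)" using sv(2) by (simp add: sum_list_sum_nth atLeast0LessThan)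
 also have "... = sum_mset (image_mset ?f (mset ?xs))" by (simp flip: mset_map sum_mset_sum_list)
 also have "... = (\<Sum>i<d. ?f (sqrt (\<mu> i)))" by (simp add: sv(1) multiset.map_comp o_def sum_unfold_sum_mset)
 also have "... = (\<Sum>i<d. \<mu> i^m)" using eig_nonneg[OF e psd_Gr] by simp
 finally show ?thesis .
qed

lemma singular_value_antimono:
 assumes A: "A \<in> carrier_mat d d" and k: "1 <= k" "k <= k'"
 shows "(singular_value k' A)^2 <= (singular_value k A)^2"
proof (rule ccontr)
 obtain e \<mu> where e: "eig d (Gr d A) e \<mu>" using eig_exists psd_symm[OF psd_Gr] by blast
 assume "\<not> ?thesis"
 then have "k' <= count_gt d ((singular_value k A)^2) \<mu>"
  using singular_value_gt_iff[OF A e, of "(singular_value k A)^2" k'] k by simp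
 then have "(singular_value k A)^2 < (singular_value k A)^2"
  using singular_value_gt_iff[OF A e, of "(singular_value k A)^2" k] k by simp
 then show False by simp
qed

text \<open>On vectors with sum zero the centring term acts as zero, so the two forms agree there up
  to the factor \<open>d\<close>. Each comparison costs one eigenvalue.\<close>

lemma centered_counts:
 assumes Q: "Q \<in> carrier_mat d d" "K \<in> carrier_mat d d" and d: "0 < d"
  and A: "eig d (Gr d (attention \<beta> d Q K)) e \<mu>" and C: "eig d (Gr d (centered_attention \<beta> d Q K)) e' \<nu>" and c: "0 <= c"
 shows "count_gt d c \<nu> <= count_gt d (c/d) \<mu> + 1"
  and "count_gt d (c/d) \<mu> <= count_gt d c \<nu> + 1"
proof -
 let ?A = "attention \<beta> d Q K" let ?C = "centered_attention \<beta> d Q K"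
 have q: "bil d v (Gr d ?C) v = d*bil d v (Gr d ?A) v" if "ip d (%_. 1) v = 0" for v
 proof -
  have s: "(\<Sum>j<d. v j) = 0" using that by (simp add: ip_def)
  have "(\<Sum>j<d. ?C $$ (i, j) * v j) = sqrt d*(\<Sum>j<d. ?A $$ (i, j) * v j)" if "i < d" for i
  proof -
   have "(\<Sum>j<d. ?C $$ (i, j) * v j) = (\<Sum>j<d. sqrt d*(?A $$ (i, j) * v j) - sqrt d*(1/d) * v j)"
    using that by (intro sum.cong refl) (simp add: centered_attention_def attention_def unit_ones_def algebra_simps)
   also have "... = sqrt d*(\<Sum>j<d. ?A $$ (i, j) * v j) - sqrt d*(1/d)*(\<Sum>j<d. v j)"
    by (simp add: sum_subtractf sum_distrib_left)
   finally show ?thesis using s by simp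
  qed
  then show ?thesis by (simp add: bil_Gr power_mult_distrib flip: sum_distrib_left)
 qed
 have "count_gt d (c/d*d*1) \<nu> <= count_gt d (c/d) \<mu> + 1"
  by (rule eig_compare[OF C A, of _ _ "%_. 1" "%_. 1"]) (use c q in auto)
 then show "count_gt d c \<nu> <= count_gt d (c/d) \<mu> + 1" using d by simp
 have "count_gt d (c*(1/d)*1) \<mu> <= count_gt d c \<nu> + 1"
  by (rule eig_compare[OF A C, of _ _ "%_. 1" "%_. 1"]) (use c q d in auto)
 then show "count_gt d (c/d) \<mu> <= count_gt d c \<nu> + 1" by simp
qed

text \<open>No summability is available, so only infinitely many dimensions are claimed: beyond
  \<open>N\<close> there are dimensions with arbitrarily small failure probability, and the
  intersection of their exceptional sets is null. Frequent occurrence suffices next to sequences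
  that converge.\<close>

lemma (in prob_space) AE_frequently:
 assumes "\<And>\<eta>. 0 < \<eta> ==> EV d. whp M \<eta> (P d)"
 shows "AE w in M. \<forall>N. \<exists>d\<ge>N. P d w"
proof (subst AE_all_countable, rule)
 fix N :: nat
 have "\<exists>B\<in>events. prob B <= 1/real (Suc n) \<and> (\<forall>w\<in>space M - B. \<exists>d\<ge>N. P d w)" for n
 proof -
  have "EV d. N <= d \<and> whp M (1/real (Suc n)) (P d)"
   by (intro eventually_conj eventually_ge_at_top assms) simp
  then obtain d where "N <= d" "whp M (1/real (Suc n)) (P d)" using eventually_happens by fastforce
  then show ?thesis unfolding whp_def by blast
 qed
 then obtain B where B: "\<And>n. B n \<in> events" "\<And>n. prob (B n) <= 1/real (Suc n)" "\<And>n w. w \<in> space M - B n ==> \<exists>d\<ge>N. P d w"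
  by metis
 have "prob (\<Inter>n. B n) <= 1/real (Suc n)" for n
  by (rule order_trans[OF finite_measure_mono B(2)[of n]]) (use B(1) in auto)
 then have "prob (\<Inter>n. B n) <= 0" by (intro LIMSEQ_le_const[OF LIMSEQ_Suc[OF lim_1_over_n]]) auto
 then have "emeasure M (\<Inter>n. B n) = 0" by (simp add: emeasure_eq_measure measure_le_0_iff)
 then show "AE w in M. \<exists>d\<ge>N. P d w"
  by (intro AE_I[of _ _ "\<Inter>n. B n"]) (use B(1,3) in auto)
qed

lemma frequently_LIMSEQ_le:
 fixes X Y :: "nat => real"
 assumes X: "X \<longlonglongrightarrow> x" and Y: "Y \<longlonglongrightarrow> y" and le: "\<And>N. \<exists>d\<ge>N. X d <= Y d"
 shows "x <= y"
proof (rule ccontr)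
 assume "\<not> x <= y"
 then have "EV d. 0 < X d - Y d" by (intro order_tendstoD(1)[OF tendsto_diff[OF X Y]]) simp
 then show False using le unfolding eventually_sequentially by fastforce
qed

text \<open>A constant \<open>c > 0\<close> cannot survive below the powers of a ratio less than 1.
  Edges of a support are located by this comparison of exponential rates.\<close>

lemma power_ratio_bound:
 fixes p q c :: real
 assumes "0 < c" "0 <= p" "p < q" "\<And>m. c*q^(2*m) <= p^(2*m)"
 shows False
proof -
 have "c <= ((p/q)^2)^m" for m
  using assms(4)[of m] assms(1-3) by (simp add: power_divide power_mult pos_le_divide_eq)
 moreover have "(p/q)^2 < 1" using assms(2,3) by (simp add: abs_square_less_1)
 then have "(%m. ((p/q)^2)^m) \<longlonglongrightarrow> 0" by (intro LIMSEQ_power_zero) simp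
 ultimately show False using LIMSEQ_le_const[of _ 0 c] assms(1) by (meson not_less)
qed

locale attention_model = prob_space M for M :: "'w measure" +
 fixes \<beta> :: real and Q K :: "nat => 'w => real mat"
 assumes \<beta>: "0 < \<beta>" and QK: "\<And>d. 1 <= d ==> indep_gaussian_pair M d (Q d) (K d)"
begin

definition "att d w = attention \<beta> d (Q d w) (K d w)"
definition "edge = K_fun \<beta> (w_star \<beta>)"

lemma carriers: "1 <= d ==> w \<in> space M ==> Q d w \<in> carrier_mat d d" "1 <= d ==> w \<in> space M ==> K d w \<in> carrier_mat d d"
 using QK[of d] by (auto simp: indep_gaussian_pair_def)

lemma att_eq: "1 <= d ==> w \<in> space M ==> att d w = attf \<beta> d (entries d (K d w)) (entries d (Q d w))"
 unfolding att_def by (rule attention_attf) (auto intro: carriers)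

lemma law: "0 < d ==> distr M (rws2 d) (%w. (entries d (K d w), entries d (Q d w))) = rws2 d"
 "0 < d ==> (%w. (entries d (K d w), entries d (Q d w))) \<in> measurable M (rws2 d)"
 "0 < d ==> distr (rws d) (rws d) (tr d) = rws d"
 using gaussian_pair_law[OF QK] by auto

lemma measurable_value: "1 <= d ==> (%w. singular_value k (att d w)) \<in> borel_measurable M"
proof -
 assume d: "1 <= d"
 have "(%w. singular_value k (attf \<beta> d (entries d (K d w)) (entries d (Q d w)))) \<in> borel_measurable M"
  using measurable_compose[OF law(2) measurable_attf_singular[of k \<beta> d]] d by simp
 then show ?thesis using att_eq[OF d] by (simp cong: measurable_cong)
qed

lemma whp_att:
 assumes "1 <= d" "whp (rws2 d) \<eta> (%(x, q). P (attf \<beta> d x q))"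
 shows "whp M \<eta> (%w. P (att d w))"
proof -
 have "whp M \<eta> (%w. case (entries d (K d w), entries d (Q d w)) of (x, q) => P (attf \<beta> d x q))"
  by (rule whp_distr[OF law(2)]) (use assms law(1)[of d] in auto)
 then show ?thesis by (rule whp_mono) (use att_eq assms(1) in auto)
qed

lemma edge: "edge = kc (exp (\<beta>^2) - 1 - \<beta>^2) (\<beta>^2) (w_star \<beta>)"
 "0 < edge" "\<And>w. 0 < w ==> \<beta>^2*w^2 < 1 ==> edge <= kc (exp (\<beta>^2) - 1 - \<beta>^2) (\<beta>^2) w"
proof -
 note w = w_star_minimizer[OF \<beta>]
 show e: "edge = kc (exp (\<beta>^2) - 1 - \<beta>^2) (\<beta>^2) (w_star \<beta>)" unfolding edge_def by (rule K_fun_kc[OF w(1,2)])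
 have "0 <= exp (\<beta>^2) - 1 - \<beta>^2" using exp_ge_add_one_self[of "\<beta>^2"] by linarith
 then show "0 < edge" unfolding e kc_def using w by (intro add_nonneg_pos mult_nonneg_nonneg divide_pos_pos mult_pos_pos) auto
 show "edge <= kc (exp (\<beta>^2) - 1 - \<beta>^2) (\<beta>^2) v" if "0 < v" "\<beta>^2 * v^2 < 1" for v
  using w(3)[OF that] K_fun_kc[OF that] by (simp add: edge_def)
qed

lemma trl: "\<forall>d>0. distr (rws d) (rws d) (tr d) = rws d" using law(3) by blast

lemma upper:
 assumes "edge^2 < u" "0 < \<eta>"
 shows "EV d. whp M \<eta> (%w. d*(singular_value 2 (att d w))^2 <= u)"
proof -
 have "EV d. whp (rws2 d) \<eta> (%(x, q). d*(singular_value 2 (attf \<beta> d x q))^2 <= u)"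
  using assms trl by (intro second_value_upper[OF \<beta> w_star_minimizer(1,2)[OF \<beta>]]) (auto simp: edge(1))
 then show ?thesis using eventually_ge_at_top[of 1] by eventually_elim (rule whp_att)
qed

lemma lower:
 assumes "0 < r" "r < edge^2"
 shows "\<exists>c>0. \<forall>\<eta>>0. \<forall>n :: nat => nat. (EV d. 1 <= n d \<and> real (n d) <= c*real d) -->
  (EV d. whp M \<eta> (%w. r <= d*(singular_value (n d) (att d w))^2))"
proof -
 have "\<exists>c>0. \<forall>\<eta>>0. \<forall>n :: nat => nat. (EV d. 1 <= n d \<and> real (n d) <= c*real d) -->
  (EV d. whp (rws2 d) \<eta> (%(x, q). r <= d*(singular_value (n d) (attf \<beta> d x q))^2))"
  by (rule singular_values_lower[OF \<beta> assms edge(2,3) trl])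
 moreover have "EV d. whp M \<eta> (%w. r <= d*(singular_value (n d) (att d w))^2)"
  if "EV d. whp (rws2 d) \<eta> (%(x, q). r <= d*(singular_value (n d) (attf \<beta> d x q))^2)" for \<eta> n
  using that eventually_ge_at_top[of 1] by eventually_elim (rule whp_att)
 ultimately show ?thesis by blast
qed

text \<open>The upper bound for index 2 passes to every larger index by monotonicity; the lower
  bound holds for index \<open>k\<close> directly, with a constant sequence of indices.\<close>

theorem fixed_value:
 assumes k: "2 <= k"
 shows "tendsto_in_probability M (%d w. real d*(singular_value k (att d w))^2) (edge^2)"
 unfolding tendsto_in_probability_def
proof (intro conjI allI impI)
 show meas: "(%w. real d*(singular_value k (att d w))^2) \<in> borel_measurable M" for d
  using measurable_value[of d k] by (cases "d = 0") (auto intro!: borel_measurable_times borel_measurable_power)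
 fix \<epsilon> :: real assume \<epsilon>: "0 < \<epsilon>"
 \<comment> \<open>The maximum keeps \<open>r\<close> positive when \<open>\<epsilon>\<close>
   exceeds the squared edge.\<close>
 define r where "r = max (edge^2/2) (edge^2 - \<epsilon>)"
 have r: "0 < r" "r < edge^2" using edge(2) \<epsilon> by (auto simp: r_def max_def)
 obtain c where c: "0 < c" "\<And>\<eta> n. 0 < \<eta> ==> (EV d. 1 <= n d \<and> real (n d) <= c*real d) ==>
  EV d. whp M \<eta> (%w. r <= d*(singular_value (n d) (att d w))^2)"
  using lower[OF r] by blast
 have "EV d. k/c < real d" by real_asymp
 then have kc: "EV d. 1 <= k \<and> real k <= c*d"
  using k c(1) by (auto elim!: eventually_mono simp: field_simps)
 show "(%d. prob {w \<in> space M. \<epsilon> < \<bar>real d*(singular_value k (att d w))^2 - edge^2\<bar>}) \<longlonglongrightarrow> 0"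
 proof (rule LIMSEQ_I, goal_cases)
  case (1 \<eta>)
  have "EV d. whp M (\<eta>/4) (%w. d*(singular_value 2 (att d w))^2 <= edge^2 + \<epsilon>)"
   using 1 \<epsilon> by (intro upper) auto
  moreover have "EV d. whp M (\<eta>/4) (%w. r <= d*(singular_value k (att d w))^2)"
   using c(2)[of "\<eta>/4" "%_. k", OF _ kc] 1 by simp
  ultimately have "EV d. prob {w \<in> space M. \<epsilon> < \<bar>real d*(singular_value k (att d w))^2 - edge^2\<bar>} < \<eta>"
   using eventually_ge_at_top[of 1]
  proof eventually_elim
   case (elim d)
   obtain B where B: "B \<in> events" "prob B <= \<eta>/4 + \<eta>/4" "\<And>w. w \<in> space M - B ==>
    d*(singular_value 2 (att d w))^2 <= edge^2 + \<epsilon> \<and> r <= d*(singular_value k (att d w))^2"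
    using whp_conj[OF elim(1,2)] unfolding whp_def by blast
   have "prob {w \<in> space M. \<epsilon> < \<bar>real d*(singular_value k (att d w))^2 - edge^2\<bar>} <= prob B"
   proof (rule finite_measure_mono[OF _ B(1)], safe, rule ccontr)
    fix w assume w: "w \<in> space M" "w \<notin> B" "\<epsilon> < \<bar>real d*(singular_value k (att d w))^2 - edge^2\<bar>"
    have "(singular_value k (att d w))^2 <= (singular_value 2 (att d w))^2"
     using att_eq[OF elim(3) w(1)] k by (intro singular_value_antimono[of _ d]) auto
    then have "d*(singular_value k (att d w))^2 <= d*(singular_value 2 (att d w))^2" by (rule mult_left_mono) simp
    then show False using B(3)[of w] w by (auto simp: r_def)
   qed
   then show ?case using B(2) 1 by linarith
  qed
  then show ?case by (auto simp: eventually_sequentially abs_of_nonneg)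
 qed
qed

section \<open>The top of the support of the bulk law\<close>

context
 fixes \<nu> :: "real measure"
 assumes bulk: "limiting_bulk_law M \<beta> Q K \<nu>"
begin

interpretation \<nu>: prob_space \<nu> using bulk by (simp add: limiting_bulk_law_def)

abbreviation "supp \<equiv> topological_support \<nu>"

lemma sets_\<nu> [simp, measurable_cong]: "sets \<nu> = sets borel" using bulk by (simp add: limiting_bulk_law_def)
lemma space_\<nu> [simp]: "space \<nu> = UNIV" using sets_eq_imp_space_eq[OF sets_\<nu>] by simp

text \<open>By the Lindelof property the complement of the support is a countable union of open null
  sets.\<close>

lemma AE_supp: "AE y in \<nu>. y \<in> supp"
proof -
 let ?U = "{U. open U \<and> emeasure \<nu> U = 0}"
 obtain F where F: "F \<subseteq> ?U" "countable F" "\<Union>F = \<Union>?U" using Lindelof[of ?U] by auto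
 have eq: "- supp = \<Union>F" unfolding F(3) topological_support_def by (auto simp: zero_less_iff_neq_zero)
 have "(\<Union>U\<in>F. U) \<in> null_sets \<nu>" by (rule null_sets_UN'[OF F(2)]) (use F(1) in \<open>auto simp: null_sets_def\<close>)
 then have "\<Union>F \<in> null_sets \<nu>" by simp
 then show ?thesis by (rule AE_not_in[THEN AE_mp]) (simp flip: eq)
qed

lemma moments: "integrable \<nu> (%y. y^m)"
proof -
 have "compact supp" using bulk by (simp add: limiting_bulk_law_def)
 then obtain R where R: "\<And>y. y \<in> supp ==> \<bar>y\<bar> <= R"
  using compact_imp_bounded[of supp] unfolding bounded_iff by auto
 show ?thesis
 proof (rule \<nu>.integrable_const_bound)
  show "AE y in \<nu>. norm (y^m) <= R^m"
   using AE_supp by (rule AE_mp) (auto intro!: AE_I2 power_mono R simp: power_abs)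
 qed (intro borel_measurable_power measurable_ident_sets sets_\<nu>)
qed

definition "mom d w m = measure_pmf.expectation (empirical_law (map (%s. s^2)
 (singular_values (centered_attention \<beta> d (Q d w) (K d w))))) (%x. x^m)"

text \<open>The bulk law is deterministic, so a single outcome with convergent moments and
  frequently good spectra decides about it.\<close>

lemma typical_outcome:
 assumes "\<forall>\<eta>>0. EV d. whp M \<eta> (P d)"
 shows "\<exists>w\<in>space M. (\<forall>m. (%d. mom d w m) \<longlonglongrightarrow> (\<integral>y. y^m \<partial>\<nu>)) \<and> (\<forall>N. \<exists>d\<ge>N. P d w)"
proof -
 have "AE w in M. \<forall>m. (%d. mom d w m) \<longlonglongrightarrow> (\<integral>y. y^m \<partial>\<nu>)" using bulk by (simp add: limiting_bulk_law_def mom_def)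
 moreover have "AE w in M. \<forall>N. \<exists>d\<ge>N. P d w" by (rule AE_frequently) (use assms in blast)
 ultimately have ae: "AE w in M. (\<forall>m. (%d. mom d w m) \<longlonglongrightarrow> (\<integral>y. y^m \<partial>\<nu>)) \<and> (\<forall>N. \<exists>d\<ge>N. P d w)"
  by (rule AE_conjI)
 show ?thesis
 proof (rule ccontr)
  assume "\<not> ?thesis"
  then have "AE w in M. \<not> ((\<forall>m. (%d. mom d w m) \<longlonglongrightarrow> (\<integral>y. y^m \<partial>\<nu>)) \<and> (\<forall>N. \<exists>d\<ge>N. P d w))" by (intro AE_I2) blast
  with ae have "AE w in M. False" by eventually_elim blast
  then show False by simp
 qed
qed

text \<open>At most two eigenvalues exceed \<open>u\<close>: one left by the bound on the second
  singular value, one added by centring. The \<open>2m\<close>-th power of each is at most the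
  square root of the sum of \<open>4m\<close>-th powers, which after division by \<open>d\<close> is
  of order \<open>1/sqrt d\<close>, because the \<open>4m\<close>-th moment converges as
  well.\<close>

lemma moment_upper:
 assumes \<epsilon>: "0 < \<epsilon>" shows "(\<integral>y. y^(2*m) \<partial>\<nu>) <= (edge^2 + \<epsilon>)^(2*m)"
proof -
 define u where "u = edge^2 + \<epsilon>"
 have u: "edge^2 < u" "0 < u" using \<epsilon> zero_le_power2[of edge] by (simp_all add: u_def add_nonneg_pos)
 obtain w where w: "w \<in> space M" "\<And>m. (%d. mom d w m) \<longlonglongrightarrow> (\<integral>y. y^m \<partial>\<nu>)" "\<And>N. \<exists>d\<ge>N. d*(singular_value 2 (att d w))^2 <= u"
  using typical_outcome[of "%d w. d*(singular_value 2 (att d w))^2 <= u"] upper[OF u(1)] by blast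
 show ?thesis
  unfolding u_def[symmetric]
 proof (rule frequently_LIMSEQ_le[OF w(2)])
  have "(%d. u^(2*m) + 2 * sqrt (mom d w (4*m)*(1/d))) \<longlonglongrightarrow> u^(2*m) + 2 * sqrt ((\<integral>y. y^(4*m) \<partial>\<nu>)*0)"
   by (intro tendsto_intros w(2) lim_1_over_n)
  then show "(%d. u^(2*m) + 2 * sqrt (mom d w (4*m)*(1/d))) \<longlonglongrightarrow> u^(2*m)" by simp
  fix N
  obtain d where d: "max N 1 <= d" "d*(singular_value 2 (att d w))^2 <= u" using w(3) by blast
  then have d0: "0 < real d" "1 <= d" by auto
  let ?C = "centered_attention \<beta> d (Q d w) (K d w)"
  have C: "?C \<in> carrier_mat d d"
   unfolding centered_attention_def by (intro smult_carrier_mat minus_carrier_mat mat_carrier)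
  obtain e \<mu> where e: "eig d (Gr d (att d w)) e \<mu>" using eig_exists psd_symm[OF psd_Gr] by blast
  obtain e' \<mu>' where e': "eig d (Gr d ?C) e' \<mu>'" using eig_exists psd_symm[OF psd_Gr] by blast
  have nn: "0 <= \<mu>' i" if "i < d" for i using eig_nonneg[OF e' psd_Gr that] .
  have "\<not> u/d < (singular_value 2 (att d w))^2" using d d0 by (simp add: field_simps)
  then have "count_gt d (u/d) \<mu> <= 1"
   using singular_value_gt_iff[OF _ e, of "u/d" 2] u d0 att_eq[OF d0(2) w(1)] by simp
  then have c2: "count_gt d u \<mu>' <= 2"
   using centered_counts(1)[OF carriers[OF d0(2) w(1)] _ e[unfolded att_def] e', of u] d0 u by simp
  note mom = empirical_moment[OF C e', folded mom_def]
  define S where "S = (\<Sum>i<d. \<mu>' i^(4*m))"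
  have S0: "0 <= S" unfolding S_def using nn by (intro sum_nonneg) auto
  have each: "\<mu>' i^(2*m) <= u^(2*m) + (if u < \<mu>' i then sqrt S else 0)" if i: "i < d" for i
  proof (cases "u < \<mu>' i")
   case True
   have "\<mu>' i^(4*m) <= S"
    unfolding S_def by (rule member_le_sum[of i _ "%i. \<mu>' i^(4*m)"]) (use nn i in auto)
   then have "(\<mu>' i^(2*m))^2 <= S" by (simp flip: power_mult add: mult.commute)
   then have "\<mu>' i^(2*m) <= sqrt S" by (rule real_le_rsqrt)
   then show ?thesis using True u by (simp add: add_increasing)
  next
   case False
   then show ?thesis using nn[OF i] by (simp add: power_mono)
  qed
  have "(\<Sum>i<d. \<mu>' i^(2*m)) <= (\<Sum>i<d. u^(2*m) + (if u < \<mu>' i then sqrt S else 0))" using each by (intro sum_mono) auto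
  also have "... = d*u^(2*m) + count_gt d u \<mu>' * sqrt S"
   by (simp add: sum.distrib sum.If_cases Int_def)
  also have "... <= d*u^(2*m) + 2 * sqrt S" using c2 S0 by (intro add_left_mono mult_right_mono) auto
  finally have "mom d w (2*m) <= (d*u^(2*m) + 2 * sqrt S)/d" using d0 by (simp add: mom divide_right_mono)
  also have "... = u^(2*m) + 2*(sqrt S/d)" using d0 by (simp add: add_divide_distrib)
  also have "sqrt S/d = sqrt (mom d w (4*m)*(1/d))"
   using d0 by (simp add: mom S_def real_sqrt_divide real_sqrt_mult[symmetric])
  finally show "\<exists>d\<ge>N. mom d w (2*m) <= u^(2*m) + 2 * sqrt (mom d w (4*m)*(1/d))" using d by auto
 qed
qed

text \<open>The count is applied with an index proportional to \<open>d\<close>, so that a fixed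
  fraction of the eigenvalues exceeds \<open>r\<close> and contributes to every moment. The same
  fraction works for all \<open>m\<close>.\<close>

lemma moment_lower:
 assumes r: "0 < r" "r < edge^2"
 obtains c where "0 < c" "\<And>m. c*r^(2*m) <= (\<integral>y. y^(2*m) \<partial>\<nu>)"
proof -
 define r' where "r' = (r + edge^2)/2"
 have r': "0 < r'" "r < r'" "r' < edge^2" using r by (auto simp: r'_def)
 obtain c where c: "0 < c" "\<And>\<eta> n. 0 < \<eta> ==> (EV d. 1 <= n d \<and> real (n d) <= c*real d) ==>
  EV d. whp M \<eta> (%w. r' <= d*(singular_value (n d) (att d w))^2)"
  using lower[OF r'(1,3)] by blast
 define n where "n d = nat \<lfloor>c*real d\<rfloor>" for d
 have "EV d. 1/c < real d" by real_asymp
 then have "EV d. 1 <= n d \<and> real (n d) <= c*d"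
 proof eventually_elim
  case (elim d)
  then have "1 <= c*d" using c(1) by (simp add: field_simps)
  then show ?case by (simp add: n_def le_nat_floor)
 qed
 note n1 = this
 obtain w where w: "w \<in> space M"
  "\<And>m. (%d. mom d w m) \<longlonglongrightarrow> (\<integral>y. y^m \<partial>\<nu>)" "\<And>N. \<exists>d\<ge>N. r' <= d*(singular_value (n d) (att d w))^2"
  using typical_outcome[of "%d w. r' <= d*(singular_value (n d) (att d w))^2"] c(2)[OF _ n1] by blast
 show ?thesis
 proof (rule that[of "c/2"])
  fix m
  show "c/2*r^(2*m) <= (\<integral>y. y^(2*m) \<partial>\<nu>)"
  proof (rule frequently_LIMSEQ_le[OF tendsto_const w(2)])
   fix N
   obtain d where d: "max N (Suc (nat \<lceil>4/c\<rceil>)) <= d" "r' <= d*(singular_value (n d) (att d w))^2" using w(3) by blast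
   have d0: "0 < real d" "1 <= d" "4/c < d" "0 < d" using d by linarith+
   then have cd: "4 < c*d" using c(1) by (simp add: field_simps)
   let ?C = "centered_attention \<beta> d (Q d w) (K d w)"
   have C: "?C \<in> carrier_mat d d"
   unfolding centered_attention_def by (intro smult_carrier_mat minus_carrier_mat mat_carrier)
   obtain e \<mu> where e: "eig d (Gr d (att d w)) e \<mu>" using eig_exists psd_symm[OF psd_Gr] by blast
   obtain e' \<mu>' where e': "eig d (Gr d ?C) e' \<mu>'" using eig_exists psd_symm[OF psd_Gr] by blast
   let ?J = "{i. i < d \<and> r < \<mu>' i}"
   have n1: "c*d - 1 <= n d" "1 <= n d" using cd unfolding n_def by linarith+
   have "r/d < (singular_value (n d) (att d w))^2" using d(2) r' d0 by (simp add: field_simps)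
   then have "n d <= count_gt d (r/d) \<mu>"
    using singular_value_gt_iff[OF _ e, of "r/d" "n d"] r d0 n1 att_eq[OF d0(2) w(1)] by simp
   also have "... <= card ?J + 1"
    using centered_counts(2)[OF carriers[OF d0(2) w(1)] _ e[unfolded att_def] e', of r] d0 r by simp
   finally have J: "c/2*d <= card ?J" using n1(1) cd by linarith
   have "c/2*d*r^(2*m) <= (\<Sum>i\<in>?J. r^(2*m))" using J r by (simp add: mult_right_mono)
   also have "... <= (\<Sum>i\<in>?J. \<mu>' i^(2*m))" using r by (intro sum_mono power_mono) auto
   also have "... <= (\<Sum>i<d. \<mu>' i^(2*m))"
    using eig_nonneg[OF e' psd_Gr] by (intro sum_mono2) auto
   finally have "c/2*r^(2*m) <= mom d w (2*m)"
    using d0 unfolding mom_def empirical_moment[OF C e' d0(4)]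
    by (simp add: pos_le_divide_eq mult_ac)
   then show "\<exists>d\<ge>N. c/2*r^(2*m) <= mom d w (2*m)" using d(1) by auto
  qed
 qed (use c in simp)
qed

text \<open>Mass above the squared edge would make the even moments grow faster than
  \<open>moment_upper\<close> allows. If the squared edge were outside the support, some interval
  below it would carry no mass, and the moments would grow more slowly than
  \<open>moment_lower\<close> demands. Even exponents keep the integrands nonnegative on the whole
  line.\<close>

theorem bulk_edge: "(GREATEST x. x \<in> supp) = edge^2"
proof (rule Greatest_equality)
 let ?E = "edge^2"
 have E0: "0 < ?E" using edge(2) by simp
 show le: "y <= ?E" if y: "y \<in> supp" for y
 proof (rule ccontr)
  assume "\<not> y <= ?E"
  define \<epsilon> where "\<epsilon> = (y - ?E)/3"
  have \<epsilon>: "0 < \<epsilon>" "?E + 2*\<epsilon> < y" using \<open>\<not> y <= ?E\<close> by (auto simp: \<epsilon>_def field_simps)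
  let ?U = "{?E + 2*\<epsilon><..}"
  have U: "0 < measure \<nu> ?U" using y \<epsilon> by (auto simp: topological_support_def \<nu>.emeasure_eq_measure)
  have "measure \<nu> ?U*(?E + 2*\<epsilon>)^(2*m) <= (?E + \<epsilon>)^(2*m)" for m
  proof -
   have "measure \<nu> ?U*(?E + 2*\<epsilon>)^(2*m) = (\<integral>z. indicator ?U z*(?E + 2*\<epsilon>)^(2*m) \<partial>\<nu>)" by simp
   also have "... <= (\<integral>z. z^(2*m) \<partial>\<nu>)"
   proof (intro integral_mono moments)
    show "integrable \<nu> (%z. indicator ?U z*(?E + 2*\<epsilon>)^(2*m))"
     by (intro integrable_mult_left integrable_real_indicator) (auto simp: \<nu>.emeasure_eq_measure)
   qed (use E0 \<epsilon> in \<open>auto simp: indicator_def intro!: power_mono\<close>)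
   also have "... <= (?E + \<epsilon>)^(2*m)" by (rule moment_upper[OF \<epsilon>(1)])
   finally show ?thesis .
  qed
  then show False using power_ratio_bound[OF U, of "?E + \<epsilon>" "?E + 2*\<epsilon>"] E0 \<epsilon> by auto
 qed
 show "?E \<in> supp"
 proof (rule ccontr)
  assume "?E \<notin> supp"
  then obtain U where U: "open U" "?E \<in> U" "emeasure \<nu> U = 0" by (auto simp: topological_support_def zero_less_iff_neq_zero)
  obtain \<epsilon> where \<epsilon>: "0 < \<epsilon>" "ball ?E \<epsilon> \<subseteq> U" using openE[OF U(1,2)] .
  have "U \<in> null_sets \<nu>" using U by auto
  then have "AE y in \<nu>. y \<notin> U" by (rule AE_not_in)
  then have "AE y in \<nu>. 0 <= y \<and> y <= max 0 (?E - \<epsilon>)"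
   using AE_supp
  proof eventually_elim
   case (elim y)
   have "0 <= y" using elim(2) bulk by (auto simp: limiting_bulk_law_def)
   moreover have "\<not> dist ?E y < \<epsilon>" using elim(1) \<epsilon>(2) by auto
   ultimately show ?case using le[OF elim(2)] by (auto simp: dist_real_def)
  qed
  then have up: "(\<integral>y. y^(2*m) \<partial>\<nu>) <= (max 0 (?E - \<epsilon>))^(2*m)" for m
  proof (intro \<nu>.integral_le_const[OF moments])
   assume "AE y in \<nu>. 0 <= y \<and> y <= max 0 (?E - \<epsilon>)"
   then show "AE y in \<nu>. y^(2*m) <= (max 0 (?E - \<epsilon>))^(2*m)" by eventually_elim (intro power_mono; simp)
  qed
  define r where "r = (max 0 (?E - \<epsilon>) + ?E)/2"
  have r: "0 < r" "r < ?E" "max 0 (?E - \<epsilon>) < r" using E0 \<epsilon> by (auto simp: r_def max_def)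
  obtain c where c: "0 < c" "\<And>m. c*r^(2*m) <= (\<integral>y. y^(2*m) \<partial>\<nu>)" by (rule moment_lower[OF r(1,2)]) (rule that; blast)
  show False by (rule power_ratio_bound[OF c(1) _ r(3) order_trans[OF c(2) up]]) simp
 qed
qed

end

end

theorem corollary11p1:
  fixes M :: "'w measure"
    and \<beta> :: real
    and Q K :: "nat \<Rightarrow> 'w \<Rightarrow> real mat"
  assumes "prob_space M"
    and "\<beta> > 0"
    and "\<And>d. d \<ge> 1 \<Longrightarrow> indep_gaussian_pair M d (Q d) (K d)"
  shows "(\<forall>k\<ge>2. tendsto_in_probability M
            (\<lambda>d \<omega>. real d * (singular_value k (attention \<beta> d (Q d \<omega>) (K d \<omega>)))\<^sup>2)
            ((K_fun \<beta> (w_star \<beta>))\<^sup>2))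
       \<and> (\<forall>\<nu>. limiting_bulk_law M \<beta> Q K \<nu> \<longrightarrow>
            tendsto_in_probability M
              (\<lambda>d \<omega>. real d * (singular_value 2 (attention \<beta> d (Q d \<omega>) (K d \<omega>)))\<^sup>2)
              (GREATEST x. x \<in> topological_support \<nu>))"
proof -
  interpret prob_space M by fact
  interpret attention_model M \<beta> Q K by unfold_locales (use assms in auto)
  show ?thesis
    using fixed_value bulk_edge unfolding att_def edge_def by auto
qed
end
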